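(* Let $d\ge3$, let $K\subset\mathbb R^d$ be a $d$-simplex, let $\boldsymbol\Sigma(K):=\mathbb P_2(K;\mathbb S)\oplus\mathbb B_{\partial K}^{nn}$ with $\mathbb B_{\partial K}^{nn}$ as defined in the context, and let $$\boldsymbol\Sigma^r(K):=\{\boldsymbol\tau\in\boldsymbol\Sigma(K):\operatorname{div}\boldsymbol\tau\in\mathbf{RM},\ (\boldsymbol n_i^{\intercal}\boldsymbol\tau\boldsymbol n_j)|_e\in\mathbb P_1(e)\text{ for all }e\in\Delta_1(K),\ 1\le i\le j\le d-1\}.$$ Then the following degrees of freedom (there are $d(d+1)^2$ of them) are unisolvent for $\boldsymbol\Sigma^r(K)$: (a) $\boldsymbol\tau(\mathtt v)$ for $\mathtt v\in\Delta_0(K)$; (b) $(\boldsymbol n^{\intercal}\boldsymbol\tau\boldsymbol n,q)_F$ for $q\in\mathbb P_1(F)$, $F\in\Delta_{d-1}(K)$; (c) $(\Pi_F\boldsymbol\tau\boldsymbol n,\boldsymbol q)_F$ for $\boldsymbol q\in\mathrm{ND}_0(F)$, $F\in\Delta_{d-1}(K)$.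
   Context: $\mathbb S$: symmetric $d\times d$ matrices. $\mathbb P_k(D;\mathbb X)$: $\mathbb X$-valued polynomials of total degree at most $k$ on $D$; $\mathbb H_k$: homogeneous polynomials of degree $k$. $\Delta_r(K)$: set of $r$-dimensional subsimplices of $K$. For $f\in\Delta_r(K)$, $\boldsymbol n_1,\dots,\boldsymbol n_{d-r}$ is a fixed orthonormal basis of the space of vectors normal to $f$; for $F\in\Delta_{d-1}(K)$ write $\boldsymbol n$ for its unit normal and $\Pi_F\boldsymbol v=(\boldsymbol I-\boldsymbol n\boldsymbol n^{\intercal})\boldsymbol v$. $\operatorname{div}$ is row-wise; $(\cdot,\cdot)_D$ is the $L^2(D)$ inner product. $\mathbf{RM}=\{\boldsymbol a+\boldsymbol B\boldsymbol x:\boldsymbol a\in\mathbb R^d,\boldsymbol B\text{ skew-symmetric}\}$. $\mathbb P_k(K;\mathbb R^d)/\mathbf{RM}$ denotes the $L^2(K)$-orthogonal complement of $\mathbf{RM}$ in $\mathbb P_k(K;\mathbb R^d)$. For a face $F$ with tangent space identified with $\mathbb R^{d-1}$ and $\mathbb K_F$ the skew-symmetric matrices on that tangent space, $\mathrm{ND}_k(F)=\mathbb P_k(F;\mathbb R^{d-1})\oplus\mathbb H_k(F;\mathbb K_F)\boldsymbol x_F$ (tangential vector fields), $\boldsymbol x_F$ being the coordinate in $F$; in particular $\mathrm{ND}_0(F)$ is the rigid motion space of $F$. $\mathbb B_{\partial K}^{nn}$ is the set of $\boldsymbol\tau\in\mathbb P_{d+1}(K;\mathbb S)$ for which all of the following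 vanish: $\boldsymbol\tau(\mathtt v)$ for $\mathtt v\in\Delta_0(K)$; $(\boldsymbol n_i^{\intercal}\boldsymbol\tau\boldsymbol n_j,q)_f$ for $q\in\mathbb P_{d-r}(f)$, $f\in\Delta_r(K)$, $1\le i\le j\le d-r$, $r=1,\dots,d-2$; $(\Pi_F\boldsymbol\tau\boldsymbol n,\boldsymbol q)_F$ for $\boldsymbol q\in\mathrm{ND}_{d-1}(F)$, $F\in\Delta_{d-1}(K)$; $(\operatorname{div}\boldsymbol\tau,\boldsymbol q)_K$ for $\boldsymbol q\in\mathbb P_d(K;\mathbb R^d)/\mathbf{RM}$; $(\boldsymbol\tau,\boldsymbol q)_K$ for $\boldsymbol q\in\mathbb P_{d-1}(K;\mathbb S)$ with $\boldsymbol q\boldsymbol x=0$. It is known (from the literature) that these functionals together with $(\boldsymbol n^{\intercal}\boldsymbol\tau\boldsymbol n,q)_F$, $q\in\mathbb P_1(F)$, $F\in\Delta_{d-1}(K)$, are unisolvent for $\mathbb P_{d+1}(K;\mathbb S)$; and $\mathbb P_2(K;\mathbb S)\cap\mathbb B^{nn}_{\partial K}=\{0\}$. "Unisolvent" for a space means: the linear functionals obtained by letting the test functions run over bases of the indicated test spaces form a basis of the dual of that space (their number equals its dimension and only $\boldsymbol\tau=0$ annihilates all of them). *)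

theory Defs
  imports "HOL-Analysis.Analysis" "HOL-Library.Function_Algebras"
begin

text \<open>Functions with values in a real vector space form a real vector space under pointwise
  operations; \<^const>\<open>span\<close>, \<^const>\<open>independent\<close> and \<^const>\<open>dim\<close> below are used in this sense.\<close>

instantiation "fun" :: (type, real_vector) real_vector
begin

definition "scaleR_fun c (f :: 'a \<Rightarrow> 'b) = (\<lambda>x. c *\<^sub>R f x)"

instance
  by standard (auto simp: scaleR_fun_def plus_fun_def fun_eq_iff scaleR_add_right scaleR_add_left)

end

definition is_basis :: "'a::real_vector set \<Rightarrow> 'a set \<Rightarrow> bool" where
  "is_basis B V \<longleftrightarrow> independent B \<and> span B = V"

definition orthonormal_basis :: "'i set \<Rightarrow> ('i \<Rightarrow> 'a::real_inner) \<Rightarrow> 'a set \<Rightarrow> bool" where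
  "orthonormal_basis I t V \<longleftrightarrow>
     (\<forall>i\<in>I. \<forall>j\<in>I. t i \<bullet> t j = (if i = j then 1 else 0)) \<and> span (t ` I) = V"

definition sym_matrices :: "(real^'n^'n) set" where
  "sym_matrices = {A. transpose A = A}"

definition skew_matrices :: "(real^'n^'n) set" where
  "skew_matrices = {A. transpose A = - A}"


subsection \<open>Polynomials\<close>

definition monomial :: "('n::finite \<Rightarrow> nat) \<Rightarrow> real^'n \<Rightarrow> real" where
  "monomial \<alpha> x = (\<Prod>i\<in>UNIV. (x $ i) ^ \<alpha> i)"

text \<open>Here \<open>X\<close> is the subspace in which the values (equivalently, the coefficients) lie.\<close>

definition polys :: "nat \<Rightarrow> 'b::real_vector set \<Rightarrow> (real^'n \<Rightarrow> 'b) set" where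
  "polys k X = {\<lambda>x. \<Sum>\<alpha> | (\<Sum>i\<in>UNIV. \<alpha> i) \<le> k. monomial \<alpha> x *\<^sub>R c \<alpha> | c. \<forall>\<alpha>. c \<alpha> \<in> X}"

definition hom_polys :: "nat \<Rightarrow> 'b::real_vector set \<Rightarrow> (real^'n \<Rightarrow> 'b) set" where
  "hom_polys k X = {\<lambda>x. \<Sum>\<alpha> | (\<Sum>i\<in>UNIV. \<alpha> i) = k. monomial \<alpha> x *\<^sub>R c \<alpha> | c. \<forall>\<alpha>. c \<alpha> \<in> X}"

text \<open>A function on a face \<open>D\<close> is represented by its extension by zero, so that polynomials that
  agree on \<open>D\<close> are identified and the spaces on faces have the right dimension. Polynomials on the
  simplex \<open>K\<close> itself, which has nonempty interior, are represented by the polynomial on the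
  whole space, i.e. by \<^const>\<open>polys\<close>.\<close>

definition on_set :: "'a set \<Rightarrow> ('a \<Rightarrow> 'b::zero) \<Rightarrow> 'a \<Rightarrow> 'b" where
  "on_set D p = (\<lambda>x. if x \<in> D then p x else 0)"

definition polys_on :: "(real^'n) set \<Rightarrow> nat \<Rightarrow> 'b::real_vector set \<Rightarrow> (real^'n \<Rightarrow> 'b) set" where
  "polys_on D k X = on_set D ` polys k X"


subsection \<open>Faces, normals and integration over faces\<close>

definition subsimplices :: "nat \<Rightarrow> 'a::euclidean_space set \<Rightarrow> 'a set set" where
  "subsimplices r K = {f. f face_of K \<and> int r simplex f}"

definition tangent_space :: "'a::euclidean_space set \<Rightarrow> 'a set" where
  "tangent_space f = span {x - y | x y. x \<in> f \<and> y \<in> f}"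

text \<open>\<open>\<nu> f 1, \<dots>, \<nu> f (d - r)\<close> is the orthonormal basis of the normal space of the
  \<open>r\<close>-dimensional subsimplex \<open>f\<close>; the unit normal of a facet \<open>F\<close> is \<open>\<nu> F 1\<close>.\<close>

definition normal_frames :: "(real^'n) set \<Rightarrow> ((real^'n) set \<Rightarrow> nat \<Rightarrow> real^'n) \<Rightarrow> bool" where
  "normal_frames K \<nu> \<longleftrightarrow>
     (\<forall>r \<le> CARD('n). \<forall>f \<in> subsimplices r K.
        orthonormal_basis {1..CARD('n) - r} (\<nu> f) (orthogonal_comp (tangent_space f)))"

text \<open>\<open>r\<close>-dimensional surface measure on the affine hull of an \<open>r\<close>-dimensional convex set \<open>f\<close>: the
  image of Lebesgue measure under an isometric parametrization. It does not depend on the chosen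
  base point and orthonormal tangent frame, by translation and rotation invariance.\<close>

definition surface_measure :: "'a::euclidean_space set \<Rightarrow> 'a measure" where
  "surface_measure f =
     (let r = nat (aff_dim f);
          a = (SOME a. a \<in> f);
          t = (SOME t. orthonormal_basis {..<r} t (tangent_space f))
      in distr (Pi\<^sub>M {..<r} (\<lambda>_. lborel)) borel (\<lambda>y. a + (\<Sum>i<r. y i *\<^sub>R t i)))"

definition L2_inner :: "'a measure \<Rightarrow> 'a set \<Rightarrow> ('a \<Rightarrow> 'b::real_inner) \<Rightarrow> ('a \<Rightarrow> 'b) \<Rightarrow> real" where
  "L2_inner M D p q = (LINT x:D|M. p x \<bullet> q x)"

abbreviation inner_face ::
  "'a::euclidean_space set \<Rightarrow> ('a \<Rightarrow> 'b::real_inner) \<Rightarrow> ('a \<Rightarrow> 'b) \<Rightarrow> real" where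
  "inner_face f \<equiv> L2_inner (surface_measure f) f"

abbreviation inner_cell ::
  "'a::euclidean_space set \<Rightarrow> ('a \<Rightarrow> 'b::real_inner) \<Rightarrow> ('a \<Rightarrow> 'b) \<Rightarrow> real" where
  "inner_cell K \<equiv> L2_inner lborel K"

definition tangential_part :: "'a::real_inner \<Rightarrow> 'a \<Rightarrow> 'a" where
  "tangential_part n v = v - (n \<bullet> v) *\<^sub>R n"

text \<open>The space \<open>ND\<^sub>k(F)\<close> on a facet \<open>F\<close> with unit normal \<open>n\<close>. Tangential fields take values in
  the hyperplane orthogonal to \<open>n\<close>; skew-symmetric matrices on the tangent space are the
  skew-symmetric matrices that annihilate \<open>n\<close>; the coordinate \<open>x\<^sub>F\<close> is the tangential part of \<open>x\<close>
  (another choice of origin in \<open>F\<close> gives the same space).\<close>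

definition ND :: "nat \<Rightarrow> real^'n \<Rightarrow> (real^'n) set \<Rightarrow> (real^'n \<Rightarrow> real^'n) set" where
  "ND k n F =
     {on_set F (\<lambda>x. p x + W (tangential_part n x) *v tangential_part n x) | p W.
        p \<in> polys k {v. n \<bullet> v = 0} \<and> W \<in> hom_polys k {A \<in> skew_matrices. A *v n = 0}}"


subsection \<open>The spaces of symmetric tensors\<close>

definition div_rows :: "(real^'n \<Rightarrow> real^'n^'m) \<Rightarrow> real^'n \<Rightarrow> real^'m" where
  "div_rows \<tau> x = (\<chi> i. \<Sum>j\<in>UNIV. frechet_derivative \<tau> (at x) (axis j 1) $ i $ j)"

definition RM :: "(real^'n \<Rightarrow> real^'n) set" where
  "RM = {\<lambda>x. a + B *v x | a B. B \<in> skew_matrices}"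

definition polys_mod_RM :: "(real^'n) set \<Rightarrow> nat \<Rightarrow> (real^'n \<Rightarrow> real^'n) set" where
  "polys_mod_RM K k = {q \<in> polys k UNIV. \<forall>v\<in>RM. inner_cell K q v = 0}"

definition nn_bubbles ::
  "(real^'n) set \<Rightarrow> ((real^'n) set \<Rightarrow> nat \<Rightarrow> real^'n) \<Rightarrow> (real^'n \<Rightarrow> real^'n^'n) set" where
  "nn_bubbles K \<nu> = {\<tau> \<in> polys (CARD('n) + 1) sym_matrices.
     (\<forall>v. {v} \<in> subsimplices 0 K \<longrightarrow> \<tau> v = 0) \<and>
     (\<forall>r\<in>{1..CARD('n) - 2}. \<forall>f\<in>subsimplices r K. \<forall>i j.
        1 \<le> i \<and> i \<le> j \<and> j \<le> CARD('n) - r \<longrightarrow>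
        (\<forall>q\<in>polys_on f (CARD('n) - r) UNIV.
           inner_face f (\<lambda>x. \<nu> f i \<bullet> (\<tau> x *v \<nu> f j)) q = 0)) \<and>
     (\<forall>F\<in>subsimplices (CARD('n) - 1) K. \<forall>q\<in>ND (CARD('n) - 1) (\<nu> F 1) F.
        inner_face F (\<lambda>x. tangential_part (\<nu> F 1) (\<tau> x *v \<nu> F 1)) q = 0) \<and>
     (\<forall>q\<in>polys_mod_RM K (CARD('n)). inner_cell K (div_rows \<tau>) q = 0) \<and>
     (\<forall>q\<in>polys (CARD('n) - 1) sym_matrices.
        (\<forall>x. q x *v x = 0) \<longrightarrow> inner_cell K \<tau> q = 0)}"

text \<open>The two summands intersect only in zero, so this is the direct sum.\<close>

definition Sigma_space ::
  "(real^'n) set \<Rightarrow> ((real^'n) set \<Rightarrow> nat \<Rightarrow> real^'n) \<Rightarrow> (real^'n \<Rightarrow> real^'n^'n) set" where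
  "Sigma_space K \<nu> = {\<sigma> + \<beta> | \<sigma> \<beta>. \<sigma> \<in> polys 2 sym_matrices \<and> \<beta> \<in> nn_bubbles K \<nu>}"

definition Sigma_reduced ::
  "(real^'n) set \<Rightarrow> ((real^'n) set \<Rightarrow> nat \<Rightarrow> real^'n) \<Rightarrow> (real^'n \<Rightarrow> real^'n^'n) set" where
  "Sigma_reduced K \<nu> = {\<tau> \<in> Sigma_space K \<nu>.
     div_rows \<tau> \<in> RM \<and>
     (\<forall>e\<in>subsimplices 1 K. \<forall>i j. 1 \<le> i \<and> i \<le> j \<and> j \<le> CARD('n) - 1 \<longrightarrow>
        on_set e (\<lambda>x. \<nu> e i \<bullet> (\<tau> x *v \<nu> e j)) \<in> polys_on e 1 UNIV)}"


subsection \<open>Degrees of freedom and unisolvence\<close>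

text \<open>For linear functionals this says that \<open>(l i)\<close> restricts to a basis of the dual of \<open>V\<close>. No
  separate finiteness of \<open>V\<close> is needed: the last condition embeds \<open>V\<close> into the real functions
  on the finite set \<open>I\<close>.\<close>

definition unisolvent :: "'v::real_vector set \<Rightarrow> 'i set \<Rightarrow> ('i \<Rightarrow> 'v \<Rightarrow> real) \<Rightarrow> bool" where
  "unisolvent V I l \<longleftrightarrow>
     subspace V \<and> finite I \<and> card I = dim V \<and> (\<forall>\<tau>\<in>V. (\<forall>i\<in>I. l i \<tau> = 0) \<longrightarrow> \<tau> = 0)"

datatype 'n dof =
    Vertex "real^'n" "real^'n^'n"
  | Normal "(real^'n) set" "real^'n \<Rightarrow> real"
  | Tangential "(real^'n) set" "real^'n \<Rightarrow> real^'n"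

text \<open>The value \<open>\<tau>(v)\<close> of a symmetric tensor is tested against symmetric matrices \<open>S\<close> in the
  Frobenius inner product, which is \<^const>\<open>inner\<close> on matrices.\<close>

fun dof_value ::
  "((real^'n) set \<Rightarrow> nat \<Rightarrow> real^'n) \<Rightarrow> 'n dof \<Rightarrow> (real^'n \<Rightarrow> real^'n^'n) \<Rightarrow> real" where
  "dof_value \<nu> (Vertex v S) \<tau> = \<tau> v \<bullet> S"
| "dof_value \<nu> (Normal F q) \<tau> = inner_face F (\<lambda>x. \<nu> F 1 \<bullet> (\<tau> x *v \<nu> F 1)) q"
| "dof_value \<nu> (Tangential F q) \<tau> =
     inner_face F (\<lambda>x. tangential_part (\<nu> F 1) (\<tau> x *v \<nu> F 1)) q"

text \<open>The test functions run over \<open>B\<^sub>S\<close> at each vertex and over \<open>B\<^sub>P F\<close>, \<open>B\<^sub>N F\<close> on each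
  facet \<open>F\<close>.\<close>

definition dofs ::
  "(real^'n) set \<Rightarrow> (real^'n^'n) set \<Rightarrow> ((real^'n) set \<Rightarrow> (real^'n \<Rightarrow> real) set) \<Rightarrow>
   ((real^'n) set \<Rightarrow> (real^'n \<Rightarrow> real^'n) set) \<Rightarrow> 'n dof set" where
  "dofs K B\<^sub>S B\<^sub>P B\<^sub>N =
     {Vertex v S | v S. {v} \<in> subsimplices 0 K \<and> S \<in> B\<^sub>S} \<union>
     {Normal F q | F q. F \<in> subsimplices (CARD('n) - 1) K \<and> q \<in> B\<^sub>P F} \<union>
     {Tangential F q | F q. F \<in> subsimplices (CARD('n) - 1) K \<and> q \<in> B\<^sub>N F}"

end

theory Submission
  imports Defs
begin

text \<open>
  Injectivity. Let \<open>\<tau> = \<sigma> + b\<close> have vanishing degrees of freedom, with \<open>\<sigma>\<close> quadratic and \<open>b\<close> a bubble.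
  Face by face, a polynomial vanishing on the boundary of a face is the face bubble times a polynomial
  against which it has been tested, so all normal-normal traces of \<open>\<tau>\<close> vanish. On a facet the tangential
  trace \<open>u\<close> satisfies \<open>g\<^sub>w \<bullet> u = \<lambda>\<^sub>w p\<^sub>w\<close>, where \<open>g\<^sub>w\<close> is the gradient of the barycentric coordinate
  \<open>\<lambda>\<^sub>w\<close>; the projection of \<open>\<Sum> p\<^sub>w g\<^sub>w\<close> is an admissible test field and forces \<open>\<tau> n = 0\<close>. Such a field
  equals \<open>\<Sum> \<lambda>\<^sub>v \<lambda>\<^sub>w p\<^sub>v\<^sub>w t t\<^sup>T\<close> with edge vectors \<open>t = w - v\<close>, for which Green's formula reduces to
  integration along edge directions. Hence \<open>div \<tau> = 0\<close>, and since every symmetric polynomial field is a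
  symmetric gradient plus a field annihilating the position, the moment conditions give \<open>\<tau> = 0\<close>.

  Dimension. Relaxing \<open>div \<tau> \<in> RM\<close> to \<open>div \<tau>\<close> being of degree one costs at most \<open>dim \<S>\<close> conditions,
  because only the symmetric part of its gradient has to vanish. The relaxed space contains the
  independent fields \<open>\<lambda>\<^sub>v S\<close>, \<open>\<lambda>\<^sub>v \<lambda>\<^sub>w (t a\<^sup>T + a t\<^sup>T)\<close> and bubbles with prescribed normal-normal traces,
  so there are at least as many elements as functionals.
\<close>

text \<open>The two summands have different degrees but pass through the same lemmas: a symmetric
  field of degree \<open>k + 2\<close> is matched with tangential moments against
  \<open>ND k\<close> and interior moments of degree \<open>k\<close>, where \<open>k = 0\<close>
  for the quadratic part and \<open>k = CARD('n) - 1\<close> for the bubble. The functionals see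
  only the sum, so the summands must first be separated. Bubbles have no normal-normal trace on
  faces of codimension at least two, hence vertex values and linearity on edges speak about the
  quadratic part alone. Its normal-normal traces then vanish on every larger face, since the bubble
  of a face with three or more vertices has degree above two. Now the moments (b) test the bubble
  alone, and once its whole normal component on the boundary is zero, the moments (c) test the
  quadratic part alone. Functionals that separate points bound the dimension from above, so only a
  lower bound has to be constructed. It rests on two facts about matrices: the dimensions of the
  symmetric and the skew ones add up to the square of \<open>CARD('n)\<close>, and the former is at
  least the number of edges of the simplex.\<close>

abbreviation rpoly :: "nat \<Rightarrow> (real^'n \<Rightarrow> real) set" where
  "rpoly k \<equiv> polys k UNIV"

section \<open>Polynomial spaces and their restrictions to lines\<close>

lemma finite_multi_indices: "finite {\<alpha>::'n::finite \<Rightarrow> nat. sum \<alpha> UNIV \<le> k}"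
proof (rule finite_subset)
  have "\<alpha> x \<le> k" if "sum \<alpha> UNIV \<le> k" for \<alpha> :: "'n \<Rightarrow> nat" and x
    using member_le_sum[of x UNIV \<alpha>] that by simp
  then show "{\<alpha>::'n \<Rightarrow> nat. sum \<alpha> UNIV \<le> k} \<subseteq> {\<alpha>. \<forall>x. (x \<in> UNIV \<longrightarrow> \<alpha> x \<in> {..k}) \<and> (x \<notin> UNIV \<longrightarrow> \<alpha> x = 0)}"
    by (auto simp: subset_iff)
qed (rule finite_set_of_finite_funs, auto)

lemma polysI: "(\<And>\<alpha>. c \<alpha> \<in> X) \<Longrightarrow> (\<And>x. p x = (\<Sum>\<alpha> | sum \<alpha> UNIV \<le> k. monomial \<alpha> x *\<^sub>R c \<alpha>)) \<Longrightarrow> p \<in> polys k X"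
  unfolding polys_def by (intro CollectI exI[of _ c] conjI ext) auto

lemma polysE:
  assumes "p \<in> polys k X"
  obtains c where "\<And>\<alpha>. c \<alpha> \<in> X" "\<And>x. p x = (\<Sum>\<alpha> | sum \<alpha> UNIV \<le> k. monomial \<alpha> x *\<^sub>R c \<alpha>)"
  using assms unfolding polys_def by blast

lemma polys_monomial:
  assumes X: "subspace X" and a: "a \<in> X" and d: "sum \<alpha> UNIV \<le> k"
  shows "(\<lambda>x. monomial \<alpha> x *\<^sub>R a) \<in> polys k X"
proof (rule polysI[where c="\<lambda>\<beta>. if \<beta> = \<alpha> then a else 0"])
  show "(if \<beta> = \<alpha> then a else 0) \<in> X" for \<beta>
    using X a by (simp add: subspace_0)
  show "monomial \<alpha> x *\<^sub>R a = (\<Sum>\<beta> | sum \<beta> UNIV \<le> k. monomial \<beta> x *\<^sub>R (if \<beta> = \<alpha> then a else 0))" for x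
    using d by (simp add: if_distrib[of "(*\<^sub>R) _"] finite_multi_indices cong: if_cong)
qed

lemma polys_const: "subspace X \<Longrightarrow> a \<in> X \<Longrightarrow> (\<lambda>x. a) \<in> polys k X"
  using polys_monomial[of X a "\<lambda>_. 0" k] by (simp add: monomial_def)

lemma polys_add:
  assumes X: "subspace X" and "p \<in> polys k X" "q \<in> polys k X"
  shows "(\<lambda>x. p x + q x) \<in> polys k X"
proof -
  obtain c where c: "\<And>\<alpha>. c \<alpha> \<in> X" "\<And>x. p x = (\<Sum>\<alpha> | sum \<alpha> UNIV \<le> k. monomial \<alpha> x *\<^sub>R c \<alpha>)"
    using assms polysE by blast
  obtain e where e: "\<And>\<alpha>. e \<alpha> \<in> X" "\<And>x. q x = (\<Sum>\<alpha> | sum \<alpha> UNIV \<le> k. monomial \<alpha> x *\<^sub>R e \<alpha>)"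
    using assms polysE by blast
  show ?thesis
    by (rule polysI[where c="\<lambda>\<alpha>. c \<alpha> + e \<alpha>"])
      (use X c e in \<open>auto simp: scaleR_add_right sum.distrib subspace_add\<close>)
qed

lemma polys_scaleR:
  assumes X: "subspace X" and "p \<in> polys k X"
  shows "(\<lambda>x. r *\<^sub>R p x) \<in> polys k X"
proof -
  obtain c where c: "\<And>\<alpha>. c \<alpha> \<in> X" "\<And>x. p x = (\<Sum>\<alpha> | sum \<alpha> UNIV \<le> k. monomial \<alpha> x *\<^sub>R c \<alpha>)"
    using assms polysE by blast
  show ?thesis
    by (rule polysI[where c="\<lambda>\<alpha>. r *\<^sub>R c \<alpha>"])
      (use X c in \<open>auto simp: scaleR_sum_right subspace_scale mult.commute\<close>)
qed

lemma zero_fun_eq: "(0::'a \<Rightarrow> 'b::real_vector) = (\<lambda>x. 0)"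
  by (simp add: fun_eq_iff)

lemma subspace_polys: "subspace X \<Longrightarrow> subspace (polys k X)"
  unfolding subspace_def[of "polys k X"] plus_fun_def scaleR_fun_def zero_fun_eq
  by (auto intro: polys_add polys_scaleR polys_const simp: subspace_0)

lemma polys_sum:
  "subspace X \<Longrightarrow> (\<And>i. i \<in> I \<Longrightarrow> p i \<in> polys k X) \<Longrightarrow> (\<lambda>x. \<Sum>i\<in>I. p i x) \<in> polys k X"
  by (induction I rule: infinite_finite_induct) (auto intro: polys_add polys_const simp: subspace_0)

lemma polys_sub_image:
  assumes "p \<in> polys k X" "linear L" "L ` X \<subseteq> Y"
  shows "(\<lambda>x. L (p x)) \<in> polys k Y"
proof -
  obtain c where c: "\<And>\<alpha>. c \<alpha> \<in> X" "\<And>x. p x = (\<Sum>\<alpha> | sum \<alpha> UNIV \<le> k. monomial \<alpha> x *\<^sub>R c \<alpha>)"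
    using assms polysE by blast
  show ?thesis
    by (rule polysI[where c="\<lambda>\<alpha>. L (c \<alpha>)"])
      (use assms c in \<open>auto simp: linear_sum linear_scale\<close>)
qed

lemma polys_in: "subspace X \<Longrightarrow> p \<in> polys k X \<Longrightarrow> p x \<in> X"
  by (elim polysE) (simp add: subspace_sum subspace_scale)

lemma polys_mono:
  assumes X: "subspace X" and "p \<in> polys k X" "k \<le> l"
  shows "p \<in> polys l X"
proof -
  obtain c where c: "\<And>\<alpha>. c \<alpha> \<in> X" "\<And>x. p x = (\<Sum>\<alpha> | sum \<alpha> UNIV \<le> k. monomial \<alpha> x *\<^sub>R c \<alpha>)"
    using assms polysE by blast
  have "p = (\<lambda>x. \<Sum>\<alpha> | sum \<alpha> UNIV \<le> k. monomial \<alpha> x *\<^sub>R c \<alpha>)"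
    using c by auto
  then show ?thesis
    using X c(1) assms(3) by (auto intro!: polys_sum polys_monomial)
qed

lemma monomial_upd: "monomial (\<alpha>(i := Suc (\<alpha> i))) x = x $ i * monomial \<alpha> x"
proof -
  have "monomial (\<alpha>(i := Suc (\<alpha> i))) x = (\<Prod>j\<in>UNIV. (if j = i then x $ i else 1) * (x $ j) ^ \<alpha> j)"
    unfolding monomial_def by (intro prod.cong) auto
  then show ?thesis
    by (simp add: prod.distrib monomial_def)
qed

lemma sum_upd: "sum (\<alpha>(i := Suc (\<alpha> i))) (UNIV::'n::finite set) = Suc (sum \<alpha> UNIV)"
proof -
  have "sum (\<alpha>(i := Suc (\<alpha> i))) UNIV = (\<Sum>j\<in>UNIV. (if j = i then 1 else 0) + \<alpha> j)"
    by (intro sum.cong) auto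
  then show ?thesis
    by (simp add: sum.distrib)
qed

lemma polys_coord_mult:
  assumes X: "subspace X" and "p \<in> polys k X"
  shows "(\<lambda>x. (x $ i) *\<^sub>R p x) \<in> polys (Suc k) X"
proof -
  obtain c where c: "\<And>\<alpha>. c \<alpha> \<in> X" "\<And>x. p x = (\<Sum>\<alpha> | sum \<alpha> UNIV \<le> k. monomial \<alpha> x *\<^sub>R c \<alpha>)"
    using assms polysE by blast
  have "(\<lambda>x. (x $ i) *\<^sub>R p x) = (\<lambda>x. \<Sum>\<alpha> | sum \<alpha> UNIV \<le> k. monomial (\<alpha>(i := Suc (\<alpha> i))) x *\<^sub>R c \<alpha>)"
    by (simp add: c(2) fun_eq_iff scaleR_sum_right monomial_upd)
  also have "\<dots> \<in> polys (Suc k) X"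
    using X c(1) by (auto intro!: polys_sum polys_monomial simp: sum_upd simp del: fun_upd_apply)
  finally show ?thesis .
qed

text \<open>Every polynomial is built from constants by sums and by multiplication with single
  coordinates. The degree bound is an argument of \<open>Q\<close>, so that the case
  \<open>coord\<close> can raise it.\<close>

lemma polys_induct [consumes 1, case_names const add coord]:
  fixes p :: "real^'n \<Rightarrow> real"
  assumes "p \<in> rpoly k"
    and const: "\<And>k c. Q k (\<lambda>_. c)"
    and add: "\<And>k f g. f \<in> rpoly k \<Longrightarrow> g \<in> rpoly k \<Longrightarrow> Q k f \<Longrightarrow> Q k g \<Longrightarrow> Q k (\<lambda>x. f x + g x)"
    and coord: "\<And>k i f. f \<in> rpoly k \<Longrightarrow> Q k f \<Longrightarrow> Q (Suc k) (\<lambda>x. x $ i * f x)"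
  shows "Q k p"
proof -
  have mono: "Q k (\<lambda>x. monomial \<alpha> x *\<^sub>R c)" if "sum \<alpha> UNIV \<le> k" for k \<alpha> and c :: real
    using that
  proof (induction "sum \<alpha> UNIV" arbitrary: \<alpha> k)
    case 0
    then have "\<alpha> = (\<lambda>_. 0)" by (auto simp: fun_eq_iff)
    then show ?case using const by (simp add: monomial_def)
  next
    case (Suc m)
    then obtain i where i: "\<alpha> i > 0" by (metis not_gr_zero sum.neutral nat.distinct(1))
    define \<beta> where "\<beta> = \<alpha>(i := \<alpha> i - 1)"
    have a: "\<alpha> = \<beta>(i := Suc (\<beta> i))" using i by (auto simp: \<beta>_def)
    have s: "sum \<alpha> UNIV = Suc (sum \<beta> UNIV)" by (subst a) (rule sum_upd)
    obtain l where l: "k = Suc l" using Suc.prems s by (cases k) auto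
    have "Q l (\<lambda>x. monomial \<beta> x *\<^sub>R c)" using Suc s l by auto
    moreover have "(\<lambda>x. monomial \<beta> x *\<^sub>R c) \<in> rpoly l"
      using Suc.prems s l by (intro polys_monomial) auto
    ultimately have "Q k (\<lambda>x. x $ i * (monomial \<beta> x *\<^sub>R c))" using coord l by auto
    then show ?case by (subst a) (simp add: monomial_upd mult_ac del: fun_upd_apply)
  qed
  obtain c where c: "\<And>x. p x = (\<Sum>\<alpha> | sum \<alpha> UNIV \<le> k. monomial \<alpha> x *\<^sub>R c \<alpha>)"
    using assms(1) polysE by blast
  have "Q k (\<lambda>x. \<Sum>\<alpha>\<in>I. monomial \<alpha> x *\<^sub>R c \<alpha>)" if "I \<subseteq> {\<alpha>. sum \<alpha> UNIV \<le> k}" "finite I" for I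
    using that(2,1)
  proof (induction I rule: finite_induct)
    case (insert a I)
    have m: "(\<lambda>x. monomial \<alpha> x *\<^sub>R c \<alpha>) \<in> rpoly k" if "\<alpha> \<in> insert a I" for \<alpha>
      using insert.prems that by (intro polys_monomial) auto
    have "(\<lambda>x. \<Sum>\<alpha>\<in>I. monomial \<alpha> x *\<^sub>R c \<alpha>) \<in> rpoly k"
      by (rule polys_sum) (use m in auto)
    then have "Q k (\<lambda>x. monomial a x *\<^sub>R c a + (\<Sum>\<alpha>\<in>I. monomial \<alpha> x *\<^sub>R c \<alpha>))"
      using insert m by (intro add mono) auto
    then show ?case using insert.hyps by simp
  qed (use const[of k 0] in simp)
  note Q = this[OF order_refl finite_multi_indices]
  have "p = (\<lambda>x. \<Sum>\<alpha> | sum \<alpha> UNIV \<le> k. monomial \<alpha> x *\<^sub>R c \<alpha>)"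
    by (rule ext) (rule c)
  with Q show ?thesis by (simp only:)
qed

lemma rpoly_mult:
  assumes "p \<in> rpoly k" and "q \<in> rpoly l"
  shows "(\<lambda>x. p x * q x) \<in> rpoly (k + l)"
  using assms(1)
proof (induction rule: polys_induct)
  case (const k c)
  then show ?case using polys_scaleR[of UNIV q l c] assms(2) by (auto intro: polys_mono)
next
  case (add k f g)
  then show ?case using polys_add[of UNIV "\<lambda>x. f x * q x" "k+l" "\<lambda>x. g x * q x"]
    by (simp add: algebra_simps)
next
  case (coord k i f)
  then show ?case using polys_coord_mult[of UNIV "\<lambda>x. f x * q x" "k+l" i]
    by (simp add: algebra_simps)
qed

lemma rpoly_const: "(\<lambda>x. c) \<in> rpoly k" by (simp add: polys_const)
lemma rpoly_add: "p \<in> rpoly k \<Longrightarrow> q \<in> rpoly k \<Longrightarrow> (\<lambda>x. p x + q x) \<in> rpoly k" by (simp add: polys_add)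
lemma rpoly_scale: "p \<in> rpoly k \<Longrightarrow> (\<lambda>x. c * p x) \<in> rpoly k" using polys_scaleR[of UNIV p k c] by simp
lemma rpoly_scale2: "p \<in> rpoly k \<Longrightarrow> (\<lambda>x. p x * c) \<in> rpoly k" using rpoly_scale[of p k c] by (simp add: mult.commute)
lemma rpoly_uminus: "p \<in> rpoly k \<Longrightarrow> (\<lambda>x. - p x) \<in> rpoly k" using rpoly_scale[of p k "-1"] by simp
lemma rpoly_diff: "p \<in> rpoly k \<Longrightarrow> q \<in> rpoly k \<Longrightarrow> (\<lambda>x. p x - q x) \<in> rpoly k"
  using rpoly_add[OF _ rpoly_uminus, of p k q] by simp
lemma rpoly_sum: "(\<And>i. i \<in> I \<Longrightarrow> p i \<in> rpoly k) \<Longrightarrow> (\<lambda>x. \<Sum>i\<in>I. p i x) \<in> rpoly k"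
  by (rule polys_sum) auto
lemma rpoly_mono: "p \<in> rpoly k \<Longrightarrow> k \<le> l \<Longrightarrow> p \<in> rpoly l" by (rule polys_mono) auto

lemma rpoly_coord: "(\<lambda>x. x $ i) \<in> rpoly 1"
  using polys_coord_mult[of UNIV "\<lambda>x. 1::real" 0 i] by (simp add: polys_const)

lemma rpoly_inner: "(\<lambda>x. a \<bullet> x) \<in> rpoly 1"
  unfolding inner_vec_def by (auto intro!: rpoly_sum rpoly_scale rpoly_coord[unfolded One_nat_def])

lemma rpoly_prod:
  assumes "finite I" "\<And>i. i \<in> I \<Longrightarrow> p i \<in> rpoly 1"
  shows "(\<lambda>x. \<Prod>i\<in>I. p i x) \<in> rpoly (card I)"
  using assms
proof (induction I rule: finite_induct)
  case (insert a I)
  then show ?case using rpoly_mult[of "p a" 1 "\<lambda>x. \<Prod>i\<in>I. p i x" "card I"] by simp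
qed (simp add: polys_const)

lemma rpoly_0D: "p \<in> rpoly 0 \<Longrightarrow> \<exists>c. p = (\<lambda>_. c)"
proof -
  have "k = 0 \<longrightarrow> (\<exists>c. p = (\<lambda>_. c))" if "p \<in> rpoly k" for k
    using that by (induction rule: polys_induct) auto
  then show "p \<in> rpoly 0 \<Longrightarrow> \<exists>c. p = (\<lambda>_. c)" by blast
qed

lemma rpoly_compose:
  fixes p :: "real^'n \<Rightarrow> real" and \<phi> :: "real^'m \<Rightarrow> real^'n"
  assumes "p \<in> rpoly k" and "\<And>i. (\<lambda>x. \<phi> x $ i) \<in> rpoly 1"
  shows "(\<lambda>x. p (\<phi> x)) \<in> rpoly k"
  using assms(1)
proof (induction rule: polys_induct)
  case (coord k i f)
  then show ?case using rpoly_mult[OF assms(2)[of i], of "\<lambda>x. f (\<phi> x)" k] by simp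
qed (auto intro: rpoly_add rpoly_const)

lemma continuous_on_rpoly: 
  assumes "p \<in> rpoly k" shows "continuous_on S p"
  using assms by (induction rule: polys_induct) (auto intro!: continuous_intros)

text \<open>The definition of \<open>polys\<close> puts the coefficients into \<open>X\<close>, the
  right-hand side only the values. Expanding the values in an orthonormal basis of \<open>X\<close>
  changes nothing and produces coefficients in \<open>X\<close>. This reduces vector and matrix
  fields to scalar polynomials.\<close>

lemma polys_iff:
  fixes p :: "real^'n \<Rightarrow> 'b::euclidean_space"
  assumes X: "subspace X"
  shows "p \<in> polys k X \<longleftrightarrow> (\<forall>b\<in>Basis. (\<lambda>x. p x \<bullet> b) \<in> rpoly k) \<and> (\<forall>x. p x \<in> X)"
proof safe
  assume p: "p \<in> polys k X"
  show "(\<lambda>x. p x \<bullet> b) \<in> rpoly k" for b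
    by (rule polys_sub_image[OF p]) (auto intro: bounded_linear.linear bounded_linear_inner_left)
  show "p x \<in> X" for x using X p polys_in by blast
next
  assume p: "\<forall>b\<in>Basis. (\<lambda>x. p x \<bullet> b) \<in> rpoly k" "\<forall>x. p x \<in> X"
  obtain B where B: "B \<subseteq> X" "pairwise orthogonal B" "\<And>x. x \<in> B \<Longrightarrow> norm x = 1" "independent B" "span B = X"
    using orthonormal_basis_subspace[OF X] by metis
  have fB: "finite B" using B(4) by (rule independent_imp_finite)
  have exp: "p x = (\<Sum>b\<in>B. (p x \<bullet> b) *\<^sub>R b)" for x
  proof -
    have "p x \<in> span B" using p B by auto
    then obtain u where u: "p x = (\<Sum>b\<in>B. u b *\<^sub>R b)"
      using fB by (auto simp: span_finite)
    have "p x \<bullet> b = u b" if "b \<in> B" for b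
    proof -
      have "p x \<bullet> b = (\<Sum>e\<in>B. if e = b then u b else 0)"
        unfolding u inner_sum_left using B(2,3) that
        by (intro sum.cong) (auto simp: pairwise_def orthogonal_def norm_eq_1)
      then show ?thesis using fB that by simp
    qed
    then show ?thesis using u by simp
  qed
  have "(\<lambda>x. (p x \<bullet> b) *\<^sub>R b) \<in> polys k X" if "b \<in> B" for b
  proof -
    have "(\<lambda>x. p x \<bullet> b) = (\<lambda>x. \<Sum>e\<in>Basis. (b \<bullet> e) * (p x \<bullet> e))"
    proof
      fix x show "p x \<bullet> b = (\<Sum>e\<in>Basis. (b \<bullet> e) * (p x \<bullet> e))"
        by (subst euclidean_inner) (simp only: mult.commute)
    qed
    also have "\<dots> \<in> rpoly k" using p by (auto intro!: rpoly_sum rpoly_scale)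
    finally show ?thesis
      by (rule polys_sub_image[of _ k UNIV])
        (use B that X in \<open>auto intro!: linearI simp: scaleR_add_left subspace_scale subset_iff\<close>)
  qed
  then have "(\<lambda>x. \<Sum>b\<in>B. (p x \<bullet> b) *\<^sub>R b) \<in> polys k X"
    using X by (intro polys_sum) auto
  moreover have "(\<lambda>x. \<Sum>b\<in>B. (p x \<bullet> b) *\<^sub>R b) = p"
    using exp by auto
  ultimately show "p \<in> polys k X" by simp
qed

lemma polys_vec_iff:
  fixes p :: "real^'n \<Rightarrow> real^'m"
  assumes X: "subspace X"
  shows "p \<in> polys k X \<longleftrightarrow> (\<forall>i. (\<lambda>x. p x $ i) \<in> rpoly k) \<and> (\<forall>x. p x \<in> X)"
  by (subst polys_iff[OF X]) (auto simp: Basis_vec_def inner_axis)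

lemma polys_mat_iff:
  fixes p :: "real^'n \<Rightarrow> real^'m^'l"
  assumes X: "subspace X"
  shows "p \<in> polys k X \<longleftrightarrow> (\<forall>i j. (\<lambda>x. p x $ i $ j) \<in> rpoly k) \<and> (\<forall>x. p x \<in> X)"
  by (subst polys_iff[OF X]) (auto simp: Basis_vec_def inner_axis)

lemma continuous_on_polys:
  fixes p :: "real^'n \<Rightarrow> 'b::euclidean_space"
  assumes "p \<in> polys k X" "subspace X" shows "continuous_on S p"
proof -
  have "continuous_on S (\<lambda>x. \<Sum>b\<in>Basis. (p x \<bullet> b) *\<^sub>R b)"
    using assms(1) unfolding polys_iff[OF assms(2)]
    by (intro continuous_intros continuous_on_rpoly) auto
  then show ?thesis by (simp add: euclidean_representation)
qed

lemma rpoly_line: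
  assumes "p \<in> rpoly k"
  shows "\<exists>P. degree P \<le> k \<and> (\<forall>s. p (a + s *\<^sub>R b) = poly P s)"
  using assms
proof (induction rule: polys_induct)
  case (const k c)
  show ?case by (rule exI[of _ "[:c:]"]) auto
next
  case (add k f g)
  then obtain P Q where "degree P \<le> k" "\<forall>s. f (a + s *\<^sub>R b) = poly P s"
    "degree Q \<le> k" "\<forall>s. g (a + s *\<^sub>R b) = poly Q s" by blast
  then show ?case by (intro exI[of _ "P + Q"]) (auto intro: degree_add_le)
next
  case (coord k i f)
  then obtain P where P: "degree P \<le> k" "\<forall>s. f (a + s *\<^sub>R b) = poly P s" by blast
  have "degree ([:a $ i, b $ i:] * P) \<le> Suc k"
    using degree_mult_le[of "[:a $ i, b $ i:]" P] P by (auto simp: degree_pCons_eq_if split: if_splits)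
  then show ?case using P by (intro exI[of _ "[:a $ i, b $ i:] * P"]) (auto simp: algebra_simps)
qed

text \<open>On a line \<open>p\<close> is a polynomial in one variable with infinitely many
  roots.\<close>

lemma rpoly_line_zero:
  assumes "p \<in> rpoly k" "\<delta> > 0" "\<And>s. 0 < s \<Longrightarrow> s < \<delta> \<Longrightarrow> p (a + s *\<^sub>R b) = 0"
  shows "p (a + s *\<^sub>R b) = 0"
proof -
  obtain P where P: "\<And>s. p (a + s *\<^sub>R b) = poly P s" using rpoly_line[OF assms(1)] by blast
  have "{0<..<\<delta>} \<subseteq> {s. poly P s = 0}" using P assms(3) by auto
  then have "infinite {s. poly P s = 0}"
    using assms(2) infinite_Ioo[of 0 \<delta>] finite_subset by blast
  then have "P = 0" using poly_roots_finite by blast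
  then show ?thesis using P by simp
qed

text \<open>A polynomial of degree zero has no part divisible by \<open>\<lambda>\<close>; truncated subtraction would otherwise
  hide this, so that case is recorded separately.\<close>

lemma rpoly_hyperplane_quotient:
  fixes p :: "real^'n \<Rightarrow> real"
  assumes "p \<in> rpoly k" and lam: "lam \<in> rpoly 1"
  shows "\<exists>q. q \<in> rpoly (k - 1) \<and> (k = 0 \<longrightarrow> q = (\<lambda>_. 0)) \<and> (\<forall>x. p x - p (x - lam x *\<^sub>R e) = lam x * q x)"
  using assms(1)
proof (induction rule: polys_induct)
  case (const k c)
  show ?case by (rule exI[of _ "\<lambda>_. 0"]) (auto intro: rpoly_const)
next
  case (add k f g)
  then obtain q r where q: "q \<in> rpoly (k - 1)" "k = 0 \<longrightarrow> q = (\<lambda>_. 0)" "\<And>x. f x - f (x - lam x *\<^sub>R e) = lam x * q x"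
    and r: "r \<in> rpoly (k - 1)" "k = 0 \<longrightarrow> r = (\<lambda>_. 0)" "\<And>x. g x - g (x - lam x *\<^sub>R e) = lam x * r x" by blast
  have "f x + g x - (f (x - lam x *\<^sub>R e) + g (x - lam x *\<^sub>R e)) = lam x * (q x + r x)" for x
    using q(3)[of x] r(3)[of x] by (simp add: distrib_left)
  then show ?case using q r by (intro exI[of _ "\<lambda>x. q x + r x"]) (auto intro: rpoly_add)
next
  case (coord k i f)
  then obtain q where q: "q \<in> rpoly (k - 1)" "k = 0 \<longrightarrow> q = (\<lambda>_. 0)"
    "\<And>x. f x - f (x - lam x *\<^sub>R e) = lam x * q x" by blast
  have comp: "(\<lambda>x. (x - lam x *\<^sub>R e) $ j) \<in> rpoly 1" for j
    using rpoly_diff[OF rpoly_coord[of j] rpoly_scale2[OF lam, of "e $ j"]] by simp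
  have "(\<lambda>x. x $ i * q x) \<in> rpoly k"
  proof (cases k)
    case (Suc l)
    then show ?thesis using polys_coord_mult[of UNIV q l i] q(1) by simp
  qed (use q rpoly_const in simp)
  then have "(\<lambda>x. x $ i * q x + f (x - lam x *\<^sub>R e) * e $ i) \<in> rpoly k"
    by (intro rpoly_add rpoly_scale2 rpoly_compose[OF coord.hyps comp])
  moreover have "x $ i * f x - (x - lam x *\<^sub>R e) $ i * f (x - lam x *\<^sub>R e) =
      lam x * (x $ i * q x + f (x - lam x *\<^sub>R e) * e $ i)" for x
  proof -
    have "f x = f (x - lam x *\<^sub>R e) + lam x * q x" using q(3)[of x] by simp
    then show ?thesis by (simp only: vector_minus_component vector_scaleR_component) (simp add: algebra_simps)
  qed
  ultimately show ?case by (intro exI[of _ "\<lambda>x. x $ i * q x + f (x - lam x *\<^sub>R e) * e $ i"]) auto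
qed

subsection \<open>Derivatives and homogeneity\<close>

definition pd :: "'n \<Rightarrow> (real^'n \<Rightarrow> real) \<Rightarrow> real^'n \<Rightarrow> real" where
  "pd i p x = frechet_derivative p (at x) (axis i 1)"

lemma pd_eq: "(p has_derivative D) (at x) \<Longrightarrow> pd i p x = D (axis i 1)"
  unfolding pd_def using frechet_derivative_at by metis

text \<open>The degree \<open>k - 1\<close> is truncated at zero. The separate clause for
  \<open>k = 0\<close> is what keeps \<open>x $ i * D j x\<close> within degree \<open>k\<close> in
  the product step.\<close>

lemma rpoly_derivative_exists:
  fixes p :: "real^'n \<Rightarrow> real"
  assumes "p \<in> rpoly k"
  shows "\<exists>D. (\<forall>x. (p has_derivative (\<lambda>h. \<Sum>i\<in>UNIV. h $ i * D i x)) (at x)) \<and> (\<forall>i. D i \<in> rpoly (k - 1))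
    \<and> (k = 0 \<longrightarrow> D = (\<lambda>_ _. 0))"
  using assms
proof (induction rule: polys_induct)
  case (const k c)
  show ?case by (rule exI[of _ "\<lambda>_ _. 0"]) (auto intro: rpoly_const)
next
  case (add k f g)
  then obtain D E where
    D: "\<And>x. (f has_derivative (\<lambda>h. \<Sum>i\<in>UNIV. h $ i * D i x)) (at x)" "\<And>i. D i \<in> rpoly (k - 1)"
    "k = 0 \<longrightarrow> D = (\<lambda>_ _. 0)" and
    E: "\<And>x. (g has_derivative (\<lambda>h. \<Sum>i\<in>UNIV. h $ i * E i x)) (at x)" "\<And>i. E i \<in> rpoly (k - 1)"
    "k = 0 \<longrightarrow> E = (\<lambda>_ _. 0)" by (elim exE conjE) (rule that, auto)
  show ?case
    by (intro exI[of _ "\<lambda>i x. D i x + E i x"] conjI allI)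
      (use D(2,3) E(2,3) has_derivative_add[OF D(1) E(1)] in \<open>auto intro: rpoly_add simp: algebra_simps sum.distrib\<close>)
next
  case (coord k i f)
  then obtain D where
    D: "\<And>x. (f has_derivative (\<lambda>h. \<Sum>i\<in>UNIV. h $ i * D i x)) (at x)" "\<And>i. D i \<in> rpoly (k - 1)"
    "k = 0 \<longrightarrow> D = (\<lambda>_ _. 0)" by (elim exE conjE) (rule that, auto)
  let ?D = "\<lambda>j x. (if j = i then f x else 0) + x $ i * D j x"
  have "((\<lambda>x. x $ i * f x) has_derivative (\<lambda>h. \<Sum>j\<in>UNIV. h $ j * ?D j x)) (at x)" for x
  proof -
    have "((\<lambda>x. x $ i * f x) has_derivative
        (\<lambda>h. x $ i * (\<Sum>j\<in>UNIV. h $ j * D j x) + h $ i * f x)) (at x)"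
      by (intro has_derivative_mult D bounded_linear_imp_has_derivative bounded_linear_vec_nth)
    moreover have "(\<Sum>j\<in>UNIV. h $ j * ?D j x) = x $ i * (\<Sum>j\<in>UNIV. h $ j * D j x) + h $ i * f x" for h
      by (simp add: algebra_simps sum.distrib sum_distrib_left if_distrib[of "(*) _"] cong: if_cong)
    ultimately show ?thesis by simp
  qed
  moreover have "?D j \<in> rpoly k" for j
  proof -
    have "(\<lambda>x. x $ i * D j x) \<in> rpoly k"
    proof (cases k)
      case (Suc l)
      then show ?thesis using polys_coord_mult[of UNIV "D j" l i] D(2)[of j] by simp
    qed (use D rpoly_const in simp)
    then show ?thesis using coord.hyps by (cases "j = i") (simp_all add: rpoly_add)
  qed
  ultimately show ?case by (intro exI[of _ ?D]) auto
qed

lemma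
  assumes "p \<in> rpoly k"
  shows rpoly_derivative: "(p has_derivative (\<lambda>h. \<Sum>i\<in>UNIV. h $ i * pd i p x)) (at x)"
    and rpoly_pd: "pd i p \<in> rpoly (k - 1)"
    and rpoly_0_pd: "k = 0 \<Longrightarrow> pd i p = (\<lambda>_. 0)"
proof -
  obtain D where
    D: "\<And>x. (p has_derivative (\<lambda>h. \<Sum>i\<in>UNIV. h $ i * D i x)) (at x)" "\<And>i. D i \<in> rpoly (k - 1)"
    "k = 0 \<longrightarrow> D = (\<lambda>_ _. 0)"
    using rpoly_derivative_exists[OF assms] by (elim exE conjE) (rule that, auto)
  have "pd i p x = D i x" for i x
    using pd_eq[OF D(1)[of x], of i] by (simp add: axis_def if_distrib[of "\<lambda>y. y * _"] cong: if_cong)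
  then have e: "pd i p = D i" for i by auto
  show "(p has_derivative (\<lambda>h. \<Sum>i\<in>UNIV. h $ i * pd i p x)) (at x)" "pd i p \<in> rpoly (k - 1)"
    "k = 0 \<Longrightarrow> pd i p = (\<lambda>_. 0)"
    using D by (auto simp: e)
qed

lemma rpoly_pd': "p \<in> rpoly (Suc k) \<Longrightarrow> pd i p \<in> rpoly k"
  using rpoly_pd[of p "Suc k"] by simp

lemma rpoly_pd_same: "p \<in> rpoly k \<Longrightarrow> pd i p \<in> rpoly k"
  using rpoly_mono[OF rpoly_pd[of p k i], of k] by simp

lemma pd_add:
  assumes "p \<in> rpoly k" "q \<in> rpoly l"
  shows "pd i (\<lambda>x. p x + q x) x = pd i p x + pd i q x"
  using pd_eq[OF has_derivative_add[OF rpoly_derivative[OF assms(1)] rpoly_derivative[OF assms(2)]], of i x]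
  by (simp add: axis_def if_distrib[of "\<lambda>y. y * _"] cong: if_cong)

lemma pd_mult:
  assumes "p \<in> rpoly k" "q \<in> rpoly l"
  shows "pd i (\<lambda>x. p x * q x) x = pd i p x * q x + p x * pd i q x"
  using pd_eq[OF has_derivative_mult[OF rpoly_derivative[OF assms(1)] rpoly_derivative[OF assms(2)]], of i x]
  by (simp add: axis_def if_distrib[of "\<lambda>y. y * _"] cong: if_cong)

lemma pd_const [simp]: "pd i (\<lambda>x. c) x = 0"
  by (subst pd_eq[OF has_derivative_const]) simp

lemma pd_coord: "pd i (\<lambda>x. x $ j) x = (if i = j then 1 else 0)"
  by (subst pd_eq[OF bounded_linear_imp_has_derivative[OF bounded_linear_vec_nth]]) (simp add: axis_def)

lemma pd_scale: "p \<in> rpoly k \<Longrightarrow> pd i (\<lambda>x. c * p x) x = c * pd i p x"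
  using pd_mult[OF rpoly_const[of c 0], of p k i x] by simp

lemma pd_inner: "pd i (\<lambda>x. a \<bullet> x) x = a $ i"
  by (subst pd_eq[OF bounded_linear_imp_has_derivative[OF bounded_linear_inner_right]]) (simp add: inner_axis)

lemma pd_sum:
  assumes "\<And>j. j \<in> I \<Longrightarrow> p j \<in> rpoly k"
  shows "pd i (\<lambda>x. \<Sum>j\<in>I. p j x) x = (\<Sum>j\<in>I. pd i (p j) x)"
  using assms
proof (induction I rule: infinite_finite_induct)
  case (insert a I)
  then show ?case using pd_add[of "p a" k "\<lambda>x. \<Sum>j\<in>I. p j x" k] by (simp add: rpoly_sum)
qed auto

text \<open>Homogeneity as a property of the function, which makes degree comparisons and
  differentiation easy; \<open>hom_polysI\<close> translates it back into a condition on
  coefficients.\<close>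

definition hom :: "nat \<Rightarrow> (real^'n \<Rightarrow> 'b::real_vector) \<Rightarrow> bool" where
  "hom k p \<longleftrightarrow> (\<forall>t>0. \<forall>x. p (t *\<^sub>R x) = t ^ k *\<^sub>R p x)"

text \<open>Along the ray through \<open>x\<close> the polynomial equals \<open>s ^ m * p x\<close>,
  a monomial whose degree exceeds the available degree \<open>k\<close>.\<close>

lemma hom_eq_0:
  fixes p :: "real^'n \<Rightarrow> real"
  assumes "p \<in> rpoly k" "hom m p" "k < m"
  shows "p x = 0"
proof -
  obtain P where P: "degree P \<le> k" "\<And>s. p (s *\<^sub>R x) = poly P s"
    using rpoly_line[OF assms(1), of 0 x] by auto
  let ?Q = "P - monom (p x) m"
  have "{0<..<1} \<subseteq> {s. poly ?Q s = 0}"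
    using assms(2) by (auto simp: hom_def P(2)[symmetric] poly_monom)
  then have "infinite {s. poly ?Q s = 0}"
    using infinite_Ioo[of 0 "1::real"] by (meson finite_subset zero_less_one)
  then have "?Q = 0" using poly_roots_finite by blast
  then have "P = monom (p x) m" by simp
  then have "coeff P m = p x" by simp
  then show ?thesis using P(1) assms(3) by (simp add: coeff_eq_0)
qed

lemma rpoly_split_hom:
  fixes p :: "real^'n \<Rightarrow> real"
  assumes "p \<in> rpoly k"
  shows "\<exists>h q. h \<in> rpoly k \<and> hom k h \<and> q \<in> rpoly (k - 1) \<and> (k = 0 \<longrightarrow> q = (\<lambda>_. 0)) \<and> (\<forall>x. p x = h x + q x)"
  using assms
proof (induction rule: polys_induct)
  case (const k c)
  show ?case
  proof (cases k)
    case 0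
    then show ?thesis
      by (intro exI[of _ "\<lambda>_. c"] exI[of _ "\<lambda>_. 0"]) (auto intro: rpoly_const simp: hom_def)
  next
    case (Suc l)
    then show ?thesis
      by (intro exI[of _ "\<lambda>_. 0"] exI[of _ "\<lambda>_. c"]) (auto intro: rpoly_const simp: hom_def)
  qed
next
  case (add k f g)
  then obtain h q h' q' where h: "h \<in> rpoly k" "hom k h" "q \<in> rpoly (k - 1)" "k = 0 \<longrightarrow> q = (\<lambda>_. 0)"
    "\<forall>x. f x = h x + q x" and h': "h' \<in> rpoly k" "hom k h'" "q' \<in> rpoly (k - 1)" "k = 0 \<longrightarrow> q' = (\<lambda>_. 0)"
    "\<forall>x. g x = h' x + q' x" by blast
  have "hom k (\<lambda>x. h x + h' x)" using h(2) h'(2) by (simp add: hom_def distrib_left)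
  moreover have "\<forall>x. f x + g x = (h x + h' x) + (q x + q' x)" using h(5) h'(5) by simp
  moreover have "(\<lambda>x. h x + h' x) \<in> rpoly k" "(\<lambda>x. q x + q' x) \<in> rpoly (k - 1)"
    using h h' by (auto intro: rpoly_add)
  moreover have "k = 0 \<longrightarrow> (\<lambda>x. q x + q' x) = (\<lambda>_. 0)" using h(4) h'(4) by auto
  ultimately show ?case by blast
next
  case (coord k i f)
  then obtain h q where h: "h \<in> rpoly k" "hom k h" "q \<in> rpoly (k - 1)" "k = 0 \<longrightarrow> q = (\<lambda>_. 0)"
    "\<forall>x. f x = h x + q x" by blast
  have "(\<lambda>x. x $ i * q x) \<in> rpoly k"
  proof (cases k)
    case (Suc l)
    then show ?thesis using polys_coord_mult[of UNIV q l i] h by simp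
  qed (use h rpoly_const in simp)
  moreover have "(\<lambda>x. x $ i * h x) \<in> rpoly (Suc k)" using polys_coord_mult[of UNIV h k i] h by simp
  moreover have "hom (Suc k) (\<lambda>x. x $ i * h x)" using h(2) by (simp add: hom_def)
  moreover have "\<forall>x. x $ i * f x = x $ i * h x + x $ i * q x" using h(5) by (simp add: distrib_left)
  ultimately show ?case
    by (intro exI[of _ "\<lambda>x. x $ i * h x"] exI[of _ "\<lambda>x. x $ i * q x"]) simp
qed

text \<open>Differentiate \<open>p (t *\<^sub>R x) = t ^ m * p x\<close> at
  \<open>t = 1\<close>.\<close>

lemma euler_identity:
  assumes "p \<in> rpoly k" "hom m p"
  shows "(\<Sum>i\<in>UNIV. x $ i * pd i p x) = m * p x"
proof -
  have "((\<lambda>t. t *\<^sub>R x) has_derivative (\<lambda>h. h *\<^sub>R x)) (at 1)"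
    by (auto intro!: derivative_eq_intros)
  from has_derivative_compose[OF this rpoly_derivative[OF assms(1)]]
  have "((\<lambda>t. p (t *\<^sub>R x)) has_derivative (\<lambda>h. \<Sum>i\<in>UNIV. (h *\<^sub>R x) $ i * pd i p x)) (at 1)"
    by simp
  then have "((\<lambda>t. p (t *\<^sub>R x)) has_derivative (\<lambda>h. (\<Sum>i\<in>UNIV. x $ i * pd i p x) * h)) (at 1)"
    by (simp add: sum_distrib_left sum_distrib_right mult_ac)
  then have a: "((\<lambda>t. p (t *\<^sub>R x)) has_real_derivative (\<Sum>i\<in>UNIV. x $ i * pd i p x)) (at 1)"
    by (simp add: has_field_derivative_def mult_commute_abs)
  have "((\<lambda>t. t ^ m * p x) has_real_derivative real m * p x) (at 1)"
    by (auto intro!: derivative_eq_intros)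
  then have "((\<lambda>t. p (t *\<^sub>R x)) has_real_derivative real m * p x) (at 1)"
    by (rule has_field_derivative_transform_within_open[where S="{0<..}"])
      (use assms(2) in \<open>auto simp: hom_def\<close>)
  with a show ?thesis using DERIV_unique by blast
qed

lemma hom_pd:
  fixes p :: "real^'n \<Rightarrow> real"
  assumes "p \<in> rpoly k" "hom (Suc m) p"
  shows "hom m (pd i p)"
  unfolding hom_def
proof safe
  fix t :: real and x :: "real^'n" assume t: "t > 0"
  have "((\<lambda>x. t *\<^sub>R x) has_derivative (\<lambda>h. t *\<^sub>R h)) (at x)"
    by (auto intro!: derivative_eq_intros)
  from has_derivative_compose[OF this rpoly_derivative[OF assms(1)]]
  have "((\<lambda>x. p (t *\<^sub>R x)) has_derivative (\<lambda>h. \<Sum>i\<in>UNIV. (t *\<^sub>R h) $ i * pd i p (t *\<^sub>R x))) (at x)" .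
  from pd_eq[OF this, of i] have "pd i (\<lambda>x. p (t *\<^sub>R x)) x = t * pd i p (t *\<^sub>R x)"
    by (simp add: axis_def if_distrib[of "\<lambda>y. _ * y * _"] if_distrib[of "\<lambda>y. y * _"] cong: if_cong)
  moreover have "(\<lambda>x. p (t *\<^sub>R x)) = (\<lambda>x. t ^ Suc m * p x)" using assms(2) t by (simp add: hom_def)
  ultimately have "t * pd i p (t *\<^sub>R x) = t ^ Suc m * pd i p x"
    using pd_scale[OF assms(1)] by metis
  then show "pd i p (t *\<^sub>R x) = t ^ m *\<^sub>R pd i p x" using t by simp
qed

text \<open>The lower-order part \<open>?q\<close> is a difference of two functions homogeneous of
  degree \<open>k\<close>, hence itself of that kind; having degree below \<open>k\<close>, it
  vanishes by \<open>hom_eq_0\<close>.\<close>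

lemma hom_polysI:
  fixes p :: "real^'n \<Rightarrow> 'b::euclidean_space"
  assumes X: "subspace X" and "p \<in> polys k X" "hom k p"
  shows "p \<in> hom_polys k X"
proof -
  obtain c where c: "\<And>\<alpha>. c \<alpha> \<in> X" "\<And>x. p x = (\<Sum>\<alpha> | sum \<alpha> UNIV \<le> k. monomial \<alpha> x *\<^sub>R c \<alpha>)"
    using assms polysE by blast
  let ?h = "\<lambda>x. \<Sum>\<alpha> | sum \<alpha> UNIV = k. monomial \<alpha> x *\<^sub>R c \<alpha>"
  let ?q = "\<lambda>x. \<Sum>\<alpha> | sum \<alpha> UNIV < k. monomial \<alpha> x *\<^sub>R c \<alpha>"
  have fin: "finite {\<alpha>::'n \<Rightarrow> nat. sum \<alpha> UNIV < k}" "finite {\<alpha>::'n \<Rightarrow> nat. sum \<alpha> UNIV = k}"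
    by (auto intro: finite_subset[OF _ finite_multi_indices[of k]])
  have pq: "p x = ?h x + ?q x" for x
    unfolding c(2) by (subst sum.union_disjoint[symmetric]) (auto intro!: sum.cong fin)
  have mono: "monomial \<alpha> (t *\<^sub>R x) = t ^ sum \<alpha> UNIV * monomial \<alpha> x" for \<alpha> t and x :: "real^'n"
    by (simp add: monomial_def power_mult_distrib prod.distrib power_sum)
  have "hom k ?q"
    unfolding hom_def
  proof safe
    fix t :: real and x :: "real^'n" assume t: "t > 0"
    have "?h (t *\<^sub>R x) = t ^ k *\<^sub>R ?h x" by (simp add: mono scaleR_sum_right)
    then show "?q (t *\<^sub>R x) = t ^ k *\<^sub>R ?q x"
      using pq[of "t *\<^sub>R x"] pq[of x] assms(3) t by (simp add: hom_def algebra_simps)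
  qed
  have "?q x = 0" for x
  proof (cases k)
    case (Suc l)
    have "?q \<in> polys l UNIV"
      using Suc by (intro polys_sum polys_monomial) auto
    then have "(\<lambda>x. ?q x \<bullet> b) \<in> rpoly l" if "b \<in> Basis" for b using polys_iff[of UNIV ?q l] that by auto
    moreover have "hom k (\<lambda>x. ?q x \<bullet> b)" for b using \<open>hom k ?q\<close> by (simp add: hom_def)
    ultimately have "?q x \<bullet> b = 0" if "b \<in> Basis" for b using hom_eq_0[of "\<lambda>x. ?q x \<bullet> b" l k x] that Suc by auto
    then show ?thesis using euclidean_all_zero_iff by blast
  qed simp
  then have "p = ?h" using pq by auto
  then show ?thesis unfolding hom_polys_def using c(1) by blast
qed

lemma hom_polys_0:
  fixes W :: "real^'n \<Rightarrow> 'b::real_vector"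
  shows "W \<in> hom_polys 0 X \<longleftrightarrow> (\<exists>A\<in>X. W = (\<lambda>_. A))"
proof -
  have "{\<alpha>::'n \<Rightarrow> nat. sum \<alpha> UNIV = 0} = {\<lambda>_. 0}" by auto
  then have "(hom_polys 0 X :: (real^'n \<Rightarrow> 'b) set) = {\<lambda>_. c (\<lambda>_::'n. 0::nat) | c. \<forall>\<alpha>. c \<alpha> \<in> X}"
    unfolding hom_polys_def by (simp only:) (simp add: monomial_def)
  moreover have "\<exists>c. W = (\<lambda>_. c (\<lambda>_::'n. 0::nat)) \<and> (\<forall>\<alpha>. c \<alpha> \<in> X)" if "A \<in> X" "W = (\<lambda>_. A)" for A
    using that by (intro exI[of _ "\<lambda>_. A"]) auto
  ultimately show ?thesis by blast
qed

lemma polys_0: "polys 0 X = hom_polys 0 X"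
  by (simp add: polys_def hom_polys_def)

subsection \<open>Linear functionals and dimensions\<close>

lemma finite_basis_exists:
  fixes V :: "'a::real_vector set"
  assumes "subspace V" "V \<subseteq> span T" "finite T"
  obtains B where "finite B" "independent B" "B \<subseteq> V" "span B = V"
proof -
  obtain B where B: "B \<subseteq> V" "independent B" "V \<subseteq> span B"
    using real_vector.maximal_independent_subset by metis
  then have "finite B" using real_vector.independent_span_bound[OF assms(3), of B] assms(2) by blast
  moreover have "span B = V" using B assms(1) by (simp add: span_minimal subset_antisym)
  ultimately show ?thesis using B that by blast
qed

text \<open>Gram-Schmidt for an anisotropic symmetric form: a representative on the span of
  \<open>B'\<close> is corrected by a multiple of the part of the next basis vector that is
  orthogonal to \<open>B'\<close>. The functional is generalized in the induction because the
  hypothesis is applied both to the given functional and to \<open>\<beta> a\<close>.\<close>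

lemma riesz_finite:
  fixes V :: "'a::real_vector set"
  assumes V: "subspace V"
    and add: "\<And>u v w. u \<in> V \<Longrightarrow> v \<in> V \<Longrightarrow> w \<in> V \<Longrightarrow> \<beta> (u + v) w = \<beta> u w + \<beta> v w"
    and scale: "\<And>r u w. u \<in> V \<Longrightarrow> w \<in> V \<Longrightarrow> \<beta> (r *\<^sub>R u) w = r * \<beta> u w"
    and sym: "\<And>u w. u \<in> V \<Longrightarrow> w \<in> V \<Longrightarrow> \<beta> u w = \<beta> w u"
    and pos: "\<And>u. u \<in> V \<Longrightarrow> \<beta> u u = 0 \<Longrightarrow> u = 0"
    and l_add: "\<And>u v. u \<in> V \<Longrightarrow> v \<in> V \<Longrightarrow> l (u + v) = l u + l v"
    and l_scale: "\<And>r u. u \<in> V \<Longrightarrow> l (r *\<^sub>R u) = r * (l u :: real)"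
    and fin: "V \<subseteq> span T" "finite T"
  shows "\<exists>P\<in>V. \<forall>Q\<in>V. \<beta> P Q = l Q"
proof -
  obtain B where B: "finite B" "B \<subseteq> V" "span B = V"
    using finite_basis_exists[OF V fin] by metis
  have add2: "\<beta> w (u + v) = \<beta> w u + \<beta> w v" if "u \<in> V" "v \<in> V" "w \<in> V" for u v w
    using add[OF that] sym[of w] that subspace_add[OF V, of u v] by simp
  have scale2: "\<beta> w (r *\<^sub>R u) = r * \<beta> w u" if "u \<in> V" "w \<in> V" for r u w
    using scale[OF that] sym[of w] that subspace_scale[OF V, of u r] by simp
  have agree: "\<beta> P Q = l' Q"
    if "B' \<subseteq> V" "Q \<in> span B'" "P \<in> V" "\<And>b. b \<in> B' \<Longrightarrow> \<beta> P b = l' b"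
      "\<And>u v. u \<in> V \<Longrightarrow> v \<in> V \<Longrightarrow> l' (u + v) = l' u + l' v"
      "\<And>r u. u \<in> V \<Longrightarrow> l' (r *\<^sub>R u) = r * (l' u :: real)" for l' P Q B'
  proof -
    have 0: "\<beta> P 0 = 0" "l' 0 = 0"
      using scale[of 0 P 0] sym[of P 0] that(3) that(6)[of 0 0] subspace_0[OF V] by auto
    have "Q \<in> V \<and> \<beta> P Q = l' Q" using that(2)
    proof (induction rule: span_induct_alt)
      case base
      then show ?case using 0 subspace_0[OF V] by simp
    next
      case (step c x y)
      have x: "x \<in> V" using step that by auto
      then have "c *\<^sub>R x \<in> V" using V subspace_scale by blast
      then have "\<beta> P (c *\<^sub>R x + y) = c * \<beta> P x + \<beta> P y"
        using step that(3) x \<open>c *\<^sub>R x \<in> V\<close> add2 scale2 by simp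
      moreover have "l' (c *\<^sub>R x + y) = c * l' x + l' y"
        using step that(5,6) x \<open>c *\<^sub>R x \<in> V\<close> by simp
      ultimately show ?case
        using step that(4) \<open>c *\<^sub>R x \<in> V\<close> subspace_add[OF V] by simp
    qed
    then show ?thesis by simp
  qed
  have "\<exists>P\<in>span B'. \<forall>b\<in>B'. \<beta> P b = l' b"
    if "finite B'" "B' \<subseteq> V"
      "\<And>u v. u \<in> V \<Longrightarrow> v \<in> V \<Longrightarrow> l' (u + v) = l' u + l' v"
      "\<And>r u. u \<in> V \<Longrightarrow> l' (r *\<^sub>R u) = r * (l' u :: real)" for l' B'
    using that
  proof (induction B' arbitrary: l' rule: finite_induct)
    case empty
    then show ?case using span_zero by auto
  next
    case (insert a B')
    have BV: "B' \<subseteq> V" "a \<in> V" "span B' \<subseteq> V" using insert.prems V by (auto simp: span_minimal)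
    obtain P where P: "P \<in> span B'" "\<And>b. b \<in> B' \<Longrightarrow> \<beta> P b = l' b"
      using insert.IH[OF BV(1) insert.prems(2,3)] by blast
    obtain R where R: "R \<in> span B'" "\<And>b. b \<in> B' \<Longrightarrow> \<beta> R b = \<beta> a b"
      using insert.IH[OF BV(1), of "\<beta> a"] BV(2) add2[of _ _ a] scale2[of _ a] by auto
    have PV: "P \<in> V" "R \<in> V" using P R BV by auto
    \<comment> \<open>\<open>R\<close> represents \<open>\<beta> a\<close> on \<open>B'\<close>, so
      \<open>u\<close> is orthogonal to \<open>B'\<close>. Either \<open>u = 0\<close> and
      \<open>a\<close> brings nothing new, or \<open>\<beta> u a = \<beta> u u\<close> is nonzero
      and one can divide by it.\<close>
    define u where "u = a - R"
    have uV: "u \<in> V" using PV BV V by (simp add: u_def subspace_diff)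
    have mR: "(- 1) *\<^sub>R R \<in> V" using PV V subspace_scale by blast
    have \<beta>u: "\<beta> u w = \<beta> a w - \<beta> R w" if "w \<in> V" for w
      using add[of a "(- 1) *\<^sub>R R" w] scale[of R w "- 1"] that PV BV mR by (simp add: u_def)
    have ub: "\<beta> u b = 0" if "b \<in> B'" for b using \<beta>u[of b] R(2)[OF that] that BV by auto
    have uR: "\<beta> u R = 0" by (rule agree[OF BV(1) R(1) uV, of "\<lambda>_. 0", OF ub]) auto
    show ?case
    proof (cases "u = 0")
      case True
      then have "a \<in> span B'" using R(1) by (simp add: u_def)
      then have "\<beta> P a = l' a" using agree[OF BV(1) _ PV(1) P(2) insert.prems(2,3)] by simp
      moreover have "P \<in> span (insert a B')" using P(1) span_mono[of B' "insert a B'"] by auto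
      ultimately show ?thesis using P(2) by (intro bexI[of _ P]) auto
    next
      case False
      then have "\<beta> u u \<noteq> 0" using pos uV by blast
      moreover have "\<beta> u u = \<beta> u a"
        using \<beta>u[OF uV] sym[OF uV BV(2)] sym[OF uV PV(2)] uR by simp
      ultimately have nz: "\<beta> u a \<noteq> 0" by simp
      define c where "c = (l' a - \<beta> P a) / \<beta> u a"
      have cu: "c *\<^sub>R u \<in> V" using uV V subspace_scale by blast
      have "\<beta> (P + c *\<^sub>R u) b = l' b" if "b \<in> insert a B'" for b
        using that add[OF PV(1) cu, of b] scale[OF uV, of b c] BV ub P nz by (auto simp: c_def)
      moreover have "P + c *\<^sub>R u \<in> span (insert a B')"
        using P(1) R(1) span_mono[of B' "insert a B'"]
        unfolding u_def by (intro span_add span_scale span_diff) (auto simp: span_base)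
      ultimately show ?thesis by (intro bexI[of _ "P + c *\<^sub>R u"]) simp_all
    qed
  qed
  from this[of B l, OF B(1,2) l_add l_scale] have "\<exists>P\<in>span B. \<forall>b\<in>B. \<beta> P b = l b"
    by simp
  then obtain P where P: "P \<in> V" "\<And>b. b \<in> B \<Longrightarrow> \<beta> P b = l b"
    using B(3) by auto
  have "\<beta> P Q = l Q" if "Q \<in> V" for Q
    by (rule agree[OF B(2) _ P(1), of Q l, OF _ P(2) l_add l_scale]) (use that B(3) in auto)
  then show ?thesis using P(1) by auto
qed

text \<open>The functionals are integrals, which need not be additive on non-integrable arguments;
  linearity is therefore asked for only on a subspace.\<close>

definition linear_on_sub :: "'a::real_vector set \<Rightarrow> ('a \<Rightarrow> real) \<Rightarrow> bool" where
  "linear_on_sub V m \<longleftrightarrow>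
     (\<forall>u\<in>V. \<forall>v\<in>V. m (u + v) = m u + m v) \<and> (\<forall>r. \<forall>u\<in>V. m (r *\<^sub>R u) = r * m u)"

lemma linear_on_sub_mono: "linear_on_sub V m \<Longrightarrow> W \<subseteq> V \<Longrightarrow> linear_on_sub W m"
  unfolding linear_on_sub_def by blast

lemma subspace_kernel:
  assumes "subspace U" "linear_on_sub U m"
  shows "subspace {u \<in> U. m u = 0}"
proof -
  have "m (0 *\<^sub>R 0) = 0 * m 0"
    using assms(2) subspace_0[OF assms(1)] unfolding linear_on_sub_def by blast
  then show ?thesis
    using assms unfolding linear_on_sub_def subspace_def by auto
qed

text \<open>If \<open>m a \<noteq> 0\<close> for some \<open>a\<close> in \<open>D\<close>, every
  member of \<open>D\<close> differs from a kernel element by a multiple of \<open>a\<close>. Sizes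
  are measured by finite independent sets, because \<open>dim\<close> says nothing before the space
  is known to be finite-dimensional.\<close>

lemma kernel_codim_one:
  fixes U :: "'a::real_vector set"
  assumes U: "subspace U" and m: "linear_on_sub U m"
    and D: "D \<subseteq> U" "independent D" "finite D"
  obtains E where "E \<subseteq> {u \<in> U. m u = 0}" "independent E" "finite E" "card D \<le> card E + 1"
proof (cases "\<forall>d\<in>D. m d = 0")
  case True
  then show ?thesis using that[of D] D by auto
next
  case False
  then obtain a where a: "a \<in> D" "m a \<noteq> 0" by blast
  have "subspace ({u \<in> U. m u = 0} \<inter> span D)"
    by (intro subspace_inter subspace_kernel U m subspace_span)
  then obtain E where E: "finite E" "independent E" "E \<subseteq> {u \<in> U. m u = 0} \<inter> span D"
      "span E = {u \<in> U. m u = 0} \<inter> span D"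
    using finite_basis_exists[of _ D] D(3) by blast
  have "d \<in> span (insert a E)" if "d \<in> D" for d
  proof -
    define c where "c = - m d / m a"
    have "m (d + c *\<^sub>R a) = m d + c * m a"
      using m subsetD[OF D(1) a(1)] subsetD[OF D(1) that] subspace_scale[OF U] unfolding linear_on_sub_def by simp
    then have "m (d + c *\<^sub>R a) = 0" using a by (simp add: c_def)
    moreover have "d + c *\<^sub>R a \<in> U"
      using subspace_add[OF U] subspace_scale[OF U] D(1) a that by (meson subsetD)
    moreover have "d + c *\<^sub>R a \<in> span D"
      using a(1) that by (intro span_add span_scale span_base)
    ultimately have "d + c *\<^sub>R a \<in> span E" using E(4) by blast
    then have "(d + c *\<^sub>R a) - c *\<^sub>R a \<in> span (insert a E)"
      using span_mono[of E "insert a E"] by (intro span_diff span_scale) (auto intro: span_base)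
    then show ?thesis by simp
  qed
  then have "card D \<le> card (insert a E)"
    using real_vector.independent_span_bound[of "insert a E" D] D(2) E(1) by blast
  also have "\<dots> \<le> card E + 1" using E(1) by (simp add: card_insert_if)
  finally show ?thesis using that[of E] E by blast
qed

lemma kernel_codim:
  fixes U :: "'a::real_vector set"
  assumes U: "subspace U" and "finite J" and m: "\<And>j. j \<in> J \<Longrightarrow> linear_on_sub U (m j)"
    and D: "D \<subseteq> U" "independent D" "finite D"
  shows "subspace {u \<in> U. \<forall>j\<in>J. m j u = 0} \<and>
    (\<exists>E. E \<subseteq> {u \<in> U. \<forall>j\<in>J. m j u = 0} \<and> independent E \<and> finite E \<and> card D \<le> card E + card J)"
  using assms(2,3)
proof (induction J rule: finite_induct)
  case empty
  then show ?case using U D by auto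
next
  case (insert j J)
  let ?K = "{u \<in> U. \<forall>j\<in>J. m j u = 0}"
  obtain E where E: "E \<subseteq> ?K" "independent E" "finite E" "card D \<le> card E + card J"
    using insert by auto
  have K: "subspace ?K" "linear_on_sub ?K (m j)"
    using insert linear_on_sub_mono[of U "m j" ?K] by auto
  obtain F where F: "F \<subseteq> {u \<in> ?K. m j u = 0}" "independent F" "finite F" "card E \<le> card F + 1"
    using kernel_codim_one[OF K E(1-3)] by blast
  have "{u \<in> U. \<forall>i\<in>insert j J. m i u = 0} = {u \<in> ?K. m j u = 0}" by auto
  moreover have "card D \<le> card F + card (insert j J)"
    using E(4) F(4) insert.hyps by simp
  ultimately show ?case using subspace_kernel[OF K] F(1-3) by (intro conjI exI[of _ F]) auto
qed

text \<open>A finite part of \<open>D\<close> loses at most \<open>card I\<close> members on passing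
  to the common kernel, which is zero. So no finite part is larger than \<open>card I\<close>, and
  this also makes \<open>D\<close> finite.\<close>

lemma card_le_functionals:
  fixes V :: "'a::real_vector set"
  assumes V: "subspace V" and I: "finite I" and l: "\<And>i. i \<in> I \<Longrightarrow> linear_on_sub V (l i)"
    and inj: "\<And>u. u \<in> V \<Longrightarrow> (\<And>i. i \<in> I \<Longrightarrow> l i u = 0) \<Longrightarrow> u = 0"
    and D: "D \<subseteq> V" "independent D"
  shows "finite D \<and> card D \<le> card I"
proof -
  have *: "card F \<le> card I" if F: "F \<subseteq> D" "finite F" for F
  proof -
    have "F \<subseteq> V" "independent F" using F D(1) D(2) dependent_mono[of F D] by auto
    then have "\<exists>E. E \<subseteq> {u \<in> V. \<forall>i\<in>I. l i u = 0} \<and> independent E \<and> finite E \<and> card F \<le> card E + card I"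
      by (intro conjunct2[OF kernel_codim[OF V I]] l F(2))
    then obtain E where E: "E \<subseteq> {u \<in> V. \<forall>i\<in>I. l i u = 0}" "independent E" "finite E"
        "card F \<le> card E + card I" by (elim conjE exE)
    have "E \<subseteq> {0}" using E(1) inj by auto
    then have "E = {}" using E(2) real_vector.dependent_zero[of E] by auto
    then show ?thesis using E(4) by simp
  qed
  have "finite D"
  proof (rule ccontr)
    assume "infinite D"
    then obtain F where F: "F \<subseteq> D" "finite F" "card F = Suc (card I)"
      using infinite_arbitrarily_large by blast
    show False using *[OF F(1,2)] F(3) by simp
  qed
  then show ?thesis using * by blast
qed

text \<open>The counting principle: \<open>U\<close> is the relaxed space, \<open>m\<close> the
  conditions that cut out the reduced space, \<open>l\<close> the degrees of freedom. The kernel of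
  \<open>m\<close> has dimension at most \<open>card I\<close> because \<open>l\<close> separates
  its points, and at least \<open>card D - card J\<close>; the size of \<open>D\<close> makes both
  bounds meet.\<close>

lemma dim_kernel_eq:
  fixes U :: "'a::real_vector set"
  assumes U: "subspace U" and I: "finite I" and J: "finite J"
    and l: "\<And>i. i \<in> I \<Longrightarrow> linear_on_sub U (l i)" and m: "\<And>j. j \<in> J \<Longrightarrow> linear_on_sub U (m j)"
    and inj: "\<And>u. u \<in> U \<Longrightarrow> (\<And>j. j \<in> J \<Longrightarrow> m j u = 0) \<Longrightarrow> (\<And>i. i \<in> I \<Longrightarrow> l i u = 0) \<Longrightarrow> u = 0"
    and D: "D \<subseteq> U" "independent D" "finite D" "card I + card J \<le> card D"
  shows "subspace {u \<in> U. \<forall>j\<in>J. m j u = 0} \<and> dim {u \<in> U. \<forall>j\<in>J. m j u = 0} = card I"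
proof -
  let ?V = "{u \<in> U. \<forall>j\<in>J. m j u = 0}"
  have k: "subspace ?V \<and> (\<exists>E. E \<subseteq> ?V \<and> independent E \<and> finite E \<and> card D \<le> card E + card J)"
    by (intro kernel_codim U J m D(1-3))
  then obtain E where E: "E \<subseteq> ?V" "independent E" "finite E" "card D \<le> card E + card J"
    by (elim conjE exE)
  have V: "subspace ?V" using k by simp
  have lV: "linear_on_sub ?V (l i)" if "i \<in> I" for i
    using l[OF that] linear_on_sub_mono[of U "l i" ?V] by auto
  obtain B where B: "B \<subseteq> ?V" "independent B" "?V \<subseteq> span B"
    by (rule real_vector.maximal_independent_subset[of ?V])
  have fB: "finite B" "card B \<le> card I"
    using card_le_functionals[OF V I lV _ B(1,2)] inj by auto
  have "E \<subseteq> span B" using E(1) B(3) by (rule subset_trans)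
  then have "card E \<le> card B"
    using real_vector.independent_span_bound[OF fB(1) E(2)] by blast
  moreover have "card I \<le> card E" using D(4) E(4) by simp
  moreover have "dim ?V = card B"
    using real_vector.basis_card_eq_dim[OF B(1) B(3) B(2)] by simp
  ultimately show ?thesis using fB V by simp
qed

lemma independent_family:
  fixes y :: "'i \<Rightarrow> 'a::real_vector"
  assumes P: "finite P" and z: "\<And>c p. (\<Sum>p\<in>P. c p *\<^sub>R y p) = 0 \<Longrightarrow> p \<in> P \<Longrightarrow> c p = (0::real)"
  shows "inj_on y P \<and> independent (y ` P)"
proof -
  have inj: "inj_on y P"
  proof (rule inj_onI)
    fix p q assume pq: "p \<in> P" "q \<in> P" "y p = y q"
    show "p = q"
    proof (rule ccontr)
      assume ne: "p \<noteq> q"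
      let ?c = "\<lambda>r. (if r = p then 1 else 0) - (if r = q then 1 else (0::real))"
      have "(\<Sum>r\<in>P. ?c r *\<^sub>R y r) = (\<Sum>r\<in>P. if r = p then y r else 0) - (\<Sum>r\<in>P. if r = q then y r else 0)"
        unfolding sum_subtractf[symmetric] by (intro sum.cong) auto
      also have "\<dots> = 0" using P pq by simp
      finally have "?c p = 0" using z[of ?c p] pq by blast
      then show False using ne by simp
    qed
  qed
  moreover have "independent (y ` P)"
    unfolding real_vector.dependent_finite[OF finite_imageI[OF P]]
  proof clarify
    fix u p assume u: "(\<Sum>v\<in>y ` P. u v *\<^sub>R v) = 0" and p: "p \<in> P" "u (y p) \<noteq> 0"
    have "(\<Sum>p\<in>P. u (y p) *\<^sub>R y p) = 0" using u by (simp add: sum.reindex[OF inj])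
    then show False using z[of "\<lambda>p. u (y p)" p] p by blast
  qed
  ultimately show ?thesis by blast
qed

subsection \<open>Symmetric gradients\<close>

lemma subspace_sym: "subspace (sym_matrices :: (real^'n^'n) set)"
  by (auto simp: subspace_def sym_matrices_def transpose_def vec_eq_iff)

lemma sym_iff: "A \<in> sym_matrices \<longleftrightarrow> (\<forall>i j. A $ i $ j = A $ j $ i)"
  by (auto simp: sym_matrices_def transpose_def vec_eq_iff)

lemma skew_iff: "A \<in> skew_matrices \<longleftrightarrow> (\<forall>i j. A $ i $ j + A $ j $ i = 0)"
proof -
  have "A \<in> skew_matrices \<longleftrightarrow> (\<forall>i j. A $ j $ i = - A $ i $ j)"
    by (simp add: skew_matrices_def transpose_def vec_eq_iff)
  also have "\<dots> \<longleftrightarrow> (\<forall>i j. A $ i $ j + A $ j $ i = 0)"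
    by (simp add: eq_neg_iff_add_eq_0 add.commute)
  finally show ?thesis .
qed

lemma subspace_skew: "subspace (skew_matrices :: (real^'n^'n) set)"
  unfolding subspace_def
proof safe
  fix A B :: "real^'n^'n" and c :: real assume A: "A \<in> skew_matrices" 
  show "c *\<^sub>R A \<in> skew_matrices" using A by (simp add: skew_iff flip: distrib_left)
  assume B: "B \<in> skew_matrices"
  show "A + B \<in> skew_matrices"
    unfolding skew_iff
  proof safe
    fix i j
    have "A $ i $ j + A $ j $ i = 0" "B $ i $ j + B $ j $ i = 0" using A B skew_iff by auto
    then show "(A + B) $ i $ j + (A + B) $ j $ i = 0" by simp
  qed
qed (simp add: skew_iff)

text \<open>The linearized strain, written \<open>def q\<close> in the explanations. Its kernel
  among polynomial fields is \<open>RM\<close>.\<close>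

definition sgrad :: "(real^'n \<Rightarrow> real^'n) \<Rightarrow> real^'n \<Rightarrow> real^'n^'n" where
  "sgrad q x = (\<chi> i j. (pd i (\<lambda>y. q y $ j) x + pd j (\<lambda>y. q y $ i) x) / 2)"

lemma polys_comp: "q \<in> polys k UNIV \<Longrightarrow> (\<lambda>x. q x $ i) \<in> rpoly k" for q :: "real^'n \<Rightarrow> real^'m"
  by (simp add: polys_vec_iff)

lemma sgrad_polys:
  fixes q :: "real^'n \<Rightarrow> real^'n"
  assumes "q \<in> polys (Suc k) UNIV" shows "sgrad q \<in> polys k sym_matrices"
  unfolding polys_mat_iff[OF subspace_sym]
proof safe
  fix i j
  have "(\<lambda>x. (1/2) * (pd i (\<lambda>y. q y $ j) x + pd j (\<lambda>y. q y $ i) x)) \<in> rpoly k"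
    by (intro rpoly_scale rpoly_add rpoly_pd' polys_comp assms)
  then show "(\<lambda>x. sgrad q x $ i $ j) \<in> rpoly k" by (simp add: sgrad_def)
qed (simp add: sgrad_def sym_iff add.commute)

lemma RM_iff: "q \<in> RM \<longleftrightarrow> (\<exists>a B. B \<in> skew_matrices \<and> q = (\<lambda>x. a + B *v x))"
  by (auto simp: RM_def)

lemma affine_comp: "(\<lambda>x. (a + B *v x) $ i) \<in> rpoly 1"
  unfolding matrix_vector_mult_def by (auto intro!: rpoly_add rpoly_const rpoly_sum rpoly_scale rpoly_coord[unfolded One_nat_def])

lemma affine_polys: "(\<lambda>x. a + B *v x) \<in> polys 1 UNIV"
  unfolding polys_vec_iff[OF subspace_UNIV] using affine_comp by blast

lemma RM_polys: "q \<in> RM \<Longrightarrow> q \<in> polys 1 UNIV"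
  by (auto simp: RM_def affine_polys[unfolded One_nat_def])

lemma pd_affine: "pd i (\<lambda>x. (a + B *v x) $ j) x = B $ j $ i"
proof -
  have "(\<lambda>x. (a + B *v x) $ j) = (\<lambda>x. a $ j + (B $ j) \<bullet> x)"
    by (auto simp: matrix_vector_mult_def inner_vec_def)
  then show ?thesis
    using pd_add[OF rpoly_const[of "a $ j" 0] rpoly_inner[of "B $ j"], of i x] by (simp add: pd_inner)
qed

lemma sgrad_affine: "sgrad (\<lambda>x. a + B *v x) x = (\<chi> i j. (B $ i $ j + B $ j $ i) / 2)"
  unfolding sgrad_def pd_affine by (subst add.commute) (rule refl)

lemma sgrad_RM: "q \<in> RM \<Longrightarrow> sgrad q x = 0"
  unfolding RM_iff by (elim exE conjE) (simp only: sgrad_affine skew_iff, simp add: vec_eq_iff)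

text \<open>The partial derivatives are homogeneous of degree zero, so they are constant on each
  open ray, and as polynomials also up to its origin. Euler's identity then gives the
  formula.\<close>

lemma linear_of_hom_1:
  fixes u :: "real^'n \<Rightarrow> real"
  assumes u: "u \<in> rpoly k" "hom 1 u"
  shows "u x = (\<Sum>j\<in>UNIV. x $ j * pd j u 0)"
proof -
  have "pd j u x = pd j u 0" for j
  proof -
    have h: "hom 0 (pd j u)" using hom_pd[of u k 0 j] u by simp
    have p: "(\<lambda>y. pd j u y - pd j u x) \<in> rpoly k"
      by (intro rpoly_diff rpoly_const rpoly_pd_same u)
    have "pd j u (0 + 0 *\<^sub>R x) - pd j u x = 0"
      by (rule rpoly_line_zero[OF p, of 1]) (use h in \<open>auto simp: hom_def\<close>)
    then show ?thesis by simp
  qed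
  then show ?thesis using euler_identity[OF u, of x] by simp
qed

text \<open>The Euler equation says that \<open>u (t *\<^sub>R x) / t\<close> has derivative zero on
  the positive ray.\<close>

lemma hom_1_of_euler:
  fixes u :: "real^'n \<Rightarrow> real"
  assumes u: "u \<in> rpoly k" and e: "\<And>x. (\<Sum>j\<in>UNIV. x $ j * pd j u x) = u x"
  shows "hom 1 u"
  unfolding hom_def
proof safe
  fix t :: real and x assume t: "t > 0"
  have D: "((\<lambda>t. u (t *\<^sub>R x) / t) has_real_derivative 0) (at s within {0<..})" if "s > 0" for s
  proof -
    have "((\<lambda>t. t *\<^sub>R x) has_derivative (\<lambda>h. h *\<^sub>R x)) (at s within {0<..})"
      by (auto intro!: derivative_eq_intros)
    from has_derivative_compose[OF this rpoly_derivative[OF u]]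
    have "((\<lambda>t. u (t *\<^sub>R x)) has_derivative (\<lambda>h. (\<Sum>i\<in>UNIV. x $ i * pd i u (s *\<^sub>R x)) * h)) (at s within {0<..})"
      by (simp add: sum_distrib_left sum_distrib_right mult_ac)
    then have d: "((\<lambda>t. u (t *\<^sub>R x)) has_real_derivative (\<Sum>i\<in>UNIV. x $ i * pd i u (s *\<^sub>R x))) (at s within {0<..})"
      by (simp add: has_field_derivative_def mult_commute_abs)
    have "s * (\<Sum>i\<in>UNIV. x $ i * pd i u (s *\<^sub>R x)) = u (s *\<^sub>R x)"
      using e[of "s *\<^sub>R x"] by (simp add: sum_distrib_left mult_ac)
    then show ?thesis
      using DERIV_divide[OF d DERIV_ident] that by (simp add: mult.commute)
  qed
  obtain c where c: "\<And>s. s > 0 \<Longrightarrow> u (s *\<^sub>R x) / s = c"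
    using has_field_derivative_zero_constant[of "{0::real<..}" "\<lambda>t. u (t *\<^sub>R x) / t"] D by auto
  then have "u (t *\<^sub>R x) / t = u x" using c[OF t] c[of 1] by simp
  then show "u (t *\<^sub>R x) = t ^ 1 *\<^sub>R u x" using t by (simp add: field_simps)
qed

text \<open>Along every ray \<open>x \<bullet> q\<close> is constant, so \<open>x \<bullet> (q x - q 0)\<close> vanishes; differentiating this and
  combining with the hypothesis shows that \<open>q - q 0\<close> is homogeneous of degree one.\<close>

lemma sgrad_mult_position_zero:
  fixes q :: "real^'n \<Rightarrow> real^'n"
  assumes q: "q \<in> polys k UNIV" and z: "\<And>x. sgrad q x *v x = 0"
  shows "q \<in> RM"
proof -
  have qc: "(\<lambda>x. q x $ i) \<in> rpoly k" for i using q by (rule polys_comp)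
  have z': "(\<Sum>j\<in>UNIV. (pd i (\<lambda>y. q y $ j) x + pd j (\<lambda>y. q y $ i) x) * x $ j) = 0" for i x
  proof -
    have "(sgrad q x *v x) $ i = 0" using z by simp
    then have "(\<Sum>j\<in>UNIV. (pd i (\<lambda>y. q y $ j) x + pd j (\<lambda>y. q y $ i) x) / 2 * x $ j) = 0"
      by (simp add: sgrad_def matrix_vector_mult_def)
    then have "(\<Sum>j\<in>UNIV. (pd i (\<lambda>y. q y $ j) x + pd j (\<lambda>y. q y $ i) x) * x $ j) / 2 = 0"
      by (simp add: sum_divide_distrib)
    then show ?thesis by simp
  qed
  have zz: "(\<Sum>i\<in>UNIV. \<Sum>j\<in>UNIV. x $ i * x $ j * pd j (\<lambda>y. q y $ i) x) = 0" for x
  proof -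
    let ?S = "\<Sum>i\<in>UNIV. \<Sum>j\<in>UNIV. x $ i * x $ j * pd j (\<lambda>y. q y $ i) x"
    have "0 = (\<Sum>i\<in>UNIV. x $ i * (\<Sum>j\<in>UNIV. (pd i (\<lambda>y. q y $ j) x + pd j (\<lambda>y. q y $ i) x) * x $ j))"
      using z' by simp
    also have "\<dots> = (\<Sum>i\<in>UNIV. \<Sum>j\<in>UNIV. x $ j * x $ i * pd i (\<lambda>y. q y $ j) x) + ?S"
      by (simp add: sum_distrib_left sum.distrib algebra_simps)
    also have "(\<Sum>i\<in>UNIV. \<Sum>j\<in>UNIV. x $ j * x $ i * pd i (\<lambda>y. q y $ j) x) = ?S"
      by (rule sum.swap)
    finally show ?thesis by simp
  qed
  have ray: "x \<bullet> q x = x \<bullet> q 0" for x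
  proof -
    let ?f = "\<lambda>t. x \<bullet> q (t *\<^sub>R x)"
    have der: "(?f has_real_derivative (\<Sum>i\<in>UNIV. \<Sum>j\<in>UNIV. x $ i * x $ j * pd j (\<lambda>y. q y $ i) (t *\<^sub>R x))) (at t)" for t
    proof -
      have "((\<lambda>t. t *\<^sub>R x) has_derivative (\<lambda>h. h *\<^sub>R x)) (at t)"
        by (auto intro!: derivative_eq_intros)
      note D = has_derivative_compose[OF this rpoly_derivative[OF qc]]
      have "((\<lambda>t. \<Sum>i\<in>UNIV. x $ i * q (t *\<^sub>R x) $ i) has_derivative
          (\<lambda>h. \<Sum>i\<in>UNIV. x $ i * (\<Sum>j\<in>UNIV. (h *\<^sub>R x) $ j * pd j (\<lambda>y. q y $ i) (t *\<^sub>R x)))) (at t)"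
        by (intro has_derivative_sum has_derivative_mult_right D)
      moreover have "(\<Sum>i\<in>UNIV. x $ i * (\<Sum>j\<in>UNIV. (h *\<^sub>R x) $ j * pd j (\<lambda>y. q y $ i) (t *\<^sub>R x)))
          = (\<Sum>i\<in>UNIV. \<Sum>j\<in>UNIV. x $ i * x $ j * pd j (\<lambda>y. q y $ i) (t *\<^sub>R x)) * h" for h
        by (simp add: sum_distrib_left sum_distrib_right mult_ac)
      ultimately show ?thesis
        by (simp add: has_field_derivative_def inner_vec_def mult_commute_abs)
    qed
    \<comment> \<open>The identity \<open>zz\<close> at \<open>t *\<^sub>R x\<close> carries a
      factor \<open>t * t\<close>, so the derivative is first known to vanish only for
      \<open>t \<noteq> 0\<close>; continuity takes care of the end point.\<close>
    have "(\<Sum>i\<in>UNIV. \<Sum>j\<in>UNIV. x $ i * x $ j * pd j (\<lambda>y. q y $ i) (t *\<^sub>R x)) = 0" if "t \<noteq> 0" for t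
    proof -
      have "t * t * (\<Sum>i\<in>UNIV. \<Sum>j\<in>UNIV. x $ i * x $ j * pd j (\<lambda>y. q y $ i) (t *\<^sub>R x)) = 0"
        using zz[of "t *\<^sub>R x"] by (simp add: sum_distrib_left mult_ac)
      then show ?thesis using that by simp
    qed
    then have d0: "(?f has_real_derivative 0) (at t)" if "t \<noteq> 0" for t using der[of t] that by simp
    have "continuous_on {0..1} ?f"
      using der by (meson DERIV_isCont continuous_at_imp_continuous_on)
    then have "?f 1 = ?f 0"
      using d0 by (intro DERIV_isconst2[of 0 1 ?f 1]) auto
    then show ?thesis by simp
  qed
  define u where "u i x = q x $ i - q 0 $ i" for i x
  have up: "u i \<in> rpoly k" for i
    unfolding u_def by (intro rpoly_diff qc rpoly_const)
  have pu: "pd j (u i) x = pd j (\<lambda>y. q y $ i) x" for i j x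
    using pd_add[OF qc[of i] rpoly_const[of "- q 0 $ i" 0], of j x] by (simp add: u_def[abs_def])
  have 1: "u i x + (\<Sum>j\<in>UNIV. x $ j * pd i (u j) x) = 0" for i x
  proof -
    have "(\<lambda>x. \<Sum>j\<in>UNIV. x $ j * u j x) = (\<lambda>x. 0)"
      using ray by (auto simp: u_def inner_vec_def algebra_simps sum_subtractf)
    then have "0 = pd i (\<lambda>x. \<Sum>j\<in>UNIV. x $ j * u j x) x" by simp
    also have "\<dots> = (\<Sum>j\<in>UNIV. pd i (\<lambda>x. x $ j * u j x) x)"
      by (rule pd_sum) (rule rpoly_mult[OF rpoly_coord up])
    also have "\<dots> = (\<Sum>j\<in>UNIV. (if i = j then u j x else 0) + x $ j * pd i (u j) x)"
      by (intro sum.cong refl) (simp add: pd_mult[OF rpoly_coord up] pd_coord)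
    also have "\<dots> = u i x + (\<Sum>j\<in>UNIV. x $ j * pd i (u j) x)"
      by (simp add: sum.distrib)
    finally show ?thesis by simp
  qed
  have 2: "(\<Sum>j\<in>UNIV. x $ j * pd i (u j) x) + (\<Sum>j\<in>UNIV. x $ j * pd j (u i) x) = 0" for i x
    using z'[of i x] by (simp add: pu sum.distrib algebra_simps)
  have "(\<Sum>j\<in>UNIV. x $ j * pd j (u i) x) = u i x" for i x
    using 1[where i=i and x=x] 2[where i=i and x=x] by linarith
  then have "hom 1 (u i)" for i using hom_1_of_euler[OF up] by blast
  then have lin: "u i x = (\<Sum>j\<in>UNIV. x $ j * pd j (u i) 0)" for i x using linear_of_hom_1[OF up] by blast
  define B where "B = (\<chi> i j. pd j (u i) 0)"
  have qB: "q = (\<lambda>x. q 0 + B *v x)"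
  proof (rule ext, subst vec_eq_iff, rule allI)
    fix x i show "q x $ i = (q 0 + B *v x) $ i"
      using lin[of i x] by (simp add: u_def B_def matrix_vector_mult_def mult.commute)
  qed
  have "sgrad q x = (\<chi> i j. (B $ i $ j + B $ j $ i) / 2)" for x
    by (subst qB) (rule sgrad_affine)
  then have "(\<chi> i j. (B $ i $ j + B $ j $ i) / 2) *v x = 0" for x using z[of x] by simp
  then have "(\<chi> i j. (B $ i $ j + B $ j $ i) / 2) = 0" by (subst matrix_eq) simp
  then have "B \<in> skew_matrices" by (simp add: skew_iff vec_eq_iff)
  then show ?thesis using qB unfolding RM_iff by blast
qed

lemma sgrad_zero: "q \<in> polys k UNIV \<Longrightarrow> (\<And>x. sgrad q x = 0) \<Longrightarrow> q \<in> RM"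
  using sgrad_mult_position_zero by (metis matrix_vector_mult_0)

text \<open>For \<open>H\<close> homogeneous of degree \<open>m \<ge> 1\<close> the equation \<open>(def q) x = H x\<close> reads
  \<open>m q + \<nabla>(x \<bullet> q) = 2 H x\<close>; multiplying by \<open>x\<close> and using Euler's identity gives
  \<open>x \<bullet> q = (x \<bullet> H x) / (m + 1)\<close>, hence the formula for \<open>q\<close> below.\<close>

lemma sgrad_solve_hom:
  fixes H :: "real^'n \<Rightarrow> real^'n^'n"
  assumes H: "H \<in> polys m sym_matrices" and hom: "hom m H"
  shows "\<exists>q\<in>polys (Suc m) UNIV. \<forall>x. sgrad q x *v x = H x *v x"
proof (cases "m = 0")
  case True
  then obtain A where A: "H = (\<lambda>_. A)" "A \<in> sym_matrices" using H by (auto simp: polys_0 hom_polys_0)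
  have "sgrad (\<lambda>x. 0 + A *v x) x = A" for x
    unfolding sgrad_affine using A(2) by (simp add: sym_iff vec_eq_iff)
  then show ?thesis using A True affine_polys[of 0 A]
    by (intro bexI[of _ "\<lambda>x. 0 + A *v x"]) auto
next
  case False
  have Hp: "(\<lambda>x. H x $ i $ j) \<in> rpoly m" for i j using H by (simp add: polys_mat_iff[OF subspace_sym])
  define s where "s i x = (\<Sum>j\<in>UNIV. H x $ i $ j * x $ j)" for i x
  define w where "w x = (\<Sum>i\<in>UNIV. x $ i * s i x)" for x
  have sp: "s i \<in> rpoly (Suc m)" for i
    unfolding s_def using rpoly_mult[OF Hp rpoly_coord] by (intro rpoly_sum) simp
  have wp: "w \<in> rpoly (Suc (Suc m))"
    unfolding w_def using rpoly_mult[OF rpoly_coord sp] by (intro rpoly_sum) simp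
  have sh: "hom (Suc m) (s i)" for i
    using hom by (simp add: hom_def s_def sum_distrib_left mult_ac)
  have wh: "hom (Suc (Suc m)) w"
    using sh by (simp add: hom_def w_def sum_distrib_left mult_ac)
  define q where "q x = (\<chi> i. (1 / m) * (2 * s i x - (1 / (m + 1)) * pd i w x))" for x
  have qp: "(\<lambda>x. q x $ i) \<in> rpoly (Suc m)" for i
  proof -
    have "(\<lambda>x. (1 / m) * (2 * s i x - (1 / (m + 1)) * pd i w x)) \<in> rpoly (Suc m)"
      by (intro rpoly_scale rpoly_diff rpoly_pd' sp wp)
    then show ?thesis by (simp add: q_def)
  qed
  have qh: "hom (Suc m) (\<lambda>x. q x $ i)" for i
    using sh[of i] hom_pd[OF wp wh, of i] by (simp add: hom_def q_def algebra_simps)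
  have xq: "(\<Sum>j\<in>UNIV. x $ j * q x $ j) = (1 / (m + 1)) * w x" for x
  proof -
    have e: "(\<Sum>j\<in>UNIV. x $ j * pd j w x) = (m + 2) * w x"
      using euler_identity[OF wp wh, of x] by simp
    have "(\<Sum>j\<in>UNIV. x $ j * q x $ j) = (1 / m) * (2 * w x - (1 / (m + 1)) * (\<Sum>j\<in>UNIV. x $ j * pd j w x))"
      unfolding w_def q_def by (simp add: algebra_simps sum_subtractf sum_distrib_left sum_divide_distrib)
    also have "\<dots> = (1 / (m + 1)) * w x"
      unfolding e using False by (simp add: field_simps)
    finally show ?thesis .
  qed
  have "sgrad q x *v x = H x *v x" for x
  proof (subst vec_eq_iff, rule allI)
    fix i
    have "(\<Sum>j\<in>UNIV. x $ j * pd i (\<lambda>y. q y $ j) x) + q x $ i = (1 / (m + 1)) * pd i w x"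
    proof -
      have "(1 / (m + 1)) * pd i w x = pd i (\<lambda>x. \<Sum>j\<in>UNIV. x $ j * q x $ j) x"
        unfolding xq using pd_scale[OF wp, of i "1 / (m + 1)" x] by simp
      also have "\<dots> = (\<Sum>j\<in>UNIV. pd i (\<lambda>x. x $ j * q x $ j) x)"
        by (rule pd_sum) (rule rpoly_mult[OF rpoly_coord qp])
      also have "\<dots> = (\<Sum>j\<in>UNIV. (if i = j then q x $ j else 0) + x $ j * pd i (\<lambda>y. q y $ j) x)"
        by (intro sum.cong refl) (simp add: pd_mult[OF rpoly_coord qp] pd_coord)
      finally show ?thesis by (simp add: sum.distrib)
    qed
    moreover have "(\<Sum>j\<in>UNIV. x $ j * pd j (\<lambda>y. q y $ i) x) = (m + 1) * q x $ i"
      using euler_identity[OF qp qh, of x i] by simp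
    moreover have "m * q x $ i = 2 * s i x - (1 / (m + 1)) * pd i w x"
      using False by (simp add: q_def)
    ultimately have *: "(\<Sum>j\<in>UNIV. x $ j * pd i (\<lambda>y. q y $ j) x) + (\<Sum>j\<in>UNIV. x $ j * pd j (\<lambda>y. q y $ i) x) = 2 * s i x"
      by (simp add: distrib_right)
    have "(sgrad q x *v x) $ i = (\<Sum>j\<in>UNIV. (x $ j * pd i (\<lambda>y. q y $ j) x + x $ j * pd j (\<lambda>y. q y $ i) x) / 2)"
      unfolding sgrad_def matrix_vector_mult_def by (simp add: algebra_simps add_divide_distrib)
    also have "\<dots> = s i x" unfolding sum_divide_distrib[symmetric] sum.distrib * by simp
    finally show "(sgrad q x *v x) $ i = (H x *v x) $ i" by (simp add: s_def matrix_vector_mult_def)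
  qed
  moreover have "q \<in> polys (Suc m) UNIV" using qp by (simp add: polys_vec_iff)
  ultimately show ?thesis by blast
qed

lemma sgrad_add:
  assumes "q \<in> polys k UNIV" "r \<in> polys l UNIV"
  shows "sgrad (\<lambda>x. q x + r x) x = sgrad q x + sgrad r x"
  using pd_add[OF polys_comp[OF assms(1)] polys_comp[OF assms(2)]]
  by (simp add: sgrad_def vec_eq_iff add_divide_distrib algebra_simps)

text \<open>Homogeneous parts are peeled off from the top degree. The splitting acts on single
  entries, so both parts are symmetrized; they still add up to \<open>Q\<close> because
  \<open>Q\<close> is symmetric. As a consequence \<open>Q - def q\<close> annihilates the position
  vector, which is the kind of field tested in the interior moments.\<close>

lemma sgrad_solve:
  fixes Q :: "real^'n \<Rightarrow> real^'n^'n"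
  assumes "Q \<in> polys m sym_matrices"
  shows "\<exists>q\<in>polys (Suc m) UNIV. \<forall>x. sgrad q x *v x = Q x *v x"
  using assms
proof (induction m arbitrary: Q)
  case 0
  then have "hom 0 Q" by (auto simp: polys_0 hom_polys_0 hom_def)
  then show ?case using sgrad_solve_hom[OF 0] by blast
next
  case (Suc m)
  have "\<exists>h r. h \<in> rpoly (Suc m) \<and> hom (Suc m) h \<and> r \<in> rpoly m \<and> (\<forall>x. Q x $ i $ j = h x + r x)" for i j
    using rpoly_split_hom[of "\<lambda>x. Q x $ i $ j" "Suc m"] Suc.prems
    by (auto simp: polys_mat_iff[OF subspace_sym])
  then obtain h r where h: "\<And>i j. h i j \<in> rpoly (Suc m)" "\<And>i j. hom (Suc m) (h i j)"
    "\<And>i j. r i j \<in> rpoly m" "\<And>i j x. Q x $ i $ j = h i j x + r i j x"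
    by metis
  define H where "H x = (\<chi> i j. (1/2) * (h i j x + h j i x))" for x
  define R where "R x = (\<chi> i j. (1/2) * (r i j x + r j i x))" for x
  have Hp: "H \<in> polys (Suc m) sym_matrices"
    unfolding polys_mat_iff[OF subspace_sym] H_def
    using h(1) by (auto simp: sym_iff add.commute intro!: rpoly_scale[of _ _ "1/2", simplified] rpoly_add)
  have Rp: "R \<in> polys m sym_matrices"
    unfolding polys_mat_iff[OF subspace_sym] R_def
    using h(3) by (auto simp: sym_iff add.commute intro!: rpoly_scale[of _ _ "1/2", simplified] rpoly_add)
  have Hh: "hom (Suc m) H"
    using h(2) by (simp add: hom_def H_def vec_eq_iff distrib_left)
  have QHR: "Q x = H x + R x" for x
  proof -
    have "Q x $ i $ j = (1/2) * (h i j x + h j i x) + (1/2) * (r i j x + r j i x)" for i j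
    proof -
      have "Q x $ i $ j = Q x $ j $ i"
        using Suc.prems polys_in[OF subspace_sym] sym_iff by blast
      then show ?thesis
        using h(4)[where i=i and j=j and x=x] h(4)[where i=j and j=i and x=x] by argo
    qed
    then show ?thesis unfolding H_def R_def by (simp add: vec_eq_iff)
  qed
  obtain q where q: "q \<in> polys (Suc (Suc m)) UNIV" "\<And>x. sgrad q x *v x = H x *v x"
    using sgrad_solve_hom[OF Hp Hh] by blast
  obtain q' where q': "q' \<in> polys (Suc m) UNIV" "\<And>x. sgrad q' x *v x = R x *v x"
    using Suc.IH[OF Rp] by blast
  have "(\<lambda>x. q x + q' x) \<in> polys (Suc (Suc m)) UNIV"
    using polys_add[OF _ q(1) polys_mono[OF _ q'(1)]] by simp
  moreover have "sgrad (\<lambda>x. q x + q' x) x *v x = Q x *v x" for x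
    by (simp add: sgrad_add[OF q(1) q'(1)] matrix_vector_mult_add_rdistrib q(2) q'(2) QHR)
  ultimately show ?case by blast
qed

subsection \<open>Moments on faces and cells\<close>

text \<open>The common ground of surface measure on a face and Lebesgue measure on the simplex:
  continuous functions are integrable over \<open>f\<close>, and a nonnegative continuous function
  with integral zero vanishes at every point of \<open>f\<close>, boundary points included.\<close>

definition charges :: "'a::euclidean_space measure \<Rightarrow> 'a set \<Rightarrow> bool" where
  "charges M f \<longleftrightarrow> sets M = sets borel \<and> compact f \<and> emeasure M f < \<infinity> \<and>
     (\<forall>x\<in>f. \<forall>\<epsilon>>0. emeasure M (ball x \<epsilon> \<inter> f) > 0)"

lemma charges_integrable:
  fixes h :: "'a::euclidean_space \<Rightarrow> real"
  assumes M: "charges M f" and h: "continuous_on UNIV h"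
  shows "set_integrable M f h"
proof -
  have sM: "sets M = sets borel" and c: "compact f" and fin: "emeasure M f < \<infinity>"
    using M by (auto simp: charges_def)
  have "compact (h ` f)" using c h continuous_on_subset compact_continuous_image by blast
  then obtain B where B: "\<And>x. x \<in> f \<Longrightarrow> norm (h x) \<le> B"
    using compact_imp_bounded bounded_iff by (metis imageI)
  have "h \<in> borel_measurable M"
    using borel_measurable_continuous_onI[OF h] measurable_cong_sets[OF sM refl] by blast
  then have "integrable M (\<lambda>x. indicator f x *\<^sub>R h x)"
    using fin B sM c by (intro integrableI_bounded_set_indicator[where B=B])
      (auto simp: borel_compact)
  then show ?thesis by (simp add: set_integrable_def)
qed

lemma charges_integral_zero:
  fixes h :: "'a::euclidean_space \<Rightarrow> real"
  assumes M: "charges M f" and h: "continuous_on UNIV h" and nn: "\<And>x. x \<in> f \<Longrightarrow> 0 \<le> h x"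
    and z: "(LINT x:f|M. h x) = 0" and x: "x \<in> f"
  shows "h x = 0"
proof (rule ccontr)
  assume "h x \<noteq> 0"
  then have hx: "h x > 0" using nn[OF x] by simp
  have "open {y. 0 < h y}" by (rule open_Collect_less) (use h in auto)
  then obtain \<epsilon> where e: "\<epsilon> > 0" "ball x \<epsilon> \<subseteq> {y. h y > 0}"
    by (rule openE[of _ x]) (use hx in auto)
  have sM: "sets M = sets borel" and c: "compact f" using M by (auto simp: charges_def)
  have "integrable M (\<lambda>y. indicator f y *\<^sub>R h y)"
    using charges_integrable[OF M h] by (simp add: set_integrable_def)
  moreover have "AE y in M. 0 \<le> indicator f y *\<^sub>R h y"
    using nn by (intro AE_I2) (simp add: indicator_def)
  moreover have "(\<integral>y. indicator f y *\<^sub>R h y \<partial>M) = 0"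
    using z by (simp add: set_lebesgue_integral_def)
  ultimately have "AE y in M. indicator f y *\<^sub>R h y = 0"
    using integral_nonneg_eq_0_iff_AE by blast
  then have "AE y in M. y \<notin> ball x \<epsilon> \<inter> f"
    by eventually_elim (use e in \<open>auto simp: subset_iff indicator_def\<close>)
  moreover have s: "ball x \<epsilon> \<inter> f \<in> sets M"
    unfolding sM by (intro sets.Int borel_open borel_compact c open_ball)
  moreover have s': "{y \<in> space M. \<not> y \<notin> ball x \<epsilon> \<inter> f} = ball x \<epsilon> \<inter> f"
    using sets_eq_imp_space_eq[OF sM] by auto
  ultimately have "emeasure M (ball x \<epsilon> \<inter> f) = 0" using AE_iff_measurable[OF s s'] by simp
  moreover have "emeasure M (ball x \<epsilon> \<inter> f) > 0" using M e(1) x unfolding charges_def by blast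
  ultimately show False by simp
qed

text \<open>Each point of \<open>K\<close> is a limit of interior points, so every ball around it
  contains a small ball lying inside \<open>K\<close>.\<close>

lemma charges_lborel:
  fixes K :: "'a::euclidean_space set"
  assumes "compact K" "convex K" "interior K \<noteq> {}"
  shows "charges lborel K"
  unfolding charges_def
proof (intro conjI ballI allI impI)
  show "emeasure lborel K < \<infinity>" using assms(1) emeasure_compact_finite by auto
  fix x and \<epsilon> :: real assume x: "x \<in> K" and e: "\<epsilon> > 0"
  have "x \<in> closure (interior K)"
    using convex_closure_interior[OF assms(2,3)] x closure_subset by auto
  then obtain y where y: "y \<in> interior K" "dist y x < \<epsilon>" using e closure_approachable by blast
  then have "y \<in> ball x \<epsilon> \<inter> interior K" by (simp add: dist_commute)
  moreover have "open (ball x \<epsilon> \<inter> interior K)" by auto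
  ultimately obtain \<delta> where d: "\<delta> > 0" "ball y \<delta> \<subseteq> ball x \<epsilon> \<inter> interior K"
    by (meson open_contains_ball)
  have "0 < emeasure lborel (ball y \<delta>)"
    using d(1) content_ball_pos[of \<delta> y] by (simp add: measure_def zero_less_iff_neq_zero) auto
  also have "\<dots> \<le> emeasure lborel (ball x \<epsilon> \<inter> K)"
    using d(2) interior_subset[of K] assms(1) by (intro emeasure_mono) (auto simp: borel_compact)
  finally show "0 < emeasure lborel (ball x \<epsilon> \<inter> K)" .
qed (use assms in auto)

section \<open>Tangent spaces, surface measure and the inner products\<close>

lemma tangent_space_base:
  assumes "a \<in> f" shows "tangent_space f = span ((\<lambda>x. x - a) ` f)"
proof
  have "x - y \<in> span ((\<lambda>x. x - a) ` f)" if "x \<in> f" "y \<in> f" for x y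
    using span_diff[OF span_base[of "x - a" "(\<lambda>x. x - a) ` f"] span_base[of "y - a" "(\<lambda>x. x - a) ` f"]] that by auto
  then show "tangent_space f \<subseteq> span ((\<lambda>x. x - a) ` f)"
    unfolding tangent_space_def by (intro span_minimal) auto
  show "span ((\<lambda>x. x - a) ` f) \<subseteq> tangent_space f"
    unfolding tangent_space_def using assms by (intro span_mono) auto
qed

lemma dim_tangent_space:
  assumes "f \<noteq> {}" shows "int (dim (tangent_space f)) = aff_dim f"
proof -
  obtain a where a: "a \<in> f" using assms by auto
  have "aff_dim f = int (dim ((+) (- a) ` f))"
    using a by (intro aff_dim_eq_dim hull_inc)
  moreover have "(+) (- a) ` f = (\<lambda>x. x - a) ` f" by auto
  ultimately show ?thesis using tangent_space_base[OF a] by (simp add: dim_span)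
qed

lemma orthonormal_frame_exists:
  assumes "f \<noteq> {}" shows "\<exists>t. orthonormal_basis {..<nat (aff_dim f)} t (tangent_space f)"
proof -
  have "subspace (tangent_space f)" by (simp add: tangent_space_def)
  then obtain B where B: "B \<subseteq> tangent_space f" "pairwise orthogonal B" "\<And>x. x \<in> B \<Longrightarrow> norm x = 1"
      "independent B" "card B = dim (tangent_space f)" "span B = tangent_space f"
    by (rule orthonormal_basis_subspace) blast
  have "card B = nat (aff_dim f)" using B(5) dim_tangent_space[OF assms] by simp
  moreover have "finite B" using B(4) by (rule independent_imp_finite)
  ultimately obtain t where t: "bij_betw t {..<nat (aff_dim f)} B"
    using ex_bij_betw_nat_finite[of B] by (auto simp: atLeast0LessThan)
  have "t i \<bullet> t j = (if i = j then 1 else 0)" if "i < nat (aff_dim f)" "j < nat (aff_dim f)" for i j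
  proof (cases "i = j")
    case True
    then show ?thesis using B(3) t that by (auto simp: bij_betw_def norm_eq_1)
  next
    case False
    then have "t i \<noteq> t j" using t that by (auto simp: bij_betw_def inj_on_def)
    then show ?thesis using False B(2) t that by (auto simp: bij_betw_def pairwise_def orthogonal_def)
  qed
  moreover have "span (t ` {..<nat (aff_dim f)}) = tangent_space f"
    using t B(6) by (simp add: bij_betw_def)
  ultimately show ?thesis by (intro exI[of _ t]) (simp add: orthonormal_basis_def)
qed

lemma affine_hull_tangent:
  assumes "a \<in> f" shows "affine hull f = {a + w | w. w \<in> tangent_space f}"
  using affine_hull_span_gen[of a f] hull_inc[of a f affine] assms tangent_space_base[OF assms]
  by (auto simp: image_def)

text \<open>In the coordinates \<open>y\<close> of the parametrization the set \<open>f\<close> lies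
  in a cube, which gives finiteness, and the part of \<open>f\<close> near any of its points
  contains a cube, which gives positivity. For the latter the point is approximated by a relative
  interior point \<open>z\<close>, around which the affine hull stays in \<open>f\<close>.\<close>

lemma charges_surface_measure:
  fixes f :: "'a::euclidean_space set"
  assumes f: "compact f" "convex f" "f \<noteq> {}"
  shows "charges (surface_measure f) f"
proof -
  define r where "r = nat (aff_dim f)"
  define a where "a = (SOME a. a \<in> f)"
  define t where "t = (SOME t. orthonormal_basis {..<r} t (tangent_space f))"
  have a: "a \<in> f" using f(3) by (auto simp: a_def intro: someI)
  have "orthonormal_basis {..<r} t (tangent_space f)"
    unfolding t_def r_def using orthonormal_frame_exists[OF f(3)] by (rule someI_ex)
  then have tt: "\<And>i j. i < r \<Longrightarrow> j < r \<Longrightarrow> t i \<bullet> t j = (if i = j then 1 else 0)"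
    and ts: "span (t ` {..<r}) = tangent_space f" by (auto simp: orthonormal_basis_def)
  define \<phi> where "\<phi> y = a + (\<Sum>i<r. y i *\<^sub>R t i)" for y :: "nat \<Rightarrow> real"
  let ?P = "Pi\<^sub>M {..<r} (\<lambda>_. lborel :: real measure)"
  have SM: "surface_measure f = distr ?P borel \<phi>"
    unfolding surface_measure_def Let_def \<phi>_def a_def r_def[symmetric] t_def ..
  have meas: "\<phi> \<in> borel_measurable ?P"
    unfolding \<phi>_def by measurable
  interpret product_sigma_finite "\<lambda>_. lborel :: real measure" by standard
  have em: "emeasure (surface_measure f) A = emeasure ?P (\<phi> -` A \<inter> space ?P)" if "A \<in> sets borel" for A
    unfolding SM by (rule emeasure_distr[OF meas that])
  have fb: "f \<in> sets borel" using f(1) by (rule borel_compact)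
  have coord: "t i \<bullet> (\<phi> y - a) = y i" if "i < r" for i y
  proof -
    have "t i \<bullet> (\<phi> y - a) = (\<Sum>j<r. if j = i then y i else 0)"
      unfolding \<phi>_def add_diff_cancel_left' inner_sum_right
      by (rule sum.cong) (use tt that in auto)
    then show ?thesis using that by simp
  qed
  have box: "emeasure ?P (Pi\<^sub>E {..<r} (\<lambda>i. S i)) = (\<Prod>i<r. emeasure lborel (S i))"
    if "\<And>i. i < r \<Longrightarrow> S i \<in> sets borel" for S
    using that by (intro emeasure_PiM) auto
  have "emeasure (surface_measure f) f < \<infinity>"
  proof -
    have "bounded ((\<lambda>x. x - a) ` f)" 
      using compact_imp_bounded[OF f(1)] bounded_translation_minus by blast
    then obtain R where R: "\<And>x. x \<in> f \<Longrightarrow> norm (x - a) \<le> R" unfolding bounded_iff by blast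
    have "\<phi> -` f \<inter> space ?P \<subseteq> Pi\<^sub>E {..<r} (\<lambda>i. {-R..R})"
    proof
      fix y assume y: "y \<in> \<phi> -` f \<inter> space ?P"
      have "\<bar>y i\<bar> \<le> R" if "i < r" for i
      proof -
        have "norm (t i) = 1" using tt[OF that that] by (simp add: norm_eq_1)
        then have "\<bar>y i\<bar> \<le> norm (\<phi> y - a)"
          using Cauchy_Schwarz_ineq2[of "t i" "\<phi> y - a"] coord[OF that, of y] by simp
        then show ?thesis using R[of "\<phi> y"] y by simp
      qed
      then show "y \<in> Pi\<^sub>E {..<r} (\<lambda>i. {-R..R})"
        using y by (auto simp: space_PiM PiE_iff abs_le_iff minus_le_iff)
    qed
    then have "emeasure (surface_measure f) f \<le> emeasure ?P (Pi\<^sub>E {..<r} (\<lambda>i. {-R..R}))"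
      unfolding em[OF fb] by (intro emeasure_mono) auto
    also have "\<dots> = (\<Prod>i<r. emeasure lborel {-R..R})" by (rule box) auto
    also have "\<dots> < \<infinity>" by (cases "R \<ge> 0") (auto simp: ennreal_power[symmetric] power_less_top_ennreal zero_power)
    finally show ?thesis .
  qed
  moreover have "emeasure (surface_measure f) (ball x \<epsilon> \<inter> f) > 0" if x: "x \<in> f" and e: "\<epsilon> > 0" for x \<epsilon>
  proof -
    have "x \<in> closure (rel_interior f)"
      using convex_closure_rel_interior[OF f(2)] x closure_subset by auto
    then obtain z where z: "z \<in> rel_interior f" "dist z x < \<epsilon>" using e closure_approachable by blast
    obtain \<delta>' where d': "\<delta>' > 0" "ball z \<delta>' \<inter> affine hull f \<subseteq> f" using z(1) mem_rel_interior_ball by blast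
    define \<delta> where "\<delta> = min \<delta>' (\<epsilon> - dist z x)"
    have d: "\<delta> > 0" using d' z by (simp add: \<delta>_def)
    have sub: "ball z \<delta> \<inter> affine hull f \<subseteq> ball x \<epsilon> \<inter> f"
    proof
      fix w assume w: "w \<in> ball z \<delta> \<inter> affine hull f"
      have "dist x w \<le> dist x z + dist z w" by (rule dist_triangle)
      then have "w \<in> ball x \<epsilon>" using w by (simp add: \<delta>_def dist_commute)
      then show "w \<in> ball x \<epsilon> \<inter> f" using w d' by (auto simp: \<delta>_def)
    qed
    have zf: "z \<in> f" using z(1) rel_interior_subset by blast
    then have "z - a \<in> span (t ` {..<r})" unfolding ts tangent_space_def using a by (auto intro: span_base)
    then obtain u where u: "z - a = (\<Sum>i<r. u i *\<^sub>R t i)"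
    proof -
      have "inj_on t {..<r}"
      proof (rule inj_onI)
        fix i j assume "i \<in> {..<r}" "j \<in> {..<r}" "t i = t j"
        then show "i = j" using tt[of i j] tt[of j j] by (auto split: if_splits)
      qed
      moreover obtain c where "z - a = (\<Sum>v\<in>t ` {..<r}. c v *\<^sub>R v)"
        using \<open>z - a \<in> span (t ` {..<r})\<close> by (auto simp: span_finite)
      ultimately have "z - a = (\<Sum>i<r. c (t i) *\<^sub>R t i)" by (simp add: sum.reindex)
      then show ?thesis using that[of "\<lambda>i. c (t i)"] by simp
    qed
    \<comment> \<open>The summand 1 makes the final estimate strict and allows
      \<open>r = 0\<close>.\<close>
    define \<eta> where "\<eta> = \<delta> / (real r + 1)"
    have eta: "\<eta> > 0" using d by (simp add: \<eta>_def)
    have "Pi\<^sub>E {..<r} (\<lambda>i. {u i - \<eta><..<u i + \<eta>}) \<subseteq> \<phi> -` (ball x \<epsilon> \<inter> f) \<inter> space ?P"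
    proof
      fix y assume y: "y \<in> Pi\<^sub>E {..<r} (\<lambda>i. {u i - \<eta><..<u i + \<eta>})"
      have zy: "\<phi> y - z = (\<Sum>i<r. (y i - u i) *\<^sub>R t i)"
        using u by (simp add: \<phi>_def algebra_simps sum_subtractf)
      have "norm (\<phi> y - z) \<le> (\<Sum>i<r. norm ((y i - u i) *\<^sub>R t i))" unfolding zy by (rule norm_sum)
      also have "\<dots> \<le> (\<Sum>i<r. \<eta>)"
      proof (rule sum_mono)
        fix i assume i: "i \<in> {..<r}"
        have "norm (t i) = 1" using tt[of i i] i by (simp add: norm_eq_1)
        moreover have "y i \<in> {u i - \<eta><..<u i + \<eta>}" using y i by (auto simp: PiE_iff)
        ultimately show "norm ((y i - u i) *\<^sub>R t i) \<le> \<eta>" by (auto simp: abs_le_iff)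
      qed
      also have "\<dots> < \<delta>" using d by (simp add: \<eta>_def field_simps)
      finally have "\<phi> y \<in> ball z \<delta>" by (simp add: dist_norm norm_minus_commute)
      moreover have "(\<Sum>i<r. y i *\<^sub>R t i) \<in> span (t ` {..<r})"
        by (rule span_sum) (rule span_scale, rule span_base, rule imageI)
      then have "\<phi> y \<in> affine hull f"
        unfolding affine_hull_tangent[OF a] \<phi>_def ts by blast
      ultimately have "\<phi> y \<in> ball x \<epsilon> \<inter> f" using sub by auto
      then show "y \<in> \<phi> -` (ball x \<epsilon> \<inter> f) \<inter> space ?P" using y by (auto simp: space_PiM PiE_iff)
    qed
    moreover have m: "ball x \<epsilon> \<inter> f \<in> sets borel" using fb by auto
    ultimately have "emeasure ?P (Pi\<^sub>E {..<r} (\<lambda>i. {u i - \<eta><..<u i + \<eta>})) \<le> emeasure (surface_measure f) (ball x \<epsilon> \<inter> f)"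
      unfolding em[OF m] using measurable_sets[OF meas m] by (intro emeasure_mono) auto
    moreover have "emeasure ?P (Pi\<^sub>E {..<r} (\<lambda>i. {u i - \<eta><..<u i + \<eta>})) = ennreal ((2 * \<eta>) ^ r)"
      using eta by (subst box) (auto simp: ennreal_power)
    moreover have "0 < ennreal ((2 * \<eta>) ^ r)" using eta by simp
    ultimately show ?thesis by (simp only:)
  qed
  ultimately show ?thesis using f unfolding charges_def by (simp add: SM)
qed

lemma L2_inner_cong:
  "(\<And>x. x \<in> D \<Longrightarrow> p x = p' x) \<Longrightarrow> (\<And>x. x \<in> D \<Longrightarrow> q x = q' x) \<Longrightarrow> L2_inner M D p q = L2_inner M D p' q'"
  unfolding L2_inner_def set_lebesgue_integral_def
  by (rule Bochner_Integration.integral_cong) (auto simp: indicator_def)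

lemma L2_inner_zero: "(\<And>x. x \<in> D \<Longrightarrow> p x \<bullet> q x = 0) \<Longrightarrow> L2_inner M D p q = 0"
proof -
  assume "\<And>x. x \<in> D \<Longrightarrow> p x \<bullet> q x = 0"
  then have "(\<lambda>x. indicator D x *\<^sub>R (p x \<bullet> q x)) = (\<lambda>x. 0)" by (auto simp: indicator_def)
  then show ?thesis unfolding L2_inner_def set_lebesgue_integral_def by simp
qed

lemma L2_inner_commute: "L2_inner M D p q = L2_inner M D q p"
  by (simp add: L2_inner_def inner_commute)

lemma L2_inner_add:
  fixes p p' q :: "'a::euclidean_space \<Rightarrow> 'b::euclidean_space"
  assumes "charges M D" "continuous_on UNIV p" "continuous_on UNIV p'" "continuous_on UNIV q"
  shows "L2_inner M D (\<lambda>x. p x + p' x) q = L2_inner M D p q + L2_inner M D p' q"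
proof -
  have "set_integrable M D (\<lambda>x. p x \<bullet> q x)" "set_integrable M D (\<lambda>x. p' x \<bullet> q x)"
    using assms by (auto intro!: charges_integrable continuous_on_inner)
  then show ?thesis unfolding L2_inner_def inner_add_left by (rule set_integral_add)
qed

lemma L2_inner_scale: "L2_inner M D (\<lambda>x. c *\<^sub>R p x) q = c * L2_inner M D p q"
  by (simp add: L2_inner_def)

lemma L2_inner_pos:
  fixes p :: "'a::euclidean_space \<Rightarrow> 'b::euclidean_space"
  assumes "charges M D" "continuous_on UNIV p" "L2_inner M D p p = 0" "x \<in> D"
  shows "p x = 0"
  using charges_integral_zero[OF assms(1), of "\<lambda>x. p x \<bullet> p x" x] assms
  by (simp add: L2_inner_def continuous_on_inner)

subsection \<open>Barycentric coordinates\<close>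

text \<open>\<open>lam v\<close> is the barycentric coordinate of the vertex \<open>v\<close> on the
  whole space and \<open>g v\<close> its constant gradient. Since \<open>lam v\<close> vanishes on
  the facet opposite to \<open>v\<close>, \<open>g v\<close> is an unnormalized normal of that
  facet.\<close>

locale bary =
  fixes C :: "(real^'n) set" and lam :: "real^'n \<Rightarrow> real^'n \<Rightarrow> real" and g :: "real^'n \<Rightarrow> real^'n"
  assumes finC: "finite C" and cardC: "card C = CARD('n) + 1" and indC: "\<not> affine_dependent C"
    and lam_vertex: "\<And>v w. v \<in> C \<Longrightarrow> w \<in> C \<Longrightarrow> lam v w = (if v = w then 1 else 0)"
    and lam_affine: "\<And>v x. v \<in> C \<Longrightarrow> lam v x = lam v 0 + g v \<bullet> x"
    and lam_sum: "\<And>x. (\<Sum>v\<in>C. lam v x) = 1"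
    and lam_repr: "\<And>x. (\<Sum>v\<in>C. lam v x *\<^sub>R v) = x"

text \<open>With a second vertex \<open>b\<close> as origin the edge vectors are independent, so
  some linear form equals 1 on \<open>v - b\<close> and 0 on the others. Applied to any affine
  combination of the vertices, the resulting affine function returns the coefficient of
  \<open>v\<close>.\<close>

lemma barycentric_exists:
  fixes C :: "(real^'n) set"
  assumes C: "\<not> affine_dependent C" "card C = CARD('n) + 1"
  shows "\<exists>lam g. bary C lam g"
proof -
  have fin: "finite C" using C(1) aff_independent_finite by blast
  have hull: "affine hull C = UNIV"
    using C affine_independent_span_eq[of C] by simp
  have "\<exists>h b. b \<in> C \<and> (\<forall>w\<in>C. h \<bullet> (w - b) = (if w = v then 1 else 0))" if v: "v \<in> C" for v
  proof -
    have "card (C - {v}) > 0" using C(2) v fin by (simp add: card_Diff_singleton)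
    then obtain b where b: "b \<in> C" "b \<noteq> v" by (metis DiffE all_not_in_conv card_gt_0_iff insertI1)
    have ind: "independent ((\<lambda>x. - b + x) ` (C - {b}))"
      using C(1) b(1) affine_dependent_iff_dependent2[of b C] by (simp add: translation_diff) 
    then obtain F where F: "linear F" "\<And>y. y \<in> (\<lambda>x. - b + x) ` (C - {b}) \<Longrightarrow> F y = (if y = v - b then 1 else (0::real))"
      using linear_independent_extend[of _ "\<lambda>y. if y = v - b then 1 else (0::real)"] by metis
    define h where "h = (\<Sum>e\<in>Basis. F e *\<^sub>R e)"
    have h: "h \<bullet> y = F y" for y
    proof -
      have "F y = F (\<Sum>e\<in>Basis. (y \<bullet> e) *\<^sub>R e)" by (simp add: euclidean_representation)
      also have "\<dots> = (\<Sum>e\<in>Basis. (y \<bullet> e) * F e)" using F(1) by (simp add: linear_sum linear_scale)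
      also have "\<dots> = h \<bullet> y" unfolding h_def inner_sum_left by (simp add: inner_commute mult.commute)
      finally show ?thesis by simp
    qed
    have "h \<bullet> (w - b) = (if w = v then 1 else 0)" if "w \<in> C" for w
    proof (cases "w = b")
      case False
      then have "F (w - b) = (if w - b = v - b then 1 else 0)" using that by (intro F(2)) auto
      then show ?thesis by (simp add: h)
    qed (use b in auto)
    then show ?thesis using b by blast
  qed
  then obtain g b where gb: "\<And>v. v \<in> C \<Longrightarrow> b v \<in> C"
    "\<And>v w. v \<in> C \<Longrightarrow> w \<in> C \<Longrightarrow> g v \<bullet> (w - b v) = (if w = v then 1 else 0)"
    by metis
  define lam where "lam v x = g v \<bullet> (x - b v)" for v x
  have lv: "lam v w = (if v = w then 1 else 0)" if "v \<in> C" "w \<in> C" for v w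
    using gb(2)[OF that] by (auto simp: lam_def)
  have la: "lam v x = lam v 0 + g v \<bullet> x" for v x by (simp add: lam_def inner_diff_right)
  have "\<exists>u. (\<Sum>v\<in>C. u v) = 1 \<and> (\<Sum>v\<in>C. u v *\<^sub>R v) = x" for x
  proof -
    have "x \<in> affine hull C" by (simp add: hull)
    then show ?thesis unfolding affine_hull_finite[OF fin] by blast
  qed
  then obtain u where u: "\<And>x. (\<Sum>v\<in>C. u x v) = 1" "\<And>x. (\<Sum>v\<in>C. u x v *\<^sub>R v) = x" by metis
  have lu: "lam v x = u x v" if "v \<in> C" for v x
  proof -
    have "lam v x = (\<Sum>w\<in>C. u x w) * lam v 0 + g v \<bullet> (\<Sum>w\<in>C. u x w *\<^sub>R w)"
      unfolding u by (subst la) simp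
    also have "\<dots> = (\<Sum>w\<in>C. u x w * lam v w)"
      by (subst la[of v "_"]) (simp add: inner_sum_right sum_distrib_right sum.distrib distrib_left)
    also have "\<dots> = (\<Sum>w\<in>C. if v = w then u x w else 0)"
      using lv that by (intro sum.cong) auto
    finally show ?thesis using fin that by simp
  qed
  have "bary C lam g"
  proof
    show "(\<Sum>v\<in>C. lam v x) = 1" for x using lu u(1) by (simp cong: sum.cong)
    show "(\<Sum>v\<in>C. lam v x *\<^sub>R v) = x" for x using lu u(2) by (simp cong: sum.cong)
    show "lam v x = lam v 0 + g v \<bullet> x" for v x by (rule la)
    show "lam v w = (if v = w then 1 else 0)" if "v \<in> C" "w \<in> C" for v w by (rule lv[OF that])
  qed (fact fin C)+
  then show ?thesis by blast
qed

context bary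
begin

lemma C_ne: "C \<noteq> {}" using cardC by auto

lemma lam_rpoly: "v \<in> C \<Longrightarrow> lam v \<in> rpoly 1"
proof -
  assume "v \<in> C"
  then have "lam v = (\<lambda>x. lam v 0 + g v \<bullet> x)" by (intro ext lam_affine)
  moreover have "(\<lambda>x. lam v 0 + g v \<bullet> x) \<in> rpoly 1" by (intro rpoly_add rpoly_const rpoly_inner)
  ultimately show ?thesis by simp
qed

lemma lam_shift: "v \<in> C \<Longrightarrow> lam v (x + y) = lam v x + g v \<bullet> y"
  using lam_affine[of v "x + y"] lam_affine[of v x] by (simp add: inner_add_right)

lemma lam_diff: "v \<in> C \<Longrightarrow> lam v x - lam v y = g v \<bullet> (x - y)"
  using lam_affine[of v x] lam_affine[of v y] by (simp add: inner_diff_right)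

lemma g_edge: "v \<in> C \<Longrightarrow> a \<in> C \<Longrightarrow> b \<in> C \<Longrightarrow>
    g v \<bullet> (a - b) = (if v = a then 1 else 0) - (if v = b then 1 else 0)"
  using lam_diff[of v a b] lam_vertex by simp

lemma sum_g: "(\<Sum>v\<in>C. g v) = 0"
proof -
  have "(\<Sum>v\<in>C. g v) \<bullet> y = 0" for y
  proof -
    have "(\<Sum>v\<in>C. g v) \<bullet> y = (\<Sum>v\<in>C. lam v y - lam v 0)"
      unfolding inner_sum_left by (intro sum.cong) (auto simp: lam_diff)
    then show ?thesis by (simp add: sum_subtractf lam_sum)
  qed
  then show ?thesis using inner_eq_zero_iff by blast
qed

lemma g_repr: "(\<Sum>v\<in>C. (g v \<bullet> y) *\<^sub>R v) = y"
proof -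
  have "(\<Sum>v\<in>C. (g v \<bullet> y) *\<^sub>R v) = (\<Sum>v\<in>C. (lam v y - lam v 0) *\<^sub>R v)"
    by (intro sum.cong) (auto simp: lam_diff)
  then show ?thesis by (simp add: scaleR_diff_left sum_subtractf lam_repr)
qed

lemma sum_g_inner: "(\<Sum>v\<in>C. g v \<bullet> y) = 0"
  using sum_g by (simp flip: inner_sum_left)

lemma g_ne_0: "v \<in> C \<Longrightarrow> g v \<noteq> 0"
proof
  assume v: "v \<in> C" "g v = 0"
  have "card (C - {v}) > 0" using cardC v finC by (simp add: card_Diff_singleton)
  then obtain b where "b \<in> C" "b \<noteq> v" by (metis DiffE all_not_in_conv card_gt_0_iff insertI1)
  then show False using g_edge[of v v b] v by simp
qed

lemma inner_expand: "n \<bullet> y = (\<Sum>v\<in>C. (g v \<bullet> y) * (n \<bullet> v))"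
proof -
  have "n \<bullet> y = n \<bullet> (\<Sum>v\<in>C. (g v \<bullet> y) *\<^sub>R v)" by (simp only: g_repr)
  then show ?thesis by (simp only: inner_sum_right inner_scaleR_right)
qed

lemma vec_eq_0I: "(\<And>v. v \<in> C \<Longrightarrow> g v \<bullet> y = 0) \<Longrightarrow> y = 0"
  using g_repr[of y] by simp

text \<open>The affine hull of the face with vertices \<open>c\<close>, as the zero set of the
  remaining coordinates. Polynomial identities are stated here and not on the face itself, because
  the retractions used for division may leave the face but never its affine hull.\<close>

definition aff :: "(real^'n) set \<Rightarrow> (real^'n) set" where
  "aff c = {x. \<forall>v\<in>C - c. lam v x = 0}"

lemma aff_C [simp]: "aff C = UNIV" by (simp add: aff_def)

lemma aff_mono: "c \<subseteq> c' \<Longrightarrow> aff c \<subseteq> aff c'" by (auto simp: aff_def)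

lemma aff_sum: "c \<subseteq> C \<Longrightarrow> x \<in> aff c \<Longrightarrow> (\<Sum>v\<in>c. lam v x) = 1"
  using sum.mono_neutral_left[of C c "\<lambda>v. lam v x"] finC lam_sum[of x] by (auto simp: aff_def)

lemma aff_repr: "c \<subseteq> C \<Longrightarrow> x \<in> aff c \<Longrightarrow> (\<Sum>v\<in>c. lam v x *\<^sub>R v) = x"
  using sum.mono_neutral_left[of C c "\<lambda>v. lam v x *\<^sub>R v"] finC lam_repr[of x] by (auto simp: aff_def)

lemma conv_eq:
  assumes c: "c \<subseteq> C"
  shows "convex hull c = {x \<in> aff c. \<forall>v\<in>c. 0 \<le> lam v x}"
proof safe
  have fc: "finite c" using c finC finite_subset by blast
  fix x assume "x \<in> convex hull c"
  then obtain u where u: "\<And>v. v \<in> c \<Longrightarrow> 0 \<le> u v" "sum u c = 1" "(\<Sum>v\<in>c. u v *\<^sub>R v) = x"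
    by (auto simp: convex_hull_finite[OF fc])
  have l: "lam w x = (if w \<in> c then u w else 0)" if "w \<in> C" for w
  proof -
    have "lam w x = sum u c * lam w 0 + g w \<bullet> (\<Sum>v\<in>c. u v *\<^sub>R v)"
      unfolding u using lam_affine[OF that, of x] by simp
    also have "\<dots> = (\<Sum>v\<in>c. u v * (lam w 0 + g w \<bullet> v))"
      by (simp add: inner_sum_right sum_distrib_right sum.distrib distrib_left)
    also have "\<dots> = (\<Sum>v\<in>c. if w = v then u v else 0)"
      using lam_affine[OF that, symmetric] lam_vertex[OF that] c by (intro sum.cong) auto
    finally show ?thesis using fc by simp
  qed
  show "x \<in> aff c" using l by (auto simp: aff_def)
  show "0 \<le> lam v x" if "v \<in> c" for v using l[of v] u(1) c that by auto
next
  have fc: "finite c" using c finC finite_subset by blast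
  fix x assume "x \<in> aff c" "\<forall>v\<in>c. 0 \<le> lam v x"
  then show "x \<in> convex hull c"
    unfolding convex_hull_finite[OF fc] using aff_sum[OF c] aff_repr[OF c]
    by (intro CollectI exI[of _ "\<lambda>v. lam v x"]) auto
qed

lemma vertex_aff: "c \<subseteq> C \<Longrightarrow> v \<in> C \<Longrightarrow> v \<in> aff c \<longleftrightarrow> v \<in> c"
  by (auto simp: aff_def lam_vertex)

lemma center_exists:
  assumes c: "c \<subseteq> C" "c \<noteq> {}"
  shows "\<exists>z. z \<in> aff c \<and> (\<forall>u\<in>c. lam u z = 1 / card c)"
proof -
  have fc: "finite c" using c finC finite_subset by blast
  define z where "z = (\<Sum>v\<in>c. (1 / card c) *\<^sub>R v)"
  have nz: "card c \<noteq> 0" using fc c by auto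
  have "lam w z = (if w \<in> c then 1 / card c else 0)" if w: "w \<in> C" for w
  proof -
    have "lam w z = (\<Sum>v\<in>c. 1 / card c) * lam w 0 + g w \<bullet> (\<Sum>v\<in>c. (1 / card c) *\<^sub>R v)"
      using lam_affine[OF w, of z] nz by (simp add: z_def)
    also have "\<dots> = (\<Sum>v\<in>c. (1 / card c) * (lam w 0 + g w \<bullet> v))"
      by (simp only: inner_sum_right sum_distrib_right sum.distrib distrib_left inner_scaleR_right)
    also have "\<dots> = (\<Sum>v\<in>c. if w = v then 1 / card c else 0)"
      using lam_affine[OF w, symmetric] lam_vertex[OF w] c by (intro sum.cong) auto
    finally show ?thesis using fc by simp
  qed
  then show ?thesis using c by (intro exI[of _ z]) (auto simp: aff_def)
qed

lemma aff_ne: "c \<subseteq> C \<Longrightarrow> c \<noteq> {} \<Longrightarrow> aff c \<noteq> {}" using center_exists by blast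

text \<open>On the line from the barycenter \<open>y\<close> to \<open>x\<close> all coordinates of
  \<open>c\<close> stay positive near \<open>y\<close>, so \<open>p\<close> vanishes on a segment of
  the line and hence on all of it.\<close>

lemma vanish_on_aff:
  assumes p: "p \<in> rpoly k" and c: "c \<subseteq> C" "c \<noteq> {}"
    and z: "\<And>x. x \<in> aff c \<Longrightarrow> (\<And>u. u \<in> c \<Longrightarrow> 0 < lam u x) \<Longrightarrow> p x = 0"
    and x: "x \<in> aff c"
  shows "p x = 0"
proof -
  have fc: "finite c" using c finC finite_subset by blast
  obtain y where y: "y \<in> aff c" "\<And>u. u \<in> c \<Longrightarrow> lam u y = 1 / card c"
    using center_exists[OF c] by blast
  define N where "N = 1 / real (card c)"
  have N: "N > 0" using fc c by (auto simp: N_def card_gt_0_iff)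
  define M where "M = (\<Sum>u\<in>c. \<bar>lam u x\<bar>)"
  have M: "\<bar>lam u x\<bar> \<le> M" if "u \<in> c" for u
    unfolding M_def using fc that by (intro member_le_sum) auto
  have M0: "M \<ge> 0" by (simp add: M_def sum_nonneg)
  have line: "lam u (y + s *\<^sub>R (x - y)) = (1 - s) * lam u y + s * lam u x" if "u \<in> C" for u s
    using lam_shift[OF that, of y "s *\<^sub>R (x - y)"] by (simp add: lam_diff[OF that, symmetric]) (simp add: algebra_simps)
  have "p (y + 1 *\<^sub>R (x - y)) = 0"
  \<comment> \<open>A coordinate of \<open>c\<close> is at least \<open>(1 - s) * N - s * M\<close>
    on the line, which is positive precisely for \<open>s < N / (N + M)\<close>.\<close>
  proof (rule rpoly_line_zero[OF p, of "N / (N + M)"])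
    show "0 < N / (N + M)" using N M0 by simp
    fix s assume s: "0 < s" "s < N / (N + M)"
    show "p (y + s *\<^sub>R (x - y)) = 0"
    proof (rule z)
      show "y + s *\<^sub>R (x - y) \<in> aff c" using x y(1) line by (auto simp: aff_def)
      fix u assume u: "u \<in> c"
      have "s * (N + M) < N" using s N M0 by (simp add: pos_less_divide_eq)
      moreover have "s * (- M) \<le> s * lam u x" using M[OF u] s(1) by (intro mult_left_mono) auto
      ultimately have "0 < (1 - s) * N + s * lam u x" by (simp add: algebra_simps)
      then show "0 < lam u (y + s *\<^sub>R (x - y))" using line[of u s] y(2)[OF u] u c by (auto simp: N_def)
    qed
  qed
  then show ?thesis by simp
qed

text \<open>The coordinates are divided out one at a time. With another vertex \<open>w\<close> of
  \<open>c\<close>, the map sending \<open>x\<close> to \<open>x - lam u x *\<^sub>R (u - w)\<close>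
  retracts \<open>aff c\<close> onto \<open>aff (c - {u})\<close>, where the current quotient
  vanishes, so \<open>rpoly_hyperplane_quotient\<close> applies. The clause for
  \<open>k < card s\<close> records that an exhausted degree leaves nothing, which truncated
  subtraction would conceal.\<close>

lemma face_bubble_factor:
  assumes c: "c \<subseteq> C" "2 \<le> card c" and s: "s \<subseteq> c" and p: "p \<in> rpoly k"
    and z: "\<And>u x. u \<in> s \<Longrightarrow> x \<in> aff (c - {u}) \<Longrightarrow> p x = 0"
  shows "\<exists>q\<in>rpoly (k - card s). (k < card s \<longrightarrow> q = (\<lambda>_. 0)) \<and> (\<forall>x\<in>aff c. p x = (\<Prod>u\<in>s. lam u x) * q x)"
proof -
  have fc: "finite c" using c finC finite_subset by blast
  then have "finite s" using s finite_subset by blast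
  then show ?thesis using s z
  proof (induction s rule: finite_induct)
    case empty
    then show ?case using p by auto
  next
    case (insert u s)
    have "s \<subseteq> c" using insert.prems by auto
    then obtain q where q: "q \<in> rpoly (k - card s)" "k < card s \<longrightarrow> q = (\<lambda>_. 0)"
      "\<And>x. x \<in> aff c \<Longrightarrow> p x = (\<Prod>u\<in>s. lam u x) * q x"
      using insert.IH insert.prems by (metis insertI2)
    have u: "u \<in> c" "u \<in> C" using insert.prems c by auto
    have "card (c - {u}) > 0" using c fc u by (simp add: card_Diff_singleton)
    then obtain w where w: "w \<in> c" "w \<noteq> u" "w \<in> C" using c by (metis DiffE all_not_in_conv card_gt_0_iff insertI1 subsetD)
    \<comment> \<open>The factors already divided out may vanish on \<open>aff (c - {u})\<close> as
      well. They can be cancelled where all coordinates of \<open>c - {u}\<close> are positive, and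
      \<open>vanish_on_aff\<close> extends the result.\<close>
    have qz: "q x = 0" if x: "x \<in> aff (c - {u})" for x
    proof (rule vanish_on_aff[OF q(1) _ _ _ x])
      show "c - {u} \<subseteq> C" "c - {u} \<noteq> {}" using c w by auto
      fix y assume y: "y \<in> aff (c - {u})" and pos: "\<And>v. v \<in> c - {u} \<Longrightarrow> 0 < lam v y"
      have "y \<in> aff c" using y aff_mono[of "c - {u}" c] by auto
      then have "(\<Prod>u\<in>s. lam u y) * q y = 0" using q(3)[of y] insert.prems(2)[of u y] y by simp
      moreover have "(\<Prod>u\<in>s. lam u y) > 0"
        using insert.prems(1) insert.hyps by (intro prod_pos ballI pos) auto
      ultimately show "q y = 0" by simp
    qed
    obtain q' where q': "q' \<in> rpoly (k - card s - 1)" "k - card s = 0 \<longrightarrow> q' = (\<lambda>_. 0)"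
      "\<And>x. q x - q (x - lam u x *\<^sub>R (u - w)) = lam u x * q' x"
      using rpoly_hyperplane_quotient[OF q(1) lam_rpoly[OF u(2)], of "u - w"] by (elim exE conjE) (rule that, auto)
    have "p x = (\<Prod>u\<in>insert u s. lam u x) * q' x" if x: "x \<in> aff c" for x
    proof -
      have l: "lam v (x - lam u x *\<^sub>R (u - w)) = lam v x - lam u x * (g v \<bullet> (u - w))" if "v \<in> C" for v
        using lam_shift[OF that, of x "- (lam u x *\<^sub>R (u - w))"] by simp
      have "x - lam u x *\<^sub>R (u - w) \<in> aff (c - {u})"
        unfolding aff_def
      proof (intro CollectI ballI)
        fix v assume "v \<in> C - (c - {u})"
        then have v: "v \<in> C" "v \<notin> c - {u}" by auto
        show "lam v (x - lam u x *\<^sub>R (u - w)) = 0"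
        proof (cases "v = u")
          case True
          then show ?thesis using l[OF v(1)] u w by (simp add: g_edge)
        next
          case False
          then have "v \<notin> c" using v by auto
          then have "lam v x = 0" "v \<noteq> w" using v x w by (auto simp: aff_def)
          then show ?thesis using l[OF v(1)] g_edge[OF v(1) u(2) w(3)] False by simp
        qed
      qed
      then have "q x = lam u x * q' x" using q'(3)[of x] qz by simp
      then show ?thesis using q(3)[OF x] insert.hyps by (simp add: mult_ac)
    qed
    moreover have "k < card (insert u s) \<longrightarrow> q' = (\<lambda>_. 0)" using q'(2) insert.hyps by simp
    ultimately show ?case using q'(1) insert.hyps by (intro bexI[of _ q']) auto
  qed
qed

end

subsection \<open>Faces and normals\<close>

context bary
begin

abbreviation K :: "(real^'n) set" where "K \<equiv> convex hull C"

text \<open>For a single vertex every vector is normal, so values at vertices fit into the scheme of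
  normal-normal traces on faces.\<close>

definition Nrm :: "(real^'n) set \<Rightarrow> (real^'n) set" where
  "Nrm c = {n. \<forall>a\<in>c. \<forall>b\<in>c. n \<bullet> (a - b) = 0}"

lemma Nrm_mono: "c \<subseteq> c' \<Longrightarrow> Nrm c' \<subseteq> Nrm c" by (auto simp: Nrm_def)

lemma g_Nrm: "c \<subseteq> C \<Longrightarrow> v \<in> C - c \<Longrightarrow> g v \<in> Nrm c"
  unfolding Nrm_def using g_edge[of v] by (auto simp: subset_iff)

lemma orthogonal_comp_face: "orthogonal_comp (tangent_space (convex hull c)) = Nrm c"
proof (intro set_eqI iffI)
  fix n assume "n \<in> orthogonal_comp (tangent_space (convex hull c))"
  then have "n \<bullet> y = 0" if "y \<in> tangent_space (convex hull c)" for y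
    using that by (auto simp: orthogonal_comp_def orthogonal_def inner_commute)
  moreover have "a - b \<in> tangent_space (convex hull c)" if "a \<in> c" "b \<in> c" for a b
    unfolding tangent_space_def using that by (intro span_base) (auto intro: hull_inc)
  ultimately show "n \<in> Nrm c" by (simp add: Nrm_def)
next
  fix n assume n: "n \<in> Nrm c"
  have eq: "n \<bullet> x = n \<bullet> b" if "x \<in> convex hull c" "b \<in> c" for x b
  proof -
    have "n \<bullet> a = n \<bullet> b" if "a \<in> c" for a
    proof -
      have "n \<bullet> (a - b) = 0" using n that \<open>b \<in> c\<close> unfolding Nrm_def by blast
      then show ?thesis by (simp only: inner_diff_right)
    qed
    then have "convex hull c \<subseteq> {x. n \<bullet> x = n \<bullet> b}"
      by (intro hull_minimal convex_hyperplane) auto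
    then show ?thesis using that by auto
  qed
  have sub: "subspace {y. n \<bullet> y = 0}" by (rule subspace_hyperplane)
  have "n \<bullet> (x - y) = 0" if "x \<in> convex hull c" "y \<in> convex hull c" for x y
  proof -
    have "c \<noteq> {}" using that by auto
    then obtain b where "b \<in> c" by blast
    then show ?thesis using eq that by (simp add: inner_diff_right)
  qed
  then have "tangent_space (convex hull c) \<subseteq> {y. n \<bullet> y = 0}"
    unfolding tangent_space_def by (intro span_minimal sub) auto
  then show "n \<in> orthogonal_comp (tangent_space (convex hull c))"
    by (auto simp: orthogonal_comp_def orthogonal_def inner_commute subset_iff)
qed

lemma fin_sub: "c \<subseteq> C \<Longrightarrow> finite c" using finC finite_subset by blast

lemma simplex_sub: "c \<subseteq> C \<Longrightarrow> int r simplex (convex hull c) \<longleftrightarrow> card c = r + 1"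
proof
  assume c: "c \<subseteq> C"
  have ind: "\<not> affine_dependent c" using indC c affine_dependent_subset by blast
  { assume "int r simplex (convex hull c)"
    then obtain D where D: "\<not> affine_dependent D" "int (card D) = int r + 1" "convex hull c = convex hull D"
      by (auto simp: simplex_def)
    have "aff_dim c = aff_dim D" using D(3) by (metis aff_dim_convex_hull)
    then show "card c = r + 1"
      using aff_dim_affine_independent[OF ind] aff_dim_affine_independent[OF D(1)] D(2) by simp }
  { assume "card c = r + 1"
    then show "int r simplex (convex hull c)" using ind by (auto simp: simplex_def) }
qed

lemma subsimplices_eq: "subsimplices r K = {convex hull c | c. c \<subseteq> C \<and> card c = r + 1}"
proof (intro set_eqI iffI)
  fix f assume f: "f \<in> subsimplices r K"
  then obtain c where c: "c \<subseteq> C" "f = convex hull c"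
    by (auto simp: subsimplices_def face_of_convex_hull_affine_independent[OF indC])
  then show "f \<in> {convex hull c | c. c \<subseteq> C \<and> card c = r + 1}" using f by (auto simp: subsimplices_def simplex_sub)
qed (auto simp: subsimplices_def face_of_convex_hull_affine_independent[OF indC] simplex_sub)

lemma vertex_in_conv: "c \<subseteq> C \<Longrightarrow> v \<in> C \<Longrightarrow> v \<in> convex hull c \<longleftrightarrow> v \<in> c"
  using conv_eq[of c] vertex_aff[of c v] hull_inc[of v c convex] by blast

lemma conv_inj: "c \<subseteq> C \<Longrightarrow> c' \<subseteq> C \<Longrightarrow> convex hull c = convex hull c' \<Longrightarrow> c = c'"
  using vertex_in_conv by blast

lemma subsimplices_0: "{v} \<in> subsimplices 0 K \<longleftrightarrow> v \<in> C"
proof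
  assume "{v} \<in> subsimplices 0 K"
  then obtain c where c: "{v} = convex hull c" "c \<subseteq> C" "card c = 1" by (auto simp: subsimplices_eq)
  then obtain w where "c = {w}" using card_1_singletonE by blast
  then show "v \<in> C" using c by simp
next
  assume "v \<in> C"
  then show "{v} \<in> subsimplices 0 K" unfolding subsimplices_eq by (intro CollectI exI[of _ "{v}"]) auto
qed

lemma card_facet: "v \<in> C \<Longrightarrow> card (C - {v}) = CARD('n)" using cardC finC by simp

abbreviation facet :: "real^'n \<Rightarrow> (real^'n) set" where "facet v \<equiv> convex hull (C - {v})"

lemma facets_eq: "subsimplices (CARD('n) - 1) K = facet ` C"
proof (intro set_eqI iffI)
  fix f assume "f \<in> subsimplices (CARD('n) - 1) K"
  then obtain c where c: "f = convex hull c" "c \<subseteq> C" "card c = CARD('n) - 1 + 1"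
    unfolding subsimplices_eq by blast
  have "card (C - c) = 1" using c cardC fin_sub[OF c(2)] by (simp add: card_Diff_subset)
  then obtain v where "C - c = {v}" using card_1_singletonE by blast
  then have "v \<in> C" "c = C - {v}" using c(2) by auto
  then show "f \<in> facet ` C" using c(1) by blast
next
  fix f assume "f \<in> facet ` C"
  then show "f \<in> subsimplices (CARD('n) - 1) K"
    unfolding subsimplices_eq using card_facet by force
qed

lemma facet_inj: "inj_on facet C"
proof (rule inj_onI)
  fix v w assume vw: "v \<in> C" "w \<in> C" "facet v = facet w"
  then have "C - {v} = C - {w}" using conv_inj[of "C - {v}" "C - {w}"] by blast
  then show "v = w" using vw by blast
qed

lemma charges_face: "c \<subseteq> C \<Longrightarrow> c \<noteq> {} \<Longrightarrow> charges (surface_measure (convex hull c)) (convex hull c)"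
  by (intro charges_surface_measure) (auto simp: fin_sub finite_imp_compact_convex_hull)

lemma charges_K: "charges lborel K"
proof (intro charges_lborel)
  show "compact K" using finC by (rule finite_imp_compact_convex_hull)
  have "affine hull K = UNIV"
    using affine_independent_span_eq[OF indC] cardC by (simp add: affine_hull_convex_hull)
  then have "rel_interior K = interior K" by (rule rel_interior_interior)
  then show "interior K \<noteq> {}" using rel_interior_eq_empty[of K] C_ne by simp
qed simp

lemma vanish_on_conv_aff:
  assumes "p \<in> rpoly k" "c \<subseteq> C" "c \<noteq> {}" "\<And>x. x \<in> convex hull c \<Longrightarrow> p x = 0" "x \<in> aff c"
  shows "p x = 0"
proof (rule vanish_on_aff[OF assms(1-3) _ assms(5)])
  fix y assume y: "y \<in> aff c" "\<And>u. u \<in> c \<Longrightarrow> 0 < lam u y"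
  then have "y \<in> convex hull c" unfolding conv_eq[OF assms(2)] by (auto intro: less_imp_le)
  then show "p y = 0" by (rule assms(4))
qed

lemma lam_nonneg: "v \<in> C \<Longrightarrow> c \<subseteq> C \<Longrightarrow> x \<in> convex hull c \<Longrightarrow> 0 \<le> lam v x"
  by (cases "v \<in> c") (auto simp: conv_eq aff_def)

lemma continuous_lam: "v \<in> C \<Longrightarrow> continuous_on S (lam v)"
  using continuous_on_rpoly[OF lam_rpoly] by blast

text \<open>On the face \<open>p\<close> is the product of its coordinates times some
  \<open>q\<close>; the moment against this very \<open>q\<close> integrates a nonnegative function.
  If \<open>k < card c\<close>, the degree leaves no room for the product and \<open>p\<close>
  vanishes outright, hence the guard \<open>card c \<le> k\<close> on the moments.\<close>

lemma vanish_by_moments: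
  assumes c: "c \<subseteq> C" "2 \<le> card c" and p: "p \<in> rpoly k"
    and z: "\<And>u x. u \<in> c \<Longrightarrow> x \<in> aff (c - {u}) \<Longrightarrow> p x = 0"
    and m: "\<And>q. card c \<le> k \<Longrightarrow> q \<in> polys_on (convex hull c) (k - card c) UNIV \<Longrightarrow> inner_face (convex hull c) p q = 0"
    and x: "x \<in> aff c"
  shows "p x = 0"
proof -
  have "\<exists>q\<in>rpoly (k - card c). (k < card c \<longrightarrow> q = (\<lambda>_. 0)) \<and> (\<forall>x\<in>aff c. p x = (\<Prod>u\<in>c. lam u x) * q x)"
    by (rule face_bubble_factor[OF c order_refl p]) (rule z)
  then obtain q where q: "q \<in> rpoly (k - card c)" "k < card c \<longrightarrow> q = (\<lambda>_. 0)"
    "\<And>x. x \<in> aff c \<Longrightarrow> p x = (\<Prod>u\<in>c. lam u x) * q x"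
    by blast
  have ne: "c \<noteq> {}" using c by auto
  show ?thesis
  proof (cases "k < card c")
    case True
    then show ?thesis using q x by simp
  next
    case False
    let ?f = "convex hull c"
    have "inner_face ?f p (on_set ?f q) = 0"
      using q(1) False by (intro m) (auto simp: polys_on_def)
    moreover have "inner_face ?f p (on_set ?f q) = (LINT x:?f|surface_measure ?f. (\<Prod>u\<in>c. lam u x) * (q x)\<^sup>2)"
      unfolding L2_inner_def set_lebesgue_integral_def
      by (rule Bochner_Integration.integral_cong)
        (auto simp: indicator_def on_set_def conv_eq[OF c(1)] q(3) power2_eq_square)
    moreover have "continuous_on UNIV (\<lambda>x. (\<Prod>u\<in>c. lam u x) * (q x)\<^sup>2)"
      using c(1) continuous_on_rpoly[OF q(1)] by (intro continuous_intros continuous_lam) auto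
    ultimately have "(\<Prod>u\<in>c. lam u y) * (q y)\<^sup>2 = 0" if "y \<in> ?f" for y
      using c(1) lam_nonneg[OF _ c(1)] that
      by (intro charges_integral_zero[OF charges_face[OF c(1) ne], of "\<lambda>y. (\<Prod>u\<in>c. lam u y) * (q y)\<^sup>2"])
        (auto intro!: mult_nonneg_nonneg prod_nonneg)
    then have "p y = 0" if "y \<in> ?f" for y
      using that q(3)[of y] by (auto simp: conv_eq[OF c(1)])
    then show ?thesis using vanish_on_conv_aff[OF p c(1) ne _ x] by blast
  qed
qed

end

lemma rpoly_nn:
  fixes \<tau> :: "real^'n \<Rightarrow> real^'n^'n"
  assumes "\<tau> \<in> polys k sym_matrices" shows "(\<lambda>x. n \<bullet> (\<tau> x *v m)) \<in> rpoly k"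
proof -
  have "(\<lambda>x. \<tau> x $ i $ j) \<in> rpoly k" for i j using assms by (simp add: polys_mat_iff[OF subspace_sym])
  then show ?thesis
    unfolding inner_vec_def matrix_vector_mult_def
    by (simp) (intro rpoly_sum rpoly_scale rpoly_scale2)
qed

lemma sym_inner: "A \<in> sym_matrices \<Longrightarrow> x \<bullet> (A *v y) = y \<bullet> (A *v x)" for A :: "real^'n^'n"
proof -
  assume "A \<in> sym_matrices"
  then have "x v* A = A *v x" using transpose_matrix_vector[of A x] by (simp add: sym_matrices_def)
  then show ?thesis using dot_lmul_matrix[of x A y] by (simp add: inner_commute)
qed

lemma span_bilinear_zero:
  fixes A :: "real^'n^'n"
  assumes z: "\<And>a b. a \<in> S \<Longrightarrow> b \<in> S \<Longrightarrow> a \<bullet> (A *v b) = 0" and "n \<in> span S" "m \<in> span S"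
  shows "n \<bullet> (A *v m) = 0"
proof -
  have a: "a \<bullet> (A *v m) = 0" if "a \<in> S" for a
    using assms(3)
  proof (induction rule: span_induct_alt)
    case (step c x y)
    then show ?case using z[OF that] by (simp add: matrix_vector_right_distrib inner_add_right matrix_vector_mult_scaleR)
  qed simp
  show ?thesis
    using assms(2)
  proof (induction rule: span_induct_alt)
    case (step c x y)
    then show ?case using a[of x] by (simp add: inner_add_left)
  qed simp
qed

lemma tangential_part_orth: "n \<bullet> u = 0 \<Longrightarrow> tangential_part n u = u" by (simp add: tangential_part_def)

lemma tangential_part_normal: "norm n = 1 \<Longrightarrow> n \<bullet> tangential_part n u = 0"
  by (simp add: tangential_part_def inner_diff_right norm_eq_1)

lemma tangential_part_inner: "n \<bullet> u = 0 \<Longrightarrow> u \<bullet> tangential_part n w = u \<bullet> w"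
  by (simp add: tangential_part_def inner_diff_right inner_commute)

locale framed_simplex = bary C lam g
  for C :: "(real^'n) set" and lam g +
  fixes \<nu> :: "(real^'n) set \<Rightarrow> nat \<Rightarrow> real^'n"
  assumes frames: "normal_frames (convex hull C) \<nu>" and d3: "3 \<le> CARD('n)"
begin

lemma frame:
  assumes "c \<subseteq> C" "card c = r + 1"
  shows "orthonormal_basis {1..CARD('n) - r} (\<nu> (convex hull c)) (Nrm c)"
proof -
  have "card c \<le> CARD('n) + 1" using assms(1) cardC finC card_mono by metis
  then have "r \<le> CARD('n)" using assms(2) by simp
  moreover have "convex hull c \<in> subsimplices r K" using assms by (auto simp: subsimplices_eq)
  ultimately show ?thesis
    using frames orthogonal_comp_face[of c] unfolding normal_frames_def by metis
qed

text \<open>The definitions speak about frame vectors with \<open>i \<le> j\<close>; symmetry of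
  \<open>A\<close> supplies the other order and bilinearity arbitrary normals.\<close>

lemma frame_zero:
  assumes c: "c \<subseteq> C" "card c = r + 1" and A: "A \<in> sym_matrices"
    and z: "\<And>i j. 1 \<le> i \<Longrightarrow> i \<le> j \<Longrightarrow> j \<le> CARD('n) - r \<Longrightarrow> \<nu> (convex hull c) i \<bullet> (A *v \<nu> (convex hull c) j) = 0"
    and n: "n \<in> Nrm c" "m \<in> Nrm c"
  shows "n \<bullet> (A *v m) = 0"
proof (rule span_bilinear_zero[where S="\<nu> (convex hull c) ` {1..CARD('n) - r}"])
  fix a b assume "a \<in> \<nu> (convex hull c) ` {1..CARD('n) - r}" "b \<in> \<nu> (convex hull c) ` {1..CARD('n) - r}"
  then obtain i j where ij: "i \<in> {1..CARD('n) - r}" "j \<in> {1..CARD('n) - r}"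
    "a = \<nu> (convex hull c) i" "b = \<nu> (convex hull c) j" by blast
  show "a \<bullet> (A *v b) = 0"
  proof (cases "i \<le> j")
    case True
    then show ?thesis using z[of i j] ij by simp
  next
    case False
    then show ?thesis using z[of j i] ij sym_inner[OF A, of a b] by simp
  qed
qed (use n frame[OF c] in \<open>auto simp: orthonormal_basis_def\<close>)

lemma frame_Nrm:
  assumes "c \<subseteq> C" "card c = r + 1" "1 \<le> i" "i \<le> CARD('n) - r"
  shows "\<nu> (convex hull c) i \<in> Nrm c"
proof -
  have "\<nu> (convex hull c) i \<in> span (\<nu> (convex hull c) ` {1..CARD('n) - r})"
    using assms by (intro span_base) auto
  then show ?thesis using frame[OF assms(1,2)] by (simp add: orthonormal_basis_def)
qed

text \<open>A normal of the facet takes the same value at all its vertices, so expanding it over the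
  vertices relative to some \<open>b\<close> in the facet leaves only the term of \<open>v\<close>.
  The sign of the factor stays open because the frame may point to either side.\<close>

lemma facet_normal:
  assumes v: "v \<in> C"
  shows "norm (\<nu> (facet v) 1) = 1" and "\<exists>\<alpha>. \<alpha> \<noteq> 0 \<and> \<nu> (facet v) 1 = \<alpha> *\<^sub>R g v"
proof -
  have c: "C - {v} \<subseteq> C" "card (C - {v}) = (CARD('n) - 1) + 1" using card_facet[OF v] by auto
  have e: "{1..CARD('n) - (CARD('n) - 1)} = {1}" using d3 by auto
  have ob: "orthonormal_basis {1} (\<nu> (facet v)) (Nrm (C - {v}))" using frame[OF c] unfolding e .
  then show n1: "norm (\<nu> (facet v) 1) = 1" by (simp add: orthonormal_basis_def norm_eq_1)
  have nN: "\<nu> (facet v) 1 \<in> Nrm (C - {v})"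
    using ob by (auto simp: orthonormal_basis_def intro: span_base)
  have "C - {v} \<noteq> {}" using c(2) by (metis add_is_0 card.empty zero_neq_one)
  then obtain b where b: "b \<in> C - {v}" by auto
  let ?n = "\<nu> (facet v) 1"
  have "?n \<bullet> y = (?n \<bullet> (v - b)) * (g v \<bullet> y)" for y
  proof -
    have "?n \<bullet> y = (\<Sum>w\<in>C. (g w \<bullet> y) * (?n \<bullet> w)) - (\<Sum>w\<in>C. g w \<bullet> y) * (?n \<bullet> b)"
      using inner_expand[of ?n y] sum_g_inner[of y] by simp
    also have "\<dots> = (\<Sum>w\<in>C. (g w \<bullet> y) * (?n \<bullet> (w - b)))"
      by (simp add: inner_diff_right algebra_simps sum_subtractf sum_distrib_left sum_distrib_right)
    also have "\<dots> = (\<Sum>w\<in>C. if w = v then (g v \<bullet> y) * (?n \<bullet> (v - b)) else 0)"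
      using nN b by (intro sum.cong) (auto simp: Nrm_def)
    finally show ?thesis using finC v by simp
  qed
  then have "\<forall>y. ?n \<bullet> y = ((?n \<bullet> (v - b)) *\<^sub>R g v) \<bullet> y" unfolding inner_scaleR_left by blast
  then have "?n = (?n \<bullet> (v - b)) *\<^sub>R g v" by (simp only: vector_eq_rdot)
  moreover have "?n \<bullet> (v - b) \<noteq> 0" using calculation n1 by (metis norm_zero scale_zero_left zero_neq_one)
  ultimately show "\<exists>\<alpha>. \<alpha> \<noteq> 0 \<and> \<nu> (facet v) 1 = \<alpha> *\<^sub>R g v" by blast
qed

text \<open>Induction over the dimension of the face: \<open>n \<bullet> b m\<close> vanishes on the boundary of the face, so it is
  the face bubble times a polynomial against which it has been tested.\<close>

lemma bubble_nn:
  assumes b: "b \<in> nn_bubbles K \<nu>" and "c \<subseteq> C" "c \<noteq> {}" "card c \<le> CARD('n) - 1"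
    and "n \<in> Nrm c" "m \<in> Nrm c" "x \<in> aff c"
  shows "n \<bullet> (b x *v m) = 0"
  using assms(2-)
proof (induction "card c" arbitrary: c n m x rule: less_induct)
  case less
  have bp: "b \<in> polys (CARD('n) + 1) sym_matrices" using b by (simp add: nn_bubbles_def)
  have fc: "finite c" using less.prems fin_sub by blast
  then have c0: "card c > 0" using less.prems by auto
  show ?case
  proof (cases "card c = 1")
    case True
    then obtain v where v: "c = {v}" using card_1_singletonE by blast
    then have "x = v" using aff_repr[OF less.prems(1,6)] aff_sum[OF less.prems(1,6)] by simp
    moreover have "b v = 0" using b v less.prems(1) by (simp add: nn_bubbles_def subsimplices_0)
    ultimately show ?thesis by simp
  next
    case False
    define r where "r = card c - 1"
    have r: "card c = r + 1" "1 \<le> r" "r \<le> CARD('n) - 2" using False c0 less.prems(3) by (auto simp: r_def)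
    have bx: "b x \<in> sym_matrices" using polys_in[OF subspace_sym bp] .
    have "\<nu> (convex hull c) i \<bullet> (b x *v \<nu> (convex hull c) j) = 0"
      if ij: "1 \<le> i" "i \<le> j" "j \<le> CARD('n) - r" for i j
    proof (rule vanish_by_moments[where p="\<lambda>x. \<nu> (convex hull c) i \<bullet> (b x *v \<nu> (convex hull c) j)",
          OF less.prems(1) _ rpoly_nn[OF bp] _ _ less.prems(6)])
      show "2 \<le> card c" using r by simp
    next
      fix u y assume u: "u \<in> c" "y \<in> aff (c - {u})"
      have N: "\<nu> (convex hull c) i \<in> Nrm (c - {u})" "\<nu> (convex hull c) j \<in> Nrm (c - {u})"
        using frame_Nrm[OF less.prems(1) r(1)] ij Nrm_mono[of "c - {u}" c] by auto
      have "card (c - {u}) = r" using u fc r by simp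
      moreover from this have ne: "c - {u} \<noteq> {}" using r(2) by (metis card.empty not_one_le_zero)
      ultimately show "\<nu> (convex hull c) i \<bullet> (b y *v \<nu> (convex hull c) j) = 0"
        using less.prems(1,3) r u N ne by (intro less.hyps[of "c - {u}"]) auto
    next
      \<comment> \<open>Dividing degree \<open>CARD('n) + 1\<close> by the \<open>r + 1\<close>
        coordinates of the face leaves exactly the degree of the test space on that face.\<close>
      fix q assume "q \<in> polys_on (convex hull c) (CARD('n) + 1 - card c) (UNIV :: real set)"
      moreover have "CARD('n) + 1 - card c = CARD('n) - r" using r by simp
      moreover have "convex hull c \<in> subsimplices r K" using less.prems(1) r(1) by (auto simp: subsimplices_eq)
      ultimately show "inner_face (convex hull c) (\<lambda>x. \<nu> (convex hull c) i \<bullet> (b x *v \<nu> (convex hull c) j)) q = 0"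
        using b ij r unfolding nn_bubbles_def by auto
    qed
    from frame_zero[OF less.prems(1) r(1) bx this less.prems(4,5)] show ?thesis by simp
  qed
qed

text \<open>On a face with at least three vertices the product of the coordinates has degree above
  two, so a quadratic that vanishes on the boundary of the face vanishes on the face. Everything is
  thus decided on the edges.\<close>

lemma quadratic_nn:
  assumes s: "\<sigma> \<in> polys 2 sym_matrices"
    and e: "\<And>c n m x. c \<subseteq> C \<Longrightarrow> card c = 2 \<Longrightarrow> n \<in> Nrm c \<Longrightarrow> m \<in> Nrm c \<Longrightarrow> x \<in> aff c \<Longrightarrow> n \<bullet> (\<sigma> x *v m) = 0"
    and "c \<subseteq> C" "2 \<le> card c" "n \<in> Nrm c" "m \<in> Nrm c" "x \<in> aff c"
  shows "n \<bullet> (\<sigma> x *v m) = 0"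
  using assms(3-)
proof (induction "card c" arbitrary: c x rule: less_induct)
  case less
  show ?case
  proof (cases "card c = 2")
    case True
    then show ?thesis using e less.prems by blast
  next
    case False
    show ?thesis
    proof (rule vanish_by_moments[where p="\<lambda>x. n \<bullet> (\<sigma> x *v m)", OF less.prems(1,2) rpoly_nn[OF s] _ _ less.prems(5)])
      fix u y assume u: "u \<in> c" "y \<in> aff (c - {u})"
      have "card (c - {u}) = card c - 1" using u fin_sub[OF less.prems(1)] by simp
      then show "n \<bullet> (\<sigma> y *v m) = 0"
        using less.prems False u Nrm_mono[of "c - {u}" c] by (intro less.hyps[of "c - {u}"]) auto
    qed (use False less.prems in simp)
  qed
qed

end

subsection \<open>Tangential traces on facets\<close>

lemma pd_along_invariant:
  fixes p :: "real^'n \<Rightarrow> real"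
  assumes p: "p \<in> rpoly k" and inv: "\<And>s x. p (x + s *\<^sub>R n) = p x"
  shows "(\<Sum>j\<in>UNIV. n $ j * pd j p x) = 0"
proof -
  have "((\<lambda>s. x + s *\<^sub>R n) has_derivative (\<lambda>s. s *\<^sub>R n)) (at 0)"
    by (auto intro!: derivative_eq_intros)
  from has_derivative_compose[OF this rpoly_derivative[OF p]]
  have "((\<lambda>s. p x) has_derivative (\<lambda>s. \<Sum>i\<in>UNIV. (s *\<^sub>R n) $ i * pd i p (x + 0 *\<^sub>R n))) (at 0)"
    by (simp add: inv)
  from has_derivative_unique[OF this has_derivative_const]
  have "(\<lambda>s. \<Sum>i\<in>UNIV. (s *\<^sub>R n) $ i * pd i p (x + 0 *\<^sub>R n)) = (\<lambda>s. 0)" .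
  from fun_cong[OF this, of 1] show ?thesis by simp
qed

lemma subspace_skew_normal: "subspace {A \<in> skew_matrices. A *v n = (0 :: real^'n)}"
proof -
  have "subspace {A. A *v n = (0 :: real^'n)}"
    by (auto simp: subspace_def matrix_vector_mult_add_rdistrib scaleR_matrix_vector_assoc[symmetric])
  then have "subspace (skew_matrices \<inter> {A. A *v n = (0 :: real^'n)})"
    using subspace_skew by (rule subspace_inter[rotated])
  then show ?thesis by (simp add: Int_def)
qed

text \<open>\<open>ND\<^sub>k\<close> consists of the tangential fields of degree \<open>k + 1\<close> whose product with the position has
  degree at most \<open>k + 1\<close>: then the top-degree part \<open>h\<close> satisfies \<open>y \<bullet> h y = 0\<close>, and by Euler's identity
  \<open>h y = W y\<close> with \<open>W\<close> the skew part of the gradient of \<open>h\<close>.\<close>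

lemma ND_intro:
  fixes w :: "real^'n \<Rightarrow> real^'n"
  assumes n: "norm n = 1" and wp: "\<And>i. (\<lambda>y. w y $ i) \<in> rpoly (Suc k)"
    and wn: "\<And>y. n \<bullet> w y = 0" and inv: "\<And>y. w (tangential_part n y) = w y"
    and low: "(\<lambda>y. y \<bullet> w y) \<in> rpoly (Suc k)"
  shows "on_set F w \<in> ND k n F"
proof -
  let ?t = "tangential_part n"
  have nn: "n \<bullet> n = 1" using n by (simp add: norm_eq_1)
  have tc: "(\<lambda>x. ?t x $ i) \<in> rpoly 1" for i
    using rpoly_diff[OF rpoly_coord[of i] rpoly_scale2[OF rpoly_inner[of n], of "n $ i"]]
    by (simp add: tangential_part_def)
  have t_scale: "?t (s *\<^sub>R x) = s *\<^sub>R ?t x" for s x by (simp add: tangential_part_def algebra_simps)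
  have t_shift: "?t (x + s *\<^sub>R n) = ?t x" for s x
    by (simp add: tangential_part_def inner_add_right nn algebra_simps)
  have t_idem: "?t (?t x) = ?t x" for x
    by (rule tangential_part_orth) (rule tangential_part_normal[OF n])
  have "\<exists>h r. h \<in> rpoly (Suc k) \<and> hom (Suc k) h \<and> r \<in> rpoly k \<and> (\<forall>x. w x $ i = h x + r x)" for i
    using rpoly_split_hom[OF wp[of i]] by auto
  then obtain h0 r0 where h0: "\<And>i. h0 i \<in> rpoly (Suc k)" "\<And>i. hom (Suc k) (h0 i)" "\<And>i. r0 i \<in> rpoly k"
    "\<And>i x. w x $ i = h0 i x + r0 i x" by metis
  \<comment> \<open>Composing with the projection makes both parts constant along \<open>n\<close>.
    Their sum is still \<open>w\<close>, since \<open>w\<close> has this invariance by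
    hypothesis.\<close>
  define h where "h x = (\<chi> i. h0 i (?t x))" for x
  define r where "r x = (\<chi> i. r0 i (?t x))" for x
  have hp: "(\<lambda>x. h x $ i) \<in> rpoly (Suc k)" for i
    using rpoly_compose[OF h0(1)[of i] tc] by (simp add: h_def)
  have rp: "(\<lambda>x. r x $ i) \<in> rpoly k" for i
    using rpoly_compose[OF h0(3)[of i] tc] by (simp add: r_def)
  have hh: "hom (Suc k) (\<lambda>x. h x $ i)" for i
    using h0(2)[of i] by (simp add: hom_def h_def t_scale)
  have whr: "w x = h x + r x" for x
    by (subst inv[symmetric], subst vec_eq_iff) (simp add: h0(4) h_def r_def)
  have h_shift: "h (x + s *\<^sub>R n) = h x" for x s by (simp add: h_def t_shift)
  have nh: "n \<bullet> h x = 0" for x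
  proof (rule hom_eq_0[of "\<lambda>x. n \<bullet> h x" k "Suc k"])
    have "(\<lambda>x. - (\<Sum>i\<in>UNIV. n $ i * r x $ i)) \<in> rpoly k"
      by (intro rpoly_uminus rpoly_sum rpoly_scale rp)
    moreover have "n \<bullet> h x = - (\<Sum>i\<in>UNIV. n $ i * r x $ i)" for x
      using wn[of x] by (simp add: whr inner_add_right inner_vec_def[of n "r x"])
    ultimately show "(\<lambda>x. n \<bullet> h x) \<in> rpoly k" by simp
    show "hom (Suc k) (\<lambda>x. n \<bullet> h x)"
      using hh by (simp add: hom_def inner_vec_def sum_distrib_left mult_ac)
  qed simp
  have nr: "n \<bullet> r x = 0" for x using wn[of x] nh[of x] by (simp add: whr inner_add_right)
  have yh: "(\<Sum>j\<in>UNIV. x $ j * h x $ j) = 0" for x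
  proof (rule hom_eq_0[of "\<lambda>x. \<Sum>j\<in>UNIV. x $ j * h x $ j" "Suc k" "Suc (Suc k)"])
    have "(\<lambda>x. x $ j * r x $ j) \<in> rpoly (Suc k)" for j
      using rpoly_mult[OF rpoly_coord rp] by simp
    then have "(\<lambda>x. x \<bullet> w x - (\<Sum>j\<in>UNIV. x $ j * r x $ j)) \<in> rpoly (Suc k)"
      by (intro rpoly_diff low rpoly_sum)
    moreover have "(\<Sum>j\<in>UNIV. x $ j * h x $ j) = x \<bullet> w x - (\<Sum>j\<in>UNIV. x $ j * r x $ j)" for x
      by (simp add: whr inner_vec_def distrib_left sum.distrib)
    ultimately show "(\<lambda>x. \<Sum>j\<in>UNIV. x $ j * h x $ j) \<in> rpoly (Suc k)" by simp
    show "hom (Suc (Suc k)) (\<lambda>x. \<Sum>j\<in>UNIV. x $ j * h x $ j)"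
      using hh by (simp add: hom_def sum_distrib_left mult_ac)
  qed simp
  \<comment> \<open>For the factor: in \<open>W x *v x\<close> the first sum is \<open>k + 1\<close>
    times \<open>h x\<close> by Euler's identity, and the second is \<open>- h x\<close> by
    differentiating \<open>x \<bullet> h x = 0\<close>, so together they give \<open>k + 2\<close>
    times \<open>h x\<close>.\<close>
  define W where "W x = (\<chi> i j. (1 / (k + 2)) * (pd j (\<lambda>y. h y $ i) x - pd i (\<lambda>y. h y $ j) x))" for x
  let ?X = "{A \<in> skew_matrices. A *v n = (0 :: real^'n)}"
  have pdyh: "(\<Sum>j\<in>UNIV. x $ j * pd i (\<lambda>y. h y $ j) x) = - h x $ i" for x i
  proof -
    have "0 = pd i (\<lambda>x. \<Sum>j\<in>UNIV. x $ j * h x $ j) x" by (simp add: yh)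
    also have "\<dots> = (\<Sum>j\<in>UNIV. pd i (\<lambda>x. x $ j * h x $ j) x)"
      by (rule pd_sum) (rule rpoly_mult[OF rpoly_coord hp])
    also have "\<dots> = (\<Sum>j\<in>UNIV. (if i = j then h x $ j else 0) + x $ j * pd i (\<lambda>y. h y $ j) x)"
      by (intro sum.cong refl) (simp add: pd_mult[OF rpoly_coord hp] pd_coord)
    finally show ?thesis by (simp add: sum.distrib)
  qed
  have pdnh: "(\<Sum>j\<in>UNIV. n $ j * pd i (\<lambda>y. h y $ j) x) = 0" for x i
  proof -
    have "0 = pd i (\<lambda>x. \<Sum>j\<in>UNIV. n $ j * h x $ j) x" using nh by (simp add: inner_vec_def)
    also have "\<dots> = (\<Sum>j\<in>UNIV. pd i (\<lambda>x. n $ j * h x $ j) x)"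
      by (rule pd_sum) (rule rpoly_scale[OF hp])
    finally show ?thesis by (simp add: pd_scale[OF hp])
  qed
  have Wx: "W x *v x = h x" for x
  proof (subst vec_eq_iff, rule allI)
    fix i
    have e: "(\<Sum>j\<in>UNIV. x $ j * pd j (\<lambda>y. h y $ i) x) = (k + 1) * h x $ i"
      using euler_identity[OF hp hh, of x i] by simp
    have "(W x *v x) $ i = (1 / (k + 2)) * ((\<Sum>j\<in>UNIV. x $ j * pd j (\<lambda>y. h y $ i) x) - (\<Sum>j\<in>UNIV. x $ j * pd i (\<lambda>y. h y $ j) x))"
      by (simp add: W_def matrix_vector_mult_def sum_subtractf[symmetric] sum_distrib_left sum_divide_distrib algebra_simps)
    also have "\<dots> = h x $ i" unfolding e pdyh by (simp add: field_simps)
    finally show "(W x *v x) $ i = h x $ i" .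
  qed
  have Wn: "W x *v n = 0" for x
  proof (subst vec_eq_iff, rule allI)
    fix i
    have e: "(\<Sum>j\<in>UNIV. n $ j * pd j (\<lambda>y. h y $ i) x) = 0"
      by (rule pd_along_invariant[OF hp]) (simp add: h_shift)
    have "(W x *v n) $ i = (1 / (k + 2)) * ((\<Sum>j\<in>UNIV. n $ j * pd j (\<lambda>y. h y $ i) x) - (\<Sum>j\<in>UNIV. n $ j * pd i (\<lambda>y. h y $ j) x))"
      by (simp add: W_def matrix_vector_mult_def sum_subtractf[symmetric] sum_distrib_left sum_divide_distrib algebra_simps)
    then show "(W x *v n) $ i = 0 $ i" unfolding e pdnh by simp
  qed
  have WX: "W x \<in> ?X" for x
    using Wn[of x] by (simp add: skew_iff W_def add_divide_distrib[symmetric])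
  have "W \<in> hom_polys k ?X"
  proof (rule hom_polysI[OF subspace_skew_normal])
    have "(\<lambda>x. W x $ i $ j) \<in> rpoly k" for i j
    proof -
      have "(\<lambda>x. (1 / (k + 2)) * (pd j (\<lambda>y. h y $ i) x - pd i (\<lambda>y. h y $ j) x)) \<in> rpoly k"
        by (intro rpoly_scale rpoly_diff rpoly_pd' hp)
      then show ?thesis by (simp add: W_def)
    qed
    then show "W \<in> polys k ?X" unfolding polys_mat_iff[OF subspace_skew_normal] using WX by blast
    show "hom k W"
      using hom_pd[OF hp hh] by (simp add: hom_def W_def vec_eq_iff algebra_simps)
  qed
  moreover have "r \<in> polys k {v. n \<bullet> v = 0}"
    unfolding polys_vec_iff[OF subspace_hyperplane] using rp nr by simp
  moreover have "w x = r x + W (?t x) *v ?t x" for x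
    unfolding Wx using whr[of x] by (simp add: h_def t_idem add.commute)
  ultimately show ?thesis
    unfolding ND_def by (intro CollectI exI[of _ r] exI[of _ W]) (auto intro: arg_cong[where f="on_set F"])
qed

context framed_simplex
begin

text \<open>With \<open>u = \<rho> n\<close> and \<open>g\<^sub>w \<bullet> u = \<lambda>\<^sub>w p\<^sub>w\<close>, the test function \<open>\<Sum> p\<^sub>w \<Pi>g\<^sub>w\<close> gives
  \<open>\<integral> \<Sum> \<lambda>\<^sub>w p\<^sub>w\<^sup>2 = 0\<close>. It lies in \<open>ND\<^sub>k\<close> because \<open>\<Sum> \<lambda>\<^sub>w p\<^sub>w = 0\<close>.\<close>

lemma facet_trace_zero:
  assumes rho: "\<rho> \<in> polys (k + 2) sym_matrices" and v: "v \<in> C"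
    and bd: "\<And>w x. w \<in> C - {v} \<Longrightarrow> x \<in> aff (C - {v} - {w}) \<Longrightarrow> g w \<bullet> (\<rho> x *v g v) = 0"
    and nn: "\<And>x. x \<in> aff (C - {v}) \<Longrightarrow> g v \<bullet> (\<rho> x *v g v) = 0"
    and test: "\<And>q. q \<in> ND k (\<nu> (facet v) 1) (facet v) \<Longrightarrow>
      inner_face (facet v) (\<lambda>x. tangential_part (\<nu> (facet v) 1) (\<rho> x *v \<nu> (facet v) 1)) q = 0"
    and x: "x \<in> aff (C - {v})"
  shows "\<rho> x *v g v = 0"
proof -
  define n where "n = \<nu> (facet v) 1"
  let ?c = "C - {v}" and ?F = "facet v"
  let ?t = "tangential_part n"
  have c: "?c \<subseteq> C" "2 \<le> card ?c" "?c \<noteq> {}"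
    using card_facet[OF v] d3 card.empty[where 'a="real^'n"] by (blast, simp, metis not_numeral_le_zero)
  have fc: "finite ?c" using finC by simp
  obtain \<alpha> where al: "\<alpha> \<noteq> 0" "n = \<alpha> *\<^sub>R g v" using facet_normal(2)[OF v] unfolding n_def by blast
  have n1: "norm n = 1" unfolding n_def by (rule facet_normal(1)[OF v])
  have up: "(\<lambda>x. a \<bullet> (\<rho> x *v g v)) \<in> rpoly (k + 2)" for a using rho by (rule rpoly_nn)
  have "\<exists>p\<in>rpoly (Suc k). \<forall>x\<in>aff ?c. g w \<bullet> (\<rho> x *v g v) = lam w x * p x" if w: "w \<in> ?c" for w
  proof -
    have "\<exists>q\<in>rpoly (k + 2 - card {w}). (k + 2 < card {w} \<longrightarrow> q = (\<lambda>_. 0)) \<and>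
        (\<forall>x\<in>aff ?c. g w \<bullet> (\<rho> x *v g v) = (\<Prod>u\<in>{w}. lam u x) * q x)"
      by (rule face_bubble_factor[OF c(1,2) _ up]) (use w bd in auto)
    then show ?thesis by simp
  qed
  then obtain p where p: "\<And>w. w \<in> ?c \<Longrightarrow> p w \<in> rpoly (Suc k)"
    "\<And>w x. w \<in> ?c \<Longrightarrow> x \<in> aff ?c \<Longrightarrow> g w \<bullet> (\<rho> x *v g v) = lam w x * p w x"
    by metis
  have syz: "(\<Sum>w\<in>?c. lam w x * p w x) = 0" if "x \<in> aff ?c" for x
  proof -
    have "(\<Sum>w\<in>?c. lam w x * p w x) = (\<Sum>w\<in>?c. g w \<bullet> (\<rho> x *v g v))"
      using p(2) that by (intro sum.cong) auto
    also have "\<dots> = (\<Sum>w\<in>C. g w \<bullet> (\<rho> x *v g v)) - g v \<bullet> (\<rho> x *v g v)"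
      using finC v by (simp add: sum_diff1)
    finally show ?thesis using nn[OF that] sum_g_inner by simp
  qed
  obtain a where a: "a \<in> aff ?c" using aff_ne[OF c(1,3)] by blast
  define \<kappa> where "\<kappa> = n \<bullet> a"
  \<comment> \<open>The orthogonal projection onto the hyperplane of the facet. A member of
    \<open>ND\<close> depends on the tangential part of its argument only, so the \<open>p w\<close>
    are precomposed with \<open>\<psi>\<close>, which does not change them on the facet.\<close>
  define \<psi> where "\<psi> y = ?t y + \<kappa> *\<^sub>R n" for y
  have n_inner: "n \<bullet> x = \<kappa>" if "x \<in> aff ?c" for x
  proof -
    have "g v \<bullet> (x - a) = 0" using that a v lam_diff[OF v, of x a] by (simp add: aff_def)
    then have "n \<bullet> (x - a) = 0" by (simp add: al(2))
    then show ?thesis by (simp add: \<kappa>_def inner_diff_right)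
  qed
  have psi_id: "\<psi> x = x" if "x \<in> aff ?c" for x
    using n_inner[OF that] by (simp add: \<psi>_def tangential_part_def)
  have psi_n: "n \<bullet> \<psi> y = \<kappa>" for y
    using tangential_part_normal[OF n1] n1 by (simp add: \<psi>_def inner_add_right norm_eq_1)
  have psi_aff: "\<psi> y \<in> aff ?c" for y
  proof -
    have "n \<bullet> (\<psi> y - a) = 0" using psi_n[of y] by (simp add: inner_diff_right \<kappa>_def)
    then have "g v \<bullet> (\<psi> y - a) = 0" using al by simp
    then have "lam v (\<psi> y) = lam v a" using lam_diff[OF v, of "\<psi> y" a] by simp
    then show ?thesis using a v by (auto simp: aff_def)
  qed
  have t_idem: "?t (?t y) = ?t y" for y
    by (rule tangential_part_orth) (rule tangential_part_normal[OF n1])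
  have tc: "(\<lambda>x. \<psi> x $ i) \<in> rpoly 1" for i
    using rpoly_add[OF rpoly_diff[OF rpoly_coord[of i] rpoly_scale2[OF rpoly_inner[of n], of "n $ i"]] rpoly_const[of "\<kappa> * n $ i"]]
    by (simp add: \<psi>_def tangential_part_def)
  have pp: "(\<lambda>y. p w (\<psi> y)) \<in> rpoly (Suc k)" if "w \<in> ?c" for w
    using rpoly_compose[OF p(1)[OF that] tc] .
  define \<omega> where "\<omega> y = (\<Sum>w\<in>?c. p w (\<psi> y) *\<^sub>R ?t (g w))" for y
  have om_c: "(\<lambda>y. \<omega> y $ i) \<in> rpoly (Suc k)" for i
  proof -
    have "(\<lambda>y. \<Sum>w\<in>?c. p w (\<psi> y) * ?t (g w) $ i) \<in> rpoly (Suc k)"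
      by (intro rpoly_sum rpoly_scale2 pp)
    then show ?thesis by (simp add: \<omega>_def)
  qed
  have "on_set ?F \<omega> \<in> ND k n ?F"
  proof (rule ND_intro[OF n1])
    show "(\<lambda>y. \<omega> y $ i) \<in> rpoly (Suc k)" for i by (rule om_c)
    show "n \<bullet> \<omega> y = 0" for y
      by (simp add: \<omega>_def inner_sum_right tangential_part_normal[OF n1])
    show "\<omega> (?t y) = \<omega> y" for y by (simp add: \<omega>_def \<psi>_def t_idem)
    have "y \<bullet> \<omega> y = (\<Sum>w\<in>?c. p w (\<psi> y) * (- (lam w 0 + \<kappa> * (g w \<bullet> n))))" for y
    proof -
      have "y \<bullet> ?t (g w) = lam w (\<psi> y) - (lam w 0 + \<kappa> * (g w \<bullet> n))" if "w \<in> ?c" for w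
      proof -
        have "y \<bullet> ?t (g w) = g w \<bullet> ?t y" by (simp add: tangential_part_def inner_diff_right inner_commute)
        also have "\<dots> = g w \<bullet> \<psi> y - \<kappa> * (g w \<bullet> n)" by (simp add: \<psi>_def inner_add_right)
        finally show ?thesis using lam_affine[of w "\<psi> y"] that by simp
      qed
      then have "y \<bullet> \<omega> y = (\<Sum>w\<in>?c. p w (\<psi> y) * (lam w (\<psi> y) - (lam w 0 + \<kappa> * (g w \<bullet> n))))"
        by (simp add: \<omega>_def inner_sum_right)
      also have "\<dots> = (\<Sum>w\<in>?c. lam w (\<psi> y) * p w (\<psi> y)) + (\<Sum>w\<in>?c. p w (\<psi> y) * (- (lam w 0 + \<kappa> * (g w \<bullet> n))))"
        unfolding sum.distrib[symmetric] by (intro sum.cong) (auto simp: algebra_simps)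
      finally show ?thesis using syz[OF psi_aff] by simp
    qed
    moreover have "(\<lambda>y. \<Sum>w\<in>?c. p w (\<psi> y) * (- (lam w 0 + \<kappa> * (g w \<bullet> n)))) \<in> rpoly (Suc k)"
      by (intro rpoly_sum rpoly_scale2 pp)
    ultimately show "(\<lambda>y. y \<bullet> \<omega> y) \<in> rpoly (Suc k)" by simp
  qed
  from test[folded n_def, OF this]
  have t0: "inner_face ?F (\<lambda>x. ?t (\<rho> x *v n)) (on_set ?F \<omega>) = 0" .
  let ?s = "\<lambda>x. \<Sum>w\<in>?c. lam w x * (p w x)\<^sup>2"
  have in_aff: "x \<in> aff ?c" if "x \<in> ?F" for x using that by (simp add: conv_eq[OF c(1)])
  have pt: "?t (\<rho> x *v n) \<bullet> on_set ?F \<omega> x = \<alpha> * ?s x" if "x \<in> ?F" for x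
  proof -
    let ?u = "\<rho> x *v g v"
    have xa: "x \<in> aff ?c" using in_aff[OF that] .
    have un: "n \<bullet> ?u = 0" using nn[OF xa] by (simp add: al(2))
    have "\<rho> x *v n = \<alpha> *\<^sub>R ?u" by (simp add: al(2) matrix_vector_mult_scaleR)
    then have "?t (\<rho> x *v n) = \<alpha> *\<^sub>R ?u" using un by (simp add: tangential_part_def)
    moreover have "?u \<bullet> \<omega> x = ?s x"
    proof -
      have "?u \<bullet> \<omega> x = (\<Sum>w\<in>?c. p w x * (g w \<bullet> ?u))"
        unfolding \<omega>_def psi_id[OF xa] inner_sum_right
        by (simp add: tangential_part_inner[OF un] inner_commute[of "\<rho> x *v g v" "g _"])
      also have "\<dots> = ?s x" using p(2)[OF _ xa] by (intro sum.cong) (auto simp: power2_eq_square)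
      finally show ?thesis .
    qed
    ultimately show ?thesis using that by (simp add: on_set_def)
  qed
  have "(LINT x:?F|surface_measure ?F. \<alpha> * ?s x) = 0"
  proof -
    have "(LINT x:?F|surface_measure ?F. \<alpha> * ?s x) = inner_face ?F (\<lambda>x. ?t (\<rho> x *v n)) (on_set ?F \<omega>)"
      unfolding L2_inner_def set_lebesgue_integral_def
      by (rule Bochner_Integration.integral_cong) (auto simp: indicator_def pt)
    then show ?thesis using t0 by simp
  qed
  then have "(LINT x:?F|surface_measure ?F. ?s x) = 0" using al(1) by simp
  moreover have "continuous_on UNIV ?s"
    using c(1) continuous_on_rpoly[OF p(1)] by (intro continuous_intros continuous_lam) auto
  moreover have nonneg: "0 \<le> lam w x * (p w x)\<^sup>2" if "x \<in> ?F" "w \<in> ?c" for x w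
    using lam_nonneg[OF _ c(1) that(1), of w] that(2) by simp
  ultimately have s0: "?s x = 0" if "x \<in> ?F" for x
    using that by (intro charges_integral_zero[OF charges_face[OF c(1,3)], of ?s]) (auto intro: sum_nonneg)
  have "g w \<bullet> (\<rho> y *v g v) = 0" if y: "y \<in> ?F" and w: "w \<in> C" for y w
  proof (cases "w = v")
    case True
    then show ?thesis using nn in_aff[OF y] by blast
  next
    case False
    then have "lam w y * (p w y)\<^sup>2 = 0"
      using s0[OF y] sum_nonneg_eq_0_iff[OF fc, of "\<lambda>w. lam w y * (p w y)\<^sup>2"] nonneg[OF y] w by auto
    then show ?thesis using p(2)[of w y] in_aff[OF y] w False by auto
  qed
  then have "g w \<bullet> (\<rho> x *v g v) = 0" if "w \<in> C" for w
    using vanish_on_conv_aff[OF up[of "g w"] c(1,3) _ x] that by blast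
  then show ?thesis by (rule vec_eq_0I)
qed

end

subsection \<open>Integration by parts on the simplex\<close>

lemma integral_lborel_translate:
  fixes f :: "'a::euclidean_space \<Rightarrow> real"
  assumes "f \<in> borel_measurable borel"
  shows "(\<integral>x. f (x + c) \<partial>lborel) = (\<integral>x. f x \<partial>lborel)"
proof -
  have "(\<integral>x. f x \<partial>lborel) = (\<integral>x. f x \<partial>distr lborel borel ((+) c))" by (simp add: lborel_distr_plus)
  also have "\<dots> = (\<integral>x. f (c + x) \<partial>lborel)" using assms by (intro integral_distr) auto
  finally show ?thesis by (simp add: add.commute)
qed

lemma integrable_lborel_translate:
  fixes f :: "'a::euclidean_space \<Rightarrow> real"
  assumes "integrable lborel f"
  shows "integrable lborel (\<lambda>x. f (x + c))"
proof -
  have "integrable (distr lborel borel ((+) c)) f" using assms by (simp add: lborel_distr_plus)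
  then have "integrable lborel (\<lambda>x. f (c + x))" using assms by (subst (asm) integrable_distr_eq) auto
  then show ?thesis by (simp add: add.commute)
qed

definition dd :: "real^'n \<Rightarrow> (real^'n \<Rightarrow> real) \<Rightarrow> real^'n \<Rightarrow> real" where
  "dd t p x = (\<Sum>i\<in>UNIV. t $ i * pd i p x)"

lemma dd_rpoly: "p \<in> rpoly k \<Longrightarrow> dd t p \<in> rpoly k"
  unfolding dd_def by (intro rpoly_sum rpoly_scale rpoly_pd_same)

lemma dd_DERIV:
  assumes p: "p \<in> rpoly k"
  shows "((\<lambda>s. p (x + s *\<^sub>R t)) has_real_derivative dd t p (x + s *\<^sub>R t)) (at s)"
proof -
  have "((\<lambda>s. x + s *\<^sub>R t) has_derivative (\<lambda>s. s *\<^sub>R t)) (at s)"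
    by (auto intro!: derivative_eq_intros)
  from has_derivative_compose[OF this rpoly_derivative[OF p]]
  have "((\<lambda>s. p (x + s *\<^sub>R t)) has_derivative (\<lambda>h. (\<Sum>i\<in>UNIV. t $ i * pd i p (x + s *\<^sub>R t)) * h)) (at s)"
    by (simp add: sum_distrib_left sum_distrib_right mult_ac)
  then show ?thesis by (simp add: has_field_derivative_def mult_commute_abs dd_def)
qed

lemma dd_mult:
  "p \<in> rpoly k \<Longrightarrow> q \<in> rpoly l \<Longrightarrow> dd t (\<lambda>x. p x * q x) x = dd t p x * q x + p x * dd t q x"
  by (simp add: dd_def pd_mult sum.distrib distrib_left sum_distrib_left sum_distrib_right mult_ac)

lemma AE_hyperplane:
  fixes a :: "'a::euclidean_space"
  assumes "a \<noteq> 0" shows "AE x in lborel. a \<bullet> x \<noteq> b"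
proof -
  have "closed {x. a \<bullet> x = b}" by (rule closed_hyperplane)
  then have "{x. a \<bullet> x = b} \<in> null_sets lborel"
    using negligible_hyperplane[of a b] assms
    by (simp add: negligible_iff_null_sets null_sets_completion_iff borel_closed)
  then show ?thesis by (rule AE_I') auto
qed

context bary
begin

lemma K_iff: "x \<in> K \<longleftrightarrow> (\<forall>u\<in>C. 0 \<le> lam u x)"
  using conv_eq[of C] by simp

text \<open>The extension by zero of \<open>\<lambda>\<^sub>v \<lambda>\<^sub>w p\<close> is Lipschitz along the direction \<open>w - v\<close>: in this direction
  one can leave the simplex only through the facets \<open>\<lambda>\<^sub>v = 0\<close> and \<open>\<lambda>\<^sub>w = 0\<close>. Its difference
  quotients have integral zero by translation invariance.\<close>

lemma integral_edge_derivative: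
  assumes vw: "v \<in> C" "w \<in> C" "v \<noteq> w" and p: "p \<in> rpoly k"
  shows "(LINT x:K|lborel. dd (w - v) (\<lambda>x. lam v x * lam w x * p x) x) = 0"
proof -
  define t where "t = w - v"
  define h where "h x = lam v x * lam w x * p x" for x
  have hp: "h \<in> rpoly (1 + 1 + k)"
    unfolding h_def using rpoly_mult[OF rpoly_mult[OF lam_rpoly[OF vw(1)] lam_rpoly[OF vw(2)]] p] .
  define D where "D = dd t h"
  have Dp: "D \<in> rpoly (1 + 1 + k)" unfolding D_def by (rule dd_rpoly[OF hp])
  have cK: "compact K" using charges_K by (simp add: charges_def)
  have gt: "g v \<bullet> t = -1" "g w \<bullet> t = 1" "\<And>u. u \<in> C \<Longrightarrow> u \<noteq> v \<Longrightarrow> u \<noteq> w \<Longrightarrow> g u \<bullet> t = 0"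
    using vw by (auto simp: t_def g_edge)
  have lt: "lam u (x + e *\<^sub>R t) = lam u x + e * (g u \<bullet> t)" if "u \<in> C" for u x e
    using lam_shift[OF that, of x "e *\<^sub>R t"] by simp
  have "\<exists>M. \<forall>x\<in>K. \<bar>f x\<bar> \<le> M" if "continuous_on UNIV f" for f :: "real^'n \<Rightarrow> real"
  proof -
    have "compact (f ` K)" using that cK continuous_on_subset compact_continuous_image by blast
    then show ?thesis using compact_imp_bounded bounded_iff by (metis imageI real_norm_def)
  qed
  note bd = this
  obtain M1 where M1: "\<And>x. x \<in> K \<Longrightarrow> \<bar>D x\<bar> \<le> M1" using bd[OF continuous_on_rpoly[OF Dp]] by blast
  obtain M2 where M2: "\<And>x. x \<in> K \<Longrightarrow> \<bar>lam w x * p x\<bar> \<le> M2"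
    using bd[of "\<lambda>x. lam w x * p x"] continuous_on_mult[OF continuous_lam[OF vw(2)] continuous_on_rpoly[OF p]] by blast
  obtain M3 where M3: "\<And>x. x \<in> K \<Longrightarrow> \<bar>lam v x * p x\<bar> \<le> M3"
    using bd[of "\<lambda>x. lam v x * p x"] continuous_on_mult[OF continuous_lam[OF vw(1)] continuous_on_rpoly[OF p]] by blast
  define M where "M = max 0 (max M1 (max M2 M3))"
  have M: "M1 \<le> M" "M2 \<le> M" "M3 \<le> M" "0 \<le> M" by (auto simp: M_def)
  obtain R where R: "\<And>x. x \<in> K \<Longrightarrow> norm x \<le> R"
    using compact_imp_bounded[OF cK] by (auto simp: bounded_iff)
  define E where "E x = indicator K x * h x" for x
  have Eint: "integrable lborel E"
    using charges_integrable[OF charges_K continuous_on_rpoly[OF hp]] by (simp add: set_integrable_def E_def[abs_def])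
  define \<epsilon> where "\<epsilon> n = 1 / real (Suc n)" for n
  have eps: "0 < \<epsilon> n" "\<epsilon> n \<le> 1" for n by (auto simp: \<epsilon>_def)
  have eps0: "\<epsilon> \<longlonglongrightarrow> 0" unfolding \<epsilon>_def using LIMSEQ_inverse_real_of_nat by (simp add: inverse_eq_divide)
  have lip: "\<bar>E (x + e *\<^sub>R t) - E x\<bar> \<le> e * M" if e: "0 < e" for x e
  proof -
    let ?y = "x + e *\<^sub>R t"
    consider "x \<in> K" "?y \<in> K" | "x \<in> K" "?y \<notin> K" | "x \<notin> K" "?y \<in> K" | "x \<notin> K" "?y \<notin> K" by blast
    then show ?thesis
    proof cases
      case 1
      obtain z where z: "0 < z" "z < e" "h (x + e *\<^sub>R t) - h (x + 0 *\<^sub>R t) = (e - 0) * D (x + z *\<^sub>R t)"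
        using MVT2[of 0 e "\<lambda>s. h (x + s *\<^sub>R t)" "\<lambda>s. D (x + s *\<^sub>R t)"] e dd_DERIV[OF hp, of x t] by (auto simp: D_def)
      have "x + z *\<^sub>R t = (1 - z / e) *\<^sub>R x + (z / e) *\<^sub>R ?y" using e by (simp add: algebra_simps)
      moreover have "(1 - z / e) *\<^sub>R x + (z / e) *\<^sub>R ?y \<in> K"
        using 1 z e by (intro convexD[OF convex_convex_hull]) auto
      ultimately have "\<bar>D (x + z *\<^sub>R t)\<bar> \<le> M" using M1 M(1) order_trans by metis
      then have "e * \<bar>D (x + z *\<^sub>R t)\<bar> \<le> e * M" using e by (intro mult_left_mono) auto
      then show ?thesis using 1 z(3) e by (simp add: E_def abs_mult)
    next
      case 2
      \<comment> \<open>Moving along \<open>t = w - v\<close> lowers \<open>lam v\<close> at unit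
        rate, raises \<open>lam w\<close> and fixes all other coordinates. A step of length
        \<open>e\<close> can therefore leave the simplex only if \<open>lam v x < e\<close>, and
        then \<open>h x\<close> is small.\<close>
      have "lam v x < e"
      proof (rule ccontr)
        assume "\<not> lam v x < e"
        then have "0 \<le> lam u ?y" if "u \<in> C" for u
          using lt[OF that, of x e] gt that 2(1) e by (cases "u = v"; cases "u = w") (auto simp: K_iff)
        then show False using 2(2) by (simp add: K_iff)
      qed
      moreover have "0 \<le> lam v x" using 2(1) vw by (simp add: K_iff)
      ultimately have "\<bar>lam v x\<bar> * \<bar>lam w x * p x\<bar> \<le> e * M"
        using M2[OF 2(1)] M e by (intro mult_mono) auto
      then show ?thesis using 2 by (simp add: E_def h_def abs_mult mult.assoc)
    next
      case 3
      \<comment> \<open>The mirror case: entering the simplex happens through the facet where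
        \<open>lam w\<close> vanishes.\<close>
      have "lam w ?y < e"
      proof (rule ccontr)
        assume "\<not> lam w ?y < e"
        then have "0 \<le> lam u x" if "u \<in> C" for u
          using lt[OF that, of x e] gt that 3(2) e vw(3) by (cases "u = v"; cases "u = w") (auto simp: K_iff dest!: bspec[of _ _ u])
        then show False using 3(1) by (simp add: K_iff)
      qed
      moreover have "0 \<le> lam w ?y" using 3(2) vw by (simp add: K_iff)
      ultimately have "\<bar>lam w ?y\<bar> * \<bar>lam v ?y * p ?y\<bar> \<le> e * M"
        using M3[OF 3(2)] M e by (intro mult_mono) auto
      then show ?thesis using 3 by (simp add: E_def h_def abs_mult mult_ac)
    next
      case 4
      then show ?thesis using e M by (simp add: E_def)
    qed
  qed
  define s where "s n x = (E (x + \<epsilon> n *\<^sub>R t) - E x) / \<epsilon> n" for n x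
  have sint: "(\<integral>x. s n x \<partial>lborel) = 0" for n
  proof -
    have "(\<integral>x. E (x + \<epsilon> n *\<^sub>R t) - E x \<partial>lborel) = 0"
      using integral_lborel_translate[of E "\<epsilon> n *\<^sub>R t"] Eint integrable_lborel_translate[OF Eint, of "\<epsilon> n *\<^sub>R t"]
      by (subst Bochner_Integration.integral_diff) auto
    then show ?thesis by (simp add: s_def)
  qed
  have "(\<lambda>n. \<integral>x. s n x \<partial>lborel) \<longlonglongrightarrow> (\<integral>x. indicator K x * D x \<partial>lborel)"
  \<comment> \<open>All step sizes are at most 1, so every difference quotient is zero outside the
    ball of radius \<open>R + norm t\<close>; inside, it is bounded by the Lipschitz constant
    \<open>M\<close>.\<close>
  proof (rule integral_dominated_convergence[where w="\<lambda>x. indicator (cball 0 (R + norm t)) x * M"])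
    show "(\<lambda>x. indicator K x * D x) \<in> borel_measurable lborel"
      using charges_integrable[OF charges_K continuous_on_rpoly[OF Dp]] by (auto simp: set_integrable_def)
    show "s n \<in> borel_measurable lborel" for n
      using Eint integrable_lborel_translate[OF Eint, of "\<epsilon> n *\<^sub>R t"] unfolding s_def by measurable
    show "integrable lborel (\<lambda>x. indicator (cball 0 (R + norm t)) x * M)"
      using borel_integrable_compact[of "cball 0 (R + norm t)" "\<lambda>_. M"] by simp
    show "AE x in lborel. norm (s n x) \<le> indicator (cball 0 (R + norm t)) x * M" for n
    proof (rule AE_I2)
      fix x
      show "norm (s n x) \<le> indicator (cball 0 (R + norm t)) x * M"
      proof (cases "x \<in> cball 0 (R + norm t)")
        case True
        then show ?thesis using lip[OF eps(1)[of n], of x] eps(1)[of n]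
          by (simp add: s_def divide_le_eq mult.commute)
      next
        case False
        then have n: "norm x > R + norm t" by simp
        then have "x \<notin> K" using R[of x] norm_ge_zero[of t] by fastforce
        moreover have "x + \<epsilon> n *\<^sub>R t \<notin> K"
        proof
          assume "x + \<epsilon> n *\<^sub>R t \<in> K"
          then have "norm (x + \<epsilon> n *\<^sub>R t) \<le> R" by (rule R)
          moreover have "norm x \<le> norm (x + \<epsilon> n *\<^sub>R t) + norm (\<epsilon> n *\<^sub>R t)"
            by (metis add_diff_cancel norm_triangle_ineq4)
          moreover have "norm (\<epsilon> n *\<^sub>R t) \<le> 1 * norm t"
            unfolding norm_scaleR using eps[of n] by (intro mult_right_mono) auto
          ultimately show False using n by simp
        qed
        ultimately show ?thesis using False by (simp add: s_def E_def)
      qed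
    qed
    \<comment> \<open>On the facet where \<open>lam v\<close> vanishes the quotients leave the
      simplex at once and need not converge to \<open>D x\<close>; the hyperplane of this facet is a
      null set.\<close>
    have "AE x in lborel. g v \<bullet> x \<noteq> - lam v 0" by (rule AE_hyperplane[OF g_ne_0[OF vw(1)]])
    then show "AE x in lborel. (\<lambda>n. s n x) \<longlonglongrightarrow> indicator K x * D x"
    proof eventually_elim
      case (elim x)
      have lv: "lam v x \<noteq> 0" using elim lam_affine[OF vw(1), of x] by simp
      have tend: "(\<lambda>n. x + \<epsilon> n *\<^sub>R t) \<longlonglongrightarrow> x"
        using tendsto_add[OF tendsto_const[of x] tendsto_scaleR[OF eps0 tendsto_const[of t]]] by simp
      show ?case
      proof (cases "x \<in> K")
        case True
        have "((\<lambda>s. h (x + s *\<^sub>R t)) has_real_derivative D x) (at 0)"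
          using dd_DERIV[OF hp, of x t 0] by (simp add: D_def)
        then have "((\<lambda>e. (h (x + e *\<^sub>R t) - h x) / e) \<longlongrightarrow> D x) (at 0)"
          by (simp add: DERIV_def)
        moreover have "filterlim \<epsilon> (at 0) sequentially"
          unfolding filterlim_at using eps0 eps(1) by (auto intro!: always_eventually simp: less_imp_neq[symmetric])
        ultimately have "(\<lambda>n. (h (x + \<epsilon> n *\<^sub>R t) - h x) / \<epsilon> n) \<longlonglongrightarrow> D x"
          by (rule filterlim_compose)
        moreover have "\<forall>\<^sub>F n in sequentially. (h (x + \<epsilon> n *\<^sub>R t) - h x) / \<epsilon> n = s n x"
        proof -
          have "0 < lam v x" using True lv vw by (simp add: K_iff order_less_le)
          then have "\<forall>\<^sub>F n in sequentially. \<epsilon> n < lam v x" using eps0 order_tendstoD(2) by blast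
          then show ?thesis
          proof eventually_elim
            case (elim n)
            have "0 \<le> lam u (x + \<epsilon> n *\<^sub>R t)" if "u \<in> C" for u
              using lt[OF that, of x "\<epsilon> n"] gt that True elim eps(1)[of n]
              by (cases "u = v"; cases "u = w") (auto simp: K_iff less_imp_le)
            then have "x + \<epsilon> n *\<^sub>R t \<in> K" by (simp add: K_iff)
            then show ?case using True by (simp add: s_def E_def)
          qed
        qed
        ultimately have "(\<lambda>n. s n x) \<longlonglongrightarrow> D x" by (rule Lim_transform_eventually)
        then show ?thesis using True by simp
      next
        case False
        have "open (- K)" using cK compact_imp_closed by auto
        then have "\<forall>\<^sub>F n in sequentially. x + \<epsilon> n *\<^sub>R t \<in> - K"
          using tend False by (intro topological_tendstoD) auto
        then have "\<forall>\<^sub>F n in sequentially. 0 = s n x"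
          by eventually_elim (use False in \<open>simp add: s_def E_def\<close>)
        then have "(\<lambda>n. s n x) \<longlonglongrightarrow> 0" by (rule Lim_transform_eventually[OF tendsto_const])
        then show ?thesis using False by simp
      qed
    qed
  qed
  then have "(\<integral>x. indicator K x * D x \<partial>lborel) = 0"
    using sint LIMSEQ_unique[OF _ tendsto_const[of "0::real"]] by simp
  then show ?thesis by (simp add: set_lebesgue_integral_def D_def t_def h_def[abs_def])
qed

end

section \<open>Rank-one tensors and the row-wise divergence\<close>

definition outer :: "real^'n \<Rightarrow> real^'n \<Rightarrow> real^'n^'n" where
  "outer a b = (\<chi> i j. a $ i * b $ j)"

lemma outer_mult: "outer a b *v y = (b \<bullet> y) *\<^sub>R a"
  by (simp add: outer_def matrix_vector_mult_def vec_eq_iff inner_vec_def sum_distrib_left mult_ac)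

lemma inner_outer: "A \<bullet> outer a b = a \<bullet> (A *v b)"
  by (simp add: outer_def matrix_vector_mult_def inner_vec_def sum_distrib_left mult_ac)

lemma outer_sym: "outer a a \<in> sym_matrices"
  by (simp add: sym_iff outer_def mult.commute)

lemma outer_0 [simp]: "outer 0 a = 0" "outer a 0 = 0"
  by (simp_all add: outer_def vec_eq_iff)

lemma matrix_eqI:
  fixes A B :: "real^'n^'m"
  assumes "\<And>x y. x \<bullet> (A *v y) = x \<bullet> (B *v y)" shows "A = B"
proof -
  have "\<forall>y. A *v y = B *v y" using assms vector_eq_ldot by blast
  then show ?thesis unfolding matrix_eq .
qed

lemma sum_matrix_mult:
  fixes A :: "'i \<Rightarrow> real^'n^'m"
  shows "(\<Sum>i\<in>I. A i) *v y = (\<Sum>i\<in>I. A i *v y)"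
proof (induction I rule: infinite_finite_induct)
  case (insert i I)
  then show ?case by (simp add: matrix_vector_mult_add_rdistrib)
qed simp_all

lemma polys_inner:
  fixes p :: "real^'n \<Rightarrow> 'b::euclidean_space"
  shows "p \<in> polys k X \<Longrightarrow> (\<lambda>x. p x \<bullet> b) \<in> rpoly k"
  by (rule polys_sub_image[where L="\<lambda>y. y \<bullet> b"])
    (auto intro: bounded_linear.linear bounded_linear_inner_left)

lemma polys_differentiable:
  fixes p :: "real^'n \<Rightarrow> 'b::euclidean_space"
  assumes "p \<in> polys k UNIV" shows "p differentiable at x"
proof (subst differentiable_componentwise_within, rule ballI)
  fix b :: 'b assume "b \<in> Basis"
  from rpoly_derivative[OF polys_inner[OF assms]] show "(\<lambda>x. p x \<bullet> b) differentiable at x" by (auto simp: differentiable_def)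
qed

lemma polys_UNIV:
  fixes p :: "real^'n \<Rightarrow> 'b::euclidean_space"
  shows "p \<in> polys k X \<Longrightarrow> p \<in> polys k UNIV"
  using polys_sub_image[of p k X "\<lambda>x. x" UNIV] by (simp add: linear_ident)

lemma div_rows_eq:
  assumes "\<tau> \<in> polys k UNIV"
  shows "div_rows \<tau> x $ i = (\<Sum>j\<in>UNIV. pd j (\<lambda>y. \<tau> y $ i $ j) x)"
proof -
  have D: "(\<tau> has_derivative frechet_derivative \<tau> (at x)) (at x)"
    using polys_differentiable[OF assms, of x] by (rule frechet_derivative_works[THEN iffD1])
  have "((\<lambda>y. \<tau> y $ i $ j) has_derivative (\<lambda>h. frechet_derivative \<tau> (at x) h $ i $ j)) (at x)" for j
    by (intro bounded_linear.has_derivative[OF bounded_linear_vec_nth] D)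
  from pd_eq[OF this] show ?thesis by (simp add: div_rows_def)
qed

lemma mat_comp: "\<tau> \<in> polys k UNIV \<Longrightarrow> (\<lambda>x. \<tau> x $ i $ j) \<in> rpoly k" for \<tau> :: "real^'n \<Rightarrow> real^'m^'l"
  by (simp add: polys_mat_iff)

lemma div_polys:
  assumes "\<tau> \<in> polys (Suc k) UNIV" shows "div_rows \<tau> \<in> polys k UNIV"
proof -
  have "(\<lambda>x. div_rows \<tau> x $ i) \<in> rpoly k" for i
    unfolding div_rows_eq[OF assms] by (intro rpoly_sum rpoly_pd' mat_comp assms)
  then show ?thesis by (simp add: polys_vec_iff)
qed

lemma div_add:
  assumes "\<sigma> \<in> polys k UNIV" "\<tau> \<in> polys l UNIV"
  shows "div_rows (\<lambda>x. \<sigma> x + \<tau> x) x = div_rows \<sigma> x + div_rows \<tau> x"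
proof -
  have "\<sigma> \<in> polys (max k l) UNIV" "\<tau> \<in> polys (max k l) UNIV"
    by (auto intro: polys_mono[OF subspace_UNIV assms(1)] polys_mono[OF subspace_UNIV assms(2)])
  then have s: "(\<lambda>x. \<sigma> x + \<tau> x) \<in> polys (max k l) UNIV" by (rule polys_add[OF subspace_UNIV])
  show ?thesis
    by (simp add: vec_eq_iff div_rows_eq[OF s] div_rows_eq[OF assms(1)] div_rows_eq[OF assms(2)]
        pd_add[OF mat_comp[OF assms(1)] mat_comp[OF assms(2)]] sum.distrib)
qed

lemma div_scale:
  assumes "\<tau> \<in> polys k UNIV"
  shows "div_rows (\<lambda>x. c *\<^sub>R \<tau> x) x = c *\<^sub>R div_rows \<tau> x"
proof -
  have s: "(\<lambda>x. c *\<^sub>R \<tau> x) \<in> polys k UNIV" by (rule polys_scaleR[OF subspace_UNIV assms])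
  show ?thesis
    by (simp add: vec_eq_iff div_rows_eq[OF s] div_rows_eq[OF assms] pd_scale[OF mat_comp[OF assms]] sum_distrib_left)
qed

lemma sgrad_scale: "q \<in> polys k UNIV \<Longrightarrow> sgrad (\<lambda>x. c *\<^sub>R q x) x = c *\<^sub>R sgrad q x"
  by (simp add: sgrad_def vec_eq_iff pd_scale[OF polys_comp] distrib_left)

text \<open>For a constant direction \<open>t\<close> the row-wise divergence of a scalar times
  \<open>outer t t\<close> is the derivative of that scalar along \<open>t\<close>, times
  \<open>t\<close>. With edge vectors for \<open>t\<close>, only derivatives along edges
  occur.\<close>

lemma div_rank_one_sum:
  assumes "finite I" and f: "\<And>e. e \<in> I \<Longrightarrow> f e \<in> rpoly k"
    and tau: "\<And>x. \<tau> x = (\<Sum>e\<in>I. f e x *\<^sub>R outer (t e) (t e))"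
  shows "\<tau> \<in> polys k sym_matrices" and "div_rows \<tau> x = (\<Sum>e\<in>I. dd (t e) (f e) x *\<^sub>R t e)"
proof -
  have c: "\<tau> x $ i $ j = (\<Sum>e\<in>I. (t e $ i * t e $ j) * f e x)" for x i j
    unfolding tau by (simp add: outer_def mult_ac)
  have "(\<lambda>x. \<tau> x $ i $ j) \<in> rpoly k" for i j
    unfolding c by (intro rpoly_sum rpoly_scale f)
  then show s: "\<tau> \<in> polys k sym_matrices"
    unfolding polys_mat_iff[OF subspace_sym] by (auto simp: sym_iff c mult_ac)
  have u: "\<tau> \<in> polys k UNIV" using polys_UNIV[OF s] .
  show "div_rows \<tau> x = (\<Sum>e\<in>I. dd (t e) (f e) x *\<^sub>R t e)"
  proof (subst vec_eq_iff, rule allI)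
    fix i
    have "pd j (\<lambda>y. \<tau> y $ i $ j) x = (\<Sum>e\<in>I. (t e $ i * t e $ j) * pd j (f e) x)" for j
    proof -
      have "pd j (\<lambda>y. \<tau> y $ i $ j) x = (\<Sum>e\<in>I. pd j (\<lambda>x. (t e $ i * t e $ j) * f e x) x)"
        unfolding c by (rule pd_sum) (rule rpoly_scale[OF f])
      then show ?thesis by (simp add: pd_scale[OF f])
    qed
    then have "div_rows \<tau> x $ i = (\<Sum>j\<in>UNIV. \<Sum>e\<in>I. (t e $ i * t e $ j) * pd j (f e) x)"
      by (simp add: div_rows_eq[OF u])
    also have "\<dots> = (\<Sum>e\<in>I. \<Sum>j\<in>UNIV. (t e $ i * t e $ j) * pd j (f e) x)" by (rule sum.swap)
    also have "\<dots> = (\<Sum>e\<in>I. dd (t e) (f e) x *\<^sub>R t e) $ i"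
      by (simp add: dd_def sum_distrib_left sum_distrib_right mult_ac)
    finally show "div_rows \<tau> x $ i = (\<Sum>e\<in>I. dd (t e) (f e) x *\<^sub>R t e) $ i" .
  qed
qed

lemma inner_sgrad:
  assumes z: "z \<in> polys l UNIV"
  shows "t \<bullet> (sgrad z x *v t) = dd t (\<lambda>y. t \<bullet> z y) x"
proof -
  let ?P = "\<Sum>i\<in>UNIV. \<Sum>j\<in>UNIV. t $ i * (t $ j * pd i (\<lambda>y. z y $ j) x)"
  have "t \<bullet> (sgrad z x *v t) = (\<Sum>i\<in>UNIV. \<Sum>j\<in>UNIV.
      (1/2) * (t $ i * (t $ j * pd i (\<lambda>y. z y $ j) x)) + (1/2) * (t $ j * (t $ i * pd j (\<lambda>y. z y $ i) x)))"
    by (simp add: sgrad_def matrix_vector_mult_def inner_vec_def sum_distrib_left add_divide_distrib algebra_simps)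
  also have "\<dots> = (1/2) * ?P + (1/2) * (\<Sum>i\<in>UNIV. \<Sum>j\<in>UNIV. t $ j * (t $ i * pd j (\<lambda>y. z y $ i) x))"
    by (simp only: sum.distrib sum_distrib_left)
  also have "(\<Sum>i\<in>UNIV. \<Sum>j\<in>UNIV. t $ j * (t $ i * pd j (\<lambda>y. z y $ i) x)) = ?P" by (rule sum.swap)
  also have "(1/2) * ?P + (1/2) * ?P = ?P" by simp
  also have "?P = dd t (\<lambda>y. t \<bullet> z y) x"
  proof -
    have "pd i (\<lambda>y. t \<bullet> z y) x = (\<Sum>j\<in>UNIV. t $ j * pd i (\<lambda>y. z y $ j) x)" for i
    proof -
      have "pd i (\<lambda>y. t \<bullet> z y) x = (\<Sum>j\<in>UNIV. pd i (\<lambda>y. t $ j * z y $ j) x)"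
        unfolding inner_vec_def inner_real_def by (rule pd_sum) (rule rpoly_scale[OF polys_comp[OF z]])
      then show ?thesis by (simp add: pd_scale[OF polys_comp[OF z]])
    qed
    then show ?thesis by (simp add: dd_def sum_distrib_left)
  qed
  finally show ?thesis .
qed

lemma rpoly_inner_polys: "z \<in> polys l UNIV \<Longrightarrow> (\<lambda>x. t \<bullet> z x) \<in> rpoly l" for z :: "real^'n \<Rightarrow> real^'m"
  unfolding inner_vec_def inner_real_def by (intro rpoly_sum rpoly_scale polys_comp)

section \<open>Edge fields, Green's formula and interior moments\<close>

context bary
begin

text \<open>The numbers \<open>a v w\<close> determine \<open>A\<close>, and their rows and columns
  sum to zero because the gradients do. Hence in the product of \<open>x \<bullet> (w - v)\<close>
  and \<open>y \<bullet> (w - v)\<close> the two pure terms drop out after summation, and the two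
  mixed terms give minus twice the bilinear form; this explains the factor -1/2. The diagonal
  numbers no longer enter, since their direction \<open>v - v\<close> is zero.\<close>

lemma sym_expand:
  assumes A: "A \<in> sym_matrices"
  shows "A = (\<Sum>(v,w)\<in>C\<times>C. (- (g v \<bullet> (A *v g w)) / 2) *\<^sub>R outer (w - v) (w - v))"
proof (rule matrix_eqI)
  fix x y
  define a where "a v w = g v \<bullet> (A *v g w)" for v w
  have a_sym: "a v w = a w v" for v w unfolding a_def by (rule sym_inner[OF A])
  have a0: "(\<Sum>w\<in>C. a w v) = 0" for v
    unfolding a_def inner_sum_left[symmetric] sum_g by simp
  have a0': "(\<Sum>w\<in>C. a v w) = 0" for v using a0[of v] by (simp add: a_sym[of v])
  have rep: "(\<Sum>v\<in>C. (x \<bullet> v) *\<^sub>R g v) = x" for x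
  proof -
    have "(\<Sum>v\<in>C. (x \<bullet> v) *\<^sub>R g v) \<bullet> y = x \<bullet> y" for y
      using inner_expand[of x y] by (simp add: inner_sum_left mult.commute)
    then show ?thesis using vector_eq_rdot by blast
  qed
  have "x \<bullet> (A *v y) = (\<Sum>v\<in>C. (x \<bullet> v) *\<^sub>R g v) \<bullet> (A *v (\<Sum>w\<in>C. (y \<bullet> w) *\<^sub>R g w))" by (simp only: rep)
  also have "\<dots> = (\<Sum>v\<in>C. \<Sum>w\<in>C. a v w * ((x \<bullet> v) * (y \<bullet> w)))"
    by (simp add: a_def inner_sum_left inner_sum_right matrix_vector_mult_scaleR
        sum_distrib_left mult_ac linear_sum[OF matrix_vector_mul_linear] cong: sum.cong) (rule sum.swap)
  finally have xy: "x \<bullet> (A *v y) = (\<Sum>v\<in>C. \<Sum>w\<in>C. a v w * ((x \<bullet> v) * (y \<bullet> w)))" .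
  have xy': "x \<bullet> (A *v y) = (\<Sum>v\<in>C. \<Sum>w\<in>C. a v w * ((x \<bullet> w) * (y \<bullet> v)))"
    unfolding xy by (subst sum.swap) (simp add: a_sym)
  have z1: "(\<Sum>v\<in>C. \<Sum>w\<in>C. a v w * ((x \<bullet> v) * (y \<bullet> v))) = 0"
    by (simp add: sum_distrib_right[symmetric] a0')
  have z2: "(\<Sum>v\<in>C. \<Sum>w\<in>C. a v w * ((x \<bullet> w) * (y \<bullet> w))) = 0"
    by (subst sum.swap) (simp add: sum_distrib_right[symmetric] a0)
  have "x \<bullet> ((\<Sum>(v,w)\<in>C\<times>C. (- (g v \<bullet> (A *v g w)) / 2) *\<^sub>R outer (w - v) (w - v)) *v y)
      = (\<Sum>v\<in>C. \<Sum>w\<in>C. (- a v w / 2) * ((x \<bullet> (w - v)) * (y \<bullet> (w - v))))"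
    unfolding sum_matrix_mult inner_sum_right sum.cartesian_product split_def a_def
      scaleR_matrix_vector_assoc[symmetric] outer_mult inner_scaleR_right
    by (simp add: inner_commute[of "_ - _" y] mult_ac)
  also have "\<dots> = (\<Sum>v\<in>C. \<Sum>w\<in>C. (1/2) * (a v w * ((x \<bullet> v) * (y \<bullet> w))) + (1/2) * (a v w * ((x \<bullet> w) * (y \<bullet> v)))
      - (1/2) * (a v w * ((x \<bullet> v) * (y \<bullet> v))) - (1/2) * (a v w * ((x \<bullet> w) * (y \<bullet> w))))"
    by (intro sum.cong refl) (simp add: inner_diff_right field_simps)
  also have "\<dots> = (1/2) * (x \<bullet> (A *v y)) + (1/2) * (x \<bullet> (A *v y)) - (1/2) * 0 - (1/2) * 0"
    unfolding sum_subtractf sum.distrib sum_distrib_left[symmetric] xy[symmetric] xy'[symmetric] z1 z2 ..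
  finally show "x \<bullet> (A *v y) = x \<bullet> ((\<Sum>(v,w)\<in>C\<times>C. (- (g v \<bullet> (A *v g w)) / 2) *\<^sub>R outer (w - v) (w - v)) *v y)"
    by simp
qed

text \<open>The normal form of symmetric fields without normal component on the boundary. The sum
  runs over ordered pairs; the degenerate pairs \<open>(v, v)\<close> contribute nothing because
  their direction is zero.\<close>

definition edge_field :: "((real^'n) \<times> (real^'n) \<Rightarrow> real^'n \<Rightarrow> real) \<Rightarrow> real^'n \<Rightarrow> real^'n^'n" where
  "edge_field f x = (\<Sum>e\<in>C\<times>C. (lam (fst e) x * lam (snd e) x * f e x) *\<^sub>R outer (snd e - fst e) (snd e - fst e))"

lemma edge_coeff_rpoly: "e \<in> C \<times> C \<Longrightarrow> f \<in> rpoly k \<Longrightarrow> (\<lambda>x. lam (fst e) x * lam (snd e) x * f x) \<in> rpoly (k + 2)"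
  using rpoly_mult[OF rpoly_mult[OF lam_rpoly[of "fst e"] lam_rpoly[of "snd e"]], of f k] by (auto simp: mem_Times_iff)

lemma edge_field_polys:
  "(\<And>e. e \<in> C \<times> C \<Longrightarrow> f e \<in> rpoly k) \<Longrightarrow> edge_field f \<in> polys (k + 2) sym_matrices"
  by (rule div_rank_one_sum(1)[where I="C \<times> C" and t="\<lambda>e. snd e - fst e"
        and f="\<lambda>e x. lam (fst e) x * lam (snd e) x * f e x" and \<tau>="edge_field f"])
    (simp_all only: finite_cartesian_product finC edge_coeff_rpoly edge_field_def)

lemma continuous_polys_mat: "\<tau> \<in> polys k UNIV \<Longrightarrow> continuous_on S \<tau>" for \<tau> :: "real^'n \<Rightarrow> 'b::euclidean_space"
  by (rule continuous_on_polys[OF _ subspace_UNIV])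

text \<open>The two integrands add up to a sum of derivatives along edges \<open>t\<close> of the
  coefficient times \<open>t \<bullet> z\<close>. Each coefficient contains both coordinates of its
  edge, so every integral vanishes by \<open>integral_edge_derivative\<close> and no boundary term
  arises.\<close>

lemma edge_field_green:
  assumes f: "\<And>e. e \<in> C \<times> C \<Longrightarrow> f e \<in> rpoly k" and z: "z \<in> polys l UNIV"
  shows "inner_cell K (div_rows (edge_field f)) z = - inner_cell K (edge_field f) (sgrad z)"
proof -
  define F where "F e x = lam (fst e) x * lam (snd e) x * f e x" for e x
  define t where "t e = snd e - fst e" for e :: "(real^'n) \<times> (real^'n)"
  have Fp: "F e \<in> rpoly (k + 2)" if "e \<in> C \<times> C" for e
    unfolding F_def using edge_coeff_rpoly[OF that f[OF that]] .
  have ef: "edge_field f x = (\<Sum>e\<in>C\<times>C. F e x *\<^sub>R outer (t e) (t e))" for x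
    by (simp add: edge_field_def F_def t_def)
  have tz: "(\<lambda>x. t e \<bullet> z x) \<in> rpoly l" for e by (rule rpoly_inner_polys[OF z])
  let ?G = "\<lambda>e x. dd (t e) (\<lambda>x. F e x * (t e \<bullet> z x)) x"
  have Gp: "?G e \<in> rpoly (k + 2 + l)" if "e \<in> C \<times> C" for e
    by (intro dd_rpoly rpoly_mult Fp[OF that] tz)
  have pt: "div_rows (edge_field f) x \<bullet> z x + edge_field f x \<bullet> sgrad z x = (\<Sum>e\<in>C\<times>C. ?G e x)" for x
  proof -
    have "div_rows (edge_field f) x \<bullet> z x = (\<Sum>e\<in>C\<times>C. dd (t e) (F e) x * (t e \<bullet> z x))"
      using div_rank_one_sum(2)[of "C \<times> C" F, OF _ Fp ef] finC by (simp add: inner_sum_left)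
    moreover have "edge_field f x \<bullet> sgrad z x = (\<Sum>e\<in>C\<times>C. F e x * dd (t e) (\<lambda>y. t e \<bullet> z y) x)"
      unfolding ef inner_sum_left
      by (simp add: inner_sgrad[OF z, symmetric] inner_outer[symmetric] inner_commute)
    ultimately show ?thesis
      by (simp add: dd_mult[OF Fp tz] sum.distrib)
  qed
  have G0: "(LINT x:K|lborel. ?G e x) = 0" if e: "e \<in> C \<times> C" for e
  proof (cases "fst e = snd e")
    case True
    then show ?thesis by (simp add: t_def dd_def set_lebesgue_integral_def)
  next
    case False
    have "(\<lambda>x. f e x * (t e \<bullet> z x)) \<in> rpoly (k + l)" by (rule rpoly_mult[OF f[OF e] tz])
    from integral_edge_derivative[OF _ _ False this] e show ?thesis
      by (auto simp: F_def t_def mult.assoc)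
  qed
  have "(LINT x:K|lborel. (\<Sum>e\<in>C\<times>C. ?G e x)) = (\<Sum>e\<in>C\<times>C. LINT x:K|lborel. ?G e x)"
    unfolding set_lebesgue_integral_def scaleR_sum_right
    using charges_integrable[OF charges_K continuous_on_rpoly[OF Gp]]
    by (intro Bochner_Integration.integral_sum) (auto simp: set_integrable_def)
  then have sum0: "(LINT x:K|lborel. div_rows (edge_field f) x \<bullet> z x + edge_field f x \<bullet> sgrad z x) = 0"
    using G0 by (simp add: pt)
  have tp: "edge_field f \<in> polys (k + 2) UNIV"
    by (rule polys_UNIV[OF edge_field_polys[OF f]])
  have dp: "div_rows (edge_field f) \<in> polys (k + 1) UNIV" using div_polys[of _ "k + 1"] tp by simp
  have sp: "sgrad z \<in> polys l UNIV"
    using polys_UNIV[OF sgrad_polys[OF polys_mono[OF subspace_UNIV z le_SucI[OF order_refl]]]] .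
  have "set_integrable lborel K (\<lambda>x. div_rows (edge_field f) x \<bullet> z x)"
    by (intro charges_integrable[OF charges_K] continuous_on_inner continuous_polys_mat[OF dp] continuous_polys_mat[OF z])
  moreover have "set_integrable lborel K (\<lambda>x. edge_field f x \<bullet> sgrad z x)"
    by (intro charges_integrable[OF charges_K] continuous_on_inner continuous_polys_mat[OF tp] continuous_polys_mat[OF sp])
  ultimately have "(LINT x:K|lborel. div_rows (edge_field f) x \<bullet> z x + edge_field f x \<bullet> sgrad z x) =
      (LINT x:K|lborel. div_rows (edge_field f) x \<bullet> z x) + (LINT x:K|lborel. edge_field f x \<bullet> sgrad z x)"
    by (rule set_integral_add(2))
  with sum0 show ?thesis by (simp add: L2_inner_def)
qed

definition zero_trace :: "(real^'n \<Rightarrow> real^'n^'n) \<Rightarrow> bool" where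
  "zero_trace \<tau> \<longleftrightarrow> (\<forall>v\<in>C. \<forall>x\<in>aff (C - {v}). \<tau> x *v g v = 0)"

text \<open>By symmetry the entry vanishes on the facets opposite to both \<open>v\<close> and
  \<open>w\<close>, so both coordinates divide it.\<close>

lemma zero_trace_factor:
  assumes t: "\<tau> \<in> polys (k + 2) sym_matrices" and z: "zero_trace \<tau>" and vw: "v \<in> C" "w \<in> C" "v \<noteq> w"
  shows "\<exists>f\<in>rpoly k. \<forall>x. g v \<bullet> (\<tau> x *v g w) = lam v x * lam w x * f x"
proof -
  have "\<exists>q\<in>rpoly (k + 2 - card {v,w}). (k + 2 < card {v,w} \<longrightarrow> q = (\<lambda>_. 0)) \<and>
     (\<forall>x\<in>aff C. g v \<bullet> (\<tau> x *v g w) = (\<Prod>u\<in>{v,w}. lam u x) * q x)"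
  proof (rule face_bubble_factor[OF order_refl _ _ rpoly_nn[OF t]])
    show "2 \<le> card C" using cardC by (simp add: Suc_le_eq)
    fix u x assume u: "u \<in> {v, w}" "x \<in> aff (C - {u})"
    have "\<tau> x *v g u = 0" using z u vw by (auto simp: zero_trace_def)
    then show "g v \<bullet> (\<tau> x *v g w) = 0"
      using u(1) sym_inner[OF polys_in[OF subspace_sym t], of "g v" x "g w"] by auto
  qed (use vw in auto)
  then show ?thesis using vw(3) by simp
qed

text \<open>The diagonal coefficients are set to zero: the expansion of \<open>sym_expand\<close>
  does not see them, and they must not contribute to the sum of squares formed in
  \<open>zero_of_moments\<close>.\<close>

lemma zero_trace_coeffs:
  assumes t: "\<tau> \<in> polys (k + 2) sym_matrices" and z: "zero_trace \<tau>"
  obtains f where "\<And>e. e \<in> C \<times> C \<Longrightarrow> f e \<in> rpoly k"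
    "\<And>v w x. v \<in> C \<Longrightarrow> w \<in> C \<Longrightarrow> v \<noteq> w \<Longrightarrow> g v \<bullet> (\<tau> x *v g w) = lam v x * lam w x * f (v, w) x"
    "\<And>v x. f (v, v) x = 0"
proof -
  define P where "P e f \<longleftrightarrow> f \<in> rpoly k \<and>
      (fst e \<noteq> snd e \<longrightarrow> (\<forall>x. g (fst e) \<bullet> (\<tau> x *v g (snd e)) = lam (fst e) x * lam (snd e) x * f x)) \<and>
      (fst e = snd e \<longrightarrow> f = (\<lambda>_. 0))" for e f
  have "\<exists>f. P e f" if e: "e \<in> C \<times> C" for e
  proof (cases "fst e = snd e")
    case True
    then have "P e (\<lambda>_. 0)" using rpoly_const[of 0 k] by (simp add: P_def)
    then show ?thesis by blast
  next
    case False
    have "fst e \<in> C" "snd e \<in> C" using e by auto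
    from zero_trace_factor[OF t z this False]
    obtain f where "f \<in> rpoly k" "\<forall>x. g (fst e) \<bullet> (\<tau> x *v g (snd e)) = lam (fst e) x * lam (snd e) x * f x" by blast
    then have "P e f" using False by (simp add: P_def)
    then show ?thesis by blast
  qed
  then have "\<forall>e\<in>C \<times> C. \<exists>f. P e f" by blast
  then obtain F where F0: "\<forall>e\<in>C \<times> C. P e (F e)" using bchoice by blast
  have F: "F e \<in> rpoly k" "fst e \<noteq> snd e \<Longrightarrow> g (fst e) \<bullet> (\<tau> x *v g (snd e)) = lam (fst e) x * lam (snd e) x * F e x"
    "fst e = snd e \<Longrightarrow> F e = (\<lambda>_. 0)" if "e \<in> C \<times> C" for e x
  proof -
    have "P e (F e)" using F0 that by blast
    then show "F e \<in> rpoly k" "fst e \<noteq> snd e \<Longrightarrow> g (fst e) \<bullet> (\<tau> x *v g (snd e)) = lam (fst e) x * lam (snd e) x * F e x"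
      "fst e = snd e \<Longrightarrow> F e = (\<lambda>_. 0)" unfolding P_def by blast+
  qed
  show ?thesis
  proof (rule that[of "\<lambda>e. if e \<in> C \<times> C then F e else (\<lambda>_. 0)"])
    show "(if e \<in> C \<times> C then F e else (\<lambda>_. 0)) \<in> rpoly k" if "e \<in> C \<times> C" for e using F(1)[OF that] that by simp
    show "g v \<bullet> (\<tau> x *v g w) = lam v x * lam w x * (if (v, w) \<in> C \<times> C then F (v, w) else (\<lambda>_. 0)) x"
      if "v \<in> C" "w \<in> C" "v \<noteq> w" for v w x using F(2)[of "(v, w)" x] that by simp
    show "(if (v, v) \<in> C \<times> C then F (v, v) else (\<lambda>_. 0)) x = 0" for v x using F(3)[of "(v, v)"] by simp
  qed
qed

text \<open>\<open>sym_expand\<close> together with the factorization of the off-diagonal entries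
  turns \<open>\<tau>\<close> into an edge field.\<close>

lemma green:
  assumes t: "\<tau> \<in> polys (k + 2) sym_matrices" and zt: "zero_trace \<tau>" and z: "z \<in> polys l UNIV"
  shows "inner_cell K (div_rows \<tau>) z = - inner_cell K \<tau> (sgrad z)"
proof -
  obtain f where f: "\<And>e. e \<in> C \<times> C \<Longrightarrow> f e \<in> rpoly k"
    "\<And>v w x. v \<in> C \<Longrightarrow> w \<in> C \<Longrightarrow> v \<noteq> w \<Longrightarrow> g v \<bullet> (\<tau> x *v g w) = lam v x * lam w x * f (v, w) x"
    "\<And>v x. f (v, v) x = 0"
    using zero_trace_coeffs[OF t zt] by blast
  have "\<tau> x = edge_field (\<lambda>e x. (- 1 / 2) * f e x) x" for x
  proof -
    have "\<tau> x = (\<Sum>e\<in>C\<times>C. (- (g (fst e) \<bullet> (\<tau> x *v g (snd e))) / 2) *\<^sub>R outer (snd e - fst e) (snd e - fst e))"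
      using sym_expand[OF polys_in[OF subspace_sym t]] by (simp add: split_def)
    also have "\<dots> = edge_field (\<lambda>e x. (- 1 / 2) * f e x) x"
      unfolding edge_field_def
    proof (rule sum.cong[OF refl])
      fix e assume e: "e \<in> C \<times> C"
      show "(- (g (fst e) \<bullet> (\<tau> x *v g (snd e))) / 2) *\<^sub>R outer (snd e - fst e) (snd e - fst e) =
          (lam (fst e) x * lam (snd e) x * ((- 1 / 2) * f e x)) *\<^sub>R outer (snd e - fst e) (snd e - fst e)"
        using f(2)[of "fst e" "snd e" x] e by (cases "fst e = snd e") auto
    qed
    finally show ?thesis .
  qed
  then have "\<tau> = edge_field (\<lambda>e x. (- 1 / 2) * f e x)" by auto
  then show ?thesis using edge_field_green[of "\<lambda>e x. (- 1 / 2) * f e x" k, OF rpoly_scale[OF f(1)] z] by simp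
qed

lemma polys_zero_on_K:
  fixes p :: "real^'n \<Rightarrow> 'b::euclidean_space"
  assumes "p \<in> polys k UNIV" "\<And>x. x \<in> K \<Longrightarrow> p x = 0"
  shows "p x = 0"
proof -
  have "p x \<bullet> b = 0" if "b \<in> Basis" for b
    by (rule vanish_on_conv_aff[OF polys_inner[OF assms(1)] order_refl C_ne]) (simp_all add: assms(2))
  then show ?thesis using euclidean_all_zero_iff by blast
qed

text \<open>Take \<open>z = div \<tau>\<close> in Green's formula: rigid motions have zero symmetric
  gradient, so \<open>div \<tau>\<close> is orthogonal to itself.\<close>

lemma div_zero_of_RM:
  assumes t: "\<tau> \<in> polys (k + 2) sym_matrices" and zt: "zero_trace \<tau>" and r: "div_rows \<tau> \<in> RM"
  shows "div_rows \<tau> x = 0"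
proof -
  have dp: "div_rows \<tau> \<in> polys 1 UNIV" by (rule RM_polys[OF r])
  have "inner_cell K (div_rows \<tau>) (div_rows \<tau>) = - inner_cell K \<tau> (sgrad (div_rows \<tau>))"
    by (rule green[OF t zt dp])
  also have "\<dots> = 0" using L2_inner_zero[of K \<tau> "sgrad (div_rows \<tau>)" lborel] sgrad_RM[OF r] by simp
  finally have "div_rows \<tau> y = 0" if "y \<in> K" for y
    using L2_inner_pos[OF charges_K continuous_polys_mat[OF dp] _ that] by simp
  then show ?thesis by (rule polys_zero_on_K[OF dp])
qed

text \<open>Testing with the symmetrized products of \<open>g v\<close> and \<open>g w\<close>,
  weighted by the coefficients \<open>f\<close>, integrates the nonnegative function with terms
  \<open>lam v * lam w * f\<^sup>2\<close>. So all off-diagonal entries vanish, and by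
  \<open>sym_expand\<close> these are enough.\<close>

lemma zero_of_moments:
  assumes t: "\<tau> \<in> polys (k + 2) sym_matrices" and zt: "zero_trace \<tau>"
    and m: "\<And>Q. Q \<in> polys k sym_matrices \<Longrightarrow> inner_cell K \<tau> Q = 0"
  shows "\<tau> x = 0"
proof -
  obtain f where f: "\<And>e. e \<in> C \<times> C \<Longrightarrow> f e \<in> rpoly k"
    "\<And>v w x. v \<in> C \<Longrightarrow> w \<in> C \<Longrightarrow> v \<noteq> w \<Longrightarrow> g v \<bullet> (\<tau> x *v g w) = lam v x * lam w x * f (v, w) x"
    "\<And>v x. f (v, v) x = 0"
    using zero_trace_coeffs[OF t zt] by blast
  define S where "S e = (1/2) *\<^sub>R (outer (g (fst e)) (g (snd e)) + outer (g (snd e)) (g (fst e)))" for e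
  define Q where "Q x = (\<Sum>e\<in>C\<times>C. f e x *\<^sub>R S e)" for x
  have "Q \<in> polys k sym_matrices"
  proof -
    have "(\<lambda>x. f e x *\<^sub>R S e) \<in> polys k sym_matrices" if "e \<in> C \<times> C" for e
    proof (rule polys_sub_image[where p="f e" and L="\<lambda>r. r *\<^sub>R S e" and X=UNIV])
      show "f e \<in> rpoly k" by (rule f(1)[OF that])
      show "linear (\<lambda>r. r *\<^sub>R S e)" by (intro linearI) (auto simp: algebra_simps)
      show "range (\<lambda>r. r *\<^sub>R S e) \<subseteq> sym_matrices"
        by (auto simp: S_def sym_iff outer_def algebra_simps)
    qed
    then show ?thesis unfolding Q_def by (intro polys_sum subspace_sym)
  qed
  then have "inner_cell K \<tau> Q = 0" by (rule m)
  moreover have pt: "\<tau> x \<bullet> Q x = (\<Sum>e\<in>C\<times>C. lam (fst e) x * lam (snd e) x * (f e x)\<^sup>2)" for x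
  proof -
    have "\<tau> x \<bullet> S e = g (fst e) \<bullet> (\<tau> x *v g (snd e))" for e
      using sym_inner[OF polys_in[OF subspace_sym t], of "g (fst e)" x "g (snd e)"]
      by (simp add: S_def inner_add_right inner_outer)
    then have "\<tau> x \<bullet> Q x = (\<Sum>e\<in>C\<times>C. f e x * (g (fst e) \<bullet> (\<tau> x *v g (snd e))))"
      by (simp add: Q_def inner_sum_right)
    also have "\<dots> = (\<Sum>e\<in>C\<times>C. lam (fst e) x * lam (snd e) x * (f e x)\<^sup>2)"
    proof (rule sum.cong[OF refl])
      fix e assume "e \<in> C \<times> C"
      then show "f e x * (g (fst e) \<bullet> (\<tau> x *v g (snd e))) = lam (fst e) x * lam (snd e) x * (f e x)\<^sup>2"
        using f(2)[of "fst e" "snd e" x] f(3)[of "fst e" x]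
        by (cases e; cases "fst e = snd e") (auto simp: power2_eq_square)
    qed
    finally show ?thesis .
  qed
  let ?s = "\<lambda>x. \<Sum>e\<in>C\<times>C. lam (fst e) x * lam (snd e) x * (f e x)\<^sup>2"
  have "(LINT x:K|lborel. ?s x) = 0" using calculation by (simp add: L2_inner_def pt)
  moreover have "continuous_on UNIV ?s"
    using continuous_on_rpoly[OF f(1)] by (intro continuous_intros continuous_lam) auto
  moreover have nn: "0 \<le> lam (fst e) y * lam (snd e) y * (f e y)\<^sup>2" if "y \<in> K" "e \<in> C \<times> C" for y e
    using that by (auto simp: K_iff)
  ultimately have s0: "?s y = 0" if "y \<in> K" for y
    using that by (intro charges_integral_zero[OF charges_K, of ?s]) (auto intro!: sum_nonneg)
  have "g v \<bullet> (\<tau> y *v g w) = 0" if y: "y \<in> K" and vw: "v \<in> C" "w \<in> C" "v \<noteq> w" for y v w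
  proof -
    have "lam v y * lam w y * (f (v, w) y)\<^sup>2 = 0"
      using s0[OF y] sum_nonneg_eq_0_iff[of "C \<times> C" "\<lambda>e. lam (fst e) y * lam (snd e) y * (f e y)\<^sup>2"] nn[OF y] vw finC
      by (auto dest!: bspec[of _ _ "(v, w)"])
    then show ?thesis using f(2)[OF vw, of y] by auto
  qed
  then have off: "g v \<bullet> (\<tau> x *v g w) = 0" if "v \<in> C" "w \<in> C" "v \<noteq> w" for v w
    using vanish_on_conv_aff[OF rpoly_nn[OF t], of C "g v" "g w" x] that C_ne by simp
  have "\<tau> x = (\<Sum>(v,w)\<in>C\<times>C. (- (g v \<bullet> (\<tau> x *v g w)) / 2) *\<^sub>R outer (w - v) (w - v))"
    by (rule sym_expand[OF polys_in[OF subspace_sym t]])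
  also have "\<dots> = 0"
  proof (rule sum.neutral, clarify)
    fix v w assume "v \<in> C" "w \<in> C"
    then show "(- (g v \<bullet> (\<tau> x *v g w)) / 2) *\<^sub>R outer (w - v) (w - v) = 0"
      using off[of v w] by (cases "v = w") auto
  qed
  finally show ?thesis .
qed

text \<open>An arbitrary \<open>Q\<close> is split as \<open>R + def q\<close> with
  \<open>R x\<close> annihilating \<open>x\<close>. The moment against \<open>R\<close> is zero by
  hypothesis, the one against \<open>def q\<close> by Green's formula because
  \<open>div \<tau> = 0\<close>.\<close>

lemma zero_of_kernel_moments:
  assumes t: "\<tau> \<in> polys (k + 2) sym_matrices" and zt: "zero_trace \<tau>" and r: "div_rows \<tau> \<in> RM"
    and m: "\<And>Q. Q \<in> polys k sym_matrices \<Longrightarrow> (\<And>x. Q x *v x = 0) \<Longrightarrow> inner_cell K \<tau> Q = 0"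
  shows "\<tau> x = 0"
proof (rule zero_of_moments[OF t zt])
  fix Q :: "real^'n \<Rightarrow> real^'n^'n" assume Q: "Q \<in> polys k sym_matrices"
  obtain q where q: "q \<in> polys (Suc k) UNIV" "\<And>x. sgrad q x *v x = Q x *v x"
    using sgrad_solve[OF Q] by blast
  have sp: "sgrad q \<in> polys k sym_matrices" by (rule sgrad_polys[OF q(1)])
  define R where "R x = Q x + (- 1) *\<^sub>R sgrad q x" for x
  have Rp: "R \<in> polys k sym_matrices"
    unfolding R_def by (intro polys_add polys_scaleR subspace_sym Q sp)
  have "R x *v x = 0" for x
    using q(2)[of x] by (simp add: R_def matrix_vector_mult_diff_rdistrib)
  then have "inner_cell K \<tau> R = 0" by (rule m[OF Rp])
  moreover have "inner_cell K \<tau> (sgrad q) = 0"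
    using green[OF t zt q(1)] div_zero_of_RM[OF t zt r] L2_inner_zero[of K "div_rows \<tau>" q lborel] by simp
  moreover have "inner_cell K \<tau> Q = inner_cell K \<tau> R + inner_cell K \<tau> (sgrad q)"
  proof -
    have "inner_cell K (\<lambda>x. R x + sgrad q x) \<tau> = inner_cell K R \<tau> + inner_cell K (sgrad q) \<tau>"
      by (intro L2_inner_add charges_K continuous_on_polys[OF _ subspace_sym]) (rule Rp sp t)+
    moreover have "(\<lambda>x. R x + sgrad q x) = Q" by (auto simp: R_def)
    ultimately show ?thesis by (simp add: L2_inner_commute[of _ _ \<tau>])
  qed
  ultimately show "inner_cell K \<tau> Q = 0" by simp
qed

end

subsection \<open>Injectivity\<close>

lemma sum_fun_eq: "(\<Sum>i\<in>I. f i) = (\<lambda>x. \<Sum>i\<in>I. f i x :: 'b::real_vector)"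
  by (induction I rule: infinite_finite_induct) (auto simp: fun_eq_iff plus_fun_def zero_fun_def)

lemma scaleR_fun_eq: "c *\<^sub>R f = (\<lambda>x. c *\<^sub>R f x)"
  by (simp add: scaleR_fun_def)

lemma add_fun_eq: "f + h = (\<lambda>x. f x + h x)"
  by (simp add: plus_fun_def)

lemma polys_finitely_spanned:
  "\<exists>T. finite T \<and> polys k (UNIV :: 'b::euclidean_space set) \<subseteq> span (T :: (real^'n \<Rightarrow> 'b) set)"
proof (intro exI conjI subsetI)
  let ?m = "\<lambda>(\<alpha>, b) x. monomial \<alpha> x *\<^sub>R (b :: 'b)"
  let ?T = "?m ` ({\<alpha>::'n \<Rightarrow> nat. sum \<alpha> UNIV \<le> k} \<times> Basis)"
  show "finite ?T" by (intro finite_imageI finite_cartesian_product finite_multi_indices finite_Basis)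
  fix p :: "real^'n \<Rightarrow> 'b" assume "p \<in> polys k UNIV"
  then obtain c where "\<And>\<alpha>. c \<alpha> \<in> UNIV" and c: "\<And>x. p x = (\<Sum>\<alpha> | sum \<alpha> UNIV \<le> k. monomial \<alpha> x *\<^sub>R c \<alpha>)" by (rule polysE) blast
  have "p = (\<Sum>\<alpha> | sum \<alpha> UNIV \<le> k. \<Sum>b\<in>Basis. (c \<alpha> \<bullet> b) *\<^sub>R ?m (\<alpha>, b))"
  proof
    fix x
    have "monomial \<alpha> x *\<^sub>R c \<alpha> = (\<Sum>b\<in>Basis. (c \<alpha> \<bullet> b) *\<^sub>R (monomial \<alpha> x *\<^sub>R b))" for \<alpha>
    proof -
      have "monomial \<alpha> x *\<^sub>R c \<alpha> = monomial \<alpha> x *\<^sub>R (\<Sum>b\<in>Basis. (c \<alpha> \<bullet> b) *\<^sub>R b)" by (simp only: euclidean_representation)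
      then show ?thesis by (simp add: scaleR_sum_right mult.commute)
    qed
    then show "p x = (\<Sum>\<alpha> | sum \<alpha> UNIV \<le> k. \<Sum>b\<in>Basis. (c \<alpha> \<bullet> b) *\<^sub>R ?m (\<alpha>, b)) x"
      by (simp add: c sum_fun_eq scaleR_fun_eq)
  qed
  also have "\<dots> \<in> span ?T" by (intro span_sum span_scale span_base imageI) auto
  finally show "p \<in> span ?T" .
qed

lemma subspace_RM: "subspace RM"
  unfolding subspace_def
proof safe
  show "(0 :: real^'n \<Rightarrow> real^'n) \<in> RM"
    unfolding RM_iff by (intro exI[of _ 0]) (auto simp: skew_iff fun_eq_iff)
  fix p q :: "real^'n \<Rightarrow> real^'n" and c :: real
  assume "p \<in> RM"
  then obtain a A where p: "A \<in> skew_matrices" "p = (\<lambda>x. a + A *v x)" by (auto simp: RM_iff)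
  show "c *\<^sub>R p \<in> RM"
    unfolding RM_iff using p subspace_scale[OF subspace_skew]
    by (intro exI[of _ "c *\<^sub>R a"] exI[of _ "c *\<^sub>R A"]) (auto simp: scaleR_fun_eq scaleR_add_right scaleR_matrix_vector_assoc)
  assume "q \<in> RM"
  then obtain b B where q: "B \<in> skew_matrices" "q = (\<lambda>x. b + B *v x)" by (auto simp: RM_iff)
  show "p + q \<in> RM"
    unfolding RM_iff using p q subspace_add[OF subspace_skew]
    by (intro exI[of _ "a + b"] exI[of _ "A + B"]) (auto simp: add_fun_eq matrix_vector_mult_add_rdistrib)
qed

lemma linear_zero_on_span:
  assumes "linear_on_sub (span B) m" "\<And>b. b \<in> B \<Longrightarrow> m b = 0" "u \<in> span B"
  shows "m u = 0"
proof -
  have "0 \<in> span B" by (rule span_zero)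
  then have "m (0 *\<^sub>R 0) = 0 * m 0" using assms(1) unfolding linear_on_sub_def by blast
  then have m0: "m 0 = 0" by simp
  have "u \<in> span B \<and> m u = 0" using assms(3)
  proof (induction rule: span_induct_alt)
    case base
    then show ?case using m0 span_zero by simp
  next
    case (step c x y)
    have s: "x \<in> span B" "y \<in> span B" using step span_base by auto
    then have s': "c *\<^sub>R x \<in> span B" by (intro span_scale)
    have "m (c *\<^sub>R x + y) = m (c *\<^sub>R x) + m y" "m (c *\<^sub>R x) = c * m x"
      using assms(1) s s' unfolding linear_on_sub_def by blast+
    then show ?case using step assms(2) span_add[OF s' s(2)] by simp
  qed
  then show ?thesis by simp
qed

lemma on_set_add: "on_set D p + on_set D q = on_set D (\<lambda>x. p x + q x :: 'b::real_vector)"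
  by (auto simp: on_set_def add_fun_eq)

lemma on_set_scale: "c *\<^sub>R on_set D p = on_set D (\<lambda>x. c *\<^sub>R p x :: 'b::real_vector)"
  by (auto simp: on_set_def scaleR_fun_eq)

lemma L2_inner_on_set: "L2_inner M D p (on_set D q) = L2_inner M D p q"
  by (rule L2_inner_cong) (auto simp: on_set_def)

lemma linear_L2_inner_on_set:
  fixes p :: "'a::euclidean_space \<Rightarrow> 'b::euclidean_space"
  assumes M: "charges M D" and p: "continuous_on UNIV p"
    and W: "\<And>q. q \<in> W \<Longrightarrow> \<exists>q'. continuous_on UNIV q' \<and> q = on_set D q'"
  shows "linear_on_sub W (L2_inner M D p)"
  unfolding linear_on_sub_def
proof safe
  fix u v and r :: real assume "u \<in> W"
  then obtain u' where u: "continuous_on UNIV u'" "u = on_set D u'" using W by blast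
  show "L2_inner M D p (r *\<^sub>R u) = r * L2_inner M D p u"
    unfolding u(2) on_set_scale L2_inner_on_set by (subst (1 2) L2_inner_commute) (rule L2_inner_scale)
  assume "v \<in> W"
  then obtain v' where v: "continuous_on UNIV v'" "v = on_set D v'" using W by blast
  show "L2_inner M D p (u + v) = L2_inner M D p u + L2_inner M D p v"
    unfolding u(2) v(2) on_set_add L2_inner_on_set
    using L2_inner_add[OF M u(1) v(1) p] by (simp add: L2_inner_commute)
qed

context framed_simplex
begin

lemma L2_K_add:
  fixes p :: "real^'n \<Rightarrow> 'b::euclidean_space"
  assumes "p \<in> polys k UNIV" "q \<in> polys l UNIV" "r \<in> polys m UNIV"
  shows "inner_cell K (\<lambda>x. p x + q x) r = inner_cell K p r + inner_cell K q r"
  by (intro L2_inner_add charges_K continuous_polys_mat assms) (rule assms)+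

lemma bubble_polys: "b \<in> nn_bubbles K \<nu> \<Longrightarrow> b \<in> polys (CARD('n) + 1) sym_matrices"
  by (simp add: nn_bubbles_def)

text \<open>The moment conditions make \<open>div b\<close> orthogonal to the complement of
  \<open>RM\<close>. Subtracting its orthogonal projection \<open>P\<close> onto \<open>RM\<close>
  gives a member \<open>r\<close> of that complement, which is then orthogonal to itself.\<close>

lemma bubble_div_RM:
  assumes b: "b \<in> nn_bubbles K \<nu>"
  shows "div_rows b \<in> RM"
proof -
  let ?I = "\<lambda>p q :: real^'n \<Rightarrow> real^'n. inner_cell K p q"
  have dp: "div_rows b \<in> polys (CARD('n)) UNIV"
    using div_polys[of b "CARD('n)"] polys_UNIV[OF bubble_polys[OF b]] by simp
  obtain T :: "(real^'n \<Rightarrow> real^'n) set" where T: "finite T" "polys 1 UNIV \<subseteq> span T"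
    using polys_finitely_spanned by blast
  have "\<exists>P\<in>RM. \<forall>Q\<in>RM. ?I P Q = ?I Q (div_rows b)"
  proof (rule riesz_finite[OF subspace_RM, of ?I "\<lambda>Q. ?I Q (div_rows b)" T])
    show "?I (u + v) w = ?I u w + ?I v w" if "u \<in> RM" "v \<in> RM" "w \<in> RM" for u v w
      unfolding add_fun_eq by (rule L2_K_add[OF RM_polys RM_polys RM_polys]) (rule that)+
    show "?I (r *\<^sub>R u) w = r * ?I u w" for r u w unfolding scaleR_fun_eq by (rule L2_inner_scale)
    show "?I u w = ?I w u" for u w by (rule L2_inner_commute)
    show "u = 0" if u: "u \<in> RM" "?I u u = 0" for u
    proof
      fix x
      have "u y = 0" if "y \<in> K" for y
        using L2_inner_pos[OF charges_K continuous_polys_mat[OF RM_polys[OF u(1)]] u(2) that] .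
      then show "u x = 0 x" using polys_zero_on_K[OF RM_polys[OF u(1)], of x] by simp
    qed
    show "?I (u + v) (div_rows b) = ?I u (div_rows b) + ?I v (div_rows b)" if "u \<in> RM" "v \<in> RM" for u v
      unfolding add_fun_eq by (rule L2_K_add[OF RM_polys RM_polys dp]) (rule that)+
    show "?I (r *\<^sub>R u) (div_rows b) = r * ?I u (div_rows b)" for r u
      unfolding scaleR_fun_eq by (rule L2_inner_scale)
    show "RM \<subseteq> span T" using T(2) RM_polys by blast
  qed (rule T(1))
  then obtain P where P: "P \<in> RM" "\<And>Q. Q \<in> RM \<Longrightarrow> ?I P Q = ?I Q (div_rows b)" by blast
  define r where "r x = div_rows b x + (- 1) *\<^sub>R P x" for x
  have Pp: "P \<in> polys 1 UNIV" by (rule RM_polys[OF P(1)])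
  have mPp: "(\<lambda>x. (- 1) *\<^sub>R P x) \<in> polys 1 UNIV" by (rule polys_scaleR[OF subspace_UNIV Pp])
  have rp: "r \<in> polys (CARD('n)) UNIV"
    unfolding r_def using d3 by (intro polys_add[OF subspace_UNIV dp] polys_mono[OF subspace_UNIV mPp]) simp
  have exp: "?I r Q = ?I (div_rows b) Q - ?I P Q" if "Q \<in> polys k UNIV" for Q k
    unfolding r_def using L2_K_add[OF dp mPp that] L2_inner_scale[of lborel K "- 1" P Q] by simp
  have rRM: "?I r Q = 0" if "Q \<in> RM" for Q
    using exp[OF RM_polys[OF that]] P(2)[OF that] by (simp add: L2_inner_commute)
  then have "r \<in> polys_mod_RM K (CARD('n))" using rp by (simp add: polys_mod_RM_def)
  then have "?I (div_rows b) r = 0" using b by (simp add: nn_bubbles_def)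
  moreover have "?I P r = 0" using rRM[OF P(1)] by (simp add: L2_inner_commute)
  ultimately have "?I r r = 0" using exp[OF rp] by simp
  then have "r y = 0" if "y \<in> K" for y
    using L2_inner_pos[OF charges_K continuous_polys_mat[OF rp] _ that] by simp
  then have "r x = 0" for x by (rule polys_zero_on_K[OF rp])
  then have "div_rows b = P" by (auto simp: r_def fun_eq_iff)
  then show ?thesis using P(1) by simp
qed

lemma facet_in: "v \<in> C \<Longrightarrow> facet v \<in> subsimplices (CARD('n) - 1) K"
  unfolding facets_eq by blast

lemma card_ridge: "v \<in> C \<Longrightarrow> w \<in> C - {v} \<Longrightarrow> card (C - {v} - {w}) = CARD('n) - 1"
  using card_facet[of v] finC by simp

lemma ridge_nonempty:
  assumes "v \<in> C" "w \<in> C - {v}" shows "C - {v} - {w} \<noteq> {}"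
proof
  assume "C - {v} - {w} = {}"
  then have "card (C - {v} - {w}) = 0" by (simp only: card.empty)
  then show False using card_ridge[OF assms] d3 by simp
qed

text \<open>The facet normal-normal traces are the ones that the definition of bubbles leaves free,
  hence they appear as the hypothesis; the tangential traces then follow from the moments of the
  bubble against \<open>ND\<close>.\<close>

lemma bubble_zero_trace:
  assumes b: "b \<in> nn_bubbles K \<nu>"
    and nn: "\<And>v x. v \<in> C \<Longrightarrow> x \<in> aff (C - {v}) \<Longrightarrow> g v \<bullet> (b x *v g v) = 0"
  shows "zero_trace b"
  unfolding zero_trace_def
proof (intro ballI)
  fix v x assume v: "v \<in> C" and x: "x \<in> aff (C - {v})"
  show "b x *v g v = 0"
  proof (rule facet_trace_zero[of b "CARD('n) - 1", OF _ v _ nn[OF v] _ x])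
    have "CARD('n) - 1 + 2 = CARD('n) + 1" using d3 by simp
    then show "b \<in> polys (CARD('n) - 1 + 2) sym_matrices" using bubble_polys[OF b] by simp
    fix w y assume w: "w \<in> C - {v}" and y: "y \<in> aff (C - {v} - {w})"
    show "g w \<bullet> (b y *v g v) = 0"
      by (rule bubble_nn[OF b _ ridge_nonempty[OF v w] _ _ _ y])
        (use v w card_ridge[OF v w] in \<open>auto intro: g_Nrm\<close>)
  next
    fix q assume "q \<in> ND (CARD('n) - 1) (\<nu> (facet v) 1) (facet v)"
    then show "inner_face (facet v) (\<lambda>x. tangential_part (\<nu> (facet v) 1) (b x *v \<nu> (facet v) 1)) q = 0"
      using b facet_in[OF v] unfolding nn_bubbles_def by blast
  qed
qed

lemma bubble_zero:
  assumes b: "b \<in> nn_bubbles K \<nu>" and z: "zero_trace b"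
  shows "b x = 0"
proof (rule zero_of_kernel_moments[of b "CARD('n) - 1", OF _ z bubble_div_RM[OF b]])
  have "CARD('n) - 1 + 2 = CARD('n) + 1" using d3 by simp
  then show "b \<in> polys (CARD('n) - 1 + 2) sym_matrices" using bubble_polys[OF b] by simp
  show "inner_cell K b Q = 0" if "Q \<in> polys (CARD('n) - 1) sym_matrices" "\<And>x. Q x *v x = 0" for Q
    using b that unfolding nn_bubbles_def by blast
qed

lemma bubble_edges:
  assumes b: "b \<in> nn_bubbles K \<nu>" and c: "c \<subseteq> C" "card c = 2" "n \<in> Nrm c" "m \<in> Nrm c" "x \<in> aff c"
  shows "n \<bullet> (b x *v m) = 0"
proof (rule bubble_nn[OF b c(1) _ _ c(3-5)])
  show "c \<noteq> {}" using c(2) by auto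
  show "card c \<le> CARD('n) - 1" using c(2) d3 by simp
qed

text \<open>A bubble has no normal-normal trace on edges, so a quadratic one has none on facets
  either. This is directness of the sum; it separates the families in the dimension count.\<close>

lemma quadratic_bubble_zero:
  assumes b: "b \<in> nn_bubbles K \<nu>" and p: "b \<in> polys 2 sym_matrices"
  shows "b x = 0"
proof (rule bubble_zero[OF b bubble_zero_trace[OF b]])
  fix v x assume v: "v \<in> C" and x: "x \<in> aff (C - {v})"
  show "g v \<bullet> (b x *v g v) = 0"
    by (rule quadratic_nn[OF p bubble_edges[OF b] _ _ _ _ x])
      (use v card_facet[OF v] d3 in \<open>auto intro: g_Nrm\<close>)
qed

definition edge_linear :: "(real^'n \<Rightarrow> real^'n^'n) \<Rightarrow> bool" where
  "edge_linear \<tau> \<longleftrightarrow> (\<forall>e\<in>subsimplices 1 K. \<forall>i j. 1 \<le> i \<and> i \<le> j \<and> j \<le> CARD('n) - 1 \<longrightarrow>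
        on_set e (\<lambda>x. \<nu> e i \<bullet> (\<tau> x *v \<nu> e j)) \<in> polys_on e 1 UNIV)"

text \<open>On an edge the trace of \<open>\<tau>\<close> is linear and zero at both ends, hence
  zero. The bubble has no trace there, so the quadratic part inherits this.\<close>

lemma edge_linear_zero:
  assumes el: "edge_linear \<tau>" and s: "\<sigma> \<in> polys 2 sym_matrices" and b: "\<beta> \<in> nn_bubbles K \<nu>"
    and t: "\<And>x. \<tau> x = \<sigma> x + \<beta> x" and z: "\<And>v. v \<in> C \<Longrightarrow> \<tau> v = 0"
    and c: "c \<subseteq> C" "card c = 2" "n \<in> Nrm c" "m \<in> Nrm c" "x \<in> aff c"
  shows "n \<bullet> (\<sigma> x *v m) = 0"
proof (rule frame_zero[OF c(1) _ polys_in[OF subspace_sym s] _ c(3,4)])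
  show c1: "card c = 1 + 1" using c(2) by simp
  have ne: "c \<noteq> {}" using c(2) by auto
  fix i j assume ij: "1 \<le> i" "i \<le> j" "j \<le> CARD('n) - 1"
  let ?e = "convex hull c"
  let ?n = "\<nu> ?e i" and ?m = "\<nu> ?e j"
  have nm: "?n \<in> Nrm c" "?m \<in> Nrm c" using frame_Nrm[OF c(1) c1] ij by auto
  have "?e \<in> subsimplices 1 K" using c(1) c1 by (auto simp: subsimplices_eq)
  then have "on_set ?e (\<lambda>x. ?n \<bullet> (\<tau> x *v ?m)) \<in> polys_on ?e 1 UNIV"
    using el ij unfolding edge_linear_def by blast
  then obtain p where p: "p \<in> rpoly 1" "on_set ?e (\<lambda>x. ?n \<bullet> (\<tau> x *v ?m)) = on_set ?e p"
    by (auto simp: polys_on_def)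
  have pe: "p y = ?n \<bullet> (\<tau> y *v ?m)" if "y \<in> ?e" for y
    using fun_cong[OF p(2), of y] that by (simp add: on_set_def)
  have pz: "p y = 0" if "y \<in> aff c" for y
  proof (rule vanish_by_moments[OF c(1) _ p(1) _ _ that])
    fix u y assume u: "u \<in> c" "y \<in> aff (c - {u})"
    have "card (c - {u}) = 1" using c(2) u fin_sub[OF c(1)] by simp
    then obtain w where w: "c - {u} = {w}" using card_1_singletonE by blast
    then have wC: "w \<in> C" "w \<in> c" "{w} \<subseteq> C" using c(1) by auto
    have "y = w" using aff_repr[OF wC(3), of y] aff_sum[OF wC(3), of y] u(2) w by simp
    moreover have "w \<in> ?e" using wC(2) by (rule hull_inc)
    ultimately show "p y = 0" using pe z[OF wC(1)] by simp
  qed (use c(2) in auto)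
  have "?n \<bullet> (\<sigma> y *v ?m) = 0" if "y \<in> ?e" for y
  proof -
    have ya: "y \<in> aff c" using that by (simp add: conv_eq[OF c(1)])
    have "?n \<bullet> (\<tau> y *v ?m) = 0" using pe[OF that] pz[OF ya] by simp
    moreover have "?n \<bullet> (\<beta> y *v ?m) = 0" by (rule bubble_edges[OF b c(1,2) nm ya])
    ultimately show ?thesis by (simp add: t matrix_vector_mult_add_rdistrib inner_add_right)
  qed
  then show "?n \<bullet> (\<sigma> x *v ?m) = 0"
    by (rule vanish_on_conv_aff[OF rpoly_nn[OF s] c(1) ne _ c(5)])
qed

lemma sigma_injective:
  assumes el: "edge_linear \<tau>" and s: "\<sigma> \<in> polys 2 sym_matrices" and b: "\<beta> \<in> nn_bubbles K \<nu>"
    and t: "\<And>x. \<tau> x = \<sigma> x + \<beta> x" and r: "div_rows \<tau> \<in> RM"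
    and a: "\<And>v. v \<in> C \<Longrightarrow> \<tau> v = 0"
    and nn: "\<And>v q. v \<in> C \<Longrightarrow> q \<in> polys_on (facet v) 1 UNIV \<Longrightarrow>
      inner_face (facet v) (\<lambda>x. \<nu> (facet v) 1 \<bullet> (\<tau> x *v \<nu> (facet v) 1)) q = 0"
    and tn: "\<And>v q. v \<in> C \<Longrightarrow> q \<in> ND 0 (\<nu> (facet v) 1) (facet v) \<Longrightarrow>
      inner_face (facet v) (\<lambda>x. tangential_part (\<nu> (facet v) 1) (\<tau> x *v \<nu> (facet v) 1)) q = 0"
  shows "\<tau> x = 0"
proof -
  have s_nn: "n \<bullet> (\<sigma> x *v m) = 0" if "c \<subseteq> C" "2 \<le> card c" "n \<in> Nrm c" "m \<in> Nrm c" "x \<in> aff c" for c n m x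
    by (rule quadratic_nn[OF s edge_linear_zero[OF el s b t a]]) (use that in auto)
  have bp: "\<beta> \<in> polys (CARD('n) + 1) sym_matrices" by (rule bubble_polys[OF b])
  have fc: "C - {v} \<subseteq> C" "2 \<le> card (C - {v})" "g v \<in> Nrm (C - {v})" if "v \<in> C" for v
    using that card_facet[OF that] d3 by (auto intro: g_Nrm)
  have in_aff: "y \<in> aff (C - {v})" if "y \<in> facet v" for v y
    using that conv_eq[of "C - {v}"] by auto
  have b_nn: "g v \<bullet> (\<beta> x *v g v) = 0" if v: "v \<in> C" and x: "x \<in> aff (C - {v})" for v x
  proof (rule vanish_by_moments[OF fc(1,2)[OF v] rpoly_nn[OF bp] _ _ x])
    fix u y assume u: "u \<in> C - {v}" "y \<in> aff (C - {v} - {u})"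
    show "g v \<bullet> (\<beta> y *v g v) = 0"
      by (rule bubble_nn[OF b _ ridge_nonempty[OF v u(1)] _ _ _ u(2)])
        (use v u card_ridge[OF v u(1)] in \<open>auto intro: g_Nrm\<close>)
  next
    \<comment> \<open>Dividing degree \<open>CARD('n) + 1\<close> by the \<open>CARD('n)\<close>
      coordinates of a facet leaves degree one, which is what the functionals (b) test.\<close>
    fix q assume q: "q \<in> polys_on (facet v) (CARD('n) + 1 - card (C - {v})) (UNIV :: real set)"
    then have "q \<in> polys_on (facet v) 1 UNIV" by (simp add: card_facet[OF v])
    from nn[OF v this] have z: "inner_face (facet v) (\<lambda>x. \<nu> (facet v) 1 \<bullet> (\<tau> x *v \<nu> (facet v) 1)) q = 0" .
    obtain \<alpha> where al: "\<alpha> \<noteq> 0" "\<nu> (facet v) 1 = \<alpha> *\<^sub>R g v" using facet_normal(2)[OF v] by blast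
    have "inner_face (facet v) (\<lambda>x. \<nu> (facet v) 1 \<bullet> (\<tau> x *v \<nu> (facet v) 1)) q =
        inner_face (facet v) (\<lambda>x. (\<alpha> * \<alpha>) *\<^sub>R (g v \<bullet> (\<beta> x *v g v))) q"
    proof (rule L2_inner_cong)
      fix y assume "y \<in> facet v"
      then have "g v \<bullet> (\<sigma> y *v g v) = 0" using s_nn[OF fc(1,2)[OF v] fc(3)[OF v] fc(3)[OF v] in_aff] by blast
      then show "\<nu> (facet v) 1 \<bullet> (\<tau> y *v \<nu> (facet v) 1) = (\<alpha> * \<alpha>) *\<^sub>R (g v \<bullet> (\<beta> y *v g v))"
        unfolding al(2) t by (simp add: matrix_vector_mult_add_rdistrib inner_add_right matrix_vector_mult_scaleR)
    qed simp
    then show "inner_face (facet v) (\<lambda>x. g v \<bullet> (\<beta> x *v g v)) q = 0"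
      using z al(1) L2_inner_scale[of "surface_measure (facet v)" "facet v" "\<alpha> * \<alpha>" "\<lambda>x. g v \<bullet> (\<beta> x *v g v)" q] by simp
  qed
  have zb: "zero_trace \<beta>" by (rule bubble_zero_trace[OF b b_nn])
  have zs: "zero_trace \<sigma>"
    unfolding zero_trace_def
  proof (intro ballI)
    fix v x assume v: "v \<in> C" and x: "x \<in> aff (C - {v})"
    show "\<sigma> x *v g v = 0"
    proof (rule facet_trace_zero[of \<sigma> 0, OF _ v _ _ _ x])
      show "\<sigma> \<in> polys (0 + 2) sym_matrices" using s by (simp only: add_0)
      fix w y assume w: "w \<in> C - {v}" and y: "y \<in> aff (C - {v} - {w})"
      show "g w \<bullet> (\<sigma> y *v g v) = 0"
        by (rule s_nn[OF _ _ _ _ y]) (use v w card_ridge[OF v w] d3 in \<open>auto intro: g_Nrm\<close>)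
    next
      show "g v \<bullet> (\<sigma> y *v g v) = 0" if "y \<in> aff (C - {v})" for y
        by (rule s_nn[OF fc(1,2)[OF v] fc(3)[OF v] fc(3)[OF v] that])
      obtain \<alpha> where al: "\<alpha> \<noteq> 0" "\<nu> (facet v) 1 = \<alpha> *\<^sub>R g v" using facet_normal(2)[OF v] by blast
      fix q assume q: "q \<in> ND 0 (\<nu> (facet v) 1) (facet v)"
      have "inner_face (facet v) (\<lambda>x. tangential_part (\<nu> (facet v) 1) (\<sigma> x *v \<nu> (facet v) 1)) q =
          inner_face (facet v) (\<lambda>x. tangential_part (\<nu> (facet v) 1) (\<tau> x *v \<nu> (facet v) 1)) q"
      proof (rule L2_inner_cong)
        fix y assume "y \<in> facet v"
        then have "\<beta> y *v g v = 0" using zb v in_aff unfolding zero_trace_def by blast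
        then have "\<tau> y *v \<nu> (facet v) 1 = \<sigma> y *v \<nu> (facet v) 1"
          unfolding al(2) t by (simp add: matrix_vector_mult_add_rdistrib matrix_vector_mult_scaleR)
        then show "tangential_part (\<nu> (facet v) 1) (\<sigma> y *v \<nu> (facet v) 1) =
          tangential_part (\<nu> (facet v) 1) (\<tau> y *v \<nu> (facet v) 1)" by (simp only:)
      qed simp
      then show "inner_face (facet v) (\<lambda>x. tangential_part (\<nu> (facet v) 1) (\<sigma> x *v \<nu> (facet v) 1)) q = 0"
        using tn[OF v q] by (simp only:)
    qed
  qed
  have b0: "\<beta> x = 0" for x by (rule bubble_zero[OF b zb])
  then have "\<tau> = \<sigma>" using t by auto
  then have rs: "div_rows \<sigma> \<in> RM" using r by simp
  have "\<sigma> x = 0" for x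
  proof (rule zero_of_kernel_moments[of \<sigma> 0, OF _ zs rs])
    show "\<sigma> \<in> polys (0 + 2) sym_matrices" using s by (simp only: add_0)
    \<comment> \<open>For the quadratic part the interior moments are void: a constant matrix that
      annihilates every position is zero.\<close>
    fix Q :: "real^'n \<Rightarrow> real^'n^'n" assume Q: "Q \<in> polys 0 sym_matrices" "\<And>x. Q x *v x = 0"
    then obtain A where A: "Q = (\<lambda>_. A)" by (auto simp: polys_0 hom_polys_0)
    then have "\<forall>x. A *v x = 0 *v x" using Q(2) by simp
    then have "A = 0" by (rule matrix_eq[THEN iffD2])
    then show "inner_cell K \<sigma> Q = 0" by (intro L2_inner_zero) (simp add: A)
  qed
  then show ?thesis using \<open>\<tau> = \<sigma>\<close> by simp
qed

end

subsection \<open>Existence of bubbles with prescribed normal-normal traces\<close>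

lemma sgrad_zero_fun: "sgrad (\<lambda>x. 0) x = 0"
  by (simp add: sgrad_def vec_eq_iff)

lemma subspace_polys_mod_RM:
  fixes K :: "(real^'n) set"
  assumes K: "charges lborel K"
  shows "subspace (polys_mod_RM K k)"
  unfolding subspace_def
proof safe
  show "0 \<in> polys_mod_RM K k"
    using subspace_0[OF subspace_polys[OF subspace_UNIV]]
    by (auto simp: polys_mod_RM_def zero_fun_eq intro!: L2_inner_zero)
next
  fix p q :: "real^'n \<Rightarrow> real^'n" and c :: real
  assume p: "p \<in> polys_mod_RM K k"
  then show "c *\<^sub>R p \<in> polys_mod_RM K k"
    by (auto simp: polys_mod_RM_def scaleR_fun_eq L2_inner_scale polys_scaleR)
  assume q: "q \<in> polys_mod_RM K k"
  have c: "continuous_on UNIV r" if "r \<in> polys l UNIV" for r :: "real^'n \<Rightarrow> real^'n" and l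
    by (rule continuous_on_polys[OF that subspace_UNIV])
  have "inner_cell K (\<lambda>x. p x + q x) v = 0" if v: "v \<in> RM" for v
  proof -
    have "inner_cell K (\<lambda>x. p x + q x) v = inner_cell K p v + inner_cell K q v"
      using p q by (intro L2_inner_add K c[OF RM_polys[OF v]]) (auto simp: polys_mod_RM_def intro: c)
    then show ?thesis using p q v by (simp add: polys_mod_RM_def)
  qed
  then show "p + q \<in> polys_mod_RM K k"
    using p q by (auto simp: polys_mod_RM_def add_fun_eq polys_add)
qed

lemma span_Times:
  fixes S :: "'a::real_vector set" and T :: "'b::real_vector set"
  shows "span S \<times> span T \<subseteq> span ((\<lambda>a. (a, 0)) ` S \<union> (\<lambda>b. (0, b)) ` T)"
proof clarify
  fix a b assume a: "a \<in> span S" and b: "b \<in> span T"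
  have l: "linear (\<lambda>a::'a. (a, 0::'b))" "linear (\<lambda>b::'b. (0::'a, b))" by (auto intro!: linearI)
  have "(a, 0) \<in> span ((\<lambda>a. (a, 0::'b)) ` S)" using a linear_span_image[OF l(1), of S] by auto
  moreover have "(0, b) \<in> span ((\<lambda>b. (0::'a, b)) ` T)" using b linear_span_image[OF l(2), of T] by auto
  ultimately have "(a, 0) + (0, b) \<in> span ((\<lambda>a. (a, 0)) ` S \<union> (\<lambda>b. (0, b)) ` T)"
    by (intro span_add) (auto intro: subsetD[OF span_mono])
  then show "(a, b) \<in> span ((\<lambda>a. (a, 0)) ` S \<union> (\<lambda>b. (0, b)) ` T)" by simp
qed

context bary
begin

text \<open>Term by term: if both ends of the edge lie in \<open>c\<close>, its direction is
  orthogonal to \<open>n\<close>; otherwise one of the two coordinates vanishes on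
  \<open>aff c\<close>.\<close>

lemma edge_field_normal:
  assumes c: "c \<subseteq> C" and n: "n \<in> Nrm c" and x: "x \<in> aff c"
  shows "edge_field f x *v n = 0"
proof -
  have "(lam (fst e) x * lam (snd e) x * f e x) *\<^sub>R outer (snd e - fst e) (snd e - fst e) *v n = 0" if e: "e \<in> C \<times> C" for e
  proof (cases "fst e \<in> c \<and> snd e \<in> c")
    case True
    then have "n \<bullet> (snd e - fst e) = 0" using n by (simp add: Nrm_def)
    then show ?thesis by (simp add: scaleR_matrix_vector_assoc[symmetric] outer_mult inner_commute)
  next
    case False
    then have "lam (fst e) x = 0 \<or> lam (snd e) x = 0" using e x by (auto simp: aff_def)
    then show ?thesis by auto
  qed
  then show ?thesis by (simp add: edge_field_def sum_matrix_mult)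
qed

lemma edge_field_zero_trace: "zero_trace (edge_field f)"
  unfolding zero_trace_def by (auto intro!: edge_field_normal[of "C - {_}"] g_Nrm)

text \<open>Polarization along edges makes \<open>v \<bullet> (A *v w)\<close> the mean of the
  diagonal values at \<open>v\<close> and \<open>w\<close>. In the expansion over vertices each half
  then contains a factor that sums the gradients, which is zero.\<close>

lemma edges_determine_symmetric:
  assumes A: "A \<in> sym_matrices" and z: "\<And>v w. v \<in> C \<Longrightarrow> w \<in> C \<Longrightarrow> (w - v) \<bullet> (A *v (w - v)) = 0"
  shows "A = 0"
proof (rule matrix_eqI)
  fix x y
  have vw: "v \<bullet> (A *v w) = (1/2) * (v \<bullet> (A *v v)) + (1/2) * (w \<bullet> (A *v w))" if "v \<in> C" "w \<in> C" for v w
    using z[OF that] sym_inner[OF A, of v w]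
    by (simp add: matrix_vector_mult_diff_distrib inner_diff_left inner_diff_right)
  have "x \<bullet> (A *v y) = (\<Sum>v\<in>C. (g v \<bullet> x) *\<^sub>R v) \<bullet> (A *v (\<Sum>w\<in>C. (g w \<bullet> y) *\<^sub>R w))" by (simp only: g_repr)
  also have "\<dots> = (\<Sum>w\<in>C. \<Sum>v\<in>C. (g v \<bullet> x) * (g w \<bullet> y) * (v \<bullet> (A *v w)))"
    by (simp add: inner_sum_left inner_sum_right matrix_vector_mult_scaleR
        sum_distrib_left mult_ac linear_sum[OF matrix_vector_mul_linear])
  also have "\<dots> = (\<Sum>w\<in>C. \<Sum>v\<in>C. (1/2) * ((g w \<bullet> y) * ((g v \<bullet> x) * (v \<bullet> (A *v v)))) + (1/2) * (((g w \<bullet> y) * (w \<bullet> (A *v w))) * (g v \<bullet> x)))"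
  proof (intro sum.cong refl)
    fix w v assume "w \<in> C" "v \<in> C"
    then show "(g v \<bullet> x) * (g w \<bullet> y) * (v \<bullet> (A *v w)) = (1/2) * ((g w \<bullet> y) * ((g v \<bullet> x) * (v \<bullet> (A *v v)))) +
        (1/2) * (((g w \<bullet> y) * (w \<bullet> (A *v w))) * (g v \<bullet> x))"
      unfolding vw[OF \<open>v \<in> C\<close> \<open>w \<in> C\<close>] by (simp add: algebra_simps)
  qed
  also have "\<dots> = (1/2) * ((\<Sum>w\<in>C. g w \<bullet> y) * (\<Sum>v\<in>C. (g v \<bullet> x) * (v \<bullet> (A *v v)))) +
      (1/2) * ((\<Sum>w\<in>C. (g w \<bullet> y) * (w \<bullet> (A *v w))) * (\<Sum>v\<in>C. g v \<bullet> x))"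
    by (simp only: sum.distrib flip: sum_distrib_left sum_distrib_right)
  also have "\<dots> = 0" by (simp add: sum_g_inner)
  finally show "x \<bullet> (A *v y) = x \<bullet> (0 *v y)" by simp
qed

text \<open>Its pairing with \<open>Q\<close> is the symmetric form of the edge components of
  \<open>P\<close> and \<open>Q\<close> with weights \<open>lam v * lam w\<close>. The weights give
  \<open>lift P\<close> zero trace, and the form is definite because edge components determine a
  symmetric matrix.\<close>

definition lift :: "(real^'n \<Rightarrow> real^'n^'n) \<Rightarrow> real^'n \<Rightarrow> real^'n^'n" where
  "lift P = edge_field (\<lambda>e x. (snd e - fst e) \<bullet> (P x *v (snd e - fst e)))"

lemma lift_polys: "P \<in> polys k sym_matrices \<Longrightarrow> lift P \<in> polys (k + 2) sym_matrices"
  unfolding lift_def by (intro edge_field_polys rpoly_nn)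

lemma lift_inner:
  "lift P x \<bullet> Q x = (\<Sum>e\<in>C\<times>C. lam (fst e) x * lam (snd e) x *
     (((snd e - fst e) \<bullet> (P x *v (snd e - fst e))) * ((snd e - fst e) \<bullet> (Q x *v (snd e - fst e)))))"
proof -
  have "outer t t \<bullet> Q x = t \<bullet> (Q x *v t)" for t :: "real^'n"
    using inner_outer[of "Q x" t t] by (simp add: inner_commute)
  then show ?thesis by (simp add: lift_def edge_field_def inner_sum_left mult.assoc)
qed

lemma lift_commute: "inner_cell K (lift P) Q = inner_cell K (lift Q) P"
  unfolding L2_inner_def lift_inner by (simp add: mult_ac)

lemma lift_add: "lift (\<lambda>x. P x + Q x) x = lift P x + lift Q x"
  by (simp add: lift_def edge_field_def matrix_vector_mult_add_rdistrib inner_add_right distrib_left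
      scaleR_add_left sum.distrib)

lemma lift_scale: "lift (\<lambda>x. r *\<^sub>R P x) x = r *\<^sub>R lift P x"
  by (simp add: lift_def edge_field_def scaleR_matrix_vector_assoc[symmetric] scaleR_sum_right mult_ac)

lemma lift_pos:
  assumes P: "P \<in> polys k sym_matrices" and z: "inner_cell K (lift P) P = 0"
  shows "P x = 0"
proof (rule edges_determine_symmetric[OF polys_in[OF subspace_sym P]])
  let ?t = "\<lambda>e. snd e - fst e :: real^'n"
  let ?s = "\<lambda>x. \<Sum>e\<in>C\<times>C. lam (fst e) x * lam (snd e) x * (?t e \<bullet> (P x *v ?t e))\<^sup>2"
  have "(LINT x:K|lborel. ?s x) = 0" using z unfolding L2_inner_def lift_inner by (simp add: power2_eq_square)
  moreover have "continuous_on UNIV ?s"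
    by (intro continuous_on_sum continuous_on_mult continuous_on_power continuous_lam continuous_on_rpoly[OF rpoly_nn[OF P]]) auto
  moreover have nn: "0 \<le> lam (fst e) y * lam (snd e) y * (?t e \<bullet> (P y *v ?t e))\<^sup>2" if "y \<in> K" "e \<in> C \<times> C" for y e
    using that by (auto simp: K_iff)
  ultimately have s0: "?s y = 0" if "y \<in> K" for y
    using that by (intro charges_integral_zero[OF charges_K, of ?s]) (auto intro!: sum_nonneg)
  fix v w assume vw: "v \<in> C" "w \<in> C"
  show "(w - v) \<bullet> (P x *v (w - v)) = 0"
  proof (rule vanish_on_aff[OF rpoly_nn[OF P] order_refl C_ne])
    fix y assume "y \<in> aff C" and pos: "\<And>u. u \<in> C \<Longrightarrow> 0 < lam u y"
    then have y: "y \<in> K" by (auto simp: K_iff intro: less_imp_le)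
    have "lam (fst (v,w)) y * lam (snd (v,w)) y * (?t (v,w) \<bullet> (P y *v ?t (v,w)))\<^sup>2 = 0"
      using s0[OF y] sum_nonneg_eq_0_iff[of "C \<times> C" "\<lambda>e. lam (fst e) y * lam (snd e) y * (?t e \<bullet> (P y *v ?t e))\<^sup>2"] nn[OF y] vw finC
      by (auto dest!: bspec[of _ _ "(v, w)"])
    then show "(w - v) \<bullet> (P y *v (w - v)) = 0" using pos[OF vw(1)] pos[OF vw(2)] by simp
  qed simp
qed

end

context framed_simplex
begin

text \<open>A face of codimension at least two misses two or more vertices, one of them different
  from \<open>v\<close>.\<close>

lemma facet_product_zero:
  assumes "c \<subseteq> C" "card c \<le> CARD('n) - 1" "x \<in> aff c" "v \<in> C"
  shows "(\<Prod>u\<in>C - {v}. lam u x) = 0"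
proof -
  have "card (C - c) \<ge> 2" using assms(1,2) cardC fin_sub[OF assms(1)] d3 by (simp add: card_Diff_subset)
  then have "\<not> C - c \<subseteq> {v}" using card_mono[of "{v}" "C - c"] by auto
  then obtain u where "u \<in> C - c" "u \<noteq> v" by blast
  then have "u \<in> C - {v}" "lam u x = 0" using assms(3) by (auto simp: aff_def)
  then show ?thesis using finC by (intro prod_zero) auto
qed

text \<open>Start from \<open>\<tau>\<^sub>0 = b\<^sub>F p g\<^sub>v g\<^sub>v\<^sup>T\<close>, which has the right traces, and add a field \<open>lift P\<close> with zero trace
  such that the interior moments vanish. By Green's formula these are
  \<open>\<langle>lift P, q' - def q\<rangle> = - (div \<tau>\<^sub>0, q) - (\<tau>\<^sub>0, q')\<close> for all \<open>(q, q')\<close>, which the Riesz representation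
  solves with \<open>P = q'\<^sub>0 - def q\<^sub>0\<close>: the form is definite because \<open>q' = def q\<close>, \<open>q' x = 0\<close> force
  \<open>q \<in> RM\<close>.\<close>

lemma bubble_exists:
  assumes v: "v \<in> C" and p: "p \<in> rpoly 1"
  shows "\<exists>\<beta>\<in>nn_bubbles K \<nu>.
     (\<forall>x\<in>aff (C - {v}). g v \<bullet> (\<beta> x *v g v) = (\<Prod>u\<in>C - {v}. lam u x) * p x * (g v \<bullet> g v)\<^sup>2) \<and>
     (\<forall>u\<in>C - {v}. \<forall>x\<in>aff (C - {u}). g u \<bullet> (\<beta> x *v g u) = 0)"
proof -
  define d where "d = CARD('n)"
  have d: "d \<ge> 3" "d - 1 + 2 = d + 1" "Suc (d - 1) = d" using d3 by (auto simp: d_def)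
  define B where "B x = (\<Prod>u\<in>C - {v}. lam u x) * p x" for x
  have Bp: "B \<in> rpoly (d + 1)"
    unfolding B_def using rpoly_mult[OF rpoly_prod[of "C - {v}" lam] p] finC lam_rpoly card_facet[OF v]
    by (simp add: d_def)
  define \<tau>0 where "\<tau>0 x = B x *\<^sub>R outer (g v) (g v)" for x
  have t0s: "\<tau>0 \<in> polys (d + 1) sym_matrices"
    unfolding \<tau>0_def
    by (rule polys_sub_image[where p=B and L="\<lambda>r. r *\<^sub>R outer (g v) (g v)" and X=UNIV])
      (use Bp subspace_scale[OF subspace_sym outer_sym] in \<open>auto intro!: linearI simp: scaleR_add_left\<close>)
  have t0: "\<tau>0 \<in> polys (d + 1) UNIV" by (rule polys_UNIV[OF t0s])
  have dt0: "div_rows \<tau>0 \<in> polys d UNIV" using div_polys[of \<tau>0 d] t0 by simp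
  define Z where "Z = polys_mod_RM K d \<times> {q' \<in> polys (d - 1) sym_matrices. \<forall>x. q' x *v x = (0 :: real^'n)}"
  define \<Phi> where "\<Phi> z x = snd z x + (- 1) *\<^sub>R sgrad (fst z) x"
    for z :: "((real^'n) \<Rightarrow> (real^'n)) \<times> ((real^'n) \<Rightarrow> (real^'n^'n))" and x
  have Zq: "fst z \<in> polys d UNIV" "snd z \<in> polys (d - 1) sym_matrices" if "z \<in> Z" for z
    using that by (auto simp: Z_def polys_mod_RM_def)
  have sg: "sgrad q \<in> polys (d - 1) sym_matrices" if "q \<in> polys d UNIV" for q
    using sgrad_polys[of q "d - 1"] that d(3) by simp
  have Phi: "\<Phi> z \<in> polys (d - 1) sym_matrices" if "z \<in> Z" for z
    unfolding \<Phi>_def by (intro polys_add polys_scaleR subspace_sym sg Zq that)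
  have PhiU: "\<Phi> z \<in> polys (d - 1) UNIV" if "z \<in> Z" for z by (rule polys_UNIV[OF Phi[OF that]])
  have Lift: "lift (\<Phi> z) \<in> polys (d + 1) UNIV" if "z \<in> Z" for z
    using polys_UNIV[OF lift_polys[OF Phi[OF that]]] d(2) by simp
  have Phi_add: "\<Phi> (z + z') = (\<lambda>x. \<Phi> z x + \<Phi> z' x)" if "z \<in> Z" "z' \<in> Z" for z z'
    using sgrad_add[OF Zq(1)[OF that(1)] Zq(1)[OF that(2)]]
    by (auto simp: \<Phi>_def add_fun_eq fun_eq_iff)
  have Phi_scale: "\<Phi> (r *\<^sub>R z) = (\<lambda>x. r *\<^sub>R \<Phi> z x)" if "z \<in> Z" for z r
    using sgrad_scale[OF Zq(1)[OF that], of r] by (auto simp: \<Phi>_def scaleR_fun_eq algebra_simps)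
  have subker: "subspace {q' \<in> polys (d - 1) sym_matrices. \<forall>x. q' x *v x = (0 :: real^'n)}"
    using subspace_polys[OF subspace_sym, of "d - 1"]
    by (auto simp: subspace_def scaleR_fun_eq add_fun_eq zero_fun_eq matrix_vector_mult_add_rdistrib scaleR_matrix_vector_assoc[symmetric])
  have sub: "subspace Z"
    unfolding Z_def by (intro subspace_Times subspace_polys_mod_RM charges_K subker)
  define ll where "ll z = - inner_cell K (fst z) (div_rows \<tau>0) - inner_cell K (snd z) \<tau>0" for z
  obtain T1 :: "(real^'n \<Rightarrow> real^'n) set" where T1: "finite T1" "polys d UNIV \<subseteq> span T1"
    using polys_finitely_spanned by blast
  obtain T2 :: "(real^'n \<Rightarrow> real^'n^'n) set" where T2: "finite T2" "polys (d - 1) UNIV \<subseteq> span T2"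
    using polys_finitely_spanned by blast
  let ?T = "(\<lambda>a. (a, 0)) ` T1 \<union> (\<lambda>b. (0, b)) ` T2"
  have "\<exists>z0\<in>Z. \<forall>z\<in>Z. inner_cell K (lift (\<Phi> z0)) (\<Phi> z) = ll z"
  proof (rule riesz_finite[OF sub, of "\<lambda>a b. inner_cell K (lift (\<Phi> a)) (\<Phi> b)" ll ?T])
    show "finite ?T" using T1 T2 by simp
    have "Z \<subseteq> span T1 \<times> span T2" using T1(2) T2(2) Zq polys_UNIV by (auto simp: mem_Times_iff) blast
    then show "Z \<subseteq> span ?T" using span_Times by (rule subset_trans)
    fix a b c assume a: "a \<in> Z" and b: "b \<in> Z"
    show "ll (a + b) = ll a + ll b"
      unfolding ll_def fst_add snd_add add_fun_eq
      using L2_K_add[OF Zq(1)[OF a] Zq(1)[OF b] dt0]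
        L2_K_add[OF polys_UNIV[OF Zq(2)[OF a]] polys_UNIV[OF Zq(2)[OF b]] t0] by simp
    show "inner_cell K (lift (\<Phi> a)) (\<Phi> b) = inner_cell K (lift (\<Phi> b)) (\<Phi> a)" by (rule lift_commute)
    assume c: "c \<in> Z"
    have "lift (\<Phi> (a + b)) = (\<lambda>x. lift (\<Phi> a) x + lift (\<Phi> b) x)" by (simp add: Phi_add[OF a b] lift_add fun_eq_iff)
    then show "inner_cell K (lift (\<Phi> (a + b))) (\<Phi> c) = inner_cell K (lift (\<Phi> a)) (\<Phi> c) + inner_cell K (lift (\<Phi> b)) (\<Phi> c)"
      using L2_K_add[OF Lift[OF a] Lift[OF b] PhiU[OF c]] by simp
  next
    fix r a assume a: "a \<in> Z"
    show "ll (r *\<^sub>R a) = r * ll a"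
      unfolding ll_def fst_scaleR snd_scaleR scaleR_fun_eq L2_inner_scale by (simp add: algebra_simps)
    fix c assume "c \<in> Z"
    have "lift (\<Phi> (r *\<^sub>R a)) = (\<lambda>x. r *\<^sub>R lift (\<Phi> a) x)" by (simp add: Phi_scale[OF a] lift_scale fun_eq_iff)
    then show "inner_cell K (lift (\<Phi> (r *\<^sub>R a))) (\<Phi> c) = r * inner_cell K (lift (\<Phi> a)) (\<Phi> c)"
      by (simp only: L2_inner_scale)
  next
    fix a assume a: "a \<in> Z" and z: "inner_cell K (lift (\<Phi> a)) (\<Phi> a) = 0"
    have P0: "\<Phi> a x = 0" for x by (rule lift_pos[OF Phi[OF a] z])
    then have eq: "snd a x = sgrad (fst a) x" for x using P0[of x] by (simp add: \<Phi>_def)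
    have "sgrad (fst a) x *v x = 0" for x using a unfolding eq[symmetric] by (auto simp: Z_def)
    then have RM: "fst a \<in> RM" by (rule sgrad_mult_position_zero[OF Zq(1)[OF a]])
    then have "inner_cell K (fst a) (fst a) = 0" using a by (auto simp: Z_def polys_mod_RM_def)
    then have "fst a y = 0" if "y \<in> K" for y
      using L2_inner_pos[OF charges_K continuous_polys_mat[OF Zq(1)[OF a]] _ that] by simp
    then have "fst a x = 0" for x by (rule polys_zero_on_K[OF Zq(1)[OF a]])
    moreover have "snd a x = 0" for x using eq[of x] sgrad_RM[OF RM, of x] by simp
    ultimately show "a = 0" by (auto simp: prod_eq_iff fun_eq_iff)
  qed
  then obtain z0 where z0: "z0 \<in> Z" "\<And>z. z \<in> Z \<Longrightarrow> inner_cell K (lift (\<Phi> z0)) (\<Phi> z) = ll z" by blast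
  define \<tau>1 where "\<tau>1 = lift (\<Phi> z0)"
  have t1s: "\<tau>1 \<in> polys (d + 1) sym_matrices" using lift_polys[OF Phi[OF z0(1)]] d(2) by (simp add: \<tau>1_def)
  have t1: "\<tau>1 \<in> polys (d + 1) UNIV" by (rule polys_UNIV[OF t1s])
  have dt1: "div_rows \<tau>1 \<in> polys d UNIV" using div_polys[of \<tau>1 d] t1 by simp
  define \<beta> where "\<beta> x = \<tau>0 x + \<tau>1 x" for x
  have t1n: "\<tau>1 x *v n = 0" if "c \<subseteq> C" "n \<in> Nrm c" "x \<in> aff c" for c n x
    unfolding \<tau>1_def lift_def by (rule edge_field_normal[OF that])
  have t0c: "\<tau>0 x = 0" if "c \<subseteq> C" "card c \<le> d - 1" "x \<in> aff c" for c x
    using facet_product_zero[OF that(1) _ that(3) v] that(2) by (simp add: \<tau>0_def B_def d_def)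
  have t0f: "\<tau>0 x = 0" if "u \<in> C - {v}" "x \<in> aff (C - {u})" for u x
  proof -
    have "lam u x = 0" using that by (auto simp: aff_def)
    then have "(\<Prod>u\<in>C - {v}. lam u x) = 0" using that(1) finC by (intro prod_zero) auto
    then show ?thesis by (simp add: \<tau>0_def B_def)
  qed
  have bn: "n \<bullet> (\<beta> x *v m) = n \<bullet> (\<tau>0 x *v m)" if "c \<subseteq> C" "m \<in> Nrm c" "x \<in> aff c" for c n m x
    by (simp add: \<beta>_def matrix_vector_mult_add_rdistrib t1n[OF that])
  have "\<beta> \<in> nn_bubbles K \<nu>"
    unfolding nn_bubbles_def d_def[symmetric]
  proof (intro CollectI conjI allI ballI impI)
    show "\<beta> \<in> polys (d + 1) sym_matrices"
      unfolding \<beta>_def by (rule polys_add[OF subspace_sym t0s t1s])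
    fix y assume "{y} \<in> subsimplices 0 K"
    then have y: "y \<in> C" by (simp add: subsimplices_0)
    have c: "{y} \<subseteq> C" "y \<in> aff {y}" using y vertex_aff[of "{y}" y] by auto
    have "\<tau>1 y *v n = 0" for n by (rule t1n[OF c(1) _ c(2)]) (simp add: Nrm_def)
    then have "\<tau>1 y = 0" by (simp add: matrix_eq)
    then show "\<beta> y = 0" using t0c[OF c(1) _ c(2)] d(1) by (simp add: \<beta>_def)
  next
    fix r f i j q
    assume r: "r \<in> {1..d - 2}" and f: "f \<in> subsimplices r K" and ij: "1 \<le> i \<and> i \<le> j \<and> j \<le> d - r"
    obtain c where c: "f = convex hull c" "c \<subseteq> C" "card c = r + 1" using f by (auto simp: subsimplices_eq)
    show "inner_face f (\<lambda>x. \<nu> f i \<bullet> (\<beta> x *v \<nu> f j)) q = 0"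
    proof (rule L2_inner_zero)
      fix x assume "x \<in> f"
      then have x: "x \<in> aff c" using c conv_eq[of c] by auto
      have "\<nu> f j \<in> Nrm c" unfolding c(1) using ij by (intro frame_Nrm[OF c(2,3)]) (auto simp: d_def)
      moreover have "\<tau>0 x = 0" by (rule t0c[OF c(2) _ x]) (use r c(3) in auto)
      ultimately show "(\<nu> f i \<bullet> (\<beta> x *v \<nu> f j)) \<bullet> q x = 0" using bn[OF c(2) _ x] by simp
    qed
  next
    fix F q assume "F \<in> subsimplices (d - 1) K"
    then obtain u where u: "u \<in> C" "F = facet u" unfolding d_def facets_eq by blast
    obtain \<alpha> where al: "\<nu> (facet u) 1 = \<alpha> *\<^sub>R g u" using facet_normal(2)[OF u(1)] by blast
    have n1: "norm (\<nu> (facet u) 1) = 1" by (rule facet_normal(1)[OF u(1)])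
    show "inner_face F (\<lambda>x. tangential_part (\<nu> F 1) (\<beta> x *v \<nu> F 1)) q = 0"
    proof (rule L2_inner_zero)
      fix x assume "x \<in> F"
      then have x: "x \<in> aff (C - {u})" using u conv_eq[of "C - {u}"] by auto
      have "\<tau>1 x *v g u = 0" by (rule t1n[OF _ g_Nrm x]) (use u in auto)
      then have e: "\<beta> x *v \<nu> F 1 = \<tau>0 x *v \<nu> (facet u) 1"
        unfolding u(2) al by (simp add: \<beta>_def matrix_vector_mult_add_rdistrib matrix_vector_mult_scaleR)
      have "tangential_part (\<nu> F 1) (\<beta> x *v \<nu> F 1) = 0"
      proof (cases "u = v")
        case True
        have "\<alpha> \<noteq> 0" using al n1 by auto
        then have "g v = (1 / \<alpha>) *\<^sub>R \<nu> (facet u) 1" using al True by simp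
        \<comment> \<open>On the facet opposite to \<open>v\<close> the start field does not vanish,
          but it maps the normal to a multiple of the normal, so the tangential part is
          zero.\<close>
        then have "\<tau>0 x *v \<nu> (facet u) 1 = (B x * (g v \<bullet> \<nu> (facet u) 1) / \<alpha>) *\<^sub>R \<nu> (facet u) 1"
          by (simp add: \<tau>0_def scaleR_matrix_vector_assoc[symmetric] outer_mult)
        then show ?thesis
          unfolding e unfolding u(2) using n1 by (simp add: tangential_part_def norm_eq_1)
      next
        case False
        then show ?thesis unfolding e using t0f[of u x] u x by (simp add: tangential_part_def)
      qed
      then show "tangential_part (\<nu> F 1) (\<beta> x *v \<nu> F 1) \<bullet> q x = 0" by (simp only: inner_zero_left)
    qed
  next
    fix q assume q: "q \<in> polys_mod_RM K d"
    then have qp: "q \<in> polys d UNIV" by (simp add: polys_mod_RM_def)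
    \<comment> \<open>Pairs with second component zero yield the divergence moments, pairs with
      first component zero the interior moments.\<close>
    have "(q, 0) \<in> Z" using q subspace_0[OF subker] by (simp add: Z_def)
    from z0(2)[OF this] have "inner_cell K \<tau>1 (\<Phi> (q, 0)) = - inner_cell K q (div_rows \<tau>0) - inner_cell K 0 \<tau>0"
      by (simp add: \<tau>1_def ll_def)
    moreover have "\<Phi> (q, 0) = (\<lambda>x. (- 1) *\<^sub>R sgrad q x)" by (auto simp: \<Phi>_def)
    moreover have "inner_cell K 0 \<tau>0 = 0" by (rule L2_inner_zero) simp
    moreover have "inner_cell K \<tau>1 (\<lambda>x. (- 1) *\<^sub>R sgrad q x) = - inner_cell K \<tau>1 (sgrad q)"
      using L2_inner_scale[of lborel K "- 1" "sgrad q" \<tau>1] by (simp add: L2_inner_commute)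
    moreover have "inner_cell K (div_rows \<tau>1) q = - inner_cell K \<tau>1 (sgrad q)"
    proof (rule green[where k="d - 1", OF _ _ qp])
      show "\<tau>1 \<in> polys (d - 1 + 2) sym_matrices" using t1s d(2) by simp
      show "zero_trace \<tau>1" unfolding \<tau>1_def lift_def by (rule edge_field_zero_trace)
    qed
    moreover have "div_rows \<beta> = (\<lambda>x. div_rows \<tau>0 x + div_rows \<tau>1 x)"
      unfolding \<beta>_def using div_add[OF t0 t1] by auto
    ultimately show "inner_cell K (div_rows \<beta>) q = 0"
      using L2_K_add[OF dt0 dt1 qp] by (simp add: L2_inner_commute)
  next
    fix q :: "real^'n \<Rightarrow> real^'n^'n" assume q: "q \<in> polys (d - 1) sym_matrices" "\<forall>x. q x *v x = 0"
    have "(0, q) \<in> Z" using q subspace_0[OF subspace_polys_mod_RM[OF charges_K]] by (simp add: Z_def)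
    from z0(2)[OF this] have "inner_cell K \<tau>1 (\<Phi> (0, q)) = - inner_cell K 0 (div_rows \<tau>0) - inner_cell K q \<tau>0"
      by (simp add: \<tau>1_def ll_def)
    moreover have "\<Phi> (0, q) = q" by (auto simp: \<Phi>_def zero_fun_eq sgrad_zero_fun)
    moreover have "inner_cell K 0 (div_rows \<tau>0) = 0" by (rule L2_inner_zero) simp
    moreover have "inner_cell K \<beta> q = inner_cell K \<tau>0 q + inner_cell K \<tau>1 q"
      unfolding \<beta>_def by (rule L2_K_add[OF t0 t1 polys_UNIV[OF q(1)]])
    ultimately show "inner_cell K \<beta> q = 0" by (simp add: L2_inner_commute)
  qed
  moreover have "g v \<bullet> (\<beta> x *v g v) = (\<Prod>u\<in>C - {v}. lam u x) * p x * (g v \<bullet> g v)\<^sup>2" if x: "x \<in> aff (C - {v})" for x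
    using bn[OF _ g_Nrm x, of v "g v"] v
    by (simp add: \<tau>0_def B_def scaleR_matrix_vector_assoc[symmetric] outer_mult power2_eq_square)
  moreover have "g u \<bullet> (\<beta> x *v g u) = 0" if u: "u \<in> C - {v}" and x: "x \<in> aff (C - {u})" for u x
    using bn[OF _ g_Nrm x, of u "g u"] u t0f[OF u x] by simp
  ultimately show ?thesis by blast
qed

end

subsection \<open>Counting degrees of freedom\<close>

lemma is_basis_card:
  assumes "is_basis B V" "is_basis B' V" "finite B'"
  shows "finite B \<and> card B = card B'"
proof -
  have i: "independent B" "span B = V" "independent B'" "span B' = V" using assms by (auto simp: is_basis_def)
  have "B \<subseteq> span B'" using i span_superset by metis
  then have f: "finite B" "card B \<le> card B'"
    using real_vector.independent_span_bound[OF assms(3) i(1)] by auto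
  have "B' \<subseteq> span B" using i span_superset by metis
  then have "card B' \<le> card B" using real_vector.independent_span_bound[OF f(1) i(3)] by auto
  then show ?thesis using f by simp
qed

lemma is_basis_image:
  fixes W :: "'a::euclidean_space set" and \<phi> :: "'a \<Rightarrow> 'b::real_vector"
  assumes "subspace W" "linear \<phi>" "inj_on \<phi> W" "is_basis B (\<phi> ` W)"
  shows "finite B \<and> card B = dim W"
proof -
  obtain A where A: "A \<subseteq> W" "independent A" "W \<subseteq> span A" "card A = dim W"
    using basis_exists[of W] by metis
  have sA: "span A = W" using A assms(1) by (simp add: span_minimal subset_antisym)
  have fA: "finite A" using A(2) by (rule independent_imp_finite)
  have "is_basis (\<phi> ` A) (\<phi> ` W)"
    using linear_independent_injective_image[OF assms(2) A(2)] assms(3) linear_span_image[OF assms(2), of A]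
    by (simp add: is_basis_def sA)
  moreover have "card (\<phi> ` A) = dim W"
    using A(1,4) assms(3) by (metis card_image inj_on_subset)
  ultimately show ?thesis using is_basis_card[OF assms(4), of "\<phi> ` A"] fA by simp
qed

lemma is_basis_euclidean:
  fixes W :: "'a::euclidean_space set"
  assumes "subspace W" "is_basis B W" shows "finite B \<and> card B = dim W"
  using is_basis_image[of W "\<lambda>x. x" B] assms by (simp add: linear_ident)

lemma dim_sym_plus_dim_skew:
  "dim (sym_matrices :: (real^'n^'n) set) + dim (skew_matrices :: (real^'n^'n) set) = CARD('n)\<^sup>2"
proof -
  have "{x + y | x y. x \<in> (sym_matrices :: (real^'n^'n) set) \<and> y \<in> skew_matrices} = UNIV"
  proof (intro set_eqI iffI UNIV_I)
    fix A :: "real^'n^'n"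
    have "(1/2) *\<^sub>R (A + transpose A) \<in> sym_matrices" by (simp add: sym_iff transpose_def)
    moreover have "(1/2) *\<^sub>R (A - transpose A) \<in> skew_matrices" by (simp add: skew_iff transpose_def add_divide_distrib[symmetric])
    moreover have "A = (1/2) *\<^sub>R (A + transpose A) + (1/2) *\<^sub>R (A - transpose A)"
      by (simp add: vec_eq_iff transpose_def field_simps)
    ultimately show "A \<in> {x + y | x y. x \<in> sym_matrices \<and> y \<in> skew_matrices}" by blast
  qed
  moreover have "(sym_matrices :: (real^'n^'n) set) \<inter> skew_matrices = {0}"
  proof (intro set_eqI iffI)
    fix A :: "real^'n^'n" assume "A \<in> sym_matrices \<inter> skew_matrices"
    then have "\<And>i j. A $ i $ j = A $ j $ i" "\<And>i j. A $ i $ j + A $ j $ i = 0" by (auto simp: sym_iff skew_iff)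
    then have "A $ i $ j = 0" for i j by (metis field_sum_of_halves add_cancel_right_right mult_2 mult_eq_0_iff zero_neq_numeral)
    then show "A \<in> {0}" by (simp add: vec_eq_iff)
  qed (simp add: sym_iff skew_iff)
  ultimately show ?thesis
    using dim_sums_Int[OF subspace_sym[where 'n='n] subspace_skew] by (simp add: power2_eq_square)
qed

lemma skew_inner_self: "A \<in> skew_matrices \<Longrightarrow> n \<bullet> (A *v n) = 0" for A :: "real^'n^'n"
proof -
  assume "A \<in> skew_matrices"
  then have "n v* A = (- A) *v n" using transpose_matrix_vector[of A n] by (simp add: skew_matrices_def)
  also have "\<dots> = - (A *v n)" by (simp add: matrix_vector_mult_def vec_eq_iff sum_negf)
  finally have "n v* A = - (A *v n)" .
  then have "n \<bullet> (A *v n) = - (n \<bullet> (A *v n))" using dot_lmul_matrix[of n A n] by (simp add: inner_commute)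
  then show ?thesis by simp
qed

lemma outer_add: "outer (a + b) c = outer a c + outer b c" "outer c (a + b) = outer c a + outer c b"
  by (simp_all add: outer_def vec_eq_iff algebra_simps)

lemma outer_scale: "outer (r *\<^sub>R a) c = r *\<^sub>R outer a c" "outer c (r *\<^sub>R a) = r *\<^sub>R outer c a"
  by (simp_all add: outer_def vec_eq_iff)

lemma outer_skew: "outer a b - outer b a \<in> skew_matrices"
  by (simp add: skew_iff outer_def mult.commute)

lemma rpoly_1_affine:
  fixes p :: "real^'n \<Rightarrow> real"
  assumes "p \<in> rpoly 1" shows "\<exists>a b. \<forall>x. p x = a + b \<bullet> x"
proof -
  obtain h q where h: "h \<in> rpoly 1" "hom 1 h" "q \<in> rpoly 0" "\<And>x. p x = h x + q x"
    using rpoly_split_hom[OF assms] by auto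
  obtain c where c: "q = (\<lambda>_. c)" using rpoly_0D[OF h(3)] by blast
  have "h x = (\<chi> j. pd j h 0) \<bullet> x" for x
    using linear_of_hom_1[OF h(1,2), of x] by (simp add: inner_vec_def mult.commute)
  then have "p x = c + (\<chi> j. pd j h 0) \<bullet> x" for x using h(4) c by simp
  then show ?thesis by blast
qed

context framed_simplex
begin

lemma facet_vertex: "w \<in> C - {v} \<Longrightarrow> w \<in> facet v" by (rule hull_inc)

text \<open>The coordinates of the facet's own vertices form the nodal basis: they are dual to
  evaluation at these vertices, and an affine function is recovered from its vertex values.\<close>

lemma card_polys_on_facet:
  assumes v: "v \<in> C" and B: "is_basis B (polys_on (facet v) 1 (UNIV :: real set))"
  shows "finite B \<and> card B = CARD('n)"
proof -
  let ?c = "C - {v}" and ?F = "facet v"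
  let ?y = "\<lambda>w. on_set ?F (lam w)"
  have fc: "finite ?c" using finC by simp
  have "inj_on ?y ?c \<and> independent (?y ` ?c)"
  proof (rule independent_family[OF fc])
    fix k w assume s: "(\<Sum>w\<in>?c. k w *\<^sub>R ?y w) = 0" and w: "w \<in> ?c"
    have "0 = (\<Sum>u\<in>?c. k u * ?y u w)" using fun_cong[OF s, of w] by (simp add: sum_fun_eq scaleR_fun_eq)
    also have "\<dots> = (\<Sum>u\<in>?c. if u = w then k w else 0)"
      using w facet_vertex[OF w] by (intro sum.cong) (auto simp: on_set_def lam_vertex)
    finally show "k w = 0" using w fc by simp
  qed
  then have i: "inj_on ?y ?c" "independent (?y ` ?c)" by auto
  have "span (?y ` ?c) = polys_on ?F 1 UNIV"
  proof (intro subset_antisym)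
    have "subspace (polys_on ?F 1 (UNIV :: real set))"
      unfolding polys_on_def subspace_def
      by (auto simp: on_set_add on_set_scale rpoly_add rpoly_scale intro!: image_eqI[of _ "on_set ?F"])
        (auto simp: on_set_def zero_fun_eq intro!: image_eqI[of _ "on_set ?F" "\<lambda>_. 0"] rpoly_const)
    moreover have "?y ` ?c \<subseteq> polys_on ?F 1 UNIV" using lam_rpoly by (auto simp: polys_on_def)
    ultimately show "span (?y ` ?c) \<subseteq> polys_on ?F 1 UNIV" by (rule span_minimal[rotated])
    show "polys_on ?F 1 UNIV \<subseteq> span (?y ` ?c)"
    proof
      fix q assume "q \<in> polys_on ?F 1 (UNIV :: real set)"
      then obtain p where p: "p \<in> rpoly 1" "q = on_set ?F p" by (auto simp: polys_on_def)
      obtain a b where ab: "\<And>x. p x = a + b \<bullet> x" using rpoly_1_affine[OF p(1)] by blast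
      have "q = (\<Sum>w\<in>?c. p w *\<^sub>R ?y w)"
      proof
        fix x
        show "q x = (\<Sum>w\<in>?c. p w *\<^sub>R ?y w) x"
        proof (cases "x \<in> ?F")
          case True
          have sub: "?c \<subseteq> C" by blast
          have xa: "x \<in> aff ?c" using True conv_eq[OF sub] by blast
          have "p x = a * (\<Sum>w\<in>?c. lam w x) + b \<bullet> (\<Sum>w\<in>?c. lam w x *\<^sub>R w)"
            unfolding aff_sum[OF sub xa] aff_repr[OF sub xa] ab by simp
          also have "\<dots> = (\<Sum>w\<in>?c. p w * lam w x)"
            by (simp add: ab inner_sum_right sum_distrib_left sum.distrib algebra_simps)
          finally show ?thesis using True by (simp add: p(2) on_set_def sum_fun_eq scaleR_fun_eq)
        qed (simp add: p(2) on_set_def sum_fun_eq scaleR_fun_eq)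
      qed
      also have "\<dots> \<in> span (?y ` ?c)" by (intro span_sum span_scale span_base imageI)
      finally show "q \<in> span (?y ` ?c)" .
    qed
  qed
  then have "is_basis (?y ` ?c) (polys_on ?F 1 UNIV)" using i by (simp add: is_basis_def)
  then have "finite B \<and> card B = card (?y ` ?c)" using is_basis_card[OF B] fc by blast
  then show ?thesis using card_image[OF i(1)] card_facet[OF v] by simp
qed

text \<open>A skew matrix \<open>A\<close> encodes the tangential rigid motion with translation \<open>A n\<close> and rotation the
  part of \<open>A\<close> that annihilates \<open>n\<close>.\<close>

lemma card_ND_0:
  assumes v: "v \<in> C" and B: "is_basis B (ND 0 (\<nu> (facet v) 1) (facet v))"
  shows "finite B \<and> card B = dim (skew_matrices :: (real^'n^'n) set)"
proof -
  define n where "n = \<nu> (facet v) 1"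
  let ?F = "facet v" and ?t = "tangential_part n"
  have n1: "norm n = 1" unfolding n_def by (rule facet_normal(1)[OF v])
  then have nn: "n \<bullet> n = 1" by (simp add: norm_eq_1)
  obtain \<alpha> where al: "\<alpha> \<noteq> 0" "n = \<alpha> *\<^sub>R g v" using facet_normal(2)[OF v] unfolding n_def by blast
  \<comment> \<open>Removes from \<open>A\<close> what it does to \<open>n\<close>: for skew
    \<open>A\<close> one has \<open>n \<bullet> (A *v n) = 0\<close>, so \<open>R A\<close> is skew
    and annihilates \<open>n\<close>.\<close>
  define R where "R A = A - (outer (A *v n) n - outer n (A *v n))" for A
  define \<phi> where "\<phi> A = on_set ?F (\<lambda>x. A *v n + R A *v ?t x)" for A
  have R_lin: "R (A + A') = R A + R A'" "R (r *\<^sub>R A) = r *\<^sub>R R A" for A A' r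
    by (simp_all add: R_def matrix_vector_mult_add_rdistrib outer_add scaleR_matrix_vector_assoc[symmetric] outer_scale algebra_simps)
  have lin: "linear \<phi>"
    by (rule linearI)
      (auto simp: \<phi>_def on_set_add on_set_scale R_lin matrix_vector_mult_add_rdistrib scaleR_matrix_vector_assoc[symmetric] algebra_simps)
  have R_skew: "R A \<in> skew_matrices" "R A *v n = 0" if A: "A \<in> skew_matrices" for A
  proof -
    show "R A \<in> skew_matrices" unfolding R_def by (intro subspace_diff[OF subspace_skew] A outer_skew)
    show "R A *v n = 0" using skew_inner_self[OF A, of n]
      by (simp add: R_def matrix_vector_mult_diff_rdistrib outer_mult nn inner_commute)
  qed
  have im: "\<phi> ` skew_matrices = ND 0 n ?F"
  proof (intro set_eqI iffI)
    fix q assume "q \<in> \<phi> ` skew_matrices"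
    then obtain A where A: "A \<in> skew_matrices" "q = \<phi> A" by blast
    show "q \<in> ND 0 n ?F"
      unfolding ND_def polys_0 hom_polys_0 A(2) \<phi>_def
      using R_skew[OF A(1)] skew_inner_self[OF A(1), of n]
      by (intro CollectI exI[of _ "\<lambda>_. A *v n"] exI[of _ "\<lambda>_. R A"]) auto
  next
    fix q assume "q \<in> ND 0 n ?F"
    then obtain a M where aM: "n \<bullet> a = 0" "M \<in> skew_matrices" "M *v n = 0" "q = on_set ?F (\<lambda>x. a + M *v ?t x)"
      unfolding ND_def polys_0 hom_polys_0 by auto
    define A where "A = M + (outer a n - outer n a)"
    have "A *v n = a" using aM(1,3) by (simp add: A_def matrix_vector_mult_add_rdistrib matrix_vector_mult_diff_rdistrib outer_mult nn inner_commute)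
    moreover from this have "R A = M" by (simp add: R_def A_def)
    ultimately have "q = \<phi> A" by (simp add: \<phi>_def aM(4))
    moreover have "A \<in> skew_matrices" unfolding A_def by (intro subspace_add[OF subspace_skew] aM(2) outer_skew)
    ultimately show "q \<in> \<phi> ` skew_matrices" by blast
  qed
  have ker: "A = 0" if A: "A \<in> skew_matrices" and z: "\<phi> A = 0" for A
  proof -
    have zx: "A *v n + R A *v ?t x = 0" if "x \<in> ?F" for x
      using fun_cong[OF z, of x] that by (simp add: \<phi>_def on_set_def)
    \<comment> \<open>Comparing the motion at two vertices eliminates the translation. The
      differences of facet vertices span the tangent space, so \<open>R A\<close> vanishes, and then
      the translation does as well.\<close>
    have tdiff: "R A *v (w - b) = 0" if wb: "w \<in> C - {v}" "b \<in> C - {v}" for w b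
    proof -
      have "n \<bullet> (w - b) = 0" using g_edge[OF v, of w b] wb by (auto simp: al(2))
      then have "?t w - ?t b = w - b" by (simp add: tangential_part_def inner_diff_right algebra_simps)
      moreover have "R A *v (?t w - ?t b) = 0"
        using zx[OF facet_vertex[OF wb(1)]] zx[OF facet_vertex[OF wb(2)]]
        by (simp add: matrix_vector_mult_diff_distrib eq_neg_iff_add_eq_0[symmetric] add_eq_0_iff)
      ultimately show ?thesis by simp
    qed
    have "card (C - {v}) \<noteq> 0" using card_facet[OF v] by simp
    then obtain b where b: "b \<in> C - {v}" by (metis card.empty ex_in_conv)
    have "R A *v y = 0" for y
    proof -
      let ?y = "?t y"
      have gy: "g v \<bullet> ?y = 0" using tangential_part_normal[OF n1, of y] al by simp
      have "?y = (\<Sum>w\<in>C. (g w \<bullet> ?y) *\<^sub>R w) - (\<Sum>w\<in>C. g w \<bullet> ?y) *\<^sub>R b" by (simp add: g_repr sum_g_inner)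
      also have "\<dots> = (\<Sum>w\<in>C. (g w \<bullet> ?y) *\<^sub>R (w - b))"
        by (simp add: scaleR_diff_right sum_subtractf scaleR_sum_left)
      finally have "R A *v ?y = (\<Sum>w\<in>C. (g w \<bullet> ?y) *\<^sub>R (R A *v (w - b)))"
        by (metis (no_types, lifting) linear_sum[OF matrix_vector_mul_linear] matrix_vector_mult_scaleR sum.cong)
      also have "\<dots> = 0"
      proof (rule sum.neutral, rule ballI)
        fix w assume "w \<in> C"
        then show "(g w \<bullet> ?y) *\<^sub>R (R A *v (w - b)) = 0"
          using gy tdiff[OF _ b, of w] by (cases "w = v") auto
      qed
      finally have "R A *v ?y = 0" .
      moreover have "y = ?y + (n \<bullet> y) *\<^sub>R n" by (simp add: tangential_part_def)
      ultimately show ?thesis using R_skew(2)[OF A]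
        by (metis (no_types, lifting) add.right_neutral matrix_vector_mult_scaleR matrix_vector_right_distrib scale_zero_right)
    qed
    then have RA: "R A = 0" by (simp add: matrix_eq)
    then have "A *v n = 0" using zx[OF facet_vertex[OF b]] by simp
    then show ?thesis using RA by (simp add: R_def)
  qed
  have "inj_on \<phi> skew_matrices"
    unfolding linear_inj_on_iff_eq_0[OF lin subspace_skew] using ker by blast
  from is_basis_image[OF subspace_skew lin this] show ?thesis
    using B im unfolding n_def by simp
qed

lemma card_dofs:
  assumes BS: "is_basis B\<^sub>S sym_matrices"
    and BP: "\<And>F. F \<in> subsimplices (CARD('n) - 1) K \<Longrightarrow> is_basis (B\<^sub>P F) (polys_on F 1 UNIV)"
    and BN: "\<And>F. F \<in> subsimplices (CARD('n) - 1) K \<Longrightarrow> is_basis (B\<^sub>N F) (ND 0 (\<nu> F 1) F)"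
  shows "finite (dofs K B\<^sub>S B\<^sub>P B\<^sub>N) \<and> card (dofs K B\<^sub>S B\<^sub>P B\<^sub>N) =
    (CARD('n) + 1) * (dim (sym_matrices :: (real^'n^'n) set) + CARD('n) + dim (skew_matrices :: (real^'n^'n) set))"
proof -
  let ?V = "(\<lambda>(v, S). Vertex v S) ` (C \<times> B\<^sub>S)"
  let ?N = "(\<lambda>(v, q). Normal (facet v) q) ` (SIGMA v:C. B\<^sub>P (facet v))"
  let ?T = "(\<lambda>(v, q). Tangential (facet v) q) ` (SIGMA v:C. B\<^sub>N (facet v))"
  have eq: "dofs K B\<^sub>S B\<^sub>P B\<^sub>N = ?V \<union> ?N \<union> ?T"
    unfolding dofs_def facets_eq subsimplices_0 by (auto simp: image_iff)
  have S: "finite B\<^sub>S" "card B\<^sub>S = dim (sym_matrices :: (real^'n^'n) set)"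
    using is_basis_euclidean[OF subspace_sym BS] by auto
  have P: "finite (B\<^sub>P (facet v))" "card (B\<^sub>P (facet v)) = CARD('n)" if "v \<in> C" for v
    using card_polys_on_facet[OF that BP[OF facet_in[OF that]]] by auto
  have N: "finite (B\<^sub>N (facet v))" "card (B\<^sub>N (facet v)) = dim (skew_matrices :: (real^'n^'n) set)" if "v \<in> C" for v
    using card_ND_0[OF that BN[OF facet_in[OF that]]] by auto
  have fin: "finite ?V" "finite ?N" "finite ?T" using finC S P N by auto
  have "card ?V = (CARD('n) + 1) * dim (sym_matrices :: (real^'n^'n) set)"
    by (subst card_image) (auto simp: inj_on_def S cardC card_cartesian_product)
  moreover have "card ?N = (CARD('n) + 1) * CARD('n)"
  proof -
    have "inj_on (\<lambda>(v, q). Normal (facet v) q) (SIGMA v:C. B\<^sub>P (facet v))"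
      using facet_inj by (auto simp: inj_on_def)
    then have "card ?N = card (SIGMA v:C. B\<^sub>P (facet v))" by (rule card_image)
    then show ?thesis using P finC cardC by (simp add: card_SigmaI)
  qed
  moreover have "card ?T = (CARD('n) + 1) * dim (skew_matrices :: (real^'n^'n) set)"
  proof -
    have "inj_on (\<lambda>(v, q). Tangential (facet v) q) (SIGMA v:C. B\<^sub>N (facet v))"
      using facet_inj by (auto simp: inj_on_def)
    then have "card ?T = card (SIGMA v:C. B\<^sub>N (facet v))" by (rule card_image)
    then show ?thesis using N finC cardC by (simp add: card_SigmaI)
  qed
  moreover have "?V \<inter> ?N = {}" "(?V \<union> ?N) \<inter> ?T = {}" by auto
  ultimately show ?thesis
    unfolding eq using fin by (simp add: card_Un_disjoint algebra_simps)
qed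

end

subsection \<open>The dimension count\<close>

lemma subspace_polys_on: "subspace X \<Longrightarrow> subspace (polys_on D k X)"
  unfolding polys_on_def
  by (rule linear_subspace_image[OF linearI subspace_polys])
    (simp_all only: on_set_add on_set_scale, simp_all only: add_fun_eq scaleR_fun_eq)

lemma subspace_kernel_family:
  assumes V: "subspace V" and M: "\<And>m. m \<in> M \<Longrightarrow> linear_on_sub V m"
  shows "subspace {u \<in> V. \<forall>m\<in>M. m u = 0}"
proof -
  have "{u \<in> V. \<forall>m\<in>M. m u = 0} = V \<inter> (\<Inter>m\<in>M. {u \<in> V. m u = 0})" by auto
  moreover have "subspace (V \<inter> (\<Inter>m\<in>M. {u \<in> V. m u = 0}))"
    by (intro subspace_inter V subspace_Int subspace_kernel M)
  ultimately show ?thesis by simp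
qed

lemma continuous_hom_polys:
  assumes "W \<in> hom_polys k X" shows "continuous_on S (W :: real^'n \<Rightarrow> 'b::real_normed_vector)"
proof -
  obtain c where "W = (\<lambda>x. \<Sum>\<alpha> | sum \<alpha> UNIV = k. monomial \<alpha> x *\<^sub>R c \<alpha>)"
    using assms unfolding hom_polys_def by blast
  then show ?thesis unfolding monomial_def by (auto intro!: continuous_intros)
qed

lemma continuous_tangential: "continuous_on S f \<Longrightarrow> continuous_on S (\<lambda>x. tangential_part n (f x))"
  unfolding tangential_part_def by (intro continuous_intros)

lemma continuous_matrix_vector:
  fixes A :: "'a::topological_space \<Rightarrow> real^'n^'m"
  assumes "continuous_on S A" "continuous_on S f"
  shows "continuous_on S (\<lambda>x. A x *v f x)"
proof -
  have "continuous_on S (\<lambda>x. A x $ i $ j)" for i j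
    by (intro bounded_linear.continuous_on[OF bounded_linear_vec_nth] assms)
  moreover have "continuous_on S (\<lambda>x. f x $ j)" for j
    by (intro bounded_linear.continuous_on[OF bounded_linear_vec_nth] assms)
  ultimately show ?thesis
    unfolding matrix_vector_mult_def by (intro continuous_on_vec_lambda continuous_on_sum continuous_on_mult)
qed

lemma ND_continuous:
  fixes F :: "(real^'n) set"
  assumes "q \<in> ND k n F" shows "\<exists>q'. continuous_on UNIV q' \<and> q = on_set F q'"
proof -
  obtain p W where q: "q = on_set F (\<lambda>x. p x + W (tangential_part n x) *v tangential_part n x)"
    and p: "p \<in> polys k {v. n \<bullet> v = 0}" and W: "W \<in> hom_polys k {A \<in> skew_matrices. A *v n = 0}"
    using assms unfolding ND_def by blast
  have "continuous_on UNIV (\<lambda>x. W (tangential_part n x))"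
    by (rule continuous_on_compose2[OF continuous_hom_polys[OF W, of UNIV]])
      (auto intro: continuous_tangential)
  then have "continuous_on UNIV (\<lambda>x. p x + W (tangential_part n x) *v tangential_part n x)"
    by (intro continuous_on_add continuous_on_polys[OF p subspace_hyperplane] continuous_matrix_vector continuous_tangential continuous_on_id)
  then show ?thesis using q by blast
qed

lemma polys_on_continuous:
  fixes q :: "real^'n \<Rightarrow> real"
  assumes "q \<in> polys_on F k UNIV" shows "\<exists>q'. continuous_on UNIV q' \<and> q = on_set F q'"
  using assms continuous_on_rpoly unfolding polys_on_def by blast

lemma linear_on_subI:
  assumes "\<And>u v. u \<in> V \<Longrightarrow> v \<in> V \<Longrightarrow> m (\<lambda>x. u x + v x) = m u + (m v :: real)"
    and "\<And>r u. u \<in> V \<Longrightarrow> m (\<lambda>x. r *\<^sub>R u x) = r * m u"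
  shows "linear_on_sub V m"
  unfolding linear_on_sub_def add_fun_eq scaleR_fun_eq using assms by blast

text \<open>For a field of degree one the symmetric gradient is constant, so one symmetric matrix
  decides membership in \<open>RM\<close>. This limits the number of relaxed conditions to the
  dimension of the symmetric matrices.\<close>

lemma sgrad_zero_at:
  fixes q :: "real^'n \<Rightarrow> real^'n"
  assumes q: "q \<in> polys 1 UNIV" and z: "sgrad q 0 = 0" shows "q \<in> RM"
proof -
  have "sgrad q \<in> polys 0 sym_matrices" using sgrad_polys[of q 0] q by simp
  then obtain A where A: "sgrad q = (\<lambda>_. A)" by (auto simp: polys_0 hom_polys_0)
  then have "A = 0" using z by (simp add: A)
  then show ?thesis using sgrad_zero[OF q] A by simp
qed

lemma symmetrized_outer_eq_0:
  assumes "outer t a + outer a t = 0" "t \<noteq> 0" shows "a = 0"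
proof -
  have "(outer t a + outer a t) *v t = 0" using assms(1) by simp
  then have e: "(a \<bullet> t) *\<^sub>R t + (t \<bullet> t) *\<^sub>R a = 0" by (simp add: matrix_vector_mult_add_rdistrib outer_mult)
  have "t \<bullet> ((a \<bullet> t) *\<^sub>R t + (t \<bullet> t) *\<^sub>R a) = 0" using e by simp
  then have "2 * ((a \<bullet> t) * (t \<bullet> t)) = 0" by (simp add: inner_add_right inner_commute mult.commute)
  then have "a \<bullet> t = 0" using assms(2) by simp
  then show ?thesis using e assms(2) by simp
qed

section \<open>Linearity of the moments; the bubbles form a subspace\<close>

context framed_simplex
begin

lemma facet_nonempty: "v \<in> C \<Longrightarrow> C - {v} \<noteq> {}"
  using card_facet[of v] card.empty[where 'a="real^'n"] zero_less_card_finite[where 'a='n] by (metis less_irrefl)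

lemma continuous_trace: "\<tau> \<in> polys k sym_matrices \<Longrightarrow> continuous_on S (\<lambda>x. \<tau> x *v m)"
  by (intro continuous_matrix_vector continuous_on_polys[OF _ subspace_sym] continuous_on_const)

lemma linear_nn_moment:
  fixes n m :: "real^'n"
  assumes c: "c \<subseteq> C" "c \<noteq> {}" and q: "q \<in> polys_on (convex hull c) l UNIV"
  shows "linear_on_sub (polys k sym_matrices) (\<lambda>\<tau>. inner_face (convex hull c) (\<lambda>x. n \<bullet> (\<tau> x *v m)) q)"
proof -
  obtain q' where q': "continuous_on UNIV q'" "q = on_set (convex hull c) q'" using polys_on_continuous[OF q] by blast
  show ?thesis
    unfolding q'(2) L2_inner_on_set
  proof (rule linear_on_subI)
    fix u v :: "real^'n \<Rightarrow> real^'n^'n" assume "u \<in> polys k sym_matrices" "v \<in> polys k sym_matrices"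
    then show "inner_face (convex hull c) (\<lambda>x. n \<bullet> ((u x + v x) *v m)) q' =
       inner_face (convex hull c) (\<lambda>x. n \<bullet> (u x *v m)) q' + inner_face (convex hull c) (\<lambda>x. n \<bullet> (v x *v m)) q'"
      unfolding matrix_vector_mult_add_rdistrib inner_add_right
      by (intro L2_inner_add charges_face c q'(1) continuous_on_inner continuous_on_const continuous_trace)
  next
    fix r and u :: "real^'n \<Rightarrow> real^'n^'n"
    show "inner_face (convex hull c) (\<lambda>x. n \<bullet> ((r *\<^sub>R u x) *v m)) q' = r * inner_face (convex hull c) (\<lambda>x. n \<bullet> (u x *v m)) q'"
      using L2_inner_scale[of _ _ r "\<lambda>x. n \<bullet> (u x *v m)" q'] by (simp add: scaleR_matrix_vector_assoc[symmetric])
  qed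
qed

lemma linear_tangential_moment:
  fixes n :: "real^'n"
  assumes c: "c \<subseteq> C" "c \<noteq> {}" and q: "q \<in> ND l n (convex hull c)"
  shows "linear_on_sub (polys k sym_matrices) (\<lambda>\<tau>. inner_face (convex hull c) (\<lambda>x. tangential_part n (\<tau> x *v n)) q)"
proof -
  obtain q' where q': "continuous_on UNIV q'" "q = on_set (convex hull c) q'" using ND_continuous[OF q] by blast
  have t: "tangential_part n (a + b) = tangential_part n a + tangential_part n b"
    "tangential_part n (r *\<^sub>R a) = r *\<^sub>R tangential_part n a" for a b r
    by (simp_all add: tangential_part_def inner_add_right algebra_simps)
  show ?thesis
    unfolding q'(2) L2_inner_on_set
  proof (rule linear_on_subI)
    fix u v :: "real^'n \<Rightarrow> real^'n^'n" assume "u \<in> polys k sym_matrices" "v \<in> polys k sym_matrices"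
    then show "inner_face (convex hull c) (\<lambda>x. tangential_part n ((u x + v x) *v n)) q' =
       inner_face (convex hull c) (\<lambda>x. tangential_part n (u x *v n)) q' + inner_face (convex hull c) (\<lambda>x. tangential_part n (v x *v n)) q'"
      unfolding matrix_vector_mult_add_rdistrib t
      by (intro L2_inner_add charges_face c q'(1) continuous_tangential continuous_trace)
  next
    fix r and u :: "real^'n \<Rightarrow> real^'n^'n"
    show "inner_face (convex hull c) (\<lambda>x. tangential_part n ((r *\<^sub>R u x) *v n)) q' =
        r * inner_face (convex hull c) (\<lambda>x. tangential_part n (u x *v n)) q'"
      unfolding scaleR_matrix_vector_assoc[symmetric] t by (rule L2_inner_scale)
  qed
qed

lemma linear_div_moment:
  assumes q: "q \<in> polys l UNIV"
  shows "linear_on_sub (polys (Suc k) sym_matrices) (\<lambda>\<tau>. inner_cell K (div_rows \<tau>) q)"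
proof (rule linear_on_subI)
  fix u v :: "real^'n \<Rightarrow> real^'n^'n" assume "u \<in> polys (Suc k) sym_matrices" "v \<in> polys (Suc k) sym_matrices"
  then have uv: "u \<in> polys (Suc k) UNIV" "v \<in> polys (Suc k) UNIV" using polys_UNIV by auto
  have "div_rows (\<lambda>x. u x + v x) = (\<lambda>x. div_rows u x + div_rows v x)" using div_add[OF uv] by auto
  then show "inner_cell K (div_rows (\<lambda>x. u x + v x)) q = inner_cell K (div_rows u) q + inner_cell K (div_rows v) q"
    using L2_K_add[OF div_polys[OF uv(1)] div_polys[OF uv(2)] q] by simp
next
  fix r and u :: "real^'n \<Rightarrow> real^'n^'n" assume "u \<in> polys (Suc k) sym_matrices"
  then have "div_rows (\<lambda>x. r *\<^sub>R u x) = (\<lambda>x. r *\<^sub>R div_rows u x)" using div_scale[OF polys_UNIV] by blast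
  then show "inner_cell K (div_rows (\<lambda>x. r *\<^sub>R u x)) q = r * inner_cell K (div_rows u) q" by (simp add: L2_inner_scale)
qed

lemma linear_cell_moment:
  assumes q: "q \<in> polys l sym_matrices"
  shows "linear_on_sub (polys k sym_matrices) (\<lambda>\<tau>. inner_cell K \<tau> q)"
  by (rule linear_on_subI) (auto intro!: L2_K_add polys_UNIV q simp: L2_inner_scale)

text \<open>The bubbles are exhibited as the common kernel of all functionals that are linear on the
  polynomial space and vanish on bubbles: every defining condition is, or reduces to, such a
  functional, and common kernels are subspaces.\<close>

lemma subspace_bubbles: "subspace (nn_bubbles K \<nu>)"
proof -
  let ?V = "polys (CARD('n) + 1) sym_matrices :: (real^'n \<Rightarrow> real^'n^'n) set"
  let ?M = "{m. linear_on_sub ?V m \<and> (\<forall>\<tau>\<in>nn_bubbles K \<nu>. m \<tau> = 0)}"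
  have "nn_bubbles K \<nu> = {\<tau> \<in> ?V. \<forall>m\<in>?M. m \<tau> = 0}"
  proof (intro subset_antisym subsetI)
    fix \<tau> assume "\<tau> \<in> {\<tau> \<in> ?V. \<forall>m\<in>?M. m \<tau> = 0}"
    then have t: "\<tau> \<in> ?V" and M: "\<And>m. linear_on_sub ?V m \<Longrightarrow> (\<And>\<tau>. \<tau> \<in> nn_bubbles K \<nu> \<Longrightarrow> m \<tau> = 0) \<Longrightarrow> m \<tau> = 0" by auto
    show "\<tau> \<in> nn_bubbles K \<nu>"
      unfolding nn_bubbles_def
    proof (intro CollectI conjI allI ballI impI)
      show "\<tau> \<in> ?V" by (rule t)
      fix v assume v: "{v} \<in> subsimplices 0 K"
      \<comment> \<open>The matrix-valued condition becomes a single scalar functional by pairing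
        with the value \<open>\<tau> v\<close> itself.\<close>
      have "\<tau> v \<bullet> \<tau> v = 0"
      proof (rule M[of "\<lambda>\<sigma>. \<sigma> v \<bullet> \<tau> v"])
        show "linear_on_sub ?V (\<lambda>\<sigma>. \<sigma> v \<bullet> \<tau> v)" by (rule linear_on_subI) (auto simp: inner_add_left)
        show "\<sigma> v \<bullet> \<tau> v = 0" if "\<sigma> \<in> nn_bubbles K \<nu>" for \<sigma> using that v by (simp add: nn_bubbles_def)
      qed
      then show "\<tau> v = 0" by simp
    next
      fix r f i j q
      assume r: "r \<in> {1..CARD('n) - 2}" and f: "f \<in> subsimplices r K" and ij: "1 \<le> i \<and> i \<le> j \<and> j \<le> CARD('n) - r"
        and q: "q \<in> polys_on f (CARD('n) - r) (UNIV :: real set)"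
      obtain c where c: "f = convex hull c" "c \<subseteq> C" "card c = r + 1" using f by (auto simp: subsimplices_eq)
      have "c \<noteq> {}" using c(3) by auto
      show "inner_face f (\<lambda>x. \<nu> f i \<bullet> (\<tau> x *v \<nu> f j)) q = 0"
      proof (rule M[of "\<lambda>\<tau>. inner_face f (\<lambda>x. \<nu> f i \<bullet> (\<tau> x *v \<nu> f j)) q"])
        show "linear_on_sub ?V (\<lambda>\<tau>. inner_face f (\<lambda>x. \<nu> f i \<bullet> (\<tau> x *v \<nu> f j)) q)"
          using q unfolding c(1) by (rule linear_nn_moment[OF c(2) \<open>c \<noteq> {}\<close>])
        show "inner_face f (\<lambda>x. \<nu> f i \<bullet> (\<sigma> x *v \<nu> f j)) q = 0" if "\<sigma> \<in> nn_bubbles K \<nu>" for \<sigma>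
          using that r f ij q unfolding nn_bubbles_def by blast
      qed
    next
      fix F q assume F: "F \<in> subsimplices (CARD('n) - 1) K" and q: "q \<in> ND (CARD('n) - 1) (\<nu> F 1) F"
      obtain v where v: "v \<in> C" "F = facet v" using F unfolding facets_eq by blast
      have c: "C - {v} \<subseteq> C" "C - {v} \<noteq> {}" using facet_nonempty[OF v(1)] by auto
      show "inner_face F (\<lambda>x. tangential_part (\<nu> F 1) (\<tau> x *v \<nu> F 1)) q = 0"
      proof (rule M[of "\<lambda>\<tau>. inner_face F (\<lambda>x. tangential_part (\<nu> F 1) (\<tau> x *v \<nu> F 1)) q"])
        show "linear_on_sub ?V (\<lambda>\<tau>. inner_face F (\<lambda>x. tangential_part (\<nu> F 1) (\<tau> x *v \<nu> F 1)) q)"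
          using q unfolding v(2) by (rule linear_tangential_moment[OF c])
        show "inner_face F (\<lambda>x. tangential_part (\<nu> F 1) (\<sigma> x *v \<nu> F 1)) q = 0" if "\<sigma> \<in> nn_bubbles K \<nu>" for \<sigma>
          using that F q unfolding nn_bubbles_def by blast
      qed
    next
      fix q assume q: "q \<in> polys_mod_RM K (CARD('n))"
      then have qp: "q \<in> polys (CARD('n)) UNIV" by (simp add: polys_mod_RM_def)
      show "inner_cell K (div_rows \<tau>) q = 0"
      proof (rule M[of "\<lambda>\<tau>. inner_cell K (div_rows \<tau>) q"])
        show "linear_on_sub ?V (\<lambda>\<tau>. inner_cell K (div_rows \<tau>) q)" using linear_div_moment[OF qp, of "CARD('n)"] by simp
        show "inner_cell K (div_rows \<sigma>) q = 0" if "\<sigma> \<in> nn_bubbles K \<nu>" for \<sigma>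
          using that q unfolding nn_bubbles_def by blast
      qed
    next
      fix q :: "real^'n \<Rightarrow> real^'n^'n" assume q: "q \<in> polys (CARD('n) - 1) sym_matrices" "\<forall>x. q x *v x = 0"
      show "inner_cell K \<tau> q = 0"
      proof (rule M[of "\<lambda>\<tau>. inner_cell K \<tau> q"])
        show "linear_on_sub ?V (\<lambda>\<tau>. inner_cell K \<tau> q)" by (rule linear_cell_moment[OF q(1)])
        show "inner_cell K \<sigma> q = 0" if "\<sigma> \<in> nn_bubbles K \<nu>" for \<sigma>
          using that q unfolding nn_bubbles_def by blast
      qed
    qed
  qed (use bubble_polys in blast)
  moreover have "subspace {\<tau> \<in> ?V. \<forall>m\<in>?M. m \<tau> = 0}"
    by (rule subspace_kernel_family[OF subspace_polys[OF subspace_sym]]) blast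
  ultimately show ?thesis by simp
qed

section \<open>The relaxed space\<close>

lemma Sigma_polys: "\<tau> \<in> Sigma_space K \<nu> \<Longrightarrow> \<tau> \<in> polys (CARD('n) + 1) sym_matrices"
proof -
  assume "\<tau> \<in> Sigma_space K \<nu>"
  then obtain \<sigma> \<beta> where s: "\<tau> = \<sigma> + \<beta>" "\<sigma> \<in> polys 2 sym_matrices" "\<beta> \<in> nn_bubbles K \<nu>"
    unfolding Sigma_space_def by blast
  have "\<sigma> \<in> polys (CARD('n) + 1) sym_matrices"
    using d3 by (intro polys_mono[OF subspace_sym s(2)]) simp
  then show ?thesis unfolding s(1) add_fun_eq by (intro polys_add[OF subspace_sym] bubble_polys[OF s(3)])
qed

lemma Sigma_quadratic: "\<sigma> \<in> polys 2 sym_matrices \<Longrightarrow> \<sigma> \<in> Sigma_space K \<nu>"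
  unfolding Sigma_space_def using subspace_0[OF subspace_bubbles]
  by (intro CollectI exI[of _ \<sigma>] exI[of _ 0]) simp

lemma Sigma_bubble: "\<beta> \<in> nn_bubbles K \<nu> \<Longrightarrow> \<beta> \<in> Sigma_space K \<nu>"
  unfolding Sigma_space_def using subspace_0[OF subspace_polys[OF subspace_sym]]
  by (intro CollectI exI[of _ 0] exI[of _ \<beta>]) simp

text \<open>Quadratic fields have divergence of degree one automatically, and for bubbles it even
  lies in \<open>RM\<close>. So members are easy to exhibit: only the traces on edges need
  attention.\<close>

definition U :: "(real^'n \<Rightarrow> real^'n^'n) set" where
  "U = {\<tau> \<in> Sigma_space K \<nu>. edge_linear \<tau> \<and> div_rows \<tau> \<in> polys 1 UNIV}"

lemma U_polys: "\<tau> \<in> U \<Longrightarrow> \<tau> \<in> polys (CARD('n) + 1) UNIV"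
  using polys_UNIV[OF Sigma_polys] by (simp add: U_def)

lemma subspace_U: "subspace U"
proof -
  have S: "subspace (Sigma_space K \<nu>)"
    unfolding Sigma_space_def by (rule subspace_sums[OF subspace_polys[OF subspace_sym] subspace_bubbles])
  show ?thesis
    unfolding subspace_def
  proof safe
    have "on_set e (\<lambda>x. 0) \<in> polys_on e 1 (UNIV :: real set)" for e :: "(real^'n) set"
      unfolding polys_on_def by (intro imageI rpoly_const)
    then have "edge_linear 0" by (simp add: edge_linear_def)
    moreover have "div_rows (0 :: real^'n \<Rightarrow> real^'n^'n) = (\<lambda>x. 0)"
    proof
      fix x
      have "div_rows (\<lambda>x. 0 *\<^sub>R 0) x = 0 *\<^sub>R div_rows (\<lambda>x. 0 :: real^'n^'n) (x :: real^'n)"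
        by (rule div_scale[OF polys_const[of UNIV _ 0]]) auto
      then show "div_rows (0 :: real^'n \<Rightarrow> real^'n^'n) x = 0" by (simp add: zero_fun_eq)
    qed
    ultimately show "0 \<in> U" using subspace_0[OF S] by (simp add: U_def polys_const)
  next
    fix u v and r :: real assume u: "u \<in> U"
    have pe: "subspace (polys_on e 1 (UNIV :: real set))" for e :: "(real^'n) set" by (rule subspace_polys_on) simp
    have up: "u \<in> polys (CARD('n) + 1) UNIV" by (rule U_polys[OF u])
    have "on_set e (\<lambda>x. n \<bullet> ((r *\<^sub>R u) x *v m)) = r *\<^sub>R on_set e (\<lambda>x. n \<bullet> (u x *v m))" for e n m
      unfolding on_set_scale by (simp add: scaleR_fun_eq scaleR_matrix_vector_assoc[symmetric])
    then have "edge_linear (r *\<^sub>R u)"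
      using u subspace_scale[OF pe] unfolding U_def edge_linear_def by simp
    moreover have "div_rows (r *\<^sub>R u) = (\<lambda>x. r *\<^sub>R div_rows u x)"
      unfolding scaleR_fun_eq using div_scale[OF up] by auto
    then have "div_rows (r *\<^sub>R u) \<in> polys 1 UNIV"
      using u polys_scaleR[OF subspace_UNIV, of "div_rows u"] by (simp add: U_def)
    ultimately show "r *\<^sub>R u \<in> U" using u subspace_scale[OF S] by (simp add: U_def)
    assume v: "v \<in> U"
    have vp: "v \<in> polys (CARD('n) + 1) UNIV" by (rule U_polys[OF v])
    have "on_set e (\<lambda>x. n \<bullet> ((u + v) x *v m)) = on_set e (\<lambda>x. n \<bullet> (u x *v m)) + on_set e (\<lambda>x. n \<bullet> (v x *v m))" for e n m
      unfolding on_set_add by (simp add: add_fun_eq matrix_vector_mult_add_rdistrib inner_add_right)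
    then have "edge_linear (u + v)"
      using u v subspace_add[OF pe] unfolding U_def edge_linear_def by simp
    moreover have "div_rows (u + v) = (\<lambda>x. div_rows u x + div_rows v x)"
      unfolding add_fun_eq using div_add[OF up vp] by auto
    then have "div_rows (u + v) \<in> polys 1 UNIV"
      using u v polys_add[OF subspace_UNIV, of "div_rows u" 1 "div_rows v"] by (simp add: U_def)
    ultimately show "u + v \<in> U" using u v subspace_add[OF S] by (simp add: U_def)
  qed
qed

lemma bubble_U: "\<beta> \<in> nn_bubbles K \<nu> \<Longrightarrow> \<beta> \<in> U"
proof -
  assume b: "\<beta> \<in> nn_bubbles K \<nu>"
  have "on_set e (\<lambda>x. \<nu> e i \<bullet> (\<beta> x *v \<nu> e j)) \<in> polys_on e 1 UNIV"
    if e: "e \<in> subsimplices 1 K" and ij: "1 \<le> i" "i \<le> j" "j \<le> CARD('n) - 1" for e i j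
  proof -
    obtain c where c: "e = convex hull c" "c \<subseteq> C" "card c = 1 + 1" using e by (auto simp: subsimplices_eq)
    have "\<nu> e i \<in> Nrm c" "\<nu> e j \<in> Nrm c" unfolding c(1) using frame_Nrm[OF c(2,3)] ij by auto
    then have "\<nu> e i \<bullet> (\<beta> x *v \<nu> e j) = 0" if "x \<in> e" for x
      using that c by (intro bubble_edges[OF b c(2)]) (auto simp: conv_eq)
    then have "on_set e (\<lambda>x. \<nu> e i \<bullet> (\<beta> x *v \<nu> e j)) = on_set e (\<lambda>x. 0)" by (auto simp: on_set_def)
    then show ?thesis unfolding polys_on_def using rpoly_const[of "0::real" 1] by auto
  qed
  then show ?thesis
    using Sigma_bubble[OF b] RM_polys[OF bubble_div_RM[OF b]] by (simp add: U_def edge_linear_def)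
qed

lemma quadratic_U:
  assumes s: "\<sigma> \<in> polys 2 sym_matrices"
    and e: "\<And>c n m. c \<subseteq> C \<Longrightarrow> card c = 2 \<Longrightarrow> n \<in> Nrm c \<Longrightarrow> m \<in> Nrm c \<Longrightarrow> \<exists>p\<in>rpoly 1. \<forall>x\<in>aff c. n \<bullet> (\<sigma> x *v m) = p x"
  shows "\<sigma> \<in> U"
proof -
  have "on_set e (\<lambda>x. \<nu> e i \<bullet> (\<sigma> x *v \<nu> e j)) \<in> polys_on e 1 UNIV"
    if e': "e \<in> subsimplices 1 K" and ij: "1 \<le> i" "i \<le> j" "j \<le> CARD('n) - 1" for e i j
  proof -
    obtain c where c: "e = convex hull c" "c \<subseteq> C" "card c = 1 + 1" using e' by (auto simp: subsimplices_eq)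
    have N: "\<nu> e i \<in> Nrm c" "\<nu> e j \<in> Nrm c" unfolding c(1) using frame_Nrm[OF c(2,3)] ij by auto
    have "card c = 2" using c(3) by simp
    from e[OF c(2) this N] obtain p where p: "p \<in> rpoly 1" "\<forall>x\<in>aff c. \<nu> e i \<bullet> (\<sigma> x *v \<nu> e j) = p x" by blast
    then have "on_set e (\<lambda>x. \<nu> e i \<bullet> (\<sigma> x *v \<nu> e j)) = on_set e p" using c by (auto simp: on_set_def conv_eq)
    then show ?thesis unfolding polys_on_def using p(1) by auto
  qed
  moreover have "div_rows \<sigma> \<in> polys 1 UNIV"
    using div_polys[of \<sigma> 1] polys_UNIV[OF s] by (simp add: numeral_2_eq_2)
  ultimately show ?thesis using Sigma_quadratic[OF s] by (simp add: U_def edge_linear_def)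
qed

section \<open>Counting edges and the lower bound for the dimension\<close>

lemma edges_exist:
  "\<exists>E \<subseteq> C \<times> C. (\<forall>v w. (v, w) \<in> E \<longrightarrow> v \<noteq> w \<and> (w, v) \<notin> E) \<and> 2 * card E = CARD('n) * (CARD('n) + 1)"
proof -
  \<comment> \<open>An arbitrary numbering of the vertices orients every edge once; the ordered
    pairs then split into \<open>E\<close>, its reversal and the diagonal.\<close>
  obtain i :: "real^'n \<Rightarrow> nat" where i: "inj_on i C" using finite_imp_inj_to_nat_seg[OF finC] by auto
  define E where "E = {(v, w). v \<in> C \<and> w \<in> C \<and> i v < i w}"
  have sub: "E \<subseteq> C \<times> C" by (auto simp: E_def)
  have fin: "finite E" using sub finC finite_subset by blast
  have ne: "v \<noteq> w \<and> (w, v) \<notin> E" if "(v, w) \<in> E" for v w using that by (auto simp: E_def)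
  have part: "C \<times> C = (E \<union> prod.swap ` E) \<union> (\<lambda>v. (v, v)) ` C"
  proof (intro set_eqI iffI)
    fix e assume e: "e \<in> C \<times> C"
    obtain v w where vw: "e = (v, w)" "v \<in> C" "w \<in> C" using e by auto
    consider "i v < i w" | "i w < i v" | "i v = i w" by linarith
    then show "e \<in> (E \<union> prod.swap ` E) \<union> (\<lambda>v. (v, v)) ` C"
    proof cases
      case 1
      then show ?thesis using vw by (simp add: E_def)
    next
      case 2
      then have "(w, v) \<in> E" using vw by (simp add: E_def)
      then have "prod.swap (w, v) \<in> prod.swap ` E" by (rule imageI)
      then show ?thesis using vw by simp
    next
      case 3
      then have "v = w" using inj_onD[OF i] vw by blast
      then show ?thesis using vw by blast
    qed
  qed (use sub in auto)
  have "card (C \<times> C) = card (E \<union> prod.swap ` E) + card ((\<lambda>v. (v, v)) ` C)"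
    unfolding part using ne fin finC by (intro card_Un_disjoint) auto
  also have "card (E \<union> prod.swap ` E) = card E + card (prod.swap ` E)"
    using ne fin by (intro card_Un_disjoint) auto
  also have "card (prod.swap ` E) = card E" by (intro card_image inj_on_subset[OF inj_swap]) auto
  also have "card ((\<lambda>v. (v, v)) ` C) = card C" by (intro card_image) (auto simp: inj_on_def)
  finally have "(CARD('n) + 1) * (CARD('n) + 1) = 2 * card E + (CARD('n) + 1)"
    by (simp add: card_cartesian_product cardC)
  then have "2 * card E = CARD('n) * (CARD('n) + 1)" by (simp add: algebra_simps)
  then show ?thesis using sub ne by blast
qed

text \<open>The form sending \<open>A\<close> to \<open>g v \<bullet> (A *v g w)\<close> takes the
  value -1 on the rank-one tensor of the edge \<open>(v, w)\<close> and 0 on those of the other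
  edges in \<open>E\<close>, so these tensors are independent.\<close>

lemma card_edges_le_dim_sym:
  assumes E: "E \<subseteq> C \<times> C" "\<And>v w. (v, w) \<in> E \<Longrightarrow> v \<noteq> w \<and> (w, v) \<notin> E"
  shows "card E \<le> dim (sym_matrices :: (real^'n^'n) set)"
proof -
  have fin: "finite E" using E(1) finC finite_subset by blast
  let ?y = "\<lambda>e. outer (snd e - fst e) (snd e - fst e) :: real^'n^'n"
  have "inj_on ?y E \<and> independent (?y ` E)"
  proof (rule independent_family[OF fin])
    fix c e0 assume s: "(\<Sum>e\<in>E. c e *\<^sub>R ?y e) = 0" and e0: "e0 \<in> E"
    obtain v w where vw: "e0 = (v, w)" by (cases e0)
    have vwC: "v \<in> C" "w \<in> C" "v \<noteq> w" "(w, v) \<notin> E" using e0 E vw by auto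
    have "0 = g v \<bullet> ((\<Sum>e\<in>E. c e *\<^sub>R ?y e) *v g w)" unfolding s by simp
    also have "\<dots> = (\<Sum>e\<in>E. c e * ((g w \<bullet> (snd e - fst e)) * (g v \<bullet> (snd e - fst e))))"
      by (simp add: sum_matrix_mult inner_sum_right scaleR_matrix_vector_assoc[symmetric] outer_mult inner_commute mult.assoc)
    also have "\<dots> = (\<Sum>e\<in>E. if e = e0 then - c e0 else 0)"
    proof (rule sum.cong[OF refl])
      fix e assume e: "e \<in> E"
      obtain a b where ab: "e = (a, b)" by (cases e)
      have abC: "a \<in> C" "b \<in> C" "a \<noteq> b" using e E ab by auto
      have "\<not> (v = b \<and> w = a)" using vwC(4) e ab by auto
      then show "c e * ((g w \<bullet> (snd e - fst e)) * (g v \<bullet> (snd e - fst e))) = (if e = e0 then - c e0 else 0)"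
        using abC vwC ab vw by (auto simp: g_edge)
    qed
    finally show "c e0 = 0" using fin e0 by simp
  qed
  then have i: "inj_on ?y E" "independent (?y ` E)" by auto
  have "card (?y ` E) \<le> dim (sym_matrices :: (real^'n^'n) set)"
    using i(2) outer_sym by (intro independent_card_le_dim) auto
  then show ?thesis using card_image[OF i(1)] by simp
qed

lemma lam_midpoint:
  assumes "v \<in> C" "w \<in> C" "u \<in> C" "v \<noteq> w"
  shows "lam u ((1/2) *\<^sub>R (v + w)) = (if u = v \<or> u = w then 1/2 else 0)"
proof -
  have "(1/2) *\<^sub>R (v + w) = v + (1/2) *\<^sub>R (w - v)" by (simp add: vec_eq_iff field_simps)
  then show ?thesis using lam_shift[OF assms(3), of v "(1/2) *\<^sub>R (w - v)"] assms by (auto simp: lam_vertex g_edge)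
qed

lemma vertex_field_U:
  assumes v: "v \<in> C" and S: "S \<in> sym_matrices"
  shows "(\<lambda>x. lam v x *\<^sub>R S) \<in> polys 2 sym_matrices" "(\<lambda>x. lam v x *\<^sub>R S) \<in> U"
proof -
  have "(\<lambda>x. lam v x *\<^sub>R S) \<in> polys 1 sym_matrices"
    by (rule polys_sub_image[where L="\<lambda>r. r *\<^sub>R S" and X=UNIV, OF lam_rpoly[OF v]])
      (use subspace_scale[OF subspace_sym S] in \<open>auto intro!: linearI simp: scaleR_add_left\<close>)
  then show p: "(\<lambda>x. lam v x *\<^sub>R S) \<in> polys 2 sym_matrices" by (rule polys_mono[OF subspace_sym]) simp
  show "(\<lambda>x. lam v x *\<^sub>R S) \<in> U"
  proof (rule quadratic_U[OF p])
    fix c n m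
    show "\<exists>p\<in>rpoly 1. \<forall>x\<in>aff c. n \<bullet> ((lam v x *\<^sub>R S) *v m) = p x"
      using rpoly_scale2[OF lam_rpoly[OF v], of "n \<bullet> (S *v m)"]
      by (intro bexI[of _ "\<lambda>x. lam v x * (n \<bullet> (S *v m))"]) (auto simp: scaleR_matrix_vector_assoc[symmetric])
  qed
qed

text \<open>The normal-normal traces vanish on all edges: the normals of the edge from
  \<open>v\<close> to \<open>w\<close> are orthogonal to \<open>w - v\<close>, and on any other edge
  one of the two coordinates is zero.\<close>

lemma edge_field_U:
  fixes a :: "real^'n"
  assumes vw: "v \<in> C" "w \<in> C"
  defines "S \<equiv> outer (w - v) a + outer a (w - v)"
  shows "(\<lambda>x. (lam v x * lam w x) *\<^sub>R S) \<in> polys 2 sym_matrices" "(\<lambda>x. (lam v x * lam w x) *\<^sub>R S) \<in> U"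
proof -
  have S: "S \<in> sym_matrices" by (simp add: S_def sym_iff outer_def mult.commute add.commute)
  have "(\<lambda>x. lam v x * lam w x) \<in> rpoly 2" using rpoly_mult[OF lam_rpoly[OF vw(1)] lam_rpoly[OF vw(2)]] by (simp add: numeral_2_eq_2)
  then show p: "(\<lambda>x. (lam v x * lam w x) *\<^sub>R S) \<in> polys 2 sym_matrices"
    by (rule polys_sub_image[where L="\<lambda>r. r *\<^sub>R S" and X=UNIV])
      (use subspace_scale[OF subspace_sym S] in \<open>auto intro!: linearI simp: scaleR_add_left\<close>)
  show "(\<lambda>x. (lam v x * lam w x) *\<^sub>R S) \<in> U"
  proof (rule quadratic_U[OF p])
    fix c n m assume c: "c \<subseteq> C" "card c = 2" "n \<in> Nrm c" "m \<in> Nrm c"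
    have "n \<bullet> (((lam v x * lam w x) *\<^sub>R S) *v m) = 0" if x: "x \<in> aff c" for x
    proof (cases "v \<in> c \<and> w \<in> c")
      case True
      then have "n \<bullet> (w - v) = 0" "m \<bullet> (w - v) = 0" using c by (auto simp: Nrm_def)
      then show ?thesis by (simp add: S_def scaleR_matrix_vector_assoc[symmetric] matrix_vector_mult_add_rdistrib outer_mult inner_commute inner_add_right)
    next
      case False
      then have "lam v x = 0 \<or> lam w x = 0" using vw x by (auto simp: aff_def)
      then show ?thesis by auto
    qed
    then show "\<exists>p\<in>rpoly 1. \<forall>x\<in>aff c. n \<bullet> (((lam v x * lam w x) *\<^sub>R S) *v m) = p x"
      using rpoly_const[of 0 1] by (intro bexI[of _ "\<lambda>x. 0"]) auto
  qed
qed

text \<open>Independence is triangular. Only the fields \<open>lam v S\<close> are nonzero at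
  vertices, which isolates their coefficients; the edge part is then quadratic and minus a bubble,
  so both are zero; midpoints separate the edges, and normal-normal traces on facets separate the
  bubbles.\<close>

lemma U_dimension_ge:
  assumes E: "E \<subseteq> C \<times> C" "\<And>v w. (v, w) \<in> E \<Longrightarrow> v \<noteq> w \<and> (w, v) \<notin> E"
  shows "\<exists>D\<subseteq>U. independent D \<and> finite D \<and>
    card D = (CARD('n) + 1) * dim (sym_matrices :: (real^'n^'n) set) + card E * CARD('n) + (CARD('n) + 1) * CARD('n)"
proof -
  obtain B :: "(real^'n^'n) set" where B: "B \<subseteq> sym_matrices" "independent B" "card B = dim (sym_matrices :: (real^'n^'n) set)"
    using basis_exists[of "sym_matrices :: (real^'n^'n) set"] by metis
  have fB: "finite B" using B(2) by (rule independent_imp_finite)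
  have finE: "finite E" using E(1) finC finite_subset by blast
  define P where "P v w \<beta> \<longleftrightarrow> \<beta> \<in> nn_bubbles K \<nu> \<and>
     (\<forall>x\<in>aff (C - {v}). g v \<bullet> (\<beta> x *v g v) = (\<Prod>u\<in>C - {v}. lam u x) * lam w x * (g v \<bullet> g v)\<^sup>2) \<and>
     (\<forall>u\<in>C - {v}. \<forall>x\<in>aff (C - {u}). g u \<bullet> (\<beta> x *v g u) = 0)" for v w \<beta>
  have "\<exists>\<beta>. P (fst z) (snd z) \<beta>" if "z \<in> C \<times> C" for z
  proof -
    have "fst z \<in> C" "snd z \<in> C" using that by auto
    from bubble_exists[OF this(1) lam_rpoly[OF this(2)]] obtain \<beta> where "P (fst z) (snd z) \<beta>" unfolding P_def by (rule bexE) blast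
    then show ?thesis by (rule exI[of _ \<beta>])
  qed
  then have "\<forall>z\<in>C \<times> C. \<exists>\<beta>. P (fst z) (snd z) \<beta>" by blast
  from bchoice[OF this] obtain \<beta> where \<beta>: "\<forall>z\<in>C \<times> C. P (fst z) (snd z) (\<beta> z)" by (rule exE)
  define Y1 where "Y1 z = (\<lambda>x. lam (fst z) x *\<^sub>R snd z)" for z :: "(real^'n) \<times> (real^'n^'n)"
  define Y2 where "Y2 z = (\<lambda>x. (lam (fst (fst z)) x * lam (snd (fst z)) x) *\<^sub>R
     (outer (snd (fst z) - fst (fst z)) (snd z) + outer (snd z) (snd (fst z) - fst (fst z))))"
    for z :: "((real^'n) \<times> (real^'n)) \<times> (real^'n)"
  \<comment> \<open>In the third family \<open>w\<close> ranges over the vertices of the facet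
    opposite to \<open>v\<close>, whose coordinates form a basis of the affine functions on that
    facet.\<close>
  let ?I1 = "C \<times> B" and ?I2 = "E \<times> (Basis :: (real^'n) set)" and ?I3 = "SIGMA v:C. C - {v}"
  define Y where "Y = case_sum Y1 (case_sum Y2 \<beta>)"
  let ?I = "?I1 <+> (?I2 <+> ?I3)"
  have fI: "finite ?I1" "finite ?I2" "finite ?I3" using finC fB finE by auto
  have I3: "z \<in> C \<times> C" if "z \<in> ?I3" for z using that by auto
  have Y1: "Y1 z \<in> polys 2 sym_matrices" "Y1 z \<in> U" if "z \<in> ?I1" for z
    using vertex_field_U[of "fst z" "snd z"] that B(1) by (auto simp: Y1_def)
  have Y2: "Y2 z \<in> polys 2 sym_matrices" "Y2 z \<in> U" if "z \<in> ?I2" for z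
  proof -
    have "fst (fst z) \<in> C" "snd (fst z) \<in> C" using that E(1) by auto
    from edge_field_U[OF this, of "snd z"] show "Y2 z \<in> polys 2 sym_matrices" "Y2 z \<in> U" by (simp_all add: Y2_def)
  qed
  have Y3: "\<beta> z \<in> nn_bubbles K \<nu>" "\<beta> z \<in> U" if "z \<in> ?I3" for z
    using \<beta> I3[OF that] bubble_U unfolding P_def by blast+
  have fam: "inj_on Y ?I \<and> independent (Y ` ?I)"
  proof (rule independent_family)
    show "finite ?I" using fI by (intro finite_Plus)
    fix c p assume s: "(\<Sum>p\<in>?I. c p *\<^sub>R Y p) = 0" and p: "p \<in> ?I"
    define c1 where "c1 z = c (Inl z)" for z
    define c2 where "c2 z = c (Inr (Inl z))" for z
    define c3 where "c3 z = c (Inr (Inr z))" for z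
    define V where "V = (\<Sum>z\<in>?I1. c1 z *\<^sub>R Y1 z)"
    define S where "S = (\<Sum>z\<in>?I2. c2 z *\<^sub>R Y2 z)"
    define b where "b = (\<Sum>z\<in>?I3. c3 z *\<^sub>R \<beta> z)"
    have "(\<Sum>p\<in>?I. c p *\<^sub>R Y p) = V + (S + b)"
      unfolding V_def S_def b_def using fI
      by (simp add: sum.Plus finite_Plus Y_def c1_def c2_def c3_def)
    then have VSb: "V + (S + b) = 0" using s by simp
    then have VSb': "V x + (S x + b x) = 0" for x by (metis plus_fun_apply zero_fun_apply)
    have bb: "b \<in> nn_bubbles K \<nu>"
      unfolding b_def using Y3(1) by (intro subspace_sum[OF subspace_bubbles] subspace_scale[OF subspace_bubbles])
    have Sp: "S \<in> polys 2 sym_matrices"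
      unfolding S_def using Y2(1) by (intro subspace_sum subspace_scale subspace_polys[OF subspace_sym])
    have Vx: "V x = (\<Sum>v\<in>C. lam v x *\<^sub>R (\<Sum>A\<in>B. c1 (v, A) *\<^sub>R A))" for x
      by (simp add: V_def sum_fun_eq scaleR_fun_eq Y1_def sum.cartesian_product split_def
          scaleR_sum_right mult.commute)
    have Sx: "S x = (\<Sum>z\<in>?I2. c2 z *\<^sub>R Y2 z x)" for x by (simp add: S_def sum_fun_eq scaleR_fun_eq)
    have bx: "b x = (\<Sum>z\<in>?I3. c3 z *\<^sub>R \<beta> z x)" for x by (simp add: b_def sum_fun_eq scaleR_fun_eq)
    have vert: "(\<Sum>A\<in>B. c1 (u, A) *\<^sub>R A) = 0" if u: "u \<in> C" for u
    proof -
      have "V u = (\<Sum>v\<in>C. if v = u then (\<Sum>A\<in>B. c1 (u, A) *\<^sub>R A) else 0)"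
        unfolding Vx using u by (intro sum.cong) (auto simp: lam_vertex)
      then have "V u = (\<Sum>A\<in>B. c1 (u, A) *\<^sub>R A)" using u finC by simp
      moreover have "S u = 0"
        unfolding Sx
      proof (rule sum.neutral, rule ballI)
        fix z assume z: "z \<in> ?I2"
        then have "fst (fst z) \<noteq> snd (fst z)" "fst (fst z) \<in> C" "snd (fst z) \<in> C" using E by auto
        then show "c2 z *\<^sub>R Y2 z u = 0" using u by (auto simp: Y2_def lam_vertex)
      qed
      moreover have "b u = 0" using bb u by (simp add: nn_bubbles_def subsimplices_0)
      ultimately show ?thesis using VSb'[of u] by simp
    qed
    have c1_0: "c1 z = 0" if z: "z \<in> ?I1" for z
    proof -
      have v: "fst z \<in> C" "snd z \<in> B" using z by auto
      have "c1 (fst z, snd z) = 0"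
        by (rule independentD[OF B(2) fB subset_refl vert[OF v(1)] v(2)])
      then show ?thesis by simp
    qed
    have V0: "V x = 0" for x unfolding Vx by (simp add: vert)
    have Sb: "S x = - b x" for x using VSb'[of x] V0[of x] by (simp add: eq_neg_iff_add_eq_0)
    \<comment> \<open>Once the first family is gone, \<open>S = - b\<close> is quadratic and a
      bubble at the same time.\<close>
    have "b \<in> polys 2 sym_matrices"
    proof -
      have "b = (\<lambda>x. (- 1) *\<^sub>R S x)" using Sb by auto
      then show ?thesis using polys_scaleR[OF subspace_sym Sp, of "- 1"] by simp
    qed
    then have b0: "b x = 0" for x by (rule quadratic_bubble_zero[OF bb])
    have S0: "S x = 0" for x using Sb[of x] b0[of x] by simp
    have c2_0: "c2 z = 0" if z: "z \<in> ?I2" for z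
    proof -
      obtain v w a where zz: "z = ((v, w), a)" by (metis surj_pair)
      have vw: "(v, w) \<in> E" "v \<in> C" "w \<in> C" "v \<noteq> w" "a \<in> Basis" using z zz E by auto
      define x where "x = (1/2) *\<^sub>R (v + w)"
      define t where "t = w - v"
      define A where "A = (\<Sum>e\<in>Basis. c2 ((v, w), e) *\<^sub>R e)"
      have lx: "lam u x = (if u = v \<or> u = w then 1/2 else 0)" if "u \<in> C" for u
        unfolding x_def by (rule lam_midpoint[OF vw(2,3) that vw(4)])
      have "S x = (\<Sum>f\<in>E. \<Sum>e\<in>Basis. c2 (f, e) *\<^sub>R Y2 (f, e) x)"
        unfolding Sx by (simp add: sum.cartesian_product split_def)
      \<comment> \<open>At the midpoint of the edge only its own two coordinates are nonzero, each
        equal to 1/2; hence the factor 1/4 and the absence of all other edges.\<close>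
      also have "\<dots> = (\<Sum>f\<in>E. if f = (v, w) then (1/4) *\<^sub>R (outer t A + outer A t) else 0)"
      proof (rule sum.cong[OF refl])
        fix f assume f: "f \<in> E"
        obtain v' w' where ff: "f = (v', w')" by (cases f)
        have f': "v' \<in> C" "w' \<in> C" "v' \<noteq> w'" "(w', v') \<notin> E" using f ff E by auto
        show "(\<Sum>e\<in>Basis. c2 (f, e) *\<^sub>R Y2 (f, e) x) = (if f = (v, w) then (1/4) *\<^sub>R (outer t A + outer A t) else 0)"
        proof (cases "f = (v, w)")
          case True
          have "outer t A + outer A t = (\<Sum>e\<in>Basis. c2 ((v, w), e) *\<^sub>R (outer t e + outer e t))"
          proof -
            have "linear (\<lambda>a. outer t a + outer a t)" by (rule linearI) (auto simp: outer_add outer_scale algebra_simps)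
            from linear_sum[OF this, of "\<lambda>e. c2 ((v, w), e) *\<^sub>R e" Basis] show ?thesis
              unfolding A_def by (simp add: outer_scale scaleR_add_right)
          qed
          moreover have "Y2 ((v, w), e) x = (1/4) *\<^sub>R (outer t e + outer e t)" for e
            unfolding Y2_def t_def fst_conv snd_conv lx[OF vw(2)] lx[OF vw(3)] by simp
          ultimately show ?thesis using True by (simp add: scaleR_sum_right mult.commute)
        next
          case False
          have "\<not> ((v' = v \<or> v' = w) \<and> (w' = v \<or> w' = w))" using False ff f' vw f by auto
          then have "lam v' x * lam w' x = 0" using lx[OF f'(1)] lx[OF f'(2)] by auto
          then have "Y2 (f, e) x = 0" for e unfolding Y2_def ff fst_conv snd_conv by (simp only: scaleR_zero_left)
          then show ?thesis using False by simp
        qed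
      qed
      also have "\<dots> = (1/4) *\<^sub>R (outer t A + outer A t)" using finE vw(1) by simp
      finally have "outer t A + outer A t = 0" using S0[of x] by simp
      then have "A = 0" by (rule symmetrized_outer_eq_0) (use vw(4) in \<open>simp add: t_def\<close>)
      then have "A \<bullet> a = 0" by simp
      moreover have "A \<bullet> a = c2 ((v, w), a)"
        unfolding A_def using vw(5) by (simp add: inner_sum_left inner_Basis if_distrib[of "(*) _"] cong: if_cong)
      ultimately show ?thesis using zz by simp
    qed
    have c3_0: "c3 z = 0" if z: "z \<in> ?I3" for z
    proof -
      obtain v w where zz: "z = (v, w)" by (cases z)
      have v: "v \<in> C" "w \<in> C - {v}" using z zz by auto
      have sub: "C - {v} \<subseteq> C" by auto
      let ?r = "\<lambda>x. \<Sum>u\<in>C - {v}. c3 (v, u) * lam u x"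
      have rp: "?r \<in> rpoly 1" by (intro rpoly_sum rpoly_scale lam_rpoly) auto
      have "?r x = 0" if x: "x \<in> aff (C - {v})" for x
      proof (rule vanish_on_aff[OF rp sub facet_nonempty[OF v(1)] _ x])
        fix x assume x: "x \<in> aff (C - {v})" and pos: "\<And>u. u \<in> C - {v} \<Longrightarrow> 0 < lam u x"
        have "0 = g v \<bullet> (b x *v g v)" by (simp add: b0)
        also have "\<dots> = (\<Sum>u\<in>C. \<Sum>u'\<in>C - {u}. c3 (u, u') * (g v \<bullet> (\<beta> (u, u') x *v g v)))"
          unfolding bx using finC by (simp add: sum_matrix_mult inner_sum_right scaleR_matrix_vector_assoc[symmetric] sum.Sigma split_def)
        also have "\<dots> = (\<Sum>u\<in>C. if u = v then (\<Prod>u\<in>C - {v}. lam u x) * (g v \<bullet> g v)\<^sup>2 * ?r x else 0)"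
        proof (rule sum.cong[OF refl])
          fix u assume u: "u \<in> C"
          show "(\<Sum>u'\<in>C - {u}. c3 (u, u') * (g v \<bullet> (\<beta> (u, u') x *v g v))) =
              (if u = v then (\<Prod>u\<in>C - {v}. lam u x) * (g v \<bullet> g v)\<^sup>2 * ?r x else 0)"
          proof (cases "u = v")
            case True
            have "g v \<bullet> (\<beta> (v, u') x *v g v) = (\<Prod>u\<in>C - {v}. lam u x) * lam u' x * (g v \<bullet> g v)\<^sup>2" if "u' \<in> C - {v}" for u'
              using \<beta> v(1) that x unfolding P_def by auto
            then show ?thesis using True by (simp add: sum_distrib_left mult_ac)
          next
            case False
            have "g v \<bullet> (\<beta> (u, u') x *v g v) = 0" if "u' \<in> C - {u}" for u'
              using \<beta> u that x v(1) False unfolding P_def by auto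
            then show ?thesis using False by simp
          qed
        qed
        also have "\<dots> = (\<Prod>u\<in>C - {v}. lam u x) * (g v \<bullet> g v)\<^sup>2 * ?r x" using v(1) finC by simp
        \<comment> \<open>Where the coordinates of the facet are positive the common bubble factor
          cancels and an affine function remains, whose values at the vertices are the
          coefficients.\<close>
        finally have "(\<Prod>u\<in>C - {v}. lam u x) * (g v \<bullet> g v)\<^sup>2 * ?r x = 0" by simp
        moreover have "(\<Prod>u\<in>C - {v}. lam u x) > 0" using pos by (intro prod_pos) auto
        moreover have "g v \<bullet> g v \<noteq> 0" using g_ne_0[OF v(1)] by simp
        ultimately show "?r x = 0" by auto
      qed
      then have "?r w = 0" using v vertex_aff[OF sub, of w] by auto
      moreover have "?r w = (\<Sum>u\<in>C - {v}. if u = w then c3 (v, w) else 0)"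
        using v by (intro sum.cong) (auto simp: lam_vertex)
      ultimately show ?thesis using v finC zz by simp
    qed
    consider z where "p = Inl z" "z \<in> ?I1" | z where "p = Inr (Inl z)" "z \<in> ?I2" | z where "p = Inr (Inr z)" "z \<in> ?I3"
      using p by (elim PlusE) blast+
    then show "c p = 0" using c1_0 c2_0 c3_0 unfolding c1_def c2_def c3_def by cases blast+
  qed
  moreover have "Y ` ?I \<subseteq> U"
  proof (rule image_subsetI)
    fix p assume p: "p \<in> ?I"
    consider z where "p = Inl z" "z \<in> ?I1" | z where "p = Inr (Inl z)" "z \<in> ?I2" | z where "p = Inr (Inr z)" "z \<in> ?I3"
      using p by (elim PlusE) blast+
    then show "Y p \<in> U" using Y1(2) Y2(2) Y3(2) unfolding Y_def by cases (simp_all only: sum.case)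
  qed
  moreover have "card (Y ` ?I) = (CARD('n) + 1) * dim (sym_matrices :: (real^'n^'n) set) + card E * CARD('n) + (CARD('n) + 1) * CARD('n)"
  proof -
    have "card (Y ` ?I) = card ?I1 + (card ?I2 + card ?I3)"
      using fam fI by (simp add: card_image card_Plus finite_Plus)
    moreover have "card ?I3 = (CARD('n) + 1) * CARD('n)"
      using finC cardC by (simp add: card_SigmaI card_facet)
    ultimately show ?thesis using B(3) cardC by (simp add: card_cartesian_product)
  qed
  moreover have "finite (Y ` ?I)" using fI by (intro finite_imageI finite_Plus)
  ultimately show ?thesis by blast
qed

section \<open>Unisolvence in terms of the vertices of the simplex\<close>

lemma unisolvence:
  assumes BS: "is_basis B\<^sub>S sym_matrices"
    and BP: "\<And>F. F \<in> subsimplices (CARD('n) - 1) K \<Longrightarrow> is_basis (B\<^sub>P F) (polys_on F 1 UNIV)"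
    and BN: "\<And>F. F \<in> subsimplices (CARD('n) - 1) K \<Longrightarrow> is_basis (B\<^sub>N F) (ND 0 (\<nu> F 1) F)"
  shows "card (dofs K B\<^sub>S B\<^sub>P B\<^sub>N) = CARD('n) * (CARD('n) + 1)\<^sup>2 \<and>
    unisolvent (Sigma_reduced K \<nu>) (dofs K B\<^sub>S B\<^sub>P B\<^sub>N) (dof_value \<nu>)"
proof -
  define d where "d = CARD('n)"
  define s where "s = dim (sym_matrices :: (real^'n^'n) set)"
  define k where "k = dim (skew_matrices :: (real^'n^'n) set)"
  let ?I = "dofs K B\<^sub>S B\<^sub>P B\<^sub>N"
  have fI: "finite ?I" and cI: "card ?I = (d + 1) * (s + d + k)"
    using card_dofs[OF BS BP BN] by (auto simp: d_def s_def k_def)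
  have sk: "s + k = d\<^sup>2" unfolding s_def k_def d_def by (rule dim_sym_plus_dim_skew)
  have cI': "card ?I = d * (d + 1)\<^sup>2"
  proof -
    have "card ?I = (d + 1) * ((s + k) + d)" by (simp add: cI algebra_simps)
    then show ?thesis unfolding sk by (simp add: power2_eq_square algebra_simps)
  qed
  have fBS: "finite B\<^sub>S" "card B\<^sub>S = s" using is_basis_euclidean[OF subspace_sym BS] by (auto simp: s_def)
  \<comment> \<open>The conditions that lead from \<open>U\<close> to the reduced space: for
    \<open>div \<tau>\<close> of degree one they are the components of its constant symmetric
    gradient, so evaluation at the origin is enough.\<close>
  define m where "m S \<tau> = sgrad (div_rows \<tau>) 0 \<bullet> S" for S and \<tau> :: "real^'n \<Rightarrow> real^'n^'n"
  have m_lin: "linear_on_sub U (m S)" for S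
  proof (rule linear_on_subI)
    fix u v assume u: "u \<in> U" and v: "v \<in> U"
    have "div_rows (\<lambda>x. u x + v x) = (\<lambda>x. div_rows u x + div_rows v x)"
      using div_add[OF U_polys[OF u] U_polys[OF v]] by auto
    moreover have "div_rows u \<in> polys 1 UNIV" "div_rows v \<in> polys 1 UNIV" using u v by (auto simp: U_def)
    ultimately show "m S (\<lambda>x. u x + v x) = m S u + m S v" by (simp add: m_def sgrad_add inner_add_left)
  next
    fix r u assume u: "u \<in> U"
    have "div_rows (\<lambda>x. r *\<^sub>R u x) = (\<lambda>x. r *\<^sub>R div_rows u x)" using div_scale[OF U_polys[OF u]] by auto
    moreover have "div_rows u \<in> polys 1 UNIV" using u by (auto simp: U_def)
    ultimately show "m S (\<lambda>x. r *\<^sub>R u x) = r * m S u" by (simp add: m_def sgrad_scale)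
  qed
  have m_RM: "div_rows u \<in> RM" if u: "u \<in> U" and z: "\<And>S. S \<in> B\<^sub>S \<Longrightarrow> m S u = 0" for u
  proof -
    have dp: "div_rows u \<in> polys 1 UNIV" using u by (simp add: U_def)
    let ?A = "sgrad (div_rows u) 0"
    have "?A \<in> sym_matrices" using polys_in[OF subspace_sym sgrad_polys[of "div_rows u" 0]] dp by simp
    then have "?A \<in> span B\<^sub>S" using BS by (simp add: is_basis_def)
    have "linear_on_sub (span B\<^sub>S) (\<lambda>S. ?A \<bullet> S)" by (auto simp: linear_on_sub_def inner_add_right)
    from linear_zero_on_span[OF this _ \<open>?A \<in> span B\<^sub>S\<close>] z have "?A \<bullet> ?A = 0" by (simp add: m_def)
    then show ?thesis using sgrad_zero_at[OF dp] by simp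
  qed
  have red: "Sigma_reduced K \<nu> = {u \<in> U. \<forall>S\<in>B\<^sub>S. m S u = 0}"
  proof (intro set_eqI iffI)
    fix u assume "u \<in> Sigma_reduced K \<nu>"
    then have u: "u \<in> Sigma_space K \<nu>" "div_rows u \<in> RM" "edge_linear u"
      by (auto simp: Sigma_reduced_def edge_linear_def)
    then show "u \<in> {u \<in> U. \<forall>S\<in>B\<^sub>S. m S u = 0}" using RM_polys[OF u(2)] sgrad_RM[OF u(2)] by (simp add: U_def m_def)
  next
    fix u assume u: "u \<in> {u \<in> U. \<forall>S\<in>B\<^sub>S. m S u = 0}"
    then have "div_rows u \<in> RM" using m_RM[of u] by blast
    then show "u \<in> Sigma_reduced K \<nu>" using u by (auto simp: Sigma_reduced_def U_def edge_linear_def)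
  qed
  have P_sub: "span (B\<^sub>P (facet v)) = polys_on (facet v) 1 UNIV" "B\<^sub>P (facet v) \<subseteq> polys_on (facet v) 1 UNIV" if "v \<in> C" for v
    using BP[OF facet_in[OF that]] span_superset[of "B\<^sub>P (facet v)"] by (auto simp: is_basis_def)
  have N_sub: "span (B\<^sub>N (facet v)) = ND 0 (\<nu> (facet v) 1) (facet v)" "B\<^sub>N (facet v) \<subseteq> ND 0 (\<nu> (facet v) 1) (facet v)" if "v \<in> C" for v
    using BN[OF facet_in[OF that]] span_superset[of "B\<^sub>N (facet v)"] by (auto simp: is_basis_def)
  have U_sym: "U \<subseteq> polys (CARD('n) + 1) sym_matrices" using Sigma_polys by (auto simp: U_def)
  have l_lin: "linear_on_sub U (dof_value \<nu> i)" if i: "i \<in> ?I" for i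
  proof -
    consider v S where "i = Vertex v S" "v \<in> C" "S \<in> B\<^sub>S"
      | v q where "i = Normal (facet v) q" "v \<in> C" "q \<in> B\<^sub>P (facet v)"
      | v q where "i = Tangential (facet v) q" "v \<in> C" "q \<in> B\<^sub>N (facet v)"
      using i unfolding dofs_def facets_eq subsimplices_0 by blast
    then show ?thesis
    proof cases
      case 1
      then show ?thesis by (intro linear_on_subI) (auto simp: inner_add_left)
    next
      case (2 v q)
      have "q \<in> polys_on (facet v) 1 UNIV" using P_sub(2)[OF 2(2)] 2(3) by blast
      from linear_on_sub_mono[OF linear_nn_moment[OF Diff_subset facet_nonempty[OF 2(2)] this] U_sym]
      have "linear_on_sub U (\<lambda>\<tau>. inner_face (facet v) (\<lambda>x. \<nu> (facet v) 1 \<bullet> (\<tau> x *v \<nu> (facet v) 1)) q)" .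
      moreover have "dof_value \<nu> i = (\<lambda>\<tau>. inner_face (facet v) (\<lambda>x. \<nu> (facet v) 1 \<bullet> (\<tau> x *v \<nu> (facet v) 1)) q)"
        unfolding 2(1) by (rule ext) (rule dof_value.simps)
      ultimately show ?thesis by (simp only:)
    next
      case (3 v q)
      have "q \<in> ND 0 (\<nu> (facet v) 1) (facet v)" using N_sub(2)[OF 3(2)] 3(3) by blast
      from linear_on_sub_mono[OF linear_tangential_moment[OF Diff_subset facet_nonempty[OF 3(2)] this] U_sym]
      have "linear_on_sub U (\<lambda>\<tau>. inner_face (facet v) (\<lambda>x. tangential_part (\<nu> (facet v) 1) (\<tau> x *v \<nu> (facet v) 1)) q)" .
      moreover have "dof_value \<nu> i = (\<lambda>\<tau>. inner_face (facet v) (\<lambda>x. tangential_part (\<nu> (facet v) 1) (\<tau> x *v \<nu> (facet v) 1)) q)"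
        unfolding 3(1) by (rule ext) (rule dof_value.simps)
      ultimately show ?thesis by (simp only:)
    qed
  qed
  have inj: "u = 0" if u: "u \<in> U" and z: "\<And>S. S \<in> B\<^sub>S \<Longrightarrow> m S u = 0" and l: "\<And>i. i \<in> ?I \<Longrightarrow> dof_value \<nu> i u = 0" for u
  proof
    fix x
    have "u \<in> Sigma_space K \<nu>" using u by (simp add: U_def)
    then obtain \<sigma> \<beta> where sb: "u = \<sigma> + \<beta>" "\<sigma> \<in> polys 2 sym_matrices" "\<beta> \<in> nn_bubbles K \<nu>"
      unfolding Sigma_space_def by blast
    have us: "u \<in> polys (CARD('n) + 1) sym_matrices" using u U_sym by blast
    show "u x = 0 x"
      unfolding zero_fun_apply
    proof (rule sigma_injective[OF _ sb(2,3)])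
      show "edge_linear u" using u by (simp add: U_def)
      show "u x = \<sigma> x + \<beta> x" for x by (simp add: sb(1))
      show "div_rows u \<in> RM" by (rule m_RM[OF u z])
    next
      fix v assume v: "v \<in> C"
      have "u v \<in> span B\<^sub>S" using polys_in[OF subspace_sym us] BS by (simp add: is_basis_def)
      moreover have "linear_on_sub (span B\<^sub>S) (\<lambda>S. u v \<bullet> S)" by (auto simp: linear_on_sub_def inner_add_right)
      moreover have "u v \<bullet> S = 0" if "S \<in> B\<^sub>S" for S
      proof -
        have "Vertex v S \<in> ?I" using v that unfolding dofs_def subsimplices_0 by blast
        from l[OF this] show ?thesis by simp
      qed
      ultimately have "u v \<bullet> u v = 0" using linear_zero_on_span by blast
      then show "u v = 0" by simp
    next
      fix v q assume v: "v \<in> C" and q: "q \<in> polys_on (facet v) 1 (UNIV :: real set)"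
      let ?m = "L2_inner (surface_measure (facet v)) (facet v) (\<lambda>x. \<nu> (facet v) 1 \<bullet> (u x *v \<nu> (facet v) 1))"
      show "?m q = 0"
      proof (rule linear_zero_on_span[where B="B\<^sub>P (facet v)" and m="?m"])
        show "q \<in> span (B\<^sub>P (facet v))" using q P_sub(1)[OF v] by simp
        show "linear_on_sub (span (B\<^sub>P (facet v))) ?m"
          unfolding P_sub(1)[OF v]
          by (rule linear_L2_inner_on_set[OF charges_face[OF Diff_subset facet_nonempty[OF v]] _ polys_on_continuous])
            (intro continuous_on_inner continuous_on_const continuous_trace[OF us])
        fix b assume "b \<in> B\<^sub>P (facet v)"
        then have "Normal (facet v) b \<in> ?I" using v unfolding dofs_def facets_eq by blast
        from l[OF this] show "?m b = 0" unfolding dof_value.simps .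
      qed
    next
      fix v q assume v: "v \<in> C" and q: "q \<in> ND 0 (\<nu> (facet v) 1) (facet v)"
      let ?m = "L2_inner (surface_measure (facet v)) (facet v) (\<lambda>x. tangential_part (\<nu> (facet v) 1) (u x *v \<nu> (facet v) 1))"
      show "?m q = 0"
      proof (rule linear_zero_on_span[where B="B\<^sub>N (facet v)" and m="?m"])
        show "q \<in> span (B\<^sub>N (facet v))" using q unfolding N_sub(1)[OF v] .
        show "linear_on_sub (span (B\<^sub>N (facet v))) ?m"
          unfolding N_sub(1)[OF v]
          by (rule linear_L2_inner_on_set[OF charges_face[OF Diff_subset facet_nonempty[OF v]] _ ND_continuous])
            (intro continuous_tangential continuous_trace[OF us])
        fix b assume "b \<in> B\<^sub>N (facet v)"
        then have "Tangential (facet v) b \<in> ?I" using v unfolding dofs_def facets_eq by blast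
        from l[OF this] show "?m b = 0" unfolding dof_value.simps .
      qed
    qed
  qed
  obtain E where E: "E \<subseteq> C \<times> C" "\<And>v w. (v, w) \<in> E \<Longrightarrow> v \<noteq> w \<and> (w, v) \<notin> E" "2 * card E = d * (d + 1)"
    using edges_exist unfolding d_def by blast
  obtain D where D: "D \<subseteq> U" "independent D" "finite D" "card D = (d + 1) * s + card E * d + (d + 1) * d"
    using U_dimension_ge[OF E(1,2)] unfolding d_def s_def by blast
  have sE: "card E \<le> s" using card_edges_le_dim_sym[OF E(1,2)] by (simp add: s_def)
  \<comment> \<open>After cancelling common terms the claim is
    \<open>(d + 1) * k + s \<le> card E * d\<close>. The left side equals
    \<open>d * k + d * d\<close> by \<open>sk\<close>. The edge count gives
    \<open>2 * d * card E = d * d * d + d * d\<close>, and subtracting the bound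
    \<open>d * k + d * card E \<le> d * d * d\<close> yields the inequality, so the exact value of
    \<open>s\<close> never enters.\<close>
  have "card ?I + card B\<^sub>S \<le> card D"
  proof -
    have "(d + 1) * k + s = d * k + d * d" using sk by (simp add: power2_eq_square algebra_simps)
    moreover have "d * k + d * card E \<le> d * d * d"
    proof -
      have "k + card E \<le> d * d" using sk sE by (simp add: power2_eq_square)
      then have "d * (k + card E) \<le> d * (d * d)" by (rule mult_le_mono2)
      then show ?thesis by (simp add: algebra_simps)
    qed
    moreover have "2 * (d * card E) = d * d * d + d * d" using E(3) by (simp add: algebra_simps)
    ultimately have "(d + 1) * k + s \<le> card E * d" by (simp add: mult.commute)
    then show ?thesis unfolding cI fBS(2) D(4) by (simp add: algebra_simps)
  qed
  have "subspace (Sigma_reduced K \<nu>) \<and> dim (Sigma_reduced K \<nu>) = card ?I"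
    unfolding red by (rule dim_kernel_eq[OF subspace_U fI fBS(1) l_lin m_lin inj D(1-3) \<open>card ?I + card B\<^sub>S \<le> card D\<close>])
  then have dim: "subspace (Sigma_reduced K \<nu>)" "dim (Sigma_reduced K \<nu>) = card ?I"
    by (rule conjunct1, rule conjunct2)
  have "\<forall>\<tau>\<in>Sigma_reduced K \<nu>. (\<forall>i\<in>?I. dof_value \<nu> i \<tau> = 0) \<longrightarrow> \<tau> = 0"
    unfolding red using inj by blast
  then show ?thesis using dim fI cI' by (simp add: unisolvent_def d_def)
qed

end

theorem lemma3p5:
  fixes K :: "(real^'n) set"
    and \<nu> :: "(real^'n) set \<Rightarrow> nat \<Rightarrow> real^'n"
    and B\<^sub>S :: "(real^'n^'n) set"
    and B\<^sub>P :: "(real^'n) set \<Rightarrow> (real^'n \<Rightarrow> real) set"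
    and B\<^sub>N :: "(real^'n) set \<Rightarrow> (real^'n \<Rightarrow> real^'n) set"
  assumes "3 \<le> CARD('n)"
    and "int CARD('n) simplex K"
    and "normal_frames K \<nu>"
    and "is_basis B\<^sub>S sym_matrices"
    and "\<And>F. F \<in> subsimplices (CARD('n) - 1) K \<Longrightarrow> is_basis (B\<^sub>P F) (polys_on F 1 UNIV)"
    and "\<And>F. F \<in> subsimplices (CARD('n) - 1) K \<Longrightarrow> is_basis (B\<^sub>N F) (ND 0 (\<nu> F 1) F)"
  shows "card (dofs K B\<^sub>S B\<^sub>P B\<^sub>N) = CARD('n) * (CARD('n) + 1)\<^sup>2 \<and>
    unisolvent (Sigma_reduced K \<nu>) (dofs K B\<^sub>S B\<^sub>P B\<^sub>N) (dof_value \<nu>)"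
proof -
  obtain C where C: "\<not> affine_dependent C" "int (card C) = int CARD('n) + 1" "K = convex hull C"
    using assms(2) unfolding simplex_def by blast
  have "card C = CARD('n) + 1" using C(2) by linarith
  then obtain lam g where "bary C lam g" using barycentric_exists[OF C(1)] by blast
  then interpret bary C lam g .
  interpret framed_simplex C lam g \<nu>
    by unfold_locales (use assms(1,3) C(3) in auto)
  show ?thesis
    using unisolvence[of B\<^sub>S B\<^sub>P B\<^sub>N] assms(4-6) unfolding C(3) by blast
qed

end
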